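(* Let $X$ be a $\mathrm{UMD}$ function lattice and $1<p<\infty$. Then \[ \bigg\|\sum_{k\in\mathbb{Z}} \epsilon_k (D_k^a)^* f\bigg\|_{L^p(\mathbb{R}^N\times\Omega,\mu\otimes\mathbf{P};X)} \lesssim \|f\|_{L^p(\mathbb{R}^N,\mu;X)} \] for every $f\in L^p(\mathbb{R}^N,\mu;X)$.
   Context: A $\mathrm{UMD}$ function lattice is a Banach space with the $\mathrm{UMD}$ property whose elements are represented by functions on some measure space, and whose norm satisfies: $|f|\le|g|$ pointwise implies $\|f\|_X\le\|g\|_X$. $|x|$ is the supremum norm on $\mathbb{R}^N$; $\mu$ is a compactly supported Borel measure on $\mathbb{R}^N$ with $\mu(B(x,\rho))\le\rho^d$ for all $x$, $\rho>0$, where $d\in(0,N]$. $(\epsilon_k)$ are independent random signs ($\pm1$ with probability $1/2$) on a probability space $(\Omega,\mathbf{P})$. $A\lesssim B$ means $A\le CB$ with $C$ depending only on fixed parameters (here $N,d,\delta,p,X$) and not on $f$ nor on the dyadic system. Dyadic systems: $\hat{\mathcal{D}}_k$ is the family of cubes $2^k(m+[0,1)^N)$, $m\in\mathbb{Z}^N$. For $\beta\in(\{0,1\}^N)^{\mathbb{Z}}$, $\mathcal{D}_k(\beta)=\{\hat R+\sum_{j<k}\beta_j2^j:\hat R\in\hat{\mathcal{D}}_k\}$ and $\mathcal{D}(\beta)=\bigcup_k\mathcal{D}_k(\beta)$. Fix $\mathcal{D}=\mathcal{D}(\beta)$ containing a cube $Q_0$ with $\mathrm{supp}\,\mu\subset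 Q_0$. Accretive system: for every cube $Q$ in $\mathbb{R}^N$, $b_Q$ is a complex-valued function with $\mathrm{supp}\,b_Q\subset Q$, $\|b_Q\|_{L^\infty(\mu)}\le1$ and $|\int_Qb_Q\,d\mu|\ge\delta\mu(Q)$, where $\delta\in(0,1)$ is fixed. Layers: $\mathcal{D}^0=\{Q_0\}$; $\mathcal{D}^{j}$ consists, over all $R\in\mathcal{D}^{j-1}$, of the maximal cubes $Q\in\mathcal{D}$ with $Q\subsetneq R$ and $|\int_Qb_R\,d\mu|<\delta^2\mu(Q)$. For $Q\in\mathcal{D}$ with $Q\subset Q_0$, $Q^a$ is the smallest cube in $\bigcup_{j\ge0}\mathcal{D}^j$ containing $Q$; if $Q\not\subset Q_0$, $Q^a=Q_0$. Operators: $\langle f\rangle_Q=\mu(Q)^{-1}\int_Qf\,d\mu$ ($=0$ if $\mu(Q)=0$), $E_kf=\sum_{Q\in\mathcal{D}_k}1_Q\langle f\rangle_Q$, $b_k^a=\sum_{Q\in\mathcal{D}_k}1_Qb_{Q^a}$, $E_k^af=b_k^a\,E_kf/E_kb_k^a$, $D_k^af=E_{k-1}^af-E_k^af$ ($\mu$-a.e.). The adjoint of $D_k^a$ (with respect to $\langle g,f\rangle=\int g f\,d\mu$) is \[ (D_k^a)^*f=\frac{E_{k-1}(b_{k-1}^af)}{E_{k-1}b_{k-1}^a}-\frac{E_k(b_k^af)}{E_kb_k^a}. \] *)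

theory Defs
  imports "HOL-Probability.Probability"
begin

section \<open>Strongly measurable functions, Bochner integrals and $L^p$ spaces\<close>

text \<open>
  The Bochner integral of HOL-Analysis is restricted to second countable (separable) target
  spaces.  The following definitions repeat it for arbitrary Banach spaces, with strong
  measurability in place of Borel measurability; the lemmas below show that nothing changes
  in the separable case.
\<close>

definition strongly_measurable :: "'a measure \<Rightarrow> ('a \<Rightarrow> 'x::topological_space) \<Rightarrow> bool" where
  "strongly_measurable M f \<longleftrightarrow>
     (\<exists>s. (\<forall>i::nat. simple_function M (s i)) \<and> (\<forall>x\<in>space M. (\<lambda>i. s i x) \<longlonglongrightarrow> f x))"

definition has_strong_integral :: "'a measure \<Rightarrow> ('a \<Rightarrow> 'x::real_normed_vector) \<Rightarrow> 'x \<Rightarrow> bool" where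
  "has_strong_integral M f v \<longleftrightarrow> strongly_measurable M f \<and>
     (\<exists>s. (\<forall>i::nat. Bochner_Integration.simple_bochner_integrable M (s i)) \<and>
          (\<lambda>i. \<integral>\<^sup>+x. ennreal (norm (f x - s i x)) \<partial>M) \<longlonglongrightarrow> 0 \<and>
          (\<lambda>i. Bochner_Integration.simple_bochner_integral M (s i)) \<longlonglongrightarrow> v)"

definition strong_integral :: "'a measure \<Rightarrow> ('a \<Rightarrow> 'x::real_normed_vector) \<Rightarrow> 'x" where
  "strong_integral M f =
     (if \<exists>v. has_strong_integral M f v then THE v. has_strong_integral M f v else 0)"

lemma strongly_measurable_iff_borel:
  fixes f :: "'a \<Rightarrow> 'x::{metric_space, second_countable_topology}"
  shows "strongly_measurable M f \<longleftrightarrow> f \<in> borel_measurable M"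
proof
  assume "strongly_measurable M f"
  then obtain s where s: "\<And>i::nat. simple_function M (s i)"
    and lim: "\<And>x. x \<in> space M \<Longrightarrow> (\<lambda>i. s i x) \<longlonglongrightarrow> f x"
    unfolding strongly_measurable_def by blast
  show "f \<in> borel_measurable M"
    by (rule borel_measurable_LIMSEQ_metric[OF borel_measurable_simple_function[OF s] lim])
next
  assume "f \<in> borel_measurable M"
  from borel_measurable_implies_sequence_metric[OF this, of undefined]
  show "strongly_measurable M f"
    unfolding strongly_measurable_def by blast
qed

lemma has_strong_integral_iff_has_bochner_integral:
  fixes f :: "'a \<Rightarrow> 'x::{real_normed_vector, second_countable_topology}"
  shows "has_strong_integral M f v \<longleftrightarrow> has_bochner_integral M f v"
  unfolding has_strong_integral_def has_bochner_integral.simps strongly_measurable_iff_borel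
  by blast

lemma strong_integral_eq_lebesgue_integral:
  fixes f :: "'a \<Rightarrow> 'x::{banach, second_countable_topology}"
  shows "strong_integral M f = lebesgue_integral M f"
  unfolding strong_integral_def lebesgue_integral_def has_strong_integral_iff_has_bochner_integral
  by simp

definition in_Lp :: "'a measure \<Rightarrow> real \<Rightarrow> ('a \<Rightarrow> 'x::real_normed_vector) \<Rightarrow> bool" where
  "in_Lp M p f \<longleftrightarrow> strongly_measurable M f \<and> integrable M (\<lambda>x. norm (f x) powr p)"

definition Lp_norm :: "'a measure \<Rightarrow> real \<Rightarrow> ('a \<Rightarrow> 'x::real_normed_vector) \<Rightarrow> real" where
  "Lp_norm M p f = (LINT x|M. norm (f x) powr p) powr (1 / p)"

text \<open>Unconditional convergence of a series in $L^p$, in the style of \<^const>\<open>has_sum\<close>.\<close>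

definition has_sum_Lp ::
  "'a measure \<Rightarrow> real \<Rightarrow> ('k \<Rightarrow> 'a \<Rightarrow> 'x::real_normed_vector) \<Rightarrow> ('a \<Rightarrow> 'x) \<Rightarrow> 'k set \<Rightarrow> bool" where
  "has_sum_Lp M p u g A \<longleftrightarrow> (\<forall>k\<in>A. in_Lp M p (u k)) \<and> in_Lp M p g \<and>
     ((\<lambda>K. Lp_norm M p (\<lambda>z. (\<Sum>k\<in>K. u k z) - g z)) \<longlongrightarrow> 0) (finite_subsets_at_top A)"


section \<open>UMD function lattices\<close>

text \<open>
  The UMD property.  A definition cannot range over the measure spaces of all types; the
  probability measures on subsets of the reals, with arbitrary \<open>\<sigma>\<close>-algebras, are
  enough.  Indeed, a finite $L^p$ martingale can be approximated in $L^p$ by martingales with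
  respect to a finite filtration, and a finite filtered probability space can be realised inside
  the reals.
\<close>

definition Lp_martingale ::
  "'a measure \<Rightarrow> (nat \<Rightarrow> 'a measure) \<Rightarrow> real \<Rightarrow> (nat \<Rightarrow> 'a \<Rightarrow> 'x::banach) \<Rightarrow> bool" where
  "Lp_martingale M F p f \<longleftrightarrow>
     (\<forall>k. subalgebra M (F k)) \<and> (\<forall>j k. j \<le> k \<longrightarrow> sets (F j) \<subseteq> sets (F k)) \<and>
     (\<forall>k. strongly_measurable (F k) (f k) \<and> in_Lp M p (f k)) \<and>
     (\<forall>k. \<forall>A\<in>sets (F k). strong_integral M (\<lambda>w. indicator A w *\<^sub>R f (Suc k) w) =
                       strong_integral M (\<lambda>w. indicator A w *\<^sub>R f k w))"

definition UMD :: "'x::banach itself \<Rightarrow> bool" where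
  "UMD (_ :: 'x itself) \<longleftrightarrow>
     (\<forall>p>1. \<exists>C. \<forall>(M :: real measure) F (f :: nat \<Rightarrow> real \<Rightarrow> 'x) (\<sigma> :: nat \<Rightarrow> real) n.
        prob_space M \<longrightarrow> Lp_martingale M F p f \<longrightarrow> (\<forall>k. \<sigma> k \<in> {-1, 1}) \<longrightarrow>
        Lp_norm M p (\<lambda>w. \<Sum>k<n. \<sigma> k *\<^sub>R (f (Suc k) w - f k w))
          \<le> C * Lp_norm M p (\<lambda>w. \<Sum>k<n. f (Suc k) w - f k w))"

class complex_banach = banach +
  fixes scaleC :: "complex \<Rightarrow> 'a \<Rightarrow> 'a" (infixr "*\<^sub>C" 75)
  assumes scaleC_add_right: "c *\<^sub>C (x + y) = c *\<^sub>C x + c *\<^sub>C y"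
    and scaleC_add_left: "(b + c) *\<^sub>C x = b *\<^sub>C x + c *\<^sub>C x"
    and scaleC_scaleC: "b *\<^sub>C c *\<^sub>C x = (b * c) *\<^sub>C x"
    and scaleC_complex_of_real: "complex_of_real r *\<^sub>C x = r *\<^sub>R x"
    and norm_scaleC: "norm (c *\<^sub>C x) = cmod c * norm x"

text \<open>
  \<open>rep x\<close> is a function representing the element \<open>x\<close> of the space.  Functions are
  identified when they agree almost everywhere, so all pointwise relations are understood
  almost everywhere; \<open>rep_mono\<close> and \<open>rep_scaleC\<close> imply that
  \<open>x\<close> is determined by \<open>rep x\<close>.  The law \<open>rep_modulus\<close>, closure under
  $f \mapsto |f|$, is what makes the space a lattice; closure under arbitrary dominated
  functions is not required.
\<close>

locale function_lattice =
  fixes S :: "'s measure" and rep :: "'x::complex_banach \<Rightarrow> 's \<Rightarrow> complex"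
  assumes rep_measurable: "rep x \<in> borel_measurable S"
    and rep_add: "AE s in S. rep (x + y) s = rep x s + rep y s"
    and rep_scaleC: "AE s in S. rep (c *\<^sub>C x) s = c * rep x s"
    and rep_modulus: "\<exists>y. AE s in S. rep y s = complex_of_real (cmod (rep x s))"
    and rep_mono: "(AE s in S. cmod (rep x s) \<le> cmod (rep y s)) \<Longrightarrow> norm x \<le> norm y"


section \<open>Measures, cubes and dyadic systems\<close>

definition measure_support :: "'a::topological_space measure \<Rightarrow> 'a set" where
  "measure_support M = {x. \<forall>U. open U \<longrightarrow> x \<in> U \<longrightarrow> emeasure M U \<noteq> 0}"

definition half_open_cube :: "real ^ 'n \<Rightarrow> real \<Rightarrow> (real ^ 'n) set" where
  "half_open_cube a l = {x. \<forall>i. a $ i \<le> x $ i \<and> x $ i < a $ i + l}"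

definition cubes :: "(real ^ 'n) set set" where
  "cubes = {half_open_cube a l | a l. 0 < l}"

definition standard_dyadic :: "int \<Rightarrow> (real ^ 'n) set set" where
  "standard_dyadic k =
     {half_open_cube (\<chi> i. 2 powi k * real_of_int (m $ i)) (2 powi k) | m :: int ^ 'n. True}"

definition dyadic :: "(int \<Rightarrow> real ^ 'n) \<Rightarrow> int \<Rightarrow> (real ^ 'n) set set" where
  "dyadic \<beta> k = {(\<lambda>x. x + (\<Sum>\<^sub>\<infinity>j\<in>{..<k}. (2 powi j) *\<^sub>R \<beta> j)) ` R | R. R \<in> standard_dyadic k}"

definition dyadic_system :: "(int \<Rightarrow> real ^ 'n) \<Rightarrow> (real ^ 'n) set set" where
  "dyadic_system \<beta> = (\<Union>k. dyadic \<beta> k)"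


section \<open>Accretive systems and stopping cubes\<close>

text \<open>As usual for elements of $L^\infty(\mu)$, the support condition is understood
  \<open>\<mu>\<close>-almost everywhere.\<close>

definition accretive_system ::
  "(real ^ 'n) measure \<Rightarrow> real \<Rightarrow> ((real ^ 'n) set \<Rightarrow> real ^ 'n \<Rightarrow> complex) \<Rightarrow> bool" where
  "accretive_system \<mu> \<delta> b \<longleftrightarrow> (\<forall>Q\<in>cubes.
     b Q \<in> borel_measurable \<mu> \<and>
     (AE x in \<mu>. x \<notin> Q \<longrightarrow> b Q x = 0) \<and>
     (AE x in \<mu>. cmod (b Q x) \<le> 1) \<and>
     cmod (LINT x:Q|\<mu>. b Q x) \<ge> \<delta> * measure \<mu> Q)"

definition stopping_candidates ::
  "(real ^ 'n) measure \<Rightarrow> (int \<Rightarrow> real ^ 'n) \<Rightarrow> ((real ^ 'n) set \<Rightarrow> real ^ 'n \<Rightarrow> complex) \<Rightarrow> real \<Rightarrow>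
   (real ^ 'n) set \<Rightarrow> (real ^ 'n) set set" where
  "stopping_candidates \<mu> \<beta> b \<delta> R =
     {Q \<in> dyadic_system \<beta>. Q \<subset> R \<and> cmod (LINT x:Q|\<mu>. b R x) < \<delta>\<^sup>2 * measure \<mu> Q}"

primrec layer ::
  "(real ^ 'n) measure \<Rightarrow> (int \<Rightarrow> real ^ 'n) \<Rightarrow> ((real ^ 'n) set \<Rightarrow> real ^ 'n \<Rightarrow> complex) \<Rightarrow> real \<Rightarrow>
   (real ^ 'n) set \<Rightarrow> nat \<Rightarrow> (real ^ 'n) set set" where
  "layer \<mu> \<beta> b \<delta> Q\<^sub>0 0 = {Q\<^sub>0}"
| "layer \<mu> \<beta> b \<delta> Q\<^sub>0 (Suc j) = (\<Union>R\<in>layer \<mu> \<beta> b \<delta> Q\<^sub>0 j.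
     {Q \<in> stopping_candidates \<mu> \<beta> b \<delta> R.
        \<forall>Q'\<in>stopping_candidates \<mu> \<beta> b \<delta> R. Q \<subseteq> Q' \<longrightarrow> Q' = Q})"

definition stopping_ancestor ::
  "(real ^ 'n) measure \<Rightarrow> (int \<Rightarrow> real ^ 'n) \<Rightarrow> ((real ^ 'n) set \<Rightarrow> real ^ 'n \<Rightarrow> complex) \<Rightarrow> real \<Rightarrow>
   (real ^ 'n) set \<Rightarrow> (real ^ 'n) set \<Rightarrow> (real ^ 'n) set" where
  "stopping_ancestor \<mu> \<beta> b \<delta> Q\<^sub>0 Q =
     (if Q \<subseteq> Q\<^sub>0 then LEAST R. R \<in> (\<Union>j. layer \<mu> \<beta> b \<delta> Q\<^sub>0 j) \<and> Q \<subseteq> R else Q\<^sub>0)"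


section \<open>The operators\<close>

text \<open>If $\mu(Q) = 0$ the average is $0$, because \<open>inverse 0 = 0\<close>.\<close>

definition cube_average :: "'a measure \<Rightarrow> ('a \<Rightarrow> 'x::banach) \<Rightarrow> 'a set \<Rightarrow> 'x" where
  "cube_average \<mu> f Q = inverse (measure \<mu> Q) *\<^sub>R strong_integral \<mu> (\<lambda>x. indicator Q x *\<^sub>R f x)"

text \<open>For fixed \<open>x\<close>, the sums over \<open>dyadic \<beta> k\<close> below have exactly one term
  with a nonzero indicator.\<close>

definition dyadic_expectation ::
  "(real ^ 'n) measure \<Rightarrow> (int \<Rightarrow> real ^ 'n) \<Rightarrow> int \<Rightarrow> (real ^ 'n \<Rightarrow> 'x::banach) \<Rightarrow> real ^ 'n \<Rightarrow> 'x" where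
  "dyadic_expectation \<mu> \<beta> k f x = (\<Sum>\<^sub>\<infinity>Q\<in>dyadic \<beta> k. indicator Q x *\<^sub>R cube_average \<mu> f Q)"

definition b_anc ::
  "(real ^ 'n) measure \<Rightarrow> (int \<Rightarrow> real ^ 'n) \<Rightarrow> ((real ^ 'n) set \<Rightarrow> real ^ 'n \<Rightarrow> complex) \<Rightarrow> real \<Rightarrow>
   (real ^ 'n) set \<Rightarrow> int \<Rightarrow> real ^ 'n \<Rightarrow> complex" where
  "b_anc \<mu> \<beta> b \<delta> Q\<^sub>0 k x =
     (\<Sum>\<^sub>\<infinity>Q\<in>dyadic \<beta> k. indicator Q x *\<^sub>R b (stopping_ancestor \<mu> \<beta> b \<delta> Q\<^sub>0 Q) x)"

text \<open>The adjoints, with respect to the bilinear pairing $\int g f\,d\mu$, of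
  $E_k^a f = b_k^a \, E_k f / E_k b_k^a$ and of $D_k^a = E_{k-1}^a - E_k^a$.\<close>

definition E_adj ::
  "(real ^ 'n) measure \<Rightarrow> (int \<Rightarrow> real ^ 'n) \<Rightarrow> ((real ^ 'n) set \<Rightarrow> real ^ 'n \<Rightarrow> complex) \<Rightarrow> real \<Rightarrow>
   (real ^ 'n) set \<Rightarrow> int \<Rightarrow> (real ^ 'n \<Rightarrow> 'x::complex_banach) \<Rightarrow> real ^ 'n \<Rightarrow> 'x" where
  "E_adj \<mu> \<beta> b \<delta> Q\<^sub>0 k f x =
     inverse (dyadic_expectation \<mu> \<beta> k (b_anc \<mu> \<beta> b \<delta> Q\<^sub>0 k) x) *\<^sub>C
       dyadic_expectation \<mu> \<beta> k (\<lambda>y. b_anc \<mu> \<beta> b \<delta> Q\<^sub>0 k y *\<^sub>C f y) x"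

definition D_adj ::
  "(real ^ 'n) measure \<Rightarrow> (int \<Rightarrow> real ^ 'n) \<Rightarrow> ((real ^ 'n) set \<Rightarrow> real ^ 'n \<Rightarrow> complex) \<Rightarrow> real \<Rightarrow>
   (real ^ 'n) set \<Rightarrow> int \<Rightarrow> (real ^ 'n \<Rightarrow> 'x::complex_banach) \<Rightarrow> real ^ 'n \<Rightarrow> 'x" where
  "D_adj \<mu> \<beta> b \<delta> Q\<^sub>0 k f x = E_adj \<mu> \<beta> b \<delta> Q\<^sub>0 (k - 1) f x - E_adj \<mu> \<beta> b \<delta> Q\<^sub>0 k f x"


section \<open>Random signs\<close>

definition random_signs :: "'w measure \<Rightarrow> ('k \<Rightarrow> 'w \<Rightarrow> real) \<Rightarrow> bool" where
  "random_signs P \<epsilon> \<longleftrightarrow> prob_space P \<and> prob_space.indep_vars P (\<lambda>_. borel) \<epsilon> UNIV \<and>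
     (\<forall>k. measure P {w \<in> space P. \<epsilon> k w = 1} = 1 / 2 \<and>
          measure P {w \<in> space P. \<epsilon> k w = -1} = 1 / 2)"

end

theory Submission
  imports Defs
begin

text \<open>
  Since both averages in the formula for \<open>E_adj\<close> are martingales as long as the accretive function
  does not change, each operator \<open>D_adj\<close> is an increment of a quotient \<open>a / c\<close> of two martingales:
  \<open>c\<close> consists of averages of accretive functions and is scalar, bounded, and bounded away from zero by
  the choice of the stopping cubes, and \<open>a\<close> consists of averages of the products with \<open>f\<close>. What has to be
  bounded is a randomised sum of such increments.

  For a finite sum only finitely many levels matter, and everything takes place on the finite set of
  cubes of the last level (\<open>leaf_estimate\<close>). There the UMD property yields an inequality for
  martingale differences (\<open>UMD_inequality_finite\<close>), and the levels are divided into generations. A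
  generation ends at a stopping cube, or when the square sum of the increments of \<open>c\<close> within the
  generation has become large. Inside a generation
  $d(a/c) = da/c' - a\,dc/(c c')$, where the primes denote the values at the next level. The contraction
  principle removes the scalar multipliers $1/c'$ and $1/(c c')$, and the randomised sum of
  the increments \<open>da\<close> is bounded by the UMD inequality. The products \<open>a dc\<close>
  resist both arguments, as \<open>a\<close> is vector-valued. Summation by parts expresses their sum by that of
  \<open>d(ac)\<close>, which telescopes, that of \<open>c da\<close>, which is a martingale transform, and that of
  \<open>dc da\<close>. The last is the average over random signs of the product of the randomised sums of \<open>dc\<close> and
  \<open>da\<close>; the former has bounded moments since its square sum is bounded. So a generation is
  controlled by the averages of the norm of \<open>f\<close> at its start and at its end
  (\<open>generation_estimate\<close>).

  The generations are added up with the help of two facts. The number of generations has an exponential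
  moment (\<open>exponential_moment\<close>): since \<open>c\<close> is a martingale of modulus at least \<open>\<delta>\<close> at the start and at
  most \<open>\<delta>\<^sup>2\<close> at the stopping cubes that follow, these leave out a fixed proportion of the mass; and
  the square sum has bounded mean by orthogonality, so it rarely exceeds a large threshold. It
  follows that the stops are so sparse that the averages of the norm of \<open>f\<close> over all of them are
  controlled by \<open>f\<close> (\<open>carleson_embedding\<close>).

  This gives a bound for all finite sums, with a constant depending on the space, the exponent and
  \<open>\<delta>\<close> (\<open>finite_sum_bound\<close>). On a function that is constant on the cubes of some level all but
  finitely many operators vanish, and such functions are dense, which yields unconditional convergence and the
  bound for the limit (\<open>random_series_converges\<close>).
\<close>

section \<open>Averages over signs\<close>

definition signs :: "'i set \<Rightarrow> ('i \<Rightarrow> real) set" where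
  "signs I = PiE I (\<lambda>_. {-1, 1})"

definition sign_avg :: "'i set \<Rightarrow> (('i \<Rightarrow> real) \<Rightarrow> 'b::real_vector) \<Rightarrow> 'b" where
  "sign_avg I \<phi> = (1 / 2 ^ card I) *\<^sub>R (\<Sum>\<sigma>\<in>signs I. \<phi> \<sigma>)"

lemma finite_signs: "finite I \<Longrightarrow> finite (signs I)"
  unfolding signs_def by (rule finite_PiE) auto

lemma card_signs: "finite I \<Longrightarrow> card (signs I) = 2 ^ card I"
  unfolding signs_def by (subst card_PiE) (auto simp: numeral_2_eq_2)

lemma signsD: "\<sigma> \<in> signs I \<Longrightarrow> i \<in> I \<Longrightarrow> \<sigma> i = -1 \<or> \<sigma> i = 1"
  unfolding signs_def by (auto dest: PiE_mem)

lemma sign_avg_empty: "sign_avg {} \<phi> = \<phi> (\<lambda>_. undefined)"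
  by (simp add: sign_avg_def signs_def)

lemma sign_avg_insert:
  assumes "finite I" "i \<notin> I"
  shows "sign_avg (insert i I) \<phi> = sign_avg I (\<lambda>\<sigma>. (1/2) *\<^sub>R (\<phi> (\<sigma>(i := 1)) + \<phi> (\<sigma>(i := -1))))"
proof -
  have "(\<Sum>\<sigma>\<in>signs (insert i I). \<phi> \<sigma>) = (\<Sum>(y, g)\<in>{-1, 1} \<times> signs I. \<phi> (g(i := y)))"
    unfolding signs_def PiE_insert_eq using inj_combinator[OF assms(2)]
    by (subst sum.reindex) (auto intro!: sum.cong)
  also have "\<dots> = (\<Sum>\<sigma>\<in>signs I. \<phi> (\<sigma>(i := -1))) + (\<Sum>\<sigma>\<in>signs I. \<phi> (\<sigma>(i := 1)))"
    by (simp add: sum.cartesian_product[symmetric])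
  finally show ?thesis
    using assms
    by (simp add: sign_avg_def sum.distrib scaleR_add_right scaleR_sum_right[symmetric] add.commute mult.commute)
qed

lemma sign_avg_cong: "(\<And>\<sigma>. \<sigma> \<in> signs I \<Longrightarrow> \<phi> \<sigma> = \<psi> \<sigma>) \<Longrightarrow> sign_avg I \<phi> = sign_avg I \<psi>"
  by (simp add: sign_avg_def cong: sum.cong)

lemma sign_avg_add: "sign_avg I (\<lambda>\<sigma>. \<phi> \<sigma> + \<psi> \<sigma>) = sign_avg I \<phi> + sign_avg I \<psi>"
  by (simp add: sign_avg_def sum.distrib scaleR_add_right)

lemma sign_avg_cmult: "sign_avg I (\<lambda>\<sigma>. c * \<phi> \<sigma>) = c * sign_avg I \<phi>" for c :: real
  by (simp add: sign_avg_def sum_distrib_left[symmetric])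

lemma sign_avg_divide: "sign_avg I (\<lambda>\<sigma>. \<phi> \<sigma> / c) = sign_avg I \<phi> / c" for c :: real
  by (simp add: sign_avg_def sum_divide_distrib[symmetric])

lemma sign_avg_const: "finite I \<Longrightarrow> sign_avg I (\<lambda>_. c) = c"
  by (simp add: sign_avg_def card_signs scaleR_right.sum[symmetric] sum_constant_scaleR)

lemma sign_avg_mono:
  fixes \<phi> \<psi> :: "_ \<Rightarrow> real"
  shows "(\<And>\<sigma>. \<sigma> \<in> signs I \<Longrightarrow> \<phi> \<sigma> \<le> \<psi> \<sigma>) \<Longrightarrow> sign_avg I \<phi> \<le> sign_avg I \<psi>"
  by (auto simp: sign_avg_def intro!: divide_right_mono sum_mono)

lemma sign_avg_nonneg:
  fixes \<phi> :: "_ \<Rightarrow> real"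
  shows "(\<And>\<sigma>. \<sigma> \<in> signs I \<Longrightarrow> 0 \<le> \<phi> \<sigma>) \<Longrightarrow> 0 \<le> sign_avg I \<phi>"
  by (auto simp: sign_avg_def intro!: sum_nonneg divide_nonneg_nonneg)

lemma norm_sign_avg_le: "norm (sign_avg I \<phi>) \<le> sign_avg I (\<lambda>\<sigma>. norm (\<phi> \<sigma>))"
  for \<phi> :: "_ \<Rightarrow> 'b::real_normed_vector"
  by (auto simp: sign_avg_def intro!: divide_right_mono norm_sum)

lemma sum_sign_avg: "(\<Sum>x\<in>A. w x * sign_avg I (\<phi> x)) = sign_avg I (\<lambda>\<sigma>. \<Sum>x\<in>A. w x * \<phi> x \<sigma>)"
  for w :: "_ \<Rightarrow> real"
  by (simp add: sign_avg_def sum_distrib_left sum_distrib_right sum.swap[of _ A] sum_divide_distrib mult.assoc)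

lemma sum_fun_upd_scaleR:
  assumes "finite I" "i \<notin> I"
  shows "(\<Sum>j\<in>insert i I. (\<sigma>(i := c)) j *\<^sub>R v j) = c *\<^sub>R v i + (\<Sum>j\<in>I. \<sigma> j *\<^sub>R v j)"
proof -
  have "(\<Sum>j\<in>I. (\<sigma>(i := c)) j *\<^sub>R v j) = (\<Sum>j\<in>I. \<sigma> j *\<^sub>R v j)"
    using assms(2) by (intro sum.cong) auto
  then show ?thesis using assms by simp
qed

subsection \<open>Powers of norms\<close>

lemma powr_two_point:
  fixes a b p t :: real
  assumes "1 \<le> p" "0 \<le> t" "t \<le> 1" "0 \<le> a" "0 \<le> b"
  shows "((1 - t) * a + t * b) powr p \<le> (1 - t) * a powr p + t * b powr p"
proof -
  have sm: "(s * x) powr p \<le> s * x powr p" if "0 \<le> s" "s \<le> 1" "0 \<le> x" for s x :: real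
    using that assms(1) powr_mono'[of 1 p s]
    by (cases "s = 0") (auto simp: powr_mult intro!: mult_right_mono)
  show ?thesis
  proof (cases "0 < a \<and> 0 < b")
    case True
    then show ?thesis
      using convex_onD[OF powr_convex[OF assms(1)] assms(2,3), of a b] by simp
  next
    case False
    then show ?thesis
      using assms sm[of t b] sm[of "1 - t" a] by (cases "a = 0") auto
  qed
qed

lemma powr_norm_two_point:
  fixes a b :: "'x::real_normed_vector"
  assumes "1 \<le> p" "0 \<le> t" "t \<le> 1"
  shows "norm ((1 - t) *\<^sub>R a + t *\<^sub>R b) powr p \<le> (1 - t) * norm a powr p + t * norm b powr p"
proof -
  have "norm ((1 - t) *\<^sub>R a + t *\<^sub>R b) \<le> (1 - t) *\<^sub>R norm a + t *\<^sub>R norm b"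
    using norm_triangle_ineq[of "(1 - t) *\<^sub>R a" "t *\<^sub>R b"] assms by simp
  then have "norm ((1 - t) *\<^sub>R a + t *\<^sub>R b) powr p \<le> ((1 - t) *\<^sub>R norm a + t *\<^sub>R norm b) powr p"
    using assms by (intro powr_mono2) auto
  also have "\<dots> \<le> (1 - t) * norm a powr p + t * norm b powr p"
    using powr_two_point[OF assms, of "norm a" "norm b"] by simp
  finally show ?thesis .
qed

lemma powr_add_le:
  fixes x y p :: real
  assumes "0 \<le> x" "0 \<le> y" "0 \<le> p"
  shows "(x + y) powr p \<le> 2 powr p * (x powr p + y powr p)"
proof -
  have "(x + y) powr p \<le> (2 * max x y) powr p" using assms by (intro powr_mono2) auto
  also have "\<dots> = 2 powr p * max x y powr p" using assms by (simp add: powr_mult)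
  also have "\<dots> \<le> 2 powr p * (x powr p + y powr p)"
    by (intro mult_left_mono) (auto simp: max_def)
  finally show ?thesis .
qed

lemma powr_norm_add_le:
  fixes a b :: "'x::real_normed_vector"
  assumes "0 \<le> p"
  shows "norm (a + b) powr p \<le> 2 powr p * (norm a powr p + norm b powr p)"
  using powr_add_le[of "norm a" "norm b" p] powr_mono2[OF assms norm_ge_zero norm_triangle_ineq[of a b]] assms
  by simp

subsection \<open>The contraction principle\<close>

text \<open>As a function of a single coefficient the average is convex and even, hence largest at the
  end points of the interval; coefficients are moved there one at a time.\<close>

lemma sign_avg_contraction:
  fixes v :: "'i \<Rightarrow> 'x::real_normed_vector"
  assumes "finite I" "1 \<le> p" "\<And>i. i \<in> I \<Longrightarrow> \<bar>m i\<bar> \<le> 1"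
  shows "sign_avg I (\<lambda>\<sigma>. norm (u + (\<Sum>i\<in>I. \<sigma> i *\<^sub>R m i *\<^sub>R v i)) powr p)
       \<le> sign_avg I (\<lambda>\<sigma>. norm (u + (\<Sum>i\<in>I. \<sigma> i *\<^sub>R v i)) powr p)"
  using assms(1,3)
proof (induction I arbitrary: u rule: finite_induct)
  case (insert i I)
  let ?n = "\<lambda>z. norm z powr p"
  have two: "?n (z + m i *\<^sub>R v i) + ?n (z - m i *\<^sub>R v i) \<le> ?n (z + v i) + ?n (z - v i)" for z
  proof -
    define t where "t = (1 + m i) / 2"
    have t: "0 \<le> t" "t \<le> 1" using insert.prems[of i] by (auto simp: t_def abs_le_iff)
    have gen: "(1 - t) *\<^sub>R (z - y) + t *\<^sub>R (z + y) = z + (t + t - 1) *\<^sub>R y" for y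
      by (simp add: algebra_simps) (metis mult_2_right scaleR_add_left)
    have tt: "t + t - 1 = m i" by (simp add: t_def field_simps)
    have e1: "(1 - t) *\<^sub>R (z - v i) + t *\<^sub>R (z + v i) = z + m i *\<^sub>R v i"
      and e2: "(1 - t) *\<^sub>R (z + v i) + t *\<^sub>R (z - v i) = z - m i *\<^sub>R v i"
      using gen[of "v i"] gen[of "- v i"] unfolding tt by simp_all
    show ?thesis
      using powr_norm_two_point[OF assms(2) t, of "z - v i" "z + v i"]
        powr_norm_two_point[OF assms(2) t, of "z + v i" "z - v i"]
      unfolding e1 e2 by (simp add: algebra_simps)
  qed
  have *: "sign_avg I (\<lambda>\<sigma>. ?n (u + s *\<^sub>R m i *\<^sub>R v i + (\<Sum>j\<in>I. \<sigma> j *\<^sub>R m j *\<^sub>R v j)))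
      \<le> sign_avg I (\<lambda>\<sigma>. ?n (u + s *\<^sub>R m i *\<^sub>R v i + (\<Sum>j\<in>I. \<sigma> j *\<^sub>R v j)))" for s
    using insert.prems by (intro insert.IH) auto
  have "sign_avg (insert i I) (\<lambda>\<sigma>. ?n (u + (\<Sum>j\<in>insert i I. \<sigma> j *\<^sub>R m j *\<^sub>R v j)))
     = (1/2) * (sign_avg I (\<lambda>\<sigma>. ?n (u + 1 *\<^sub>R m i *\<^sub>R v i + (\<Sum>j\<in>I. \<sigma> j *\<^sub>R m j *\<^sub>R v j)))
       + sign_avg I (\<lambda>\<sigma>. ?n (u + (-1) *\<^sub>R m i *\<^sub>R v i + (\<Sum>j\<in>I. \<sigma> j *\<^sub>R m j *\<^sub>R v j))))"
    unfolding sign_avg_insert[OF insert.hyps(1,2)] sum_fun_upd_scaleR[OF insert.hyps(1,2)]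
    by (simp only: real_scaleR_def sign_avg_cmult sign_avg_add add.assoc)
  also have "\<dots> \<le> (1/2) * (sign_avg I (\<lambda>\<sigma>. ?n (u + 1 *\<^sub>R m i *\<^sub>R v i + (\<Sum>j\<in>I. \<sigma> j *\<^sub>R v j)))
       + sign_avg I (\<lambda>\<sigma>. ?n (u + (-1) *\<^sub>R m i *\<^sub>R v i + (\<Sum>j\<in>I. \<sigma> j *\<^sub>R v j))))"
    using *[of 1] *[of "-1"] by simp
  also have "\<dots> = (1/2) * sign_avg I (\<lambda>\<sigma>. ?n ((u + (\<Sum>j\<in>I. \<sigma> j *\<^sub>R v j)) + m i *\<^sub>R v i) + ?n ((u + (\<Sum>j\<in>I. \<sigma> j *\<^sub>R v j)) - m i *\<^sub>R v i))"
    by (simp only: sign_avg_add[symmetric]) (simp add: algebra_simps)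
  also have "\<dots> \<le> (1/2) * sign_avg I (\<lambda>\<sigma>. ?n ((u + (\<Sum>j\<in>I. \<sigma> j *\<^sub>R v j)) + v i) + ?n ((u + (\<Sum>j\<in>I. \<sigma> j *\<^sub>R v j)) - v i))"
    by (intro mult_left_mono sign_avg_mono two) auto
  also have "\<dots> = sign_avg (insert i I) (\<lambda>\<sigma>. ?n (u + (\<Sum>j\<in>insert i I. \<sigma> j *\<^sub>R v j)))"
    unfolding sign_avg_insert[OF insert.hyps(1,2)] sum_fun_upd_scaleR[OF insert.hyps(1,2)]
    by (simp only: real_scaleR_def sign_avg_cmult scaleR_one scaleR_minus1_left)
      (simp add: algebra_simps)
  finally show ?case .
qed (simp add: sign_avg_empty)

lemma scaleC_bounded_linear_right: "bounded_linear (\<lambda>x::'x::complex_banach. c *\<^sub>C x)"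
proof (rule bounded_linear_intro[where K="cmod c"])
  show "c *\<^sub>C (r *\<^sub>R x) = r *\<^sub>R c *\<^sub>C x" for r and x :: 'x
    by (simp add: scaleC_complex_of_real[symmetric] scaleC_scaleC mult.commute)
qed (auto simp: scaleC_add_right norm_scaleC mult.commute)

lemma scaleC_bounded_linear_left: "bounded_linear (\<lambda>c. c *\<^sub>C (x::'x::complex_banach))"
proof (rule bounded_linear_intro[where K="norm x"])
  show "(r *\<^sub>R c) *\<^sub>C x = r *\<^sub>R c *\<^sub>C x" for r c
    by (simp add: scaleC_complex_of_real[symmetric] scaleC_scaleC scaleR_conv_of_real)
qed (auto simp: scaleC_add_left norm_scaleC)

lemmas scaleC_linear_right = bounded_linear.linear[OF scaleC_bounded_linear_right]
  and scaleC_linear_left = bounded_linear.linear[OF scaleC_bounded_linear_left]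

lemmas scaleC_zero_right [simp] = linear_0[OF scaleC_linear_right]
  and scaleC_zero_left [simp] = linear_0[OF scaleC_linear_left]
  and scaleC_scaleR_right = linear_cmul[OF scaleC_linear_right]
  and scaleC_scaleR_left = linear_cmul[OF scaleC_linear_left]
  and scaleC_sum_right = linear_sum[OF scaleC_linear_right]
  and scaleC_diff_right = linear_diff[OF scaleC_linear_right]
  and scaleC_diff_left = linear_diff[OF scaleC_linear_left]

lemma scaleC_one [simp]: "1 *\<^sub>C x = x"
  using scaleC_complex_of_real[of 1 x] by simp

text \<open>The real and the imaginary parts of the multipliers are contracted separately.\<close>

lemma sign_avg_complex_contraction:
  fixes v :: "'i \<Rightarrow> 'x::complex_banach"
  assumes "finite I" "1 \<le> p" "0 < \<kappa>" "\<And>i. i \<in> I \<Longrightarrow> cmod (m i) \<le> \<kappa>"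
  shows "sign_avg I (\<lambda>\<sigma>. norm (\<Sum>i\<in>I. \<sigma> i *\<^sub>R m i *\<^sub>C v i) powr p)
       \<le> 2 * (2 * \<kappa>) powr p * sign_avg I (\<lambda>\<sigma>. norm (\<Sum>i\<in>I. \<sigma> i *\<^sub>R v i) powr p)"
proof -
  have split: "m i *\<^sub>C v i = \<kappa> *\<^sub>R (Re (m i) / \<kappa>) *\<^sub>R v i + \<kappa> *\<^sub>R \<i> *\<^sub>C (Im (m i) / \<kappa>) *\<^sub>R v i" for i
  proof -
    have "m i *\<^sub>C v i = (complex_of_real (Re (m i)) + \<i> * complex_of_real (Im (m i))) *\<^sub>C v i"
      by (simp add: complex_eq[symmetric])
    also have "\<dots> = Re (m i) *\<^sub>R v i + \<i> *\<^sub>C Im (m i) *\<^sub>R v i"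
      by (simp add: scaleC_add_left scaleC_complex_of_real flip: scaleC_scaleC)
    finally show ?thesis using assms(3) by (simp add: scaleC_scaleR_right)
  qed
  let ?A = "\<lambda>\<sigma>. \<Sum>i\<in>I. \<sigma> i *\<^sub>R (Re (m i) / \<kappa>) *\<^sub>R v i" and ?B = "\<lambda>\<sigma>. \<Sum>i\<in>I. \<sigma> i *\<^sub>R (Im (m i) / \<kappa>) *\<^sub>R v i"
  let ?R = "sign_avg I (\<lambda>\<sigma>. norm (\<Sum>i\<in>I. \<sigma> i *\<^sub>R v i) powr p)"
  have kz: "\<kappa> \<noteq> 0" using assms(3) by simp
  have sum: "(\<Sum>i\<in>I. \<sigma> i *\<^sub>R m i *\<^sub>C v i) = \<kappa> *\<^sub>R ?A \<sigma> + \<kappa> *\<^sub>R \<i> *\<^sub>C ?B \<sigma>" for \<sigma>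
    by (simp add: split scaleC_sum_right scaleC_scaleR_right scaleR_sum_right scaleR_add_right
        sum.distrib mult.left_commute[of \<kappa>] kz)
  have "norm (\<Sum>i\<in>I. \<sigma> i *\<^sub>R m i *\<^sub>C v i) powr p \<le> (2 * \<kappa>) powr p * (norm (?A \<sigma>) powr p + norm (?B \<sigma>) powr p)" for \<sigma>
    unfolding sum
    by (rule order_trans[OF powr_norm_add_le]) (use assms in \<open>simp_all add: norm_scaleC powr_mult algebra_simps\<close>)
  then have "sign_avg I (\<lambda>\<sigma>. norm (\<Sum>i\<in>I. \<sigma> i *\<^sub>R m i *\<^sub>C v i) powr p)
      \<le> (2 * \<kappa>) powr p * (sign_avg I (\<lambda>\<sigma>. norm (?A \<sigma>) powr p) + sign_avg I (\<lambda>\<sigma>. norm (?B \<sigma>) powr p))"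
    unfolding sign_avg_add[symmetric] sign_avg_cmult[symmetric] by (rule sign_avg_mono)
  also have "\<dots> \<le> (2 * \<kappa>) powr p * (?R + ?R)"
  proof (intro mult_left_mono add_mono)
    have le: "\<bar>Re (m i) / \<kappa>\<bar> \<le> 1" "\<bar>Im (m i) / \<kappa>\<bar> \<le> 1" if "i \<in> I" for i
      using assms(3) assms(4)[OF that] abs_Re_le_cmod[of "m i"] abs_Im_le_cmod[of "m i"] by auto
    show "sign_avg I (\<lambda>\<sigma>. norm (?A \<sigma>) powr p) \<le> ?R"
      using sign_avg_contraction[OF assms(1,2) le(1), where u=0 and v=v] by simp
    show "sign_avg I (\<lambda>\<sigma>. norm (?B \<sigma>) powr p) \<le> ?R"
      using sign_avg_contraction[OF assms(1,2) le(2), where u=0 and v=v] by simp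
  qed auto
  finally show ?thesis by simp
qed

subsection \<open>Randomised products and exponential moments\<close>

text \<open>Distinct signs are uncorrelated, so only the diagonal of the product survives. The shifts
  \<open>s\<close> and \<open>u\<close> absorb the terms already removed in the induction.\<close>

lemma sign_avg_product_shift:
  fixes v :: "'i \<Rightarrow> 'x::complex_banach"
  assumes "finite I"
  shows "sign_avg I (\<lambda>\<sigma>. (s + (\<Sum>i\<in>I. \<sigma> i *\<^sub>R e i)) *\<^sub>C (u + (\<Sum>i\<in>I. \<sigma> i *\<^sub>R v i)))
       = s *\<^sub>C u + (\<Sum>i\<in>I. e i *\<^sub>C v i)"
  using assms
proof (induction I arbitrary: s u rule: finite_induct)
  case (insert i I)
  have half: "sign_avg I (\<lambda>\<sigma>. (1/2) *\<^sub>R \<phi> \<sigma>) = (1/2) *\<^sub>R sign_avg I \<phi>" for \<phi> :: "_ \<Rightarrow> 'x"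
    by (simp add: sign_avg_def scaleR_sum_right mult.commute)
  show ?case
    unfolding sign_avg_insert[OF insert.hyps(1,2)] sum_fun_upd_scaleR[OF insert.hyps(1,2)]
      half sign_avg_add add.assoc[symmetric] insert.IH
    using insert.hyps
    by (simp add: scaleC_add_left scaleC_add_right scaleC_diff_left scaleC_diff_right
        scaleR_add_right scaleR_2[symmetric] algebra_simps)
qed (simp add: sign_avg_empty)

lemma sign_avg_product:
  fixes v :: "'i \<Rightarrow> 'x::complex_banach"
  assumes "finite I"
  shows "(\<Sum>i\<in>I. e i *\<^sub>C v i) = sign_avg I (\<lambda>\<sigma>. (\<Sum>i\<in>I. \<sigma> i *\<^sub>R e i) *\<^sub>C (\<Sum>i\<in>I. \<sigma> i *\<^sub>R v i))"
  using sign_avg_product_shift[OF assms, of 0 e 0 v] by simp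

lemma cosh_le_exp_square: "(exp x + exp (- x)) / 2 \<le> exp (x\<^sup>2)" for x :: real
proof -
  have pos: "(exp x + exp (- x)) / 2 \<le> exp (x\<^sup>2)" if "0 \<le> x" for x :: real
  proof (cases "x \<le> 1")
    case True
    have "exp x \<le> 1 + x + x\<^sup>2" using exp_bound[OF that True] by simp
    moreover have "exp (- x) \<le> 1 - x + x\<^sup>2"
    proof -
      have "1 \<le> (1 - x + x\<^sup>2) * (1 + x)"
        using that by (simp add: algebra_simps power2_eq_square)
      also have "\<dots> \<le> (1 - x + x\<^sup>2) * exp x"
        using that True by (intro mult_left_mono exp_ge_add_one_self) auto
      finally show ?thesis by (simp add: exp_minus field_simps)
    qed
    ultimately show ?thesis using exp_ge_add_one_self[of "x\<^sup>2"] by argo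
  next
    case False
    then have "exp x \<le> exp (x\<^sup>2)" by (simp add: power2_eq_square)
    moreover have "exp (- x) \<le> exp x" using that by simp
    ultimately show ?thesis by argo
  qed
  show ?thesis using pos[of x] pos[of "- x"] by (cases "0 \<le> x") (auto simp: add.commute)
qed

lemma sign_avg_exp_le:
  fixes x :: "'i \<Rightarrow> real"
  assumes "finite I"
  shows "sign_avg I (\<lambda>\<sigma>. exp (s + (\<Sum>i\<in>I. \<sigma> i *\<^sub>R x i))) \<le> exp (s + (\<Sum>i\<in>I. (x i)\<^sup>2))"
  using assms
proof (induction I arbitrary: s rule: finite_induct)
  case (insert i I)
  have "sign_avg (insert i I) (\<lambda>\<sigma>. exp (s + (\<Sum>j\<in>insert i I. \<sigma> j *\<^sub>R x j)))
      = (1/2) * (sign_avg I (\<lambda>\<sigma>. exp ((s + x i) + (\<Sum>j\<in>I. \<sigma> j *\<^sub>R x j))) + sign_avg I (\<lambda>\<sigma>. exp ((s - x i) + (\<Sum>j\<in>I. \<sigma> j *\<^sub>R x j))))"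
    unfolding sign_avg_insert[OF insert.hyps(1,2)] sum_fun_upd_scaleR[OF insert.hyps(1,2)]
    by (simp add: sign_avg_divide sign_avg_add algebra_simps add_divide_distrib)
  also have "\<dots> \<le> (1/2) * (exp ((s + x i) + (\<Sum>j\<in>I. (x j)\<^sup>2)) + exp ((s - x i) + (\<Sum>j\<in>I. (x j)\<^sup>2)))"
    by (intro mult_left_mono add_mono insert.IH) auto
  also have "\<dots> = ((exp (x i) + exp (- x i)) / 2) * exp (s + (\<Sum>j\<in>I. (x j)\<^sup>2))"
    by (simp add: exp_add exp_diff exp_minus field_simps)
  also have "\<dots> \<le> exp ((x i)\<^sup>2) * exp (s + (\<Sum>j\<in>I. (x j)\<^sup>2))"
    by (intro mult_right_mono cosh_le_exp_square) auto
  also have "\<dots> = exp (s + (\<Sum>j\<in>insert i I. (x j)\<^sup>2))"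
    using insert.hyps by (simp add: exp_add algebra_simps)
  finally show ?case .
qed (simp add: sign_avg_empty)

lemma powr_le_exp: "t powr q \<le> q powr q * exp t" if "0 \<le> t" "0 < q" for t q :: real
proof (cases "t = 0")
  case False
  then have t: "0 < t" using that by simp
  have "ln (t / q) \<le> t / q - 1" using t that by (intro ln_le_minus_one) auto
  then have "q * ln (t / q) \<le> q * (t / q - 1)" using that by (intro mult_left_mono) auto
  then have "q * ln t \<le> q * ln q + t" using t that by (simp add: ln_div algebra_simps)
  then have "exp (q * ln t) \<le> exp (q * ln q + t)" by simp
  then show ?thesis using t that by (simp add: powr_def exp_add)
qed (use that in auto)

text \<open>Independence turns the exponential moment into a product of hyperbolic cosines, which the
  square sum controls; powers are dominated by exponentials.\<close>

lemma sign_avg_moment: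
  fixes e :: "'i \<Rightarrow> complex"
  assumes "finite I" "0 < q" and B: "(\<Sum>i\<in>I. (cmod (e i))\<^sup>2) \<le> B"
  shows "sign_avg I (\<lambda>\<sigma>. cmod (\<Sum>i\<in>I. \<sigma> i *\<^sub>R e i) powr q) \<le> q powr q * (2 * exp (4 * B))"
proof -
  let ?r = "\<lambda>\<sigma>. \<Sum>i\<in>I. \<sigma> i *\<^sub>R Re (e i)" and ?i = "\<lambda>\<sigma>. \<Sum>i\<in>I. \<sigma> i *\<^sub>R Im (e i)"
  have pt: "cmod (\<Sum>i\<in>I. \<sigma> i *\<^sub>R e i) powr q
      \<le> q powr q * ((1/2) * (exp (2 * ?r \<sigma>) + exp (- 2 * ?r \<sigma>) + (exp (2 * ?i \<sigma>) + exp (- 2 * ?i \<sigma>))))" for \<sigma>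
  proof -
    let ?z = "\<Sum>i\<in>I. \<sigma> i *\<^sub>R e i"
    have z: "Re ?z = ?r \<sigma>" "Im ?z = ?i \<sigma>" by simp_all
    have "exp (cmod ?z) \<le> exp \<bar>?r \<sigma>\<bar> * exp \<bar>?i \<sigma>\<bar>"
      using cmod_le[of ?z] unfolding z by (simp flip: exp_add)
    also have "\<dots> \<le> (1/2) * ((exp \<bar>?r \<sigma>\<bar>)\<^sup>2 + (exp \<bar>?i \<sigma>\<bar>)\<^sup>2)"
      using sum_squares_bound[of "exp \<bar>?r \<sigma>\<bar>" "exp \<bar>?i \<sigma>\<bar>"] by simp
    also have "\<dots> = (1/2) * (exp (2 * \<bar>?r \<sigma>\<bar>) + exp (2 * \<bar>?i \<sigma>\<bar>))"
      by (simp add: exp_double)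
    also have "\<dots> \<le> (1/2) * (exp (2 * ?r \<sigma>) + exp (- 2 * ?r \<sigma>) + (exp (2 * ?i \<sigma>) + exp (- 2 * ?i \<sigma>)))"
      by (intro mult_left_mono add_mono) (auto simp: abs_if)
    finally show ?thesis
      by (intro order_trans[OF powr_le_exp[OF norm_ge_zero assms(2)]] mult_left_mono) auto
  qed
  have ex: "sign_avg I (\<lambda>\<sigma>. exp (c * (\<Sum>i\<in>I. \<sigma> i *\<^sub>R x i))) \<le> exp (4 * B)"
    if c: "c = 2 \<or> c = -2" and x: "\<And>i. i \<in> I \<Longrightarrow> \<bar>x i\<bar> \<le> cmod (e i)" for x and c :: real
  proof -
    have "sign_avg I (\<lambda>\<sigma>. exp (0 + (\<Sum>i\<in>I. \<sigma> i *\<^sub>R (c * x i)))) \<le> exp (0 + (\<Sum>i\<in>I. (c * x i)\<^sup>2))"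
      by (rule sign_avg_exp_le[OF assms(1)])
    also have "\<dots> = exp (4 * (\<Sum>i\<in>I. (x i)\<^sup>2))"
      using c by (auto simp: power_mult_distrib sum_distrib_left)
    also have "\<dots> \<le> exp (4 * B)"
      using B sum_mono[of I "\<lambda>i. (x i)\<^sup>2" "\<lambda>i. (cmod (e i))\<^sup>2"] x by (simp add: abs_le_square_iff[symmetric])
    finally show ?thesis by (simp add: sum_distrib_left mult.left_commute)
  qed
  have "sign_avg I (\<lambda>\<sigma>. cmod (\<Sum>i\<in>I. \<sigma> i *\<^sub>R e i) powr q)
    \<le> q powr q * ((1/2) * (sign_avg I (\<lambda>\<sigma>. exp (2 * ?r \<sigma>)) + sign_avg I (\<lambda>\<sigma>. exp (- 2 * ?r \<sigma>)) +
      (sign_avg I (\<lambda>\<sigma>. exp (2 * ?i \<sigma>)) + sign_avg I (\<lambda>\<sigma>. exp (- 2 * ?i \<sigma>)))))"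
    unfolding sign_avg_add[symmetric] sign_avg_cmult[symmetric] by (rule sign_avg_mono) (rule pt)
  also have "\<dots> \<le> q powr q * ((1/2) * (exp (4 * B) + exp (4 * B) + (exp (4 * B) + exp (4 * B))))"
    by (intro mult_left_mono add_mono ex) (auto simp: abs_Re_le_cmod abs_Im_le_cmod)
  finally show ?thesis by simp
qed

section \<open>The Bochner integral in arbitrary Banach spaces\<close>

abbreviation "simple_bochner_integrable \<equiv> Bochner_Integration.simple_bochner_integrable"
abbreviation "simple_bochner_integral \<equiv> Bochner_Integration.simple_bochner_integral"

definition strong_integrable :: "'a measure \<Rightarrow> ('a \<Rightarrow> 'x::real_normed_vector) \<Rightarrow> bool" where
  "strong_integrable M f \<longleftrightarrow> strongly_measurable M f \<and> (\<integral>\<^sup>+x. ennreal (norm (f x)) \<partial>M) < \<infinity>"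

lemma strongly_measurable_compose2:
  assumes "strongly_measurable M f" "strongly_measurable M g"
    and "\<And>u v a b. u \<longlonglongrightarrow> a \<Longrightarrow> v \<longlonglongrightarrow> b \<Longrightarrow> (\<lambda>i::nat. p (u i) (v i)) \<longlonglongrightarrow> p a b"
  shows "strongly_measurable M (\<lambda>x. p (f x) (g x))"
proof -
  obtain s t where s: "\<And>i::nat. simple_function M (s i)" "\<And>x. x \<in> space M \<Longrightarrow> (\<lambda>i. s i x) \<longlonglongrightarrow> f x"
    and t: "\<And>i::nat. simple_function M (t i)" "\<And>x. x \<in> space M \<Longrightarrow> (\<lambda>i. t i x) \<longlonglongrightarrow> g x"
    using assms(1,2) unfolding strongly_measurable_def by metis
  show ?thesis
    unfolding strongly_measurable_def
  proof (intro exI[of _ "\<lambda>i x. p (s i x) (t i x)"] conjI allI ballI)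
    show "simple_function M (\<lambda>x. p (s i x) (t i x))" for i
      using s(1) t(1) by (rule simple_function_compose2)
    show "(\<lambda>i. p (s i x) (t i x)) \<longlonglongrightarrow> p (f x) (g x)" if "x \<in> space M" for x
      using assms(3)[OF s(2) t(2)] that by blast
  qed
qed

lemma strongly_measurable_simple: "simple_function M f \<Longrightarrow> strongly_measurable M f"
  unfolding strongly_measurable_def by (rule exI[of _ "\<lambda>_. f"]) auto

lemma strongly_measurable_add:
  fixes f g :: "'a \<Rightarrow> 'x::real_normed_vector"
  shows "strongly_measurable M f \<Longrightarrow> strongly_measurable M g \<Longrightarrow> strongly_measurable M (\<lambda>x. f x + g x)"
  by (rule strongly_measurable_compose2) (auto intro: tendsto_add)

lemma strongly_measurable_diff:
  fixes f g :: "'a \<Rightarrow> 'x::real_normed_vector"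
  shows "strongly_measurable M f \<Longrightarrow> strongly_measurable M g \<Longrightarrow> strongly_measurable M (\<lambda>x. f x - g x)"
  by (rule strongly_measurable_compose2) (auto intro: tendsto_diff)

lemma strongly_measurable_sum:
  fixes f :: "'k \<Rightarrow> 'a \<Rightarrow> 'x::real_normed_vector"
  assumes "finite K" "\<And>k. k \<in> K \<Longrightarrow> strongly_measurable M (f k)"
  shows "strongly_measurable M (\<lambda>x. \<Sum>k\<in>K. f k x)"
  using assms by (induction K rule: finite_induct)
    (auto intro: strongly_measurable_add strongly_measurable_simple)

lemma strongly_measurable_scaleR:
  fixes f :: "'a \<Rightarrow> 'x::real_normed_vector" and r :: "'a \<Rightarrow> real"
  assumes "r \<in> borel_measurable M" "strongly_measurable M f"
  shows "strongly_measurable M (\<lambda>x. r x *\<^sub>R f x)"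
  using assms(1)[folded strongly_measurable_iff_borel] assms(2)
  by (rule strongly_measurable_compose2) (auto intro: tendsto_scaleR)

lemma strongly_measurable_indicator:
  fixes f :: "'a \<Rightarrow> 'x::real_normed_vector"
  assumes "A \<in> sets M" "strongly_measurable M f"
  shows "strongly_measurable M (\<lambda>x. indicator A x *\<^sub>R f x)"
  by (rule strongly_measurable_scaleR[OF _ assms(2)]) (use assms(1) in auto)

lemma borel_measurable_norm_strongly_measurable:
  fixes f :: "'a \<Rightarrow> 'x::real_normed_vector"
  assumes "strongly_measurable M f"
  shows "(\<lambda>x. norm (f x)) \<in> borel_measurable M"
proof -
  obtain s where s: "\<And>i::nat. simple_function M (s i)" "\<And>x. x \<in> space M \<Longrightarrow> (\<lambda>i. s i x) \<longlonglongrightarrow> f x"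
    using assms unfolding strongly_measurable_def by metis
  have "(\<lambda>x. norm (s i x)) \<in> borel_measurable M" for i
    by (rule borel_measurable_simple_function[OF simple_function_compose1[OF s(1)]])
  then show ?thesis
    by (rule borel_measurable_LIMSEQ_real[of M "\<lambda>i x. norm (s i x)", rotated])
       (rule tendsto_norm[OF s(2)])
qed

text \<open>Cutting the approximants off where they exceed twice the norm of the limit makes them
  dominated, which opens the way to dominated convergence.\<close>

lemma strongly_measurable_dominated_approx:
  fixes f :: "'a \<Rightarrow> 'x::real_normed_vector"
  assumes "strongly_measurable M f"
  obtains s :: "nat \<Rightarrow> 'a \<Rightarrow> 'x" where "\<And>i. simple_function M (s i)"
    "\<And>x. x \<in> space M \<Longrightarrow> (\<lambda>i. s i x) \<longlonglongrightarrow> f x"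
    "\<And>i x. x \<in> space M \<Longrightarrow> norm (s i x) \<le> 2 * norm (f x)"
proof -
  obtain s where s: "\<And>i::nat. simple_function M (s i)" "\<And>x. x \<in> space M \<Longrightarrow> (\<lambda>i. s i x) \<longlonglongrightarrow> f x"
    using assms unfolding strongly_measurable_def by metis
  have [measurable]: "(\<lambda>x. norm (f x)) \<in> borel_measurable M"
    by (rule borel_measurable_norm_strongly_measurable[OF assms])
  have [measurable]: "(\<lambda>x. norm (s i x)) \<in> borel_measurable M" for i
    by (rule borel_measurable_simple_function[OF simple_function_compose1[OF s(1)]])
  define t where "t i x = (if norm (s i x) \<le> 2 * norm (f x) then s i x else 0)" for i x
  show ?thesis
  proof (rule that)
    show "simple_function M (t i)" for i
    proof -
      have "simple_function M (\<lambda>x. if x \<in> {x\<in>space M. norm (s i x) \<le> 2 * norm (f x)} then s i x else 0)"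
        by (rule simple_function_If_set) (auto intro: s)
      then show ?thesis
        by (rule simple_function_cong[THEN iffD1, rotated]) (auto simp: t_def)
    qed
    show "norm (t i x) \<le> 2 * norm (f x)" for i x
      by (auto simp: t_def)
    show "(\<lambda>i. t i x) \<longlonglongrightarrow> f x" if x: "x \<in> space M" for x
    proof (cases "f x = 0")
      case True
      then have "t i x = 0" for i by (auto simp: t_def)
      then show ?thesis using True by simp
    next
      case False
      have "(\<lambda>i. norm (s i x)) \<longlonglongrightarrow> norm (f x)"
        by (rule tendsto_norm[OF s(2)[OF x]])
      moreover have "norm (f x) < 2 * norm (f x)" using False by simp
      ultimately have "\<forall>\<^sub>F i in sequentially. norm (s i x) < 2 * norm (f x)"
        by (rule order_tendstoD)
      then have "\<forall>\<^sub>F i in sequentially. s i x = t i x"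
        by eventually_elim (auto simp: t_def)
      then show ?thesis
        using s(2)[OF x] by (rule Lim_transform_eventually[rotated])
    qed
  qed
qed

lemma has_strong_integralE:
  assumes "has_strong_integral M f v"
  obtains s where "strongly_measurable M f" "\<And>i::nat. simple_bochner_integrable M (s i)"
    "(\<lambda>i. \<integral>\<^sup>+x. ennreal (norm (f x - s i x)) \<partial>M) \<longlonglongrightarrow> 0"
    "(\<lambda>i. simple_bochner_integral M (s i)) \<longlonglongrightarrow> v"
  using assms unfolding has_strong_integral_def by blast

lemma has_strong_integral_simple:
  "simple_bochner_integrable M f \<Longrightarrow> has_strong_integral M f (simple_bochner_integral M f)"
  unfolding has_strong_integral_def
  by (auto intro!: exI[of _ "\<lambda>_. f"] strongly_measurable_simple elim: simple_bochner_integrable.cases)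

lemma simple_bochner_integral_dist:
  assumes "simple_bochner_integrable M s" "simple_bochner_integrable M t"
  shows "ennreal (norm (simple_bochner_integral M s - simple_bochner_integral M t)) \<le>
    (\<integral>\<^sup>+ x. norm (s x - t x) \<partial>M)"
proof -
  have "ennreal (norm (simple_bochner_integral M s - simple_bochner_integral M t))
      = norm (simple_bochner_integral M (\<lambda>x. s x - t x))"
    using assms by (subst simple_bochner_integral_diff) auto
  also have "\<dots> \<le> simple_bochner_integral M (\<lambda>x. norm (s x - t x))"
    using simple_bochner_integrable_compose2[of "(-)" M "s" "t"] assms
    by (auto intro!: simple_bochner_integral_norm_bound)
  also have "\<dots> = (\<integral>\<^sup>+x. norm (s x - t x) \<partial>M)"
    using simple_bochner_integrable_compose2[of "\<lambda>x y. norm (x - y)" M "s" "t"] assms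
    by (auto intro!: simple_bochner_integral_eq_nn_integral)
  finally show ?thesis .
qed

lemma strongly_measurable_simple_bochner_integrable: "simple_bochner_integrable M f \<Longrightarrow> strongly_measurable M f"
  by (auto intro!: strongly_measurable_simple elim: simple_bochner_integrable.cases)

lemma has_strong_integral_dist:
  fixes f g :: "'a \<Rightarrow> 'x::real_normed_vector"
  assumes f: "has_strong_integral M f v" and g: "has_strong_integral M g w"
  shows "ennreal (norm (v - w)) \<le> (\<integral>\<^sup>+x. norm (f x - g x) \<partial>M)"
proof -
  obtain s where fm: "strongly_measurable M f"
    and s: "\<And>i::nat. simple_bochner_integrable M (s i)"
      "(\<lambda>i. \<integral>\<^sup>+x. ennreal (norm (f x - s i x)) \<partial>M) \<longlonglongrightarrow> 0"
      "(\<lambda>i. simple_bochner_integral M (s i)) \<longlonglongrightarrow> v"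
    using f by (rule has_strong_integralE) blast
  obtain t where gm: "strongly_measurable M g"
    and t: "\<And>i::nat. simple_bochner_integrable M (t i)"
      "(\<lambda>i. \<integral>\<^sup>+x. ennreal (norm (g x - t i x)) \<partial>M) \<longlonglongrightarrow> 0"
      "(\<lambda>i. simple_bochner_integral M (t i)) \<longlonglongrightarrow> w"
    using g by (rule has_strong_integralE) blast
  have [measurable]: "(\<lambda>x. norm (f x - s i x)) \<in> borel_measurable M"
     "(\<lambda>x. norm (g x - t i x)) \<in> borel_measurable M"
     "(\<lambda>x. norm (f x - g x)) \<in> borel_measurable M" for i
    by (intro borel_measurable_norm_strongly_measurable strongly_measurable_diff fm gm
        strongly_measurable_simple_bochner_integrable s t)+
  let ?S = "\<lambda>i. \<integral>\<^sup>+x. ennreal (norm (f x - s i x)) \<partial>M" and ?T = "\<lambda>i. \<integral>\<^sup>+x. ennreal (norm (g x - t i x)) \<partial>M"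
  let ?D = "\<integral>\<^sup>+x. norm (f x - g x) \<partial>M"
  have b: "ennreal (norm (simple_bochner_integral M (s i) - simple_bochner_integral M (t i))) \<le> ?S i + ?D + ?T i" for i
  proof -
    have "norm (s i x - t i x) \<le> norm (f x - s i x) + norm (f x - g x) + norm (g x - t i x)" for x
      using norm_triangle_ineq[of "- (f x - s i x) + (f x - g x)" "g x - t i x"]
        norm_triangle_ineq[of "- (f x - s i x)" "f x - g x"] norm_minus_cancel[of "f x - s i x"]
      by (simp add: algebra_simps)
    then have "(\<integral>\<^sup>+ x. norm (s i x - t i x) \<partial>M)
        \<le> (\<integral>\<^sup>+ x. ennreal (norm (f x - s i x)) + ennreal (norm (f x - g x)) + ennreal (norm (g x - t i x)) \<partial>M)"
      by (intro nn_integral_mono) (simp flip: ennreal_plus)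
    also have "\<dots> = ?S i + ?D + ?T i"
      by (simp add: nn_integral_add)
    finally show ?thesis
      using simple_bochner_integral_dist[OF s(1) t(1), of i i] by (rule order_trans[rotated])
  qed
  have "(\<lambda>i. ?S i + ?D + ?T i) \<longlonglongrightarrow> 0 + ?D + 0"
    by (intro tendsto_add s t tendsto_const)
  moreover have "(\<lambda>i. ennreal (norm (simple_bochner_integral M (s i) - simple_bochner_integral M (t i)))) \<longlonglongrightarrow> ennreal (norm (v - w))"
    by (intro tendsto_ennrealI tendsto_norm tendsto_diff s t)
  ultimately show ?thesis
    using b by (auto intro: LIMSEQ_le)
qed

lemma has_strong_integral_unique:
  "has_strong_integral M f v \<Longrightarrow> has_strong_integral M f w \<Longrightarrow> v = w"
  using has_strong_integral_dist[of M f v f w] by (simp flip: zero_ennreal_def)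

lemma strong_integral_eqI: "has_strong_integral M f v \<Longrightarrow> strong_integral M f = v"
  unfolding strong_integral_def using has_strong_integral_unique by (metis the_equality)

text \<open>The integrals of dominated simple approximants form a Cauchy sequence; completeness of the
  space provides their limit.\<close>

lemma strong_integrable_has_strong_integral:
  fixes f :: "'a \<Rightarrow> 'x::banach"
  assumes "strong_integrable M f"
  shows "has_strong_integral M f (strong_integral M f)"
proof -
  have fm: "strongly_measurable M f" and fin: "(\<integral>\<^sup>+x. ennreal (norm (f x)) \<partial>M) < \<infinity>"
    using assms unfolding strong_integrable_def by auto
  have [measurable]: "(\<lambda>x. norm (f x)) \<in> borel_measurable M"
    by (rule borel_measurable_norm_strongly_measurable[OF fm])
  obtain s where s: "\<And>i. simple_function M (s i)" "\<And>x. x \<in> space M \<Longrightarrow> (\<lambda>i. s i x) \<longlonglongrightarrow> f x"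
    "\<And>i x. x \<in> space M \<Longrightarrow> norm (s i x) \<le> 2 * norm (f x)"
    by (rule strongly_measurable_dominated_approx[OF fm]) blast
  have sb: "simple_bochner_integrable M (s i)" for i
  proof (rule simple_bochner_integrableI_bounded[OF s(1)])
    have "(\<integral>\<^sup>+x. ennreal (norm (s i x)) \<partial>M) \<le> (\<integral>\<^sup>+x. 2 * ennreal (norm (f x)) \<partial>M)"
      using s(3) by (intro nn_integral_mono) (auto simp: ennreal_mult'[symmetric] simp flip: ennreal_numeral intro!: ennreal_leI)
    also have "\<dots> = 2 * (\<integral>\<^sup>+x. ennreal (norm (f x)) \<partial>M)" by (rule nn_integral_cmult) simp
    also have "\<dots> < \<infinity>" using fin by (simp add: ennreal_mult_less_top)
    finally show "(\<integral>\<^sup>+x. ennreal (norm (s i x)) \<partial>M) < \<infinity>" .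
  qed
  have sm: "strongly_measurable M (s i)" for i by (rule strongly_measurable_simple[OF s(1)])
  have [measurable]: "(\<lambda>x. norm (f x - s i x)) \<in> borel_measurable M" for i
    by (intro borel_measurable_norm_strongly_measurable strongly_measurable_diff fm sm)
  have lim: "(\<lambda>i. \<integral>\<^sup>+x. ennreal (norm (f x - s i x)) \<partial>M) \<longlonglongrightarrow> (\<integral>\<^sup>+x. 0 \<partial>M)"
  proof (rule nn_integral_dominated_convergence[where w="\<lambda>x. 3 * ennreal (norm (f x))"])
    show "AE x in M. ennreal (norm (f x - s i x)) \<le> 3 * ennreal (norm (f x))" for i
    proof (rule AE_I2)
      fix x assume x: "x \<in> space M"
      have "norm (f x - s i x) \<le> 3 * norm (f x)"
        using norm_triangle_ineq4[of "f x" "s i x"] s(3)[OF x, of i] by simp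
      then show "ennreal (norm (f x - s i x)) \<le> 3 * ennreal (norm (f x))"
        by (auto simp: ennreal_mult'[symmetric] simp flip: ennreal_numeral intro!: ennreal_leI)
    qed
    show "AE x in M. (\<lambda>i. ennreal (norm (f x - s i x))) \<longlonglongrightarrow> 0"
    proof (rule AE_I2)
      fix x assume x: "x \<in> space M"
      have "(\<lambda>i. ennreal (norm (f x - s i x))) \<longlonglongrightarrow> ennreal (norm (f x - f x))"
        by (intro tendsto_ennrealI tendsto_norm tendsto_diff tendsto_const s x)
      then show "(\<lambda>i. ennreal (norm (f x - s i x))) \<longlonglongrightarrow> 0" by simp
    qed
    show "(\<integral>\<^sup>+ x. 3 * ennreal (norm (f x)) \<partial>M) < \<infinity>"
      using fin by (subst nn_integral_cmult) (auto simp: ennreal_mult_less_top)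
  qed auto
  let ?I = "\<lambda>i. simple_bochner_integral M (s i)"
  have "Cauchy ?I"
  proof (rule metric_CauchyI)
    fix e :: real assume e: "0 < e"
    have "\<forall>\<^sub>F i in sequentially. (\<integral>\<^sup>+x. ennreal (norm (f x - s i x)) \<partial>M) < ennreal (e/2)"
      using lim e by (intro order_tendstoD(2)) auto
    then obtain N where N: "\<And>i. i \<ge> N \<Longrightarrow> (\<integral>\<^sup>+x. ennreal (norm (f x - s i x)) \<partial>M) < ennreal (e/2)"
      by (auto simp: eventually_sequentially)
    show "\<exists>N. \<forall>m\<ge>N. \<forall>n\<ge>N. dist (?I m) (?I n) < e"
    proof (intro exI allI impI)
      fix m n assume mn: "m \<ge> N" "n \<ge> N"
      have "norm (s m x - s n x) \<le> norm (f x - s m x) + norm (f x - s n x)" for x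
        using norm_triangle_ineq4[of "f x - s n x" "f x - s m x"] by (simp add: algebra_simps)
      then have "(\<integral>\<^sup>+x. norm (s m x - s n x) \<partial>M) \<le> (\<integral>\<^sup>+x. ennreal (norm (f x - s m x)) + ennreal (norm (f x - s n x)) \<partial>M)"
        by (intro nn_integral_mono) (simp flip: ennreal_plus)
      also have "\<dots> = (\<integral>\<^sup>+x. ennreal (norm (f x - s m x)) \<partial>M) + (\<integral>\<^sup>+x. ennreal (norm (f x - s n x)) \<partial>M)"
        by (rule nn_integral_add) auto
      also have "\<dots> < ennreal (e/2) + ennreal (e/2)"
        by (rule add_strict_mono[OF N[OF mn(1)] N[OF mn(2)]])
      also have "\<dots> = ennreal e" using e by (simp flip: ennreal_plus)
      finally show "dist (?I m) (?I n) < e"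
        using simple_bochner_integral_dist[OF sb sb, of m n] e
        by (auto simp: dist_norm ennreal_less_iff dest: order_le_less_trans)
    qed
  qed
  then obtain v where v: "?I \<longlonglongrightarrow> v"
    using Cauchy_convergent convergent_def by blast
  have "has_strong_integral M f v"
    unfolding has_strong_integral_def using fm sb lim v by auto
  then show ?thesis by (simp add: strong_integral_eqI)
qed

lemma has_strong_integral_bounded_linear:
  assumes "bounded_linear T" and f: "has_strong_integral M f v"
  shows "has_strong_integral M (\<lambda>x. T (f x)) (T v)"
proof -
  interpret T: bounded_linear T by fact
  obtain s where fm: "strongly_measurable M f" and s: "\<And>i::nat. simple_bochner_integrable M (s i)"
      "(\<lambda>i. \<integral>\<^sup>+x. ennreal (norm (f x - s i x)) \<partial>M) \<longlonglongrightarrow> 0"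
      "(\<lambda>i. simple_bochner_integral M (s i)) \<longlonglongrightarrow> v"
    using f by (rule has_strong_integralE) blast
  have [measurable]: "(\<lambda>x. norm (f x - s i x)) \<in> borel_measurable M" for i
    by (intro borel_measurable_norm_strongly_measurable strongly_measurable_diff fm
        strongly_measurable_simple_bochner_integrable s)
  obtain K where K: "K > 0" "\<And>y. norm (T y) \<le> norm y * K"
    using T.pos_bounded by auto
  show ?thesis
    unfolding has_strong_integral_def
  proof (intro conjI exI[of _ "\<lambda>i x. T (s i x)"] allI)
    show "strongly_measurable M (\<lambda>x. T (f x))"
      by (rule strongly_measurable_compose2[OF fm fm]) (rule T.tendsto)
    show "simple_bochner_integrable M (\<lambda>x. T (s i x))" for i
      using simple_bochner_integrable_compose2[of "\<lambda>x _. T x" M "s i" "s i"] by (simp add: T.zero s(1))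
    have "(\<lambda>i. simple_bochner_integral M (\<lambda>x. T (s i x))) = (\<lambda>i. T (simple_bochner_integral M (s i)))"
      using simple_bochner_integral_linear[OF T.linear s(1)] by simp
    then show "(\<lambda>i. simple_bochner_integral M (\<lambda>x. T (s i x))) \<longlonglongrightarrow> T v"
      using T.tendsto[OF s(3)] by simp
    show "(\<lambda>i. \<integral>\<^sup>+ x. norm (T (f x) - T (s i x)) \<partial>M) \<longlonglongrightarrow> 0"
    proof (rule tendsto_sandwich[where f="\<lambda>_. 0"])
      show "\<forall>\<^sub>F i in sequentially. (\<integral>\<^sup>+ x. norm (T (f x) - T (s i x)) \<partial>M) \<le> ennreal K * (\<integral>\<^sup>+ x. norm (f x - s i x) \<partial>M)"
      proof (intro always_eventually allI)
        fix i
        have "(\<integral>\<^sup>+ x. norm (T (f x) - T (s i x)) \<partial>M) \<le> (\<integral>\<^sup>+ x. ennreal K * norm (f x - s i x) \<partial>M)"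
          using K by (intro nn_integral_mono) (auto simp: ac_simps ennreal_mult[symmetric] T.diff[symmetric])
        also have "\<dots> = ennreal K * (\<integral>\<^sup>+ x. norm (f x - s i x) \<partial>M)"
          by (rule nn_integral_cmult) auto
        finally show "(\<integral>\<^sup>+ x. norm (T (f x) - T (s i x)) \<partial>M) \<le> ennreal K * (\<integral>\<^sup>+ x. norm (f x - s i x) \<partial>M)" .
      qed
      show "(\<lambda>i. ennreal K * (\<integral>\<^sup>+ x. norm (f x - s i x) \<partial>M)) \<longlonglongrightarrow> 0"
        using ennreal_tendsto_cmult[OF _ s(2), of "ennreal K"] by simp
    qed auto
  qed
qed

lemma strong_integrable_add:
  assumes "strong_integrable M f" "strong_integrable M g"
  shows "strong_integrable M (\<lambda>x. f x + g x)"
proof -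
  have [measurable]: "(\<lambda>x. norm (f x)) \<in> borel_measurable M" "(\<lambda>x. norm (g x)) \<in> borel_measurable M"
    using assms by (auto simp: strong_integrable_def intro: borel_measurable_norm_strongly_measurable)
  have "(\<integral>\<^sup>+x. norm (f x + g x) \<partial>M) \<le> (\<integral>\<^sup>+x. ennreal (norm (f x)) + ennreal (norm (g x)) \<partial>M)"
    by (intro nn_integral_mono) (simp add: norm_triangle_ineq flip: ennreal_plus)
  also have "\<dots> = (\<integral>\<^sup>+x. norm (f x) \<partial>M) + (\<integral>\<^sup>+x. norm (g x) \<partial>M)" by (rule nn_integral_add) auto
  also have "\<dots> < \<infinity>" using assms by (simp add: strong_integrable_def)
  finally show ?thesis
    using assms by (simp add: strong_integrable_def strongly_measurable_add)
qed

lemma has_strong_integral_add: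
  assumes f: "has_strong_integral M f v" and g: "has_strong_integral M g w"
  shows "has_strong_integral M (\<lambda>x. f x + g x) (v + w)"
proof -
  obtain s where fm: "strongly_measurable M f"
    and s: "\<And>i::nat. simple_bochner_integrable M (s i)"
      "(\<lambda>i. \<integral>\<^sup>+x. ennreal (norm (f x - s i x)) \<partial>M) \<longlonglongrightarrow> 0"
      "(\<lambda>i. simple_bochner_integral M (s i)) \<longlonglongrightarrow> v"
    using f by (rule has_strong_integralE) blast
  obtain t where gm: "strongly_measurable M g"
    and t: "\<And>i::nat. simple_bochner_integrable M (t i)"
      "(\<lambda>i. \<integral>\<^sup>+x. ennreal (norm (g x - t i x)) \<partial>M) \<longlonglongrightarrow> 0"
      "(\<lambda>i. simple_bochner_integral M (t i)) \<longlonglongrightarrow> w"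
    using g by (rule has_strong_integralE) blast
  have [measurable]: "(\<lambda>x. norm (f x - s i x)) \<in> borel_measurable M"
     "(\<lambda>x. norm (g x - t i x)) \<in> borel_measurable M" for i
    by (intro borel_measurable_norm_strongly_measurable strongly_measurable_diff fm gm
        strongly_measurable_simple_bochner_integrable s t)+
  let ?S = "\<lambda>i. \<integral>\<^sup>+x. ennreal (norm (f x - s i x)) \<partial>M" and ?T = "\<lambda>i. \<integral>\<^sup>+x. ennreal (norm (g x - t i x)) \<partial>M"
  show ?thesis
    unfolding has_strong_integral_def
  proof (intro conjI exI[of _ "\<lambda>i x. s i x + t i x"] allI)
    show "strongly_measurable M (\<lambda>x. f x + g x)" by (rule strongly_measurable_add[OF fm gm])
    show "simple_bochner_integrable M (\<lambda>x. s i x + t i x)" for i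
      using simple_bochner_integrable_compose2[of "(+)" M "s i" "t i"] by (simp add: s(1) t(1))
    show "(\<lambda>i. simple_bochner_integral M (\<lambda>x. s i x + t i x)) \<longlonglongrightarrow> v + w"
      by (simp add: simple_bochner_integral_add[OF s(1) t(1)]) (intro tendsto_add s t)
    show "(\<lambda>i. \<integral>\<^sup>+ x. norm (f x + g x - (s i x + t i x)) \<partial>M) \<longlonglongrightarrow> 0"
    proof (rule tendsto_sandwich[where f="\<lambda>_. 0"])
      show "\<forall>\<^sub>F i in sequentially. (\<integral>\<^sup>+ x. norm (f x + g x - (s i x + t i x)) \<partial>M) \<le> ?S i + ?T i"
      proof (intro always_eventually allI)
        fix i
        have "(\<integral>\<^sup>+ x. norm (f x + g x - (s i x + t i x)) \<partial>M) \<le> (\<integral>\<^sup>+ x. ennreal (norm (f x - s i x)) + ennreal (norm (g x - t i x)) \<partial>M)"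
          by (auto intro!: nn_integral_mono norm_diff_triangle_ineq simp flip: ennreal_plus)
        also have "\<dots> = ?S i + ?T i" by (rule nn_integral_add) auto
        finally show "(\<integral>\<^sup>+ x. norm (f x + g x - (s i x + t i x)) \<partial>M) \<le> ?S i + ?T i" .
      qed
      show "(\<lambda>i. ?S i + ?T i) \<longlonglongrightarrow> 0" using tendsto_add[OF s(2) t(2)] by simp
    qed auto
  qed
qed

lemma has_strong_integral_sum:
  fixes f :: "'k \<Rightarrow> 'a \<Rightarrow> 'x::real_normed_vector"
  assumes "finite K" "\<And>k. k \<in> K \<Longrightarrow> has_strong_integral M (f k) (v k)"
  shows "has_strong_integral M (\<lambda>x. \<Sum>k\<in>K. f k x) (\<Sum>k\<in>K. v k)"
  using assms
proof (induction K rule: finite_induct)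
  case empty
  have "simple_bochner_integrable M (\<lambda>_. 0::'x)"
    by (rule Bochner_Integration.simple_bochner_integrable.intros) auto
  moreover have "simple_bochner_integral M (\<lambda>_. 0::'x) = 0"
    unfolding Bochner_Integration.simple_bochner_integral_def by (rule sum.neutral) auto
  ultimately show ?case
    using has_strong_integral_simple[of M "\<lambda>_. 0::'x"] by simp
next
  case (insert k K)
  then show ?case by (auto intro!: has_strong_integral_add)
qed

lemma strong_integral_norm_le:
  fixes f :: "'a \<Rightarrow> 'x::banach"
  assumes "strong_integrable M f"
  shows "norm (strong_integral M f) \<le> (LINT x|M. norm (f x))"
proof -
  have [measurable]: "(\<lambda>x. norm (f x)) \<in> borel_measurable M"
    using assms by (auto simp: strong_integrable_def intro: borel_measurable_norm_strongly_measurable)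
  have "has_strong_integral M (\<lambda>_. 0::'x) 0" using has_strong_integral_sum[of "{}"] by simp
  from has_strong_integral_dist[OF strong_integrable_has_strong_integral[OF assms] this]
  have *: "ennreal (norm (strong_integral M f)) \<le> (\<integral>\<^sup>+x. norm (f x) \<partial>M)" by simp
  have "integrable M (\<lambda>x. norm (f x))"
    using assms by (auto simp: strong_integrable_def intro!: integrableI_bounded)
  then have "(\<integral>\<^sup>+x. norm (f x) \<partial>M) = ennreal (LINT x|M. norm (f x))"
    by (rule nn_integral_eq_integral) auto
  then show ?thesis using * by (simp add: integral_nonneg_AE)
qed

lemma strong_integral_cong_AE:
  fixes f g :: "'a \<Rightarrow> 'x::banach"
  assumes "strong_integrable M f" "strong_integrable M g" "AE x in M. f x = g x"
  shows "strong_integral M f = strong_integral M g"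
proof -
  have "(\<integral>\<^sup>+x. norm (f x - g x) \<partial>M) = (\<integral>\<^sup>+x. 0 \<partial>M)"
    using assms(3) by (intro nn_integral_cong_AE) auto
  with has_strong_integral_dist[OF assms(1,2)[THEN strong_integrable_has_strong_integral]]
  show ?thesis by (simp flip: zero_ennreal_def)
qed

section \<open>The UMD inequality on finite weighted sets\<close>

lemma sum_blocks_zero:
  fixes u :: "'a \<Rightarrow> 'x::comm_monoid_add"
  assumes "finite \<Omega>" "\<And>x. x \<in> \<Omega> \<Longrightarrow> (\<Sum>y | y \<in> \<Omega> \<and> \<pi> y = \<pi> x. u y) = 0"
  shows "(\<Sum>x\<in>\<Omega>. u x) = 0"
proof -
  have "(\<Sum>y | y \<in> \<Omega> \<and> \<pi> y = b. u y) = 0" if "b \<in> \<pi> ` \<Omega>" for b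
    using assms(2) that by blast
  then show ?thesis by (subst sum.image_gen[OF assms(1), of u \<pi>]) simp
qed

lemma sum_blocks_mono:
  fixes u v :: "'a \<Rightarrow> real"
  assumes "finite \<Omega>"
    "\<And>x. x \<in> \<Omega> \<Longrightarrow> (\<Sum>y | y \<in> \<Omega> \<and> \<pi> y = \<pi> x. u y) \<le> (\<Sum>y | y \<in> \<Omega> \<and> \<pi> y = \<pi> x. v y)"
  shows "(\<Sum>x\<in>\<Omega>. u x) \<le> (\<Sum>x\<in>\<Omega>. v x)"
proof -
  have "(\<Sum>y | y \<in> \<Omega> \<and> \<pi> y = b. u y) \<le> (\<Sum>y | y \<in> \<Omega> \<and> \<pi> y = b. v y)" if "b \<in> \<pi> ` \<Omega>" for b
    using assms(2) that by blast
  then show ?thesis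
    unfolding sum.image_gen[OF assms(1), of u \<pi>] sum.image_gen[OF assms(1), of v \<pi>] by (rule sum_mono)
qed

text \<open>A finite set of reals with weights of total mass one is a discrete probability space, on which
  the partial sums of the differences are a martingale with respect to the \<open>\<sigma>\<close>-algebras generated by
  the partitions.\<close>

lemma UMD_inequality_real_points:
  fixes R :: "real set" and u :: "real \<Rightarrow> real" and P :: "nat \<Rightarrow> real \<Rightarrow> 'b" and D :: "nat \<Rightarrow> real \<Rightarrow> 'x::banach"
  assumes C: "\<And>(M :: real measure) F (f :: nat \<Rightarrow> real \<Rightarrow> 'x) (\<sigma> :: nat \<Rightarrow> real) n.
        prob_space M \<Longrightarrow> Lp_martingale M F p f \<Longrightarrow> (\<forall>k. \<sigma> k \<in> {-1, 1}) \<Longrightarrow>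
        Lp_norm M p (\<lambda>w. \<Sum>k<n. \<sigma> k *\<^sub>R (f (Suc k) w - f k w))
          \<le> C * Lp_norm M p (\<lambda>w. \<Sum>k<n. f (Suc k) w - f k w)"
    and "finite R" and u: "\<And>r. r \<in> R \<Longrightarrow> 0 \<le> u r" "(\<Sum>r\<in>R. u r) = 1"
    and refine: "\<And>k x y. k < n \<Longrightarrow> x \<in> R \<Longrightarrow> y \<in> R \<Longrightarrow> P (Suc k) x = P (Suc k) y \<Longrightarrow> P k x = P k y"
    and adapted: "\<And>k x y. k < n \<Longrightarrow> x \<in> R \<Longrightarrow> y \<in> R \<Longrightarrow> P (Suc k) x = P (Suc k) y \<Longrightarrow> D k x = D k y"
    and centred: "\<And>k x. k < n \<Longrightarrow> x \<in> R \<Longrightarrow> (\<Sum>y | y \<in> R \<and> P k y = P k x. u y *\<^sub>R D k y) = 0"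
    and \<sigma>: "\<And>k. \<sigma> k \<in> {-1, 1}"
  shows "(\<Sum>r\<in>R. u r * norm (\<Sum>k<n. \<sigma> k *\<^sub>R D k r) powr p) powr (1/p)
    \<le> C * (\<Sum>r\<in>R. u r * norm (\<Sum>k<n. D k r) powr p) powr (1/p)"
proof -
  define M where "M = point_measure R (\<lambda>r. ennreal (u r))"
  define F where "F k = vimage_algebra R (P (min k n)) (count_space UNIV)" for k
  define f where "f k r = (\<Sum>i<min k n. D i r)" for k r
  have spM [simp]: "space M = R" and seM [simp]: "sets M = Pow R"
    by (simp_all add: M_def space_point_measure sets_point_measure)
  have spF [simp]: "space (F k) = R" for k by (simp add: F_def)
  have seF: "sets (F k) = {P (min k n) -` B \<inter> R | B. True}" for k
    unfolding F_def by (subst sets_vimage_algebra2) auto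
  have prob: "prob_space M"
  proof (rule prob_spaceI)
    have "emeasure M R = (\<Sum>r\<in>R. ennreal (u r))"
      unfolding M_def using \<open>finite R\<close> by (intro emeasure_point_measure_finite) auto
    also have "\<dots> = ennreal 1" using u by (subst sum_ennreal) auto
    finally show "emeasure M (space M) = 1" by simp
  qed
  have meas: "measure M {r} = u r" if "r \<in> R" for r
  proof -
    have "emeasure M {r} = (\<Sum>r\<in>{r}. ennreal (u r))"
      unfolding M_def using \<open>finite R\<close> that by (intro emeasure_point_measure_finite) auto
    then show ?thesis using u that by (simp add: measure_def)
  qed
  have simpM: "simple_function M h" for h :: "real \<Rightarrow> 'c"
    using \<open>finite R\<close> by (auto simp: simple_function_def)
  have simpF: "simple_function (F k) h"
    if "\<And>x y. x \<in> R \<Longrightarrow> y \<in> R \<Longrightarrow> P (min k n) x = P (min k n) y \<Longrightarrow> h x = h y" for h :: "real \<Rightarrow> 'c" and k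
  proof -
    have eq: "h -` {z} \<inter> R = P (min k n) -` (P (min k n) ` (h -` {z} \<inter> R)) \<inter> R" for z
      using that by auto
    have "h -` {z} \<inter> R \<in> sets (F k)" for z
      unfolding seF mem_Collect_eq
      by (intro exI[of _ "P (min k n) ` (h -` {z} \<inter> R)"] conjI TrueI) (rule eq)
    then show ?thesis using \<open>finite R\<close> by (simp add: simple_function_def)
  qed
  have integral: "strong_integral M h = (\<Sum>r\<in>R. u r *\<^sub>R h r)" for h :: "real \<Rightarrow> 'x"
  proof -
    interpret prob_space M by (rule prob)
    have sb: "simple_bochner_integrable M h"
      by (rule Bochner_Integration.simple_bochner_integrable.intros[OF simpM]) simp
    have "simple_bochner_integral M h = (\<Sum>y\<in>(\<lambda>x. x) ` space M. measure M {x\<in>space M. x = y} *\<^sub>R h y)"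
      by (rule simple_bochner_integral_partition[OF sb simpM]) auto
    also have "\<dots> = (\<Sum>r\<in>R. measure M {x\<in>R. x = r} *\<^sub>R h r)" by simp
    also have "\<dots> = (\<Sum>r\<in>R. u r *\<^sub>R h r)"
    proof (rule sum.cong[OF refl])
      fix r assume "r \<in> R"
      then have "{x \<in> R. x = r} = {r}" by auto
      then show "measure M {x \<in> R. x = r} *\<^sub>R h r = u r *\<^sub>R h r" using meas[OF \<open>r \<in> R\<close>] by simp
    qed
    finally show ?thesis using strong_integral_eqI[OF has_strong_integral_simple[OF sb]] by simp
  qed
  have Lp: "Lp_norm M p h = (\<Sum>r\<in>R. u r * norm (h r) powr p) powr (1/p)" for h :: "real \<Rightarrow> 'x"
    unfolding Lp_norm_def M_def using \<open>finite R\<close> u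
    by (subst lebesgue_integral_point_measure_finite) auto
  have refine': "j \<le> k \<Longrightarrow> k \<le> n \<Longrightarrow> x \<in> R \<Longrightarrow> y \<in> R \<Longrightarrow> P k x = P k y \<Longrightarrow> P j x = P j y" for j k x y
  proof (induction rule: dec_induct)
    case (step m)
    then show ?case using refine[of m x y] by simp
  qed
  have step: "f (Suc k) r - f k r = (if k < n then D k r else 0)" for k r
    by (auto simp: f_def min_def not_less_eq_eq)
  have mart: "Lp_martingale M F p f"
    unfolding Lp_martingale_def
  proof (intro conjI allI impI ballI)
    fix k
    show "subalgebra M (F k)" by (auto simp: subalgebra_def seF)
    show "in_Lp M p (f k)"
      unfolding in_Lp_def using strongly_measurable_simple[OF simpM]
      by (auto simp: M_def \<open>finite R\<close> intro!: integrable_point_measure_finite)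
    show "strongly_measurable (F k) (f k)"
    proof (rule strongly_measurable_simple[OF simpF])
      fix x y assume xy: "x \<in> R" "y \<in> R" "P (min k n) x = P (min k n) y"
      show "f k x = f k y" unfolding f_def
      proof (intro sum.cong refl)
        fix i assume "i \<in> {..<min k n}"
        then show "D i x = D i y" using adapted[of i x y] refine'[of "Suc i" "min k n" x y] xy by auto
      qed
    qed
  next
    fix j k :: nat assume "j \<le> k"
    show "sets (F j) \<subseteq> sets (F k)"
    proof
      fix A assume "A \<in> sets (F j)"
      then obtain B where A: "A = P (min j n) -` B \<inter> R" by (auto simp: seF)
      have "x \<in> A" if "x \<in> R" "y \<in> A" "P (min k n) x = P (min k n) y" for x y
      proof -
        have "P (min j n) x = P (min j n) y"
          using refine'[of "min j n" "min k n" x y] \<open>j \<le> k\<close> that A by auto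
        then show ?thesis using that by (auto simp: A)
      qed
      then have eq: "A = P (min k n) -` (P (min k n) ` A) \<inter> R" by (auto simp: A)
      show "A \<in> sets (F k)"
        unfolding seF mem_Collect_eq
        by (intro exI[of _ "P (min k n) ` A"] conjI TrueI) (rule eq)
    qed
  next
    fix k A assume "A \<in> sets (F k)"
    then obtain B where A: "A = P (min k n) -` B \<inter> R" by (auto simp: seF)
    have "(\<Sum>r\<in>R. u r *\<^sub>R indicator A r *\<^sub>R f (Suc k) r) - (\<Sum>r\<in>R. u r *\<^sub>R indicator A r *\<^sub>R f k r)
       = (\<Sum>r\<in>R. u r *\<^sub>R indicator A r *\<^sub>R (f (Suc k) r - f k r))"
      by (simp add: sum_subtractf scaleR_diff_right)
    also have "\<dots> = (\<Sum>r\<in>A. u r *\<^sub>R (f (Suc k) r - f k r))"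
      using \<open>finite R\<close>
      by (intro sum.mono_neutral_cong_right) (auto simp: A indicator_def split: if_splits)
    also have "\<dots> = 0"
    proof (cases "k < n")
      case True
      show ?thesis
      proof (rule sum_blocks_zero[where \<pi>="P k"])
        show "finite A" using \<open>finite R\<close> by (auto simp: A)
        fix x assume x: "x \<in> A"
        then have "{y. y \<in> A \<and> P k y = P k x} = {y. y \<in> R \<and> P k y = P k x}"
          using True by (auto simp: A)
        then show "(\<Sum>y | y \<in> A \<and> P k y = P k x. u y *\<^sub>R (f (Suc k) y - f k y)) = 0"
          using centred[OF True, of x] x True by (simp add: step A)
      qed
    qed (simp add: step)
    finally show "strong_integral M (\<lambda>w. indicator A w *\<^sub>R f (Suc k) w) = strong_integral M (\<lambda>w. indicator A w *\<^sub>R f k w)"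
      by (simp add: integral)
  qed
  show ?thesis
    using C[OF prob mart, of \<sigma> n] \<sigma> by (simp add: Lp step)
qed

text \<open>A finite filtered weighted set embeds into the reals, so that the martingales there can be
  used; passing to $p$-th powers makes the inequality independent of the total mass.\<close>

lemma UMD_inequality_finite:
  assumes "UMD TYPE('x::banach)" "1 < p"
  obtains U where "1 \<le> U"
    "\<And>(\<Omega> :: 'a set) w (\<pi> :: nat \<Rightarrow> 'a \<Rightarrow> 'b) n (d :: nat \<Rightarrow> 'a \<Rightarrow> 'x) \<sigma>. finite \<Omega> \<Longrightarrow>
      (\<And>x. x \<in> \<Omega> \<Longrightarrow> 0 \<le> w x) \<Longrightarrow>
      (\<And>k x y. k < n \<Longrightarrow> x \<in> \<Omega> \<Longrightarrow> y \<in> \<Omega> \<Longrightarrow> \<pi> (Suc k) x = \<pi> (Suc k) y \<Longrightarrow> \<pi> k x = \<pi> k y) \<Longrightarrow>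
      (\<And>k x y. k < n \<Longrightarrow> x \<in> \<Omega> \<Longrightarrow> y \<in> \<Omega> \<Longrightarrow> \<pi> (Suc k) x = \<pi> (Suc k) y \<Longrightarrow> d k x = d k y) \<Longrightarrow>
      (\<And>k x. k < n \<Longrightarrow> x \<in> \<Omega> \<Longrightarrow> (\<Sum>y | y \<in> \<Omega> \<and> \<pi> k y = \<pi> k x. w y *\<^sub>R d k y) = 0) \<Longrightarrow>
      (\<And>k. \<sigma> k \<in> {-1, 1}) \<Longrightarrow>
      (\<Sum>x\<in>\<Omega>. w x * norm (\<Sum>k<n. \<sigma> k *\<^sub>R d k x) powr p)
        \<le> U * (\<Sum>x\<in>\<Omega>. w x * norm (\<Sum>k<n. d k x) powr p)"
proof -
  obtain C where C: "\<And>(M :: real measure) F (f :: nat \<Rightarrow> real \<Rightarrow> 'x) (\<sigma> :: nat \<Rightarrow> real) n.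
        prob_space M \<Longrightarrow> Lp_martingale M F p f \<Longrightarrow> (\<forall>k. \<sigma> k \<in> {-1, 1}) \<Longrightarrow>
        Lp_norm M p (\<lambda>w. \<Sum>k<n. \<sigma> k *\<^sub>R (f (Suc k) w - f k w))
          \<le> C * Lp_norm M p (\<lambda>w. \<Sum>k<n. f (Suc k) w - f k w)"
    using assms unfolding UMD_def by blast
  define U where "U = max 1 (max C 0 powr p)"
  show thesis
  proof (rule that[of U])
    show "1 \<le> U" by (simp add: U_def)
    fix \<Omega> :: "'a set" and w :: "'a \<Rightarrow> real" and \<pi> :: "nat \<Rightarrow> 'a \<Rightarrow> 'b" and n and d :: "nat \<Rightarrow> 'a \<Rightarrow> 'x" and \<sigma> :: "nat \<Rightarrow> real"
    assume fin: "finite \<Omega>" and w: "\<And>x. x \<in> \<Omega> \<Longrightarrow> 0 \<le> w x"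
      and refine: "\<And>k x y. k < n \<Longrightarrow> x \<in> \<Omega> \<Longrightarrow> y \<in> \<Omega> \<Longrightarrow> \<pi> (Suc k) x = \<pi> (Suc k) y \<Longrightarrow> \<pi> k x = \<pi> k y"
      and adapted: "\<And>k x y. k < n \<Longrightarrow> x \<in> \<Omega> \<Longrightarrow> y \<in> \<Omega> \<Longrightarrow> \<pi> (Suc k) x = \<pi> (Suc k) y \<Longrightarrow> d k x = d k y"
      and centred: "\<And>k x. k < n \<Longrightarrow> x \<in> \<Omega> \<Longrightarrow> (\<Sum>y | y \<in> \<Omega> \<and> \<pi> k y = \<pi> k x. w y *\<^sub>R d k y) = 0"
      and \<sigma>: "\<And>k. \<sigma> k \<in> {-1, 1}"
    let ?L = "\<Sum>x\<in>\<Omega>. w x * norm (\<Sum>k<n. \<sigma> k *\<^sub>R d k x) powr p"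
    let ?R = "\<Sum>x\<in>\<Omega>. w x * norm (\<Sum>k<n. d k x) powr p"
    define W where "W = (\<Sum>x\<in>\<Omega>. w x)"
    have R0: "0 \<le> ?R" and L0: "0 \<le> ?L" using w by (auto intro!: sum_nonneg)
    show "?L \<le> U * ?R"
    proof (cases "W = 0")
      case True
      then have "w x = 0" if "x \<in> \<Omega>" for x
        using that fin w by (simp add: W_def sum_nonneg_eq_0_iff)
      then show ?thesis by simp
    next
      case False
      then have W: "0 < W" using w sum_nonneg[of \<Omega> w] by (simp add: W_def)
      obtain e0 :: "'a \<Rightarrow> nat" where "inj_on e0 \<Omega>"
        using fin finite_imp_inj_to_nat_seg by metis
      define e where "e x = real (e0 x)" for x
      have e: "inj_on e \<Omega>" using \<open>inj_on e0 \<Omega>\<close> by (simp add: e_def inj_on_def)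
      define g where "g = inv_into \<Omega> e"
      have ge [simp]: "g (e x) = x" if "x \<in> \<Omega>" for x using that e by (simp add: g_def)
      have reindex: "(\<Sum>r\<in>e ` \<Omega>. h (g r)) = (\<Sum>x\<in>\<Omega>. h x)" for h :: "'a \<Rightarrow> 'c::comm_monoid_add"
        using e by (simp add: sum.reindex)
      have block: "(\<Sum>r | r \<in> e ` \<Omega> \<and> \<pi> k (g r) = \<pi> k x. h (g r)) = (\<Sum>y | y \<in> \<Omega> \<and> \<pi> k y = \<pi> k x. h y)"
        if "x \<in> \<Omega>" for k x and h :: "'a \<Rightarrow> 'x"
      proof -
        have *: "{r. r \<in> e ` \<Omega> \<and> \<pi> k (g r) = \<pi> k x} = e ` {y. y \<in> \<Omega> \<and> \<pi> k y = \<pi> k x}"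
          using that by auto
        have "inj_on e {y. y \<in> \<Omega> \<and> \<pi> k y = \<pi> k x}" using e by (auto simp: inj_on_def)
        then show ?thesis unfolding * by (simp add: sum.reindex)
      qed
      have "(\<Sum>r\<in>e ` \<Omega>. w (g r) / W * norm (\<Sum>k<n. \<sigma> k *\<^sub>R d k (g r)) powr p) powr (1/p)
        \<le> C * (\<Sum>r\<in>e ` \<Omega>. w (g r) / W * norm (\<Sum>k<n. d k (g r)) powr p) powr (1/p)"
      proof (rule UMD_inequality_real_points[where P="\<lambda>k r. \<pi> k (g r)" and n=n])
        show "finite (e ` \<Omega>)" using fin by simp
        show "0 \<le> w (g r) / W" if "r \<in> e ` \<Omega>" for r using that w W by auto
        show "(\<Sum>r\<in>e ` \<Omega>. w (g r) / W) = 1"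
          using reindex[of "\<lambda>x. w x / W"] W by (simp add: sum_divide_distrib[symmetric] W_def)
        show "(\<Sum>s | s \<in> e ` \<Omega> \<and> \<pi> k (g s) = \<pi> k (g r). (w (g s) / W) *\<^sub>R d k (g s)) = 0"
          if kr: "k < n" "r \<in> e ` \<Omega>" for k r
        proof -
          obtain x where x: "x \<in> \<Omega>" "r = e x" using kr by auto
          have "(\<Sum>y | y \<in> \<Omega> \<and> \<pi> k y = \<pi> k x. (w y / W) *\<^sub>R d k y) = (1 / W) *\<^sub>R (\<Sum>y | y \<in> \<Omega> \<and> \<pi> k y = \<pi> k x. w y *\<^sub>R d k y)"
            by (simp add: scaleR_sum_right)
          then show ?thesis
            using block[OF x(1), of "\<lambda>y. (w y / W) *\<^sub>R d k y" k] centred[OF kr(1) x(1)] x by simp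
        qed
        show "\<pi> k (g x) = \<pi> k (g y)" "d k (g x) = d k (g y)"
          if "k < n" "x \<in> e ` \<Omega>" "y \<in> e ` \<Omega>" "\<pi> (Suc k) (g x) = \<pi> (Suc k) (g y)" for k x y
          using that refine[of k "g x" "g y"] adapted[of k "g x" "g y"] by auto
      qed (rule C \<sigma>; assumption)+
      then have "(?L / W) powr (1/p) \<le> C * (?R / W) powr (1/p)"
        using reindex[of "\<lambda>x. w x / W * norm (\<Sum>k<n. \<sigma> k *\<^sub>R d k x) powr p"]
          reindex[of "\<lambda>x. w x / W * norm (\<Sum>k<n. d k x) powr p"]
        by (simp add: sum_divide_distrib)
      also have "\<dots> \<le> max C 0 * (?R / W) powr (1/p)" by (intro mult_right_mono) auto
      finally have "((?L / W) powr (1/p)) powr p \<le> (max C 0 * (?R / W) powr (1/p)) powr p"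
        using assms(2) by (intro powr_mono2) auto
      also have "\<dots> = max C 0 powr p * (?R / W)"
        using assms(2) R0 W by (subst powr_mult) (auto simp: powr_powr)
      also have "((?L / W) powr (1/p)) powr p = ?L / W"
        using assms(2) L0 W by (auto simp: powr_powr)
      finally have "?L \<le> max C 0 powr p * ?R" using W by (simp add: field_simps)
      also have "\<dots> \<le> U * ?R" using R0 by (intro mult_right_mono) (auto simp: U_def)
      finally show ?thesis .
    qed
  qed
qed

section \<open>Counters along a path\<close>

definition starts :: "(nat \<Rightarrow> nat) \<Rightarrow> nat \<Rightarrow> nat \<Rightarrow> bool" where
  "starts N j i \<longleftrightarrow> N i = j \<and> (i = 0 \<or> N (i - 1) \<noteq> j)"

definition ends :: "(nat \<Rightarrow> nat) \<Rightarrow> nat \<Rightarrow> nat \<Rightarrow> bool" where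
  "ends N j i \<longleftrightarrow> N i = j \<and> N (Suc i) = Suc j"

locale counter =
  fixes N :: "nat \<Rightarrow> nat"
  assumes N_0: "N 0 = 0" and N_Suc: "N (Suc i) = N i \<or> N (Suc i) = Suc (N i)"
begin

lemma N_mono: "i \<le> k \<Longrightarrow> N i \<le> N k"
  by (rule lift_Suc_mono_le[of N]) (use N_Suc in \<open>metis le_Suc_eq order_refl\<close>)

lemma N_le: "N i \<le> i"
proof (induction i)
  case (Suc i)
  then show ?case using N_Suc[of i] by auto
qed (simp add: N_0)

lemma starts_Suc: "starts N (Suc j) (Suc i) \<longleftrightarrow> ends N j i"
  using N_Suc[of i] by (auto simp: starts_def ends_def)

lemma not_starts_Suc_0: "\<not> starts N (Suc j) 0"
  by (simp add: starts_def N_0)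

lemma starts_imp_le: "starts N j i \<Longrightarrow> N k = j \<Longrightarrow> i \<le> k"
proof (rule ccontr)
  assume *: "starts N j i" "N k = j" "\<not> i \<le> k"
  then have "k \<le> i - 1" "i \<noteq> 0" by auto
  then show False
    using N_mono[of k "i - 1"] N_mono[of "i - 1" i] * by (simp add: starts_def)
qed

lemma starts_unique: "starts N j i \<Longrightarrow> starts N j k \<Longrightarrow> i = k"
  using starts_imp_le[of j i k] starts_imp_le[of j k i] by (simp add: starts_def)

lemma sum_ends: "(\<Sum>i<n. of_bool (ends N j i)) = (of_bool (j < N n) :: real)"
proof (induction n)
  case (Suc n)
  then show ?case using N_Suc[of n] by (auto simp: ends_def)
qed (simp add: N_0)

lemma starts_shift: "(\<Sum>i\<le>n. if starts N (Suc j) i then g i else 0) = (\<Sum>i<n. if ends N j i then g (Suc i) else 0)"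
  for g :: "nat \<Rightarrow> 'v::comm_monoid_add"
  by (induction n) (auto simp: not_starts_Suc_0 starts_Suc)

lemma sum_starts_eq:
  assumes "starts N j i" "i \<le> n"
  shows "(\<Sum>k\<le>n. if starts N j k then g k else 0) = (g i :: 'v::comm_monoid_add)"
proof -
  have "(\<Sum>k\<le>n. if starts N j k then g k else 0) = (\<Sum>k\<le>n. if k = i then g i else 0)"
    using starts_unique assms by (intro sum.cong refl) auto
  then show ?thesis using assms by simp
qed

lemma sum_starts_apply:
  fixes F :: "nat \<Rightarrow> real"
  assumes "\<phi> 0 = 0"
  shows "\<phi> (\<Sum>i\<le>n. if starts N j i then F i else 0) = (\<Sum>i\<le>n. if starts N j i then \<phi> (F i) else (0::real))"
proof (cases "\<exists>k\<le>n. starts N j k")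
  case True
  then obtain k where k: "k \<le> n" "starts N j k" by blast
  show ?thesis
    unfolding sum_starts_eq[OF k(2,1)] ..
next
  case False
  then have "(\<Sum>i\<le>n. if starts N j i then G i else 0) = 0" for G :: "nat \<Rightarrow> real"
    by (intro sum.neutral) auto
  then show ?thesis using assms by simp
qed

text \<open>The times at which the counter has the value \<open>j\<close> form an interval, so increments cancel except
  at its two ends. The right end is a jump of the counter or the final time \<open>n\<close>.\<close>

lemma telescope:
  fixes g g' :: "nat \<Rightarrow> 'v::ab_group_add"
  assumes "\<And>i. i < n \<Longrightarrow> N (Suc i) = N i \<Longrightarrow> g (Suc i) = g' i"
  shows "(\<Sum>i<n. if N i = j then g' i - g i else 0)
    = (\<Sum>i<n. if ends N j i then g' i else 0) + (if N n = j then g n else 0)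
      - (\<Sum>i\<le>n. if starts N j i then g i else 0)"
  using assms
proof (induction n)
  case 0
  then show ?case by (simp add: starts_def)
next
  case (Suc n)
  have IH: "(\<Sum>i<n. if N i = j then g' i - g i else 0)
    = (\<Sum>i<n. if ends N j i then g' i else 0) + (if N n = j then g n else 0)
      - (\<Sum>i\<le>n. if starts N j i then g i else 0)"
    using Suc by simp
  have st: "starts N j (Suc n) \<longleftrightarrow> N (Suc n) = j \<and> N n \<noteq> j" by (simp add: starts_def)
  consider "N (Suc n) = N n" | "N (Suc n) = Suc (N n)" using N_Suc[of n] by blast
  then show ?case
  proof cases
    case 1
    then show ?thesis using Suc.prems[of n] by (simp add: IH st ends_def)
  next
    case 2
    then show ?thesis by (simp add: IH st ends_def)
  qed
qed

end

text \<open>Summing over the generations up to the last one costs only a constant once the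
  early ones carry exponentially growing weights.\<close>

definition gen_const :: "real \<Rightarrow> real \<Rightarrow> real" where
  "gen_const \<rho> p = max 1 ((1 - \<rho> powr (- 1 / (p - 1))) powr (1 - p))"

lemma gen_const_pos: "0 < gen_const \<rho> p"
  by (simp add: gen_const_def)

lemma powr_sum_generations:
  fixes \<rho> p :: real and y :: "nat \<Rightarrow> real"
  assumes "1 < \<rho>" "1 < p" and y: "\<And>j. 0 \<le> y j"
  shows "(\<Sum>j\<le>N. y j) powr p \<le> gen_const \<rho> p * (\<Sum>j\<le>N. \<rho> ^ (N - j) * y j powr p)"
proof -
  \<comment> \<open>In the induction step \<open>s + y\<close> is a convex combination with weights \<open>q\<close> and \<open>1 - q\<close>; the choice of
    \<open>q\<close> makes the factor of the old sum equal to \<open>\<rho>\<close>.\<close>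
  define q where "q = \<rho> powr (- 1 / (p - 1))"
  have q: "0 < q" "q < 1" using assms by (auto simp: q_def powr_less_one)
  define K where "K = max 1 ((1 - q) powr (1 - p))"
  have "- 1 / (p - 1) * (1 - p) = 1" using assms by (simp add: field_simps)
  then have q\<rho>: "q powr (1 - p) = \<rho>" using assms by (simp add: q_def powr_powr)
  have "(\<Sum>j\<le>N. y j) powr p \<le> K * (\<Sum>j\<le>N. \<rho> ^ (N - j) * y j powr p)"
  proof (induction N)
    case 0
    have "1 * y 0 powr p \<le> K * y 0 powr p" by (intro mult_right_mono) (auto simp: K_def)
    then show ?case by simp
  next
    case (Suc N)
    define s where "s = (\<Sum>j\<le>N. y j)"
    have s: "0 \<le> s" using y by (auto simp: s_def intro: sum_nonneg)
    have "(s + y (Suc N)) powr p = ((1 - (1 - q)) * (s / q) + (1 - q) * (y (Suc N) / (1 - q))) powr p"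
      using q by simp
    also have "\<dots> \<le> (1 - (1 - q)) * (s / q) powr p + (1 - q) * (y (Suc N) / (1 - q)) powr p"
      using q s y assms by (intro powr_two_point) auto
    also have "\<dots> = q powr (1 - p) * s powr p + (1 - q) powr (1 - p) * y (Suc N) powr p"
      using q s y by (simp add: powr_divide powr_diff field_simps)
    also have "\<dots> \<le> \<rho> * (K * (\<Sum>j\<le>N. \<rho> ^ (N - j) * y j powr p)) + K * y (Suc N) powr p"
      unfolding q\<rho> using Suc assms by (intro add_mono mult_mono) (auto simp: s_def K_def)
    also have "\<dots> = K * (\<Sum>j\<le>Suc N. \<rho> ^ (Suc N - j) * y j powr p)"
      by (simp add: sum_distrib_left Suc_diff_le algebra_simps)
    finally show ?case by (simp add: s_def)
  qed
  then show ?thesis by (simp add: K_def q_def gen_const_def)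
qed

section \<open>Stopping in a finite filtration\<close>

lemma sum_weight_swap:
  fixes w :: "'a \<Rightarrow> real"
  shows "(\<Sum>y\<in>B. w y * (\<Sum>k\<in>K. q k y)) = (\<Sum>k\<in>K. \<Sum>y\<in>B. w y * q k y)"
  unfolding sum_distrib_left by (rule sum.swap)

locale filtered_set =
  fixes \<Omega> :: "'a set" and w :: "'a \<Rightarrow> real" and \<pi> :: "nat \<Rightarrow> 'a \<Rightarrow> 'b" and n :: nat
  assumes finite_\<Omega> [simp]: "finite \<Omega>" and w_nonneg: "x \<in> \<Omega> \<Longrightarrow> 0 \<le> w x"
    and refine: "k < n \<Longrightarrow> x \<in> \<Omega> \<Longrightarrow> y \<in> \<Omega> \<Longrightarrow> \<pi> (Suc k) x = \<pi> (Suc k) y \<Longrightarrow> \<pi> k x = \<pi> k y"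
begin

definition block :: "nat \<Rightarrow> 'a \<Rightarrow> 'a set" where
  "block k x = {y \<in> \<Omega>. \<pi> k y = \<pi> k x}"

definition adapted :: "nat \<Rightarrow> ('a \<Rightarrow> 'v) \<Rightarrow> bool" where
  "adapted k g \<longleftrightarrow> (\<forall>x\<in>\<Omega>. \<forall>y\<in>\<Omega>. \<pi> k x = \<pi> k y \<longrightarrow> g x = g y)"

definition centred :: "nat \<Rightarrow> ('a \<Rightarrow> 'v::real_vector) \<Rightarrow> bool" where
  "centred k g \<longleftrightarrow> (\<forall>x\<in>\<Omega>. (\<Sum>y\<in>block k x. w y *\<^sub>R g y) = 0)"

lemma refine_le: "j \<le> k \<Longrightarrow> k \<le> n \<Longrightarrow> x \<in> \<Omega> \<Longrightarrow> y \<in> \<Omega> \<Longrightarrow> \<pi> k x = \<pi> k y \<Longrightarrow> \<pi> j x = \<pi> j y"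
proof (induction rule: dec_induct)
  case (step k)
  then show ?case using refine[of k x y] by simp
qed

lemma adapted_eq: "adapted k g \<Longrightarrow> x \<in> \<Omega> \<Longrightarrow> y \<in> \<Omega> \<Longrightarrow> \<pi> k x = \<pi> k y \<Longrightarrow> g x = g y"
  unfolding adapted_def by blast

lemma adaptedI: "(\<And>x y. x \<in> \<Omega> \<Longrightarrow> y \<in> \<Omega> \<Longrightarrow> \<pi> k x = \<pi> k y \<Longrightarrow> g x = g y) \<Longrightarrow> adapted k g"
  unfolding adapted_def by blast

lemma adapted_mono:
  assumes "adapted j g" "j \<le> k" "k \<le> n"
  shows "adapted k g"
  by (rule adaptedI) (rule adapted_eq[OF assms(1) _ _ refine_le[OF assms(2,3)]])

lemma adaptedD: "adapted k g \<Longrightarrow> x \<in> \<Omega> \<Longrightarrow> y \<in> block k x \<Longrightarrow> g y = g x"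
  unfolding adapted_def block_def by blast

lemma finite_block [simp]: "finite (block k x)"
  by (simp add: block_def)

lemma block_subset: "y \<in> block k x \<Longrightarrow> y \<in> \<Omega>"
  by (simp add: block_def)

lemma sum_mono_blocks:
  fixes u v :: "'a \<Rightarrow> real"
  assumes "\<And>x. x \<in> \<Omega> \<Longrightarrow> (\<Sum>y\<in>block k x. u y) \<le> (\<Sum>y\<in>block k x. v y)"
  shows "(\<Sum>x\<in>\<Omega>. u x) \<le> (\<Sum>x\<in>\<Omega>. v x)"
  by (rule sum_blocks_mono[where \<pi>="\<pi> k"]) (use assms in \<open>auto simp: block_def\<close>)

lemma block_in_block:
  assumes "i \<le> k" "k \<le> n" "z \<in> block i x"
  shows "{y. y \<in> block i x \<and> \<pi> k y = \<pi> k z} = block k z"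
proof -
  have "\<pi> i y = \<pi> i x" if "y \<in> \<Omega>" "\<pi> k y = \<pi> k z" for y
    using refine_le[OF assms(1,2), of y z] that assms(3) by (simp add: block_def)
  then show ?thesis by (auto simp: block_def)
qed

text \<open>Inside a block of level \<open>i\<close>, a sum may be compared blockwise at any finer level.\<close>

lemma sum_block_mono_blocks:
  fixes u v :: "'a \<Rightarrow> real"
  assumes "i \<le> k" "k \<le> n" "x \<in> \<Omega>"
    and "\<And>z. z \<in> block i x \<Longrightarrow> (\<Sum>y\<in>block k z. u y) \<le> (\<Sum>y\<in>block k z. v y)"
  shows "(\<Sum>y\<in>block i x. u y) \<le> (\<Sum>y\<in>block i x. v y)"
proof (rule sum_blocks_mono[where \<pi>="\<pi> k"])
  fix z assume z: "z \<in> block i x"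
  have "{y. y \<in> block i x \<and> \<pi> k y = \<pi> k z} = block k z"
    by (rule block_in_block[OF assms(1,2) z])
  then show "(\<Sum>y | y \<in> block i x \<and> \<pi> k y = \<pi> k z. u y) \<le> (\<Sum>y | y \<in> block i x \<and> \<pi> k y = \<pi> k z. v y)"
    using assms(4)[OF z] by simp
qed simp

lemma sum_block_centred:
  fixes g :: "'a \<Rightarrow> 'v::real_vector"
  assumes "i \<le> k" "k \<le> n" "x \<in> \<Omega>" "centred k g"
  shows "(\<Sum>y\<in>block i x. w y *\<^sub>R g y) = 0"
proof (rule sum_blocks_zero[where \<pi>="\<pi> k"])
  fix z assume z: "z \<in> block i x"
  have "{y. y \<in> block i x \<and> \<pi> k y = \<pi> k z} = block k z"
    by (rule block_in_block[OF assms(1,2) z])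
  then show "(\<Sum>y | y \<in> block i x \<and> \<pi> k y = \<pi> k z. w y *\<^sub>R g y) = 0"
    using assms(4) block_subset[OF z] by (simp add: centred_def)
qed simp

lemma centred_linear:
  assumes "centred k g" "adapted k c" "\<And>z. linear (T z)"
  shows "centred k (\<lambda>x. T (c x) (g x))"
  unfolding centred_def
proof
  fix x assume x: "x \<in> \<Omega>"
  have "(\<Sum>y\<in>block k x. w y *\<^sub>R T (c y) (g y)) = (\<Sum>y\<in>block k x. T (c x) (w y *\<^sub>R g y))"
    using adaptedD[OF assms(2) x] by (intro sum.cong refl) (simp add: linear_cmul[OF assms(3)])
  also have "\<dots> = T (c x) (\<Sum>y\<in>block k x. w y *\<^sub>R g y)"
    by (simp add: linear_sum[OF assms(3)])
  also have "\<dots> = 0" using assms(1) x by (simp add: centred_def linear_0[OF assms(3)])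
  finally show "(\<Sum>y\<in>block k x. w y *\<^sub>R T (c y) (g y)) = 0" .
qed

lemma centred_restrict:
  fixes g :: "'a \<Rightarrow> 'v::real_vector"
  assumes "centred k g" "adapted k B"
  shows "centred k (\<lambda>x. if B x then g x else 0)"
proof -
  have "linear (\<lambda>v::'v. if b then v else 0)" for b by (auto simp: linear_iff)
  then show ?thesis using centred_linear[OF assms, of "\<lambda>b v. if b then v else 0"] by blast
qed

end

text \<open>\<open>c i\<close> and \<open>c' i\<close> stand for the averages of one and the same accretive function at the levels
  \<open>i\<close> and \<open>i + 1\<close>. At the points of \<open>acc (i + 1)\<close> that function is replaced by a new one, whose
  average is at least \<open>\<delta>\<close> there, while the old average has dropped to at most \<open>\<kappa>\<close>; elsewhere the function is
  kept and \<open>c (i + 1)\<close> equals \<open>c' i\<close>. \<open>A\<close> is the threshold for square sums. The two inequalities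
  for \<open>C1\<close> and \<open>C2\<close> are those which make the induction in the proof of the exponential moment
  close.\<close>

locale accretive_filtration = filtered_set \<Omega> w \<pi> n
  for \<Omega> :: "'a set" and w and \<pi> :: "nat \<Rightarrow> 'a \<Rightarrow> 'b" and n +
  fixes acc :: "nat \<Rightarrow> 'a \<Rightarrow> bool" and c c' :: "nat \<Rightarrow> 'a \<Rightarrow> complex"
    and \<delta> \<kappa> A \<rho> C1 C2 :: real
  assumes acc_adapted: "i \<le> n \<Longrightarrow> adapted i (acc i)"
    and acc_0: "x \<in> \<Omega> \<Longrightarrow> acc 0 x"
    and c_adapted: "i \<le> n \<Longrightarrow> adapted i (c i)"
    and c'_adapted: "i < n \<Longrightarrow> adapted (Suc i) (c' i)"
    and c_centred: "i < n \<Longrightarrow> centred i (\<lambda>x. c' i x - c i x)"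
    and c_keep: "i < n \<Longrightarrow> x \<in> \<Omega> \<Longrightarrow> \<not> acc (Suc i) x \<Longrightarrow> c (Suc i) x = c' i x"
    and c_le: "i \<le> n \<Longrightarrow> x \<in> \<Omega> \<Longrightarrow> cmod (c i x) \<le> 1"
    and c'_le: "i < n \<Longrightarrow> x \<in> \<Omega> \<Longrightarrow> cmod (c' i x) \<le> 1"
    and c_ge: "i \<le> n \<Longrightarrow> x \<in> \<Omega> \<Longrightarrow> \<kappa> \<le> cmod (c i x)"
    and acc_ge: "i \<le> n \<Longrightarrow> x \<in> \<Omega> \<Longrightarrow> acc i x \<Longrightarrow> \<delta> \<le> cmod (c i x)"
    and acc_small: "i < n \<Longrightarrow> x \<in> \<Omega> \<Longrightarrow> acc (Suc i) x \<Longrightarrow> cmod (c' i x) \<le> \<kappa>"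
    and \<kappa>: "0 < \<kappa>" "\<kappa> < 1" and \<rho>: "1 < \<rho>" and A: "0 < A" and C1: "0 \<le> C1" and C2: "0 \<le> C2"
    and C2_ge: "1 + \<rho> * C1 + \<rho> * C2 / A \<le> C2"
    and C1_ge: "1 + \<rho> * C1 * ((1 - \<delta>) / (1 - \<kappa>)) + \<rho> * C2 / A \<le> C1"
begin

text \<open>A generation lasts until the accretive function changes or the square sum of the increments
  of \<open>c\<close> since the last stop exceeds \<open>A\<close>. The second kind of stop keeps the randomised sums of
  these increments bounded in all moments within one generation. The second component of the state
  is the current square sum.\<close>

primrec state :: "'a \<Rightarrow> nat \<Rightarrow> nat \<times> real" where
  "state x 0 = (0, 0)"
| "state x (Suc i) = (let N = fst (state x i); V = snd (state x i) + (cmod (c' i x - c i x))\<^sup>2 in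
     if acc (Suc i) x \<or> A < V then (Suc N, 0) else (N, V))"

definition gen :: "'a \<Rightarrow> nat \<Rightarrow> nat" where "gen x i = fst (state x i)"

abbreviation dc :: "nat \<Rightarrow> 'a \<Rightarrow> complex" where "dc i x \<equiv> c' i x - c i x"

sublocale counter "gen x" for x
  by standard (auto simp: gen_def Let_def)

lemma state_adapted: "i \<le> n \<Longrightarrow> adapted i (\<lambda>x. state x i)"
proof (induction i)
  case (Suc i)
  have *: "adapted (Suc i) (\<lambda>x. state x i)" "adapted (Suc i) (c i)"
    using Suc c_adapted[of i] by (auto intro: adapted_mono)
  show ?case
  proof (rule adaptedI)
    fix x y assume xy: "x \<in> \<Omega>" "y \<in> \<Omega>" "\<pi> (Suc i) x = \<pi> (Suc i) y"
    have "state x i = state y i" "c i x = c i y" "c' i x = c' i y" "acc (Suc i) x = acc (Suc i) y"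
      using adapted_eq[OF *(1) xy] adapted_eq[OF *(2) xy] adapted_eq[OF c'_adapted xy]
        adapted_eq[OF acc_adapted xy] Suc.prems by auto
    then show "state x (Suc i) = state y (Suc i)" by simp
  qed
qed (simp add: adapted_def)

lemma gen_adapted: "i \<le> n \<Longrightarrow> adapted i (\<lambda>x. gen x i)"
proof (rule adaptedI)
  fix x y assume "i \<le> n" and xy: "x \<in> \<Omega>" "y \<in> \<Omega>" "\<pi> i x = \<pi> i y"
  from adapted_eq[OF state_adapted[OF this(1)] xy] show "gen x i = gen y i"
    by (simp add: gen_def)
qed

lemma gen_block: "i \<le> k \<Longrightarrow> k \<le> n \<Longrightarrow> x \<in> \<Omega> \<Longrightarrow> y \<in> block k x \<Longrightarrow> gen y i = gen x i"
  by (rule adaptedD[OF adapted_mono[OF gen_adapted]]) auto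

lemma starts_block: "k \<le> n \<Longrightarrow> x \<in> \<Omega> \<Longrightarrow> y \<in> block k x \<Longrightarrow> starts (gen y) j k = starts (gen x) j k"
  using gen_block[of k k x y] gen_block[of "k - 1" k x y] by (auto simp: starts_def)

lemma ends_block: "k < n \<Longrightarrow> x \<in> \<Omega> \<Longrightarrow> y \<in> block (Suc k) x \<Longrightarrow> ends (gen y) j k = ends (gen x) j k"
  using gen_block[of k "Suc k" x y] gen_block[of "Suc k" "Suc k" x y] by (auto simp: ends_def)

lemma gen_keep: "i < n \<Longrightarrow> x \<in> \<Omega> \<Longrightarrow> gen x (Suc i) = gen x i \<Longrightarrow> c (Suc i) x = c' i x"
  by (rule c_keep) (auto simp: gen_def Let_def)

lemma acc_step: "acc (Suc i) x \<Longrightarrow> gen x (Suc i) = Suc (gen x i)"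
  by (simp add: gen_def)

subsection \<open>Square sums between two stops\<close>

lemma square_sum_state: "gen x m = j \<Longrightarrow> (\<Sum>i<m. if gen x i = j then (cmod (dc i x))\<^sup>2 else 0) = snd (state x m)"
proof (induction m arbitrary: j)
  case (Suc m)
  show ?case
  proof (cases "gen x (Suc m) = gen x m")
    case True
    then show ?thesis using Suc by (auto simp: gen_def Let_def split: if_splits)
  next
    case False
    then have j: "j = Suc (gen x m)" using N_Suc[of x m] Suc.prems by auto
    have "(\<Sum>i<Suc m. if gen x i = j then (cmod (dc i x))\<^sup>2 else 0) = 0"
    proof (intro sum.neutral ballI)
      fix i assume "i \<in> {..<Suc m}"
      then have "gen x i \<noteq> j" using N_mono[of i m x] by (simp add: j)
      then show "(if gen x i = j then (cmod (dc i x))\<^sup>2 else 0) = 0" by simp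
    qed
    then show ?thesis using False by (auto simp: gen_def Let_def split: if_splits)
  qed
qed simp

lemma snd_state_le: "snd (state x m) \<le> A"
  using A by (cases m) (auto simp: Let_def)

lemma square_sum_le:
  assumes "m \<le> n" "x \<in> \<Omega>"
  shows "(\<Sum>i<m. if gen x i = j then (cmod (dc i x))\<^sup>2 else 0) \<le> A + 4"
  using assms(1)
proof (induction m)
  case (Suc m)
  show ?case
  proof (cases "gen x m = j")
    case True
    have "cmod (dc m x) \<le> 1 + 1"
      using norm_triangle_ineq4[of "c' m x" "c m x"] c_le[of m x] c'_le[of m x] Suc.prems assms by simp
    then have "(cmod (dc m x))\<^sup>2 \<le> 2\<^sup>2" by (intro power_mono) auto
    then show ?thesis using True square_sum_state[OF True] snd_state_le[of x m] by simp
  next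
    case False
    then show ?thesis using Suc by simp
  qed
qed (use A in simp)

lemma square_sum_sq_stop:
  assumes "i < n" "ends (gen x) j i" "\<not> acc (Suc i) x"
  shows "A < (\<Sum>i<n. if gen x i = j then (cmod (dc i x))\<^sup>2 else 0)"
proof -
  have j: "gen x i = j" using assms by (simp add: ends_def)
  have "A < snd (state x i) + (cmod (dc i x))\<^sup>2"
    using assms by (auto simp: ends_def gen_def Let_def split: if_splits)
  also have "\<dots> = (\<Sum>i<Suc i. if gen x i = j then (cmod (dc i x))\<^sup>2 else 0)"
    using square_sum_state[OF j] j by simp
  also have "\<dots> \<le> (\<Sum>i<n. if gen x i = j then (cmod (dc i x))\<^sup>2 else 0)"
    using assms by (intro sum_mono2) auto
  finally show ?thesis .
qed

text \<open>Before the level \<open>i\<close> no point of the block belongs to generation \<open>j\<close>; from there on,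
  membership at level \<open>k\<close> is known at level \<open>k\<close> and so does not disturb the cancellation.\<close>

lemma gen_restrict_centred:
  fixes g :: "'a \<Rightarrow> 'v::real_vector"
  assumes x: "x \<in> \<Omega>" and st: "starts (gen x) j i" and "i \<le> n" "k < n" "centred k g"
  shows "(\<Sum>y\<in>block i x. w y *\<^sub>R (if gen y k = j then g y else 0)) = 0"
proof (cases "i \<le> k")
  case True
  have "adapted k (\<lambda>y. gen y k = j)"
  proof (rule adaptedI)
    fix y z assume "y \<in> \<Omega>" "z \<in> \<Omega>" "\<pi> k y = \<pi> k z"
    from adapted_eq[OF gen_adapted this] assms(4) show "(gen y k = j) = (gen z k = j)" by simp
  qed
  then have "centred k (\<lambda>y. if gen y k = j then g y else 0)"
    using assms by (intro centred_restrict) auto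
  then show ?thesis using True assms by (intro sum_block_centred[of i k]) auto
next
  case False
  have "gen y k \<noteq> j" if "y \<in> block i x" for y
    using starts_block[of i x y j] starts_imp_le[of y j i k] assms False that by auto
  then show ?thesis by simp
qed

text \<open>Here $|c' - c|^2 = |c'|^2 - |c|^2 - 2 \mathrm{Re}(\bar c (c' - c))$, where the last term has mean
  zero and the others telescope within a generation.\<close>

lemma orthogonality:
  assumes x: "x \<in> \<Omega>" and i: "i \<le> n" and st: "starts (gen x) j i"
  shows "(\<Sum>y\<in>block i x. w y * (\<Sum>k<n. if gen y k = j then (cmod (dc k y))\<^sup>2 else 0)) \<le> (\<Sum>y\<in>block i x. w y)"
proof -
  have Re: "centred k (\<lambda>y. Re (cnj (c k y) * dc k y))" if "k < n" for k
    using centred_linear[OF c_centred[OF that] c_adapted, of "\<lambda>z v. Re (cnj z * v)"] that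
    by (simp add: linear_iff algebra_simps)
  have sq: "(cmod (dc k y))\<^sup>2 = (cmod (c' k y))\<^sup>2 - (cmod (c k y))\<^sup>2 - 2 * Re (cnj (c k y) * dc k y)" for k y
    by (simp only: cmod_power2) (simp add: power2_eq_square algebra_simps)
  have "(\<Sum>y\<in>block i x. w y * (\<Sum>k<n. if gen y k = j then (cmod (dc k y))\<^sup>2 else 0))
      = (\<Sum>y\<in>block i x. w y * (\<Sum>k<n. if gen y k = j then (cmod (c' k y))\<^sup>2 - (cmod (c k y))\<^sup>2 else 0))
       - 2 * (\<Sum>k<n. \<Sum>y\<in>block i x. w y *\<^sub>R (if gen y k = j then Re (cnj (c k y) * dc k y) else 0))"
    unfolding sum.swap[of _ "{..<n}"] sum_distrib_left sum_subtractf[symmetric]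
    by (intro sum.cong refl) (auto simp: sq algebra_simps)
  also have "\<dots> = (\<Sum>y\<in>block i x. w y * (\<Sum>k<n. if gen y k = j then (cmod (c' k y))\<^sup>2 - (cmod (c k y))\<^sup>2 else 0))"
    using gen_restrict_centred[OF x st i _ Re] by simp
  also have "\<dots> \<le> (\<Sum>y\<in>block i x. w y * 1)"
  proof (intro sum_mono mult_left_mono)
    fix y assume "y \<in> block i x"
    then have y: "y \<in> \<Omega>" by (rule block_subset)
    then show "0 \<le> w y" by (rule w_nonneg)
    have "(\<Sum>k<n. if gen y k = j then (cmod (c' k y))\<^sup>2 - (cmod (c k y))\<^sup>2 else 0)
      = (\<Sum>k<n. if ends (gen y) j k then (cmod (c' k y))\<^sup>2 else 0) + (if gen y n = j then (cmod (c n y))\<^sup>2 else 0)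
        - (\<Sum>k\<le>n. if starts (gen y) j k then (cmod (c k y))\<^sup>2 else 0)"
      by (rule telescope) (use gen_keep y in auto)
    also have "\<dots> \<le> (\<Sum>k<n. of_bool (ends (gen y) j k)) + of_bool (gen y n = j) - 0"
      using c_le[of _ y] c'_le[of _ y] y
      by (intro diff_mono add_mono sum_mono sum_nonneg) (auto simp: power_le_one)
    also have "\<dots> \<le> 1" unfolding sum_ends by auto
    finally show "(\<Sum>k<n. if gen y k = j then (cmod (c' k y))\<^sup>2 - (cmod (c k y))\<^sup>2 else 0) \<le> 1" .
  qed
  finally show ?thesis by simp
qed

subsection \<open>The mass of the stops\<close>

definition acc_mass :: "nat \<Rightarrow> 'a \<Rightarrow> real" where
  "acc_mass j y = (\<Sum>k<n. of_bool (ends (gen y) j k \<and> acc (Suc k) y))"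

definition sq_mass :: "nat \<Rightarrow> 'a \<Rightarrow> real" where
  "sq_mass j y = (\<Sum>k<n. of_bool (ends (gen y) j k \<and> \<not> acc (Suc k) y))"

lemma mass_sum: "acc_mass j y + sq_mass j y = of_bool (j < gen y n)"
  unfolding acc_mass_def sq_mass_def sum.distrib[symmetric] sum_ends[of y j n, symmetric]
  by (intro sum.cong) auto

lemma mass_nonneg: "0 \<le> acc_mass j y" "0 \<le> sq_mass j y"
  by (auto simp: acc_mass_def sq_mass_def intro!: sum_nonneg)

text \<open>Chebyshev's inequality for the square sum.\<close>

lemma sq_mass_le:
  assumes x: "x \<in> \<Omega>" and i: "i \<le> n" and st: "starts (gen x) j i"
  shows "(\<Sum>y\<in>block i x. w y * sq_mass j y) \<le> (\<Sum>y\<in>block i x. w y) / A"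
proof -
  have "A * sq_mass j y \<le> (\<Sum>k<n. if gen y k = j then (cmod (dc k y))\<^sup>2 else 0)" if "y \<in> block i x" for y
  proof (cases "sq_mass j y = 0")
    case True
    then show ?thesis by (simp add: sum_nonneg)
  next
    case False
    have "\<exists>k<n. ends (gen y) j k \<and> \<not> acc (Suc k) y"
    proof (rule ccontr)
      assume "\<not> (\<exists>k<n. ends (gen y) j k \<and> \<not> acc (Suc k) y)"
      then have "sq_mass j y = 0" unfolding sq_mass_def by (intro sum.neutral) auto
      with False show False by simp
    qed
    then obtain k where k: "k < n" "ends (gen y) j k" "\<not> acc (Suc k) y" by blast
    have "A * sq_mass j y \<le> A * 1"
      using mass_sum[of j y] mass_nonneg[of j y] A by (intro mult_left_mono) (auto simp: of_bool_def split: if_splits)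
    then show ?thesis using square_sum_sq_stop[OF k] by linarith
  qed
  then have "(\<Sum>y\<in>block i x. w y * (A * sq_mass j y)) \<le> (\<Sum>y\<in>block i x. w y * (\<Sum>k<n. if gen y k = j then (cmod (dc k y))\<^sup>2 else 0))"
    using w_nonneg block_subset by (intro sum_mono mult_left_mono) auto
  also have "\<dots> \<le> (\<Sum>y\<in>block i x. w y)" by (rule orthogonality[OF assms])
  finally show ?thesis using A by (simp add: field_simps sum_distrib_left)
qed

text \<open>The average of the increments vanishes, so the mean of \<open>c\<close> at the stops is its value at the
  start. That is at least \<open>\<delta>\<close> at an accretive start, while accretive stops contribute at
  most \<open>\<kappa>\<close>; hence they cannot fill the block.\<close>

lemma acc_mass_le:
  assumes x: "x \<in> \<Omega>" and i: "i \<le> n" and st: "starts (gen x) j i" and acc: "acc i x"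
  shows "(\<Sum>y\<in>block i x. w y * acc_mass j y) \<le> (1 - \<delta>) / (1 - \<kappa>) * (\<Sum>y\<in>block i x. w y)"
proof -
  let ?W = "\<Sum>y\<in>block i x. w y" and ?M = "\<Sum>y\<in>block i x. w y * acc_mass j y"
  \<comment> \<open>\<open>e y\<close> is the value of the stopped martingale at the end of the generation.\<close>
  define e where "e y = (\<Sum>k<n. if ends (gen y) j k then c' k y else 0) + (if gen y n = j then c n y else 0)" for y
  have tel: "(\<Sum>k<n. if gen y k = j then dc k y else 0) = e y - c i x" if y: "y \<in> block i x" for y
  proof -
    have "(\<Sum>k<n. if gen y k = j then dc k y else 0) = e y - (\<Sum>k\<le>n. if starts (gen y) j k then c k y else 0)"
      unfolding e_def by (rule telescope) (use gen_keep block_subset[OF y] in auto)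
    also have "(\<Sum>k\<le>n. if starts (gen y) j k then c k y else 0) = c i y"
      using starts_block[OF i x y] st i by (intro sum_starts_eq) auto
    also have "c i y = c i x" by (rule adaptedD[OF c_adapted[OF i] x y])
    finally show ?thesis .
  qed
  have "(\<Sum>y\<in>block i x. w y *\<^sub>R (e y - c i x)) = (\<Sum>y\<in>block i x. \<Sum>k<n. w y *\<^sub>R (if gen y k = j then dc k y else 0))"
    by (intro sum.cong refl) (simp add: tel[symmetric] scaleR_sum_right)
  also have "\<dots> = (\<Sum>k<n. \<Sum>y\<in>block i x. w y *\<^sub>R (if gen y k = j then dc k y else 0))" by (rule sum.swap)
  also have "\<dots> = 0" using gen_restrict_centred[OF x st i _ c_centred] by simp
  finally have mean: "?W *\<^sub>R c i x = (\<Sum>y\<in>block i x. w y *\<^sub>R e y)"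
    by (simp add: scaleR_diff_right sum_subtractf scaleR_sum_left)
  have e_le: "cmod (e y) \<le> 1 - (1 - \<kappa>) * acc_mass j y" if y: "y \<in> block i x" for y
  proof -
    have y': "y \<in> \<Omega>" using y by (rule block_subset)
    have "gen y i = j" using gen_block[OF order_refl i x y] st by (simp add: starts_def)
    then have jn: "j \<le> gen y n" using N_mono[OF i, of y] by simp
    have "cmod (e y) \<le> (\<Sum>k<n. cmod (if ends (gen y) j k then c' k y else 0)) + cmod (if gen y n = j then c n y else 0)"
      unfolding e_def by (rule order_trans[OF norm_triangle_ineq]) (intro add_right_mono norm_sum)
    also have "\<dots> \<le> (\<Sum>k<n. \<kappa> * of_bool (ends (gen y) j k \<and> acc (Suc k) y) + of_bool (ends (gen y) j k \<and> \<not> acc (Suc k) y)) + of_bool (gen y n = j)"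
      using c_le[of n y] c'_le[of _ y] acc_small[of _ y] y' by (intro add_mono sum_mono) auto
    also have "\<dots> = \<kappa> * acc_mass j y + sq_mass j y + of_bool (gen y n = j)"
      by (simp add: sum.distrib acc_mass_def sq_mass_def sum_distrib_left)
    also have "\<dots> = 1 - (1 - \<kappa>) * acc_mass j y"
      using mass_sum[of j y] jn by (auto simp: algebra_simps of_bool_def split: if_splits)
    finally show ?thesis .
  qed
  have W: "0 \<le> ?W" using w_nonneg block_subset by (intro sum_nonneg) auto
  have "\<delta> * ?W \<le> cmod (c i x) * ?W" using acc_ge[OF i x acc] W by (intro mult_right_mono) auto
  also have "\<dots> = cmod (\<Sum>y\<in>block i x. w y *\<^sub>R e y)"
    unfolding mean[symmetric] using W by (simp add: mult.commute)
  also have "\<dots> \<le> (\<Sum>y\<in>block i x. cmod (w y *\<^sub>R e y))" by (rule norm_sum)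
  also have "\<dots> \<le> (\<Sum>y\<in>block i x. w y * (1 - (1 - \<kappa>) * acc_mass j y))"
    using w_nonneg[OF block_subset] e_le by (intro sum_mono) (auto intro!: mult_mono)
  also have "\<dots> = ?W - (1 - \<kappa>) * ?M"
    by (simp add: sum_subtractf sum.distrib sum_distrib_left algebra_simps)
  finally have "(1 - \<kappa>) * ?M \<le> (1 - \<delta>) * ?W" by (simp add: algebra_simps)
  then show ?thesis using \<kappa> by (simp add: field_simps)
qed

lemma power_gen_split:
  "\<rho> ^ (gen y n - j) = of_bool (gen y n \<le> j) + (\<Sum>k<n. if ends (gen y) j k then \<rho> * \<rho> ^ (gen y n - Suc j) else 0)"
proof -
  have "(\<Sum>k<n. if ends (gen y) j k then \<rho> * \<rho> ^ (gen y n - Suc j) else 0)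
      = (\<Sum>k<n. of_bool (ends (gen y) j k)) * (\<rho> * \<rho> ^ (gen y n - Suc j))"
    unfolding sum_distrib_right by (intro sum.cong) auto
  then show ?thesis
    unfolding sum_ends by (auto simp: not_le power_Suc[symmetric] Suc_diff_Suc simp del: power_Suc)
qed

text \<open>The number of later stops has an exponential moment. There are two kinds of stops: from an
  accretive one a fixed proportion of the mass meets no further accretive stop, while from any
  stop only a small proportion goes on to a stop caused by the square sum.\<close>

lemma exponential_moment:
  assumes "x \<in> \<Omega>" "i \<le> n" "starts (gen x) j i"
  shows "(\<Sum>y\<in>block i x. w y * \<rho> ^ (gen y n - j)) \<le> (if acc i x then C1 else C2) * (\<Sum>y\<in>block i x. w y)"
  using assms
proof (induction "n - i" arbitrary: i j x rule: less_induct)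
  case less
  note x = \<open>x \<in> \<Omega>\<close> and i = \<open>i \<le> n\<close> and st = \<open>starts (gen x) j i\<close>
  let ?W = "\<Sum>y\<in>block i x. w y"
  let ?C = "\<lambda>k y. if acc (Suc k) y then C1 else C2"
  have W: "0 \<le> ?W" using w_nonneg block_subset by (intro sum_nonneg) auto
  have gi: "gen y i = j" if "y \<in> block i x" for y
    using gen_block[OF order_refl i x that] st by (simp add: starts_def)
  have step: "(\<Sum>y\<in>block i x. w y * (if ends (gen y) j k then \<rho> * \<rho> ^ (gen y n - Suc j) else 0))
      \<le> (\<Sum>y\<in>block i x. w y * (if ends (gen y) j k then \<rho> * ?C k y else 0))" if k: "k < n" for k
  proof (cases "i \<le> k")
    case True
    show ?thesis
    proof (rule sum_block_mono_blocks[of i "Suc k"])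
      fix z assume "z \<in> block i x"
      then have z: "z \<in> \<Omega>" by (rule block_subset)
      have ez: "ends (gen y) j k = ends (gen z) j k" if "y \<in> block (Suc k) z" for y
        by (rule ends_block[OF k z that])
      have Cz: "?C k y = ?C k z" if "y \<in> block (Suc k) z" for y
        using adaptedD[OF acc_adapted z that] k by simp
      show "(\<Sum>y\<in>block (Suc k) z. w y * (if ends (gen y) j k then \<rho> * \<rho> ^ (gen y n - Suc j) else 0))
         \<le> (\<Sum>y\<in>block (Suc k) z. w y * (if ends (gen y) j k then \<rho> * ?C k y else 0))"
      proof (cases "ends (gen z) j k")
        case e: True
        have "(\<Sum>y\<in>block (Suc k) z. w y * \<rho> ^ (gen y n - Suc j)) \<le> ?C k z * (\<Sum>y\<in>block (Suc k) z. w y)"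
          using less.hyps[of "Suc k" z "Suc j"] True k z e by (simp add: starts_Suc)
        then have "\<rho> * (\<Sum>y\<in>block (Suc k) z. w y * \<rho> ^ (gen y n - Suc j)) \<le> \<rho> * (?C k z * (\<Sum>y\<in>block (Suc k) z. w y))"
          using \<rho> by (intro mult_left_mono) auto
        then show ?thesis using e by (simp add: ez Cz sum_distrib_left mult_ac cong: sum.cong)
      qed (simp add: ez)
    qed (use k True x in auto)
  next
    case False
    have "\<not> ends (gen y) j k" if "y \<in> block i x" for y
      using gi[OF that] N_mono[of "Suc k" i y] False by (auto simp: ends_def)
    then show ?thesis by simp
  qed
  have "(\<Sum>y\<in>block i x. w y * \<rho> ^ (gen y n - j))
     = (\<Sum>y\<in>block i x. w y * of_bool (gen y n \<le> j))
       + (\<Sum>k<n. \<Sum>y\<in>block i x. w y * (if ends (gen y) j k then \<rho> * \<rho> ^ (gen y n - Suc j) else 0))"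
    unfolding power_gen_split[of _ j] by (simp only: distrib_left sum.distrib sum_weight_swap)
  also have "\<dots> \<le> ?W + (\<Sum>k<n. \<Sum>y\<in>block i x. w y * (if ends (gen y) j k then \<rho> * ?C k y else 0))"
  proof (rule add_mono)
    show "(\<Sum>y\<in>block i x. w y * of_bool (gen y n \<le> j)) \<le> ?W"
      by (rule sum_mono) (simp add: of_bool_def w_nonneg[OF block_subset])
  qed (rule sum_mono, rule step, simp)
  also have "(\<Sum>k<n. \<Sum>y\<in>block i x. w y * (if ends (gen y) j k then \<rho> * ?C k y else 0))
     = \<rho> * (C1 * (\<Sum>y\<in>block i x. w y * acc_mass j y) + C2 * (\<Sum>y\<in>block i x. w y * sq_mass j y))"
    unfolding sum.swap[of _ "{..<n}"] acc_mass_def sq_mass_def sum_distrib_left sum.distrib[symmetric]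
    by (intro sum.cong refl) (auto simp: algebra_simps)
  also have "?W + \<dots> \<le> (if acc i x then C1 else C2) * ?W"
  proof -
    let ?a = "\<Sum>y\<in>block i x. w y * acc_mass j y" and ?s = "\<Sum>y\<in>block i x. w y * sq_mass j y"
    have s: "?s \<le> ?W / A" by (rule sq_mass_le[OF x i st])
    have a1: "?a \<le> ?W"
    proof -
      have "?a \<le> (\<Sum>y\<in>block i x. w y * 1)"
      proof (intro sum_mono mult_left_mono)
        fix y assume "y \<in> block i x"
        then show "0 \<le> w y" using w_nonneg block_subset by auto
        show "acc_mass j y \<le> 1" using mass_sum[of j y] mass_nonneg[of j y] by (auto simp: of_bool_def split: if_splits)
      qed
      then show ?thesis by simp
    qed
    show ?thesis
    proof (cases "acc i x")
      case True
      have "?W + \<rho> * (C1 * ?a + C2 * ?s) \<le> ?W + \<rho> * (C1 * ((1 - \<delta>) / (1 - \<kappa>) * ?W) + C2 * (?W / A))"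
        using s acc_mass_le[OF x i st True] C1 C2 \<rho> by (intro add_left_mono mult_left_mono add_mono) auto
      also have "\<dots> = (1 + \<rho> * C1 * ((1 - \<delta>) / (1 - \<kappa>)) + \<rho> * C2 / A) * ?W"
        by (simp add: algebra_simps)
      also have "\<dots> \<le> C1 * ?W" by (intro mult_right_mono C1_ge W)
      finally show ?thesis using True by simp
    next
      case False
      have "?W + \<rho> * (C1 * ?a + C2 * ?s) \<le> ?W + \<rho> * (C1 * ?W + C2 * (?W / A))"
        using s a1 C1 C2 \<rho> by (intro add_left_mono mult_left_mono add_mono) auto
      also have "\<dots> = (1 + \<rho> * C1 + \<rho> * C2 / A) * ?W"
        by (simp add: algebra_simps)
      also have "\<dots> \<le> C2 * ?W" by (intro mult_right_mono C2_ge W)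
      finally show ?thesis using False by simp
    qed
  qed
  finally show ?case .
qed

lemma C1_le_C2: "C1 \<le> C2" "1 \<le> C2"
proof -
  have "1 * C1 \<le> \<rho> * C1" using \<rho> C1 by (intro mult_right_mono) auto
  moreover have "0 \<le> \<rho> * C2 / A" "0 \<le> \<rho> * C1" using \<rho> C1 C2 A by auto
  ultimately  show "C1 \<le> C2" "1 \<le> C2" using C2_ge by linarith+
qed

lemma exponential_moment':
  assumes "x \<in> \<Omega>" "i \<le> n" "starts (gen x) j i"
  shows "(\<Sum>y\<in>block i x. w y * \<rho> ^ (gen y n - j)) \<le> C2 * (\<Sum>y\<in>block i x. w y)"
proof -
  have "0 \<le> (\<Sum>y\<in>block i x. w y)" using w_nonneg block_subset by (intro sum_nonneg) auto
  then show ?thesis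
    using exponential_moment[OF assms] C1_le_C2 mult_right_mono[of C1 C2 "\<Sum>y\<in>block i x. w y"]
    by (auto split: if_splits)
qed

lemma weighted_starts:
  assumes "i \<le> n" "adapted i g" "\<And>x. x \<in> \<Omega> \<Longrightarrow> 0 \<le> g x"
  shows "(\<Sum>x\<in>\<Omega>. w x * (\<rho> ^ (gen x n - j) * (if starts (gen x) j i then g x else 0)))
    \<le> C2 * (\<Sum>x\<in>\<Omega>. w x * (if starts (gen x) j i then g x else 0))"
  unfolding sum_distrib_left
proof (rule sum_mono_blocks[where k=i])
  fix x assume x: "x \<in> \<Omega>"
  have st: "starts (gen y) j i = starts (gen x) j i" "g y = g x" if "y \<in> block i x" for y
    using starts_block[OF assms(1) x that] adaptedD[OF assms(2) x that] by auto
  show "(\<Sum>y\<in>block i x. w y * (\<rho> ^ (gen y n - j) * (if starts (gen y) j i then g y else 0)))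
     \<le> (\<Sum>y\<in>block i x. C2 * (w y * (if starts (gen y) j i then g y else 0)))"
  proof (cases "starts (gen x) j i")
    case True
    have "(\<Sum>y\<in>block i x. w y * \<rho> ^ (gen y n - j)) * g x \<le> C2 * (\<Sum>y\<in>block i x. w y) * g x"
      by (intro mult_right_mono exponential_moment' assms(1,3) x True)
    then show ?thesis using True by (simp add: st sum_distrib_left sum_distrib_right mult_ac cong: sum.cong)
  qed (simp add: st)
qed

text \<open>What happens in a generation is known when it ends, and the number of generations still to
  come has an exponential moment conditionally on that.\<close>

lemma weighted_generation:
  assumes h: "\<And>x. x \<in> \<Omega> \<Longrightarrow> 0 \<le> h x"
    and ad: "\<And>k. k < n \<Longrightarrow> adapted (Suc k) (\<lambda>x. if ends (gen x) j k then h x else 0)"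
  shows "(\<Sum>x\<in>\<Omega>. w x * (\<rho> ^ (gen x n - j) * h x)) \<le> \<rho> * C2 * (\<Sum>x\<in>\<Omega>. w x * h x)"
proof -
  let ?h = "\<lambda>k x. if ends (gen x) j k then h x else 0"
  let ?s = "\<lambda>k x. if starts (gen x) (Suc j) (Suc k) then ?h k x else 0"
  have "\<rho> ^ (gen x n - j) * h x = of_bool (gen x n \<le> j) * h x + (\<Sum>k<n. \<rho> * (\<rho> ^ (gen x n - Suc j) * ?s k x))" for x
    unfolding power_gen_split[of x j] distrib_right sum_distrib_right
    by (intro arg_cong2[where f="(+)"] sum.cong refl) (auto simp: starts_Suc)
  then have "(\<Sum>x\<in>\<Omega>. w x * (\<rho> ^ (gen x n - j) * h x))
     = (\<Sum>x\<in>\<Omega>. w x * (of_bool (gen x n \<le> j) * h x)) + (\<Sum>k<n. \<Sum>x\<in>\<Omega>. w x * (\<rho> * (\<rho> ^ (gen x n - Suc j) * ?s k x)))"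
    by (simp only: distrib_left sum.distrib sum_weight_swap)
  also have "\<dots> = (\<Sum>x\<in>\<Omega>. w x * (of_bool (gen x n \<le> j) * h x))
      + \<rho> * (\<Sum>k<n. \<Sum>x\<in>\<Omega>. w x * (\<rho> ^ (gen x n - Suc j) * ?s k x))"
    by (simp only: sum_distrib_left mult.left_commute[of _ \<rho>])
  also have "\<dots> \<le> (\<Sum>x\<in>\<Omega>. w x * (of_bool (gen x n \<le> j) * h x))
      + \<rho> * (\<Sum>k<n. C2 * (\<Sum>x\<in>\<Omega>. w x * (if starts (gen x) (Suc j) (Suc k) then ?h k x else 0)))"
    using \<rho> ad h by (intro add_left_mono mult_left_mono sum_mono weighted_starts) auto
  also have "\<dots> \<le> \<rho> * C2 * (\<Sum>x\<in>\<Omega>. w x * (of_bool (gen x n \<le> j) * h x))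
      + \<rho> * (\<Sum>k<n. C2 * (\<Sum>x\<in>\<Omega>. w x * (if starts (gen x) (Suc j) (Suc k) then ?h k x else 0)))"
  proof -
    have "1 \<le> \<rho> * C2" using mult_mono[of 1 \<rho> 1 C2] \<rho> C1_le_C2 by simp
    moreover have "0 \<le> (\<Sum>x\<in>\<Omega>. w x * (of_bool (gen x n \<le> j) * h x))"
      using w_nonneg h by (intro sum_nonneg) auto
    ultimately show ?thesis using mult_right_mono by fastforce
  qed
  also have "\<dots> = \<rho> * C2 * ((\<Sum>x\<in>\<Omega>. w x * (of_bool (gen x n \<le> j) * h x)) + (\<Sum>k<n. \<Sum>x\<in>\<Omega>. w x * ?s k x))"
    by (simp only: sum_distrib_left[symmetric] distrib_left mult.assoc)
  also have "\<dots> = \<rho> * C2 * (\<Sum>x\<in>\<Omega>. w x * ((of_bool (gen x n \<le> j) + (\<Sum>k<n. of_bool (ends (gen x) j k))) * h x))"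
  proof -
    have "(of_bool (gen x n \<le> j) + (\<Sum>k<n. of_bool (ends (gen x) j k))) * h x = of_bool (gen x n \<le> j) * h x + (\<Sum>k<n. ?s k x)" for x
      unfolding distrib_right sum_distrib_right
      by (intro arg_cong2[where f="(+)"] sum.cong refl) (auto simp: starts_Suc)
    then show ?thesis by (simp only: distrib_left sum.distrib sum_weight_swap)
  qed
  also have "\<dots> = \<rho> * C2 * (\<Sum>x\<in>\<Omega>. w x * h x)"
    unfolding sum_ends by (auto intro!: arg_cong[where f="\<lambda>s. \<rho> * C2 * s"] sum.cong)
  finally show ?thesis .
qed

end

section \<open>The estimate for the stopped differences\<close>

lemma product_le_powr_add:
  fixes a b p :: real
  assumes "0 \<le> a" "0 \<le> b" "1 < p"
  shows "a * b \<le> a powr (p / (p - 1)) + b powr p"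
proof (cases "a \<le> b powr (p - 1)")
  case True
  have "a * b \<le> b powr (p - 1) * b" using True assms by (intro mult_right_mono) auto
  also have "\<dots> = b powr p" using assms by (cases "b = 0") (auto simp: powr_diff)
  also have "\<dots> \<le> a powr (p / (p - 1)) + b powr p" by simp
  finally show ?thesis .
next
  case False
  then have a: "0 < a" using assms by (smt (verit) powr_ge_zero)
  have "b = (b powr (p - 1)) powr (1 / (p - 1))" using assms by (simp add: powr_powr)
  also have "\<dots> \<le> a powr (1 / (p - 1))" using False assms by (intro powr_mono2) auto
  finally have "a * b \<le> a * a powr (1 / (p - 1))" using assms by (intro mult_left_mono) auto
  also have "\<dots> = a powr (1 + 1 / (p - 1))" using a by (simp add: powr_add)
  also have "1 + 1 / (p - 1) = p / (p - 1)" using assms by (simp add: field_simps)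
  finally show ?thesis using powr_ge_zero[of b p] by linarith
qed

lemma sign_avg_product_le:
  fixes s y :: "('i \<Rightarrow> real) \<Rightarrow> real"
  assumes I: "finite I" and p: "1 < p" and s: "\<And>\<sigma>. 0 \<le> s \<sigma>" and y: "\<And>\<sigma>. 0 \<le> y \<sigma>"
    and K: "sign_avg I (\<lambda>\<sigma>. s \<sigma> powr (p / (p - 1))) \<le> K"
  shows "sign_avg I (\<lambda>\<sigma>. s \<sigma> * y \<sigma>) powr p \<le> (K + 1) powr p * sign_avg I (\<lambda>\<sigma>. y \<sigma> powr p)"
proof -
  define E where "E = sign_avg I (\<lambda>\<sigma>. y \<sigma> powr p)"
  have E: "0 \<le> E" unfolding E_def by (rule sign_avg_nonneg) auto
  have K0: "0 \<le> K" by (rule order_trans[OF _ K]) (rule sign_avg_nonneg, simp)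
  have Y0: "0 \<le> sign_avg I (\<lambda>\<sigma>. s \<sigma> * y \<sigma>)" by (rule sign_avg_nonneg) (use s y in auto)
  show ?thesis
  proof (cases "E = 0")
    case True
    then have "(\<Sum>\<sigma>\<in>signs I. y \<sigma> powr p) = 0" by (simp add: E_def sign_avg_def)
    then have "y \<sigma> = 0" if "\<sigma> \<in> signs I" for \<sigma>
      using that finite_signs[OF I] by (simp add: sum_nonneg_eq_0_iff)
    then have "sign_avg I (\<lambda>\<sigma>. s \<sigma> * y \<sigma>) = sign_avg I (\<lambda>\<sigma>. 0)" by (intro sign_avg_cong) simp
    also have "\<dots> = 0" by (rule sign_avg_const[OF I])
    finally show ?thesis using True by (simp flip: E_def)
  next
    case False
    define t where "t = E powr (1 / p)"
    have t: "0 < t" "t powr p = E" using False E p by (auto simp: t_def powr_powr)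
    have "s \<sigma> * y \<sigma> \<le> t * (s \<sigma> powr (p / (p - 1)) + 1 / E * y \<sigma> powr p)" for \<sigma>
    proof -
      have "s \<sigma> * y \<sigma> = t * (s \<sigma> * (y \<sigma> / t))" using t by simp
      also have "\<dots> \<le> t * (s \<sigma> powr (p / (p - 1)) + (y \<sigma> / t) powr p)"
        using s y t p by (intro mult_left_mono product_le_powr_add) auto
      finally show ?thesis using y t by (simp add: powr_divide)
    qed
    then have "sign_avg I (\<lambda>\<sigma>. s \<sigma> * y \<sigma>) \<le> sign_avg I (\<lambda>\<sigma>. t * (s \<sigma> powr (p / (p - 1)) + 1 / E * y \<sigma> powr p))"
      by (intro sign_avg_mono)
    also have "\<dots> = t * (sign_avg I (\<lambda>\<sigma>. s \<sigma> powr (p / (p - 1))) + 1 / E * E)"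
      unfolding sign_avg_cmult sign_avg_add by (simp add: E_def)
    also have "\<dots> \<le> t * (K + 1)" using K t False by (intro mult_left_mono) auto
    finally have "sign_avg I (\<lambda>\<sigma>. s \<sigma> * y \<sigma>) powr p \<le> (t * (K + 1)) powr p"
      using Y0 p by (intro powr_mono2) auto
    also have "\<dots> = (K + 1) powr p * E" using t K0 by (simp add: powr_mult)
    finally show ?thesis by (simp add: E_def)
  qed
qed

lemma powr_add3_le:
  fixes x y z p :: real
  assumes "0 \<le> x" "0 \<le> y" "0 \<le> z" "0 \<le> p"
  shows "(x + y + z) powr p \<le> 3 powr p * (x powr p + y powr p + z powr p)"
proof -
  have "(x + y + z) powr p \<le> (3 * max x (max y z)) powr p" using assms by (intro powr_mono2) auto
  also have "\<dots> = 3 powr p * max x (max y z) powr p" using assms by (simp add: powr_mult)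
  also have "\<dots> \<le> 3 powr p * (x powr p + y powr p + z powr p)"
    by (intro mult_left_mono) (auto simp: max_def)
  finally show ?thesis .
qed

lemma powr_norm_add3_le:
  fixes a b c :: "'x::real_normed_vector"
  assumes "norm z \<le> norm a + norm b + norm c" "0 \<le> p"
  shows "norm z powr p \<le> 3 powr p * (norm a powr p + norm b powr p + norm c powr p)"
  using powr_mono2[OF assms(2) norm_ge_zero assms(1)] powr_add3_le[of "norm a" "norm b" "norm c" p] assms(2)
  by simp

definition moment_const :: "real \<Rightarrow> real \<Rightarrow> real" where
  "moment_const p A = (p / (p - 1)) powr (p / (p - 1)) * (2 * exp (4 * (A + 4)))"

definition carleson_const :: "real \<Rightarrow> real \<Rightarrow> real \<Rightarrow> real" where
  "carleson_const \<rho> p C2 = 2 * (2 * gen_const \<rho> (p / (p - 1)) * C2) powr (p - 1)"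

definition paraproduct_const :: "real \<Rightarrow> real \<Rightarrow> real \<Rightarrow> real" where
  "paraproduct_const p A U = 3 powr p * (1 + U * (2 * 2 powr p) * U + (moment_const p A + 1) powr p * U)"

definition generation_const :: "real \<Rightarrow> real \<Rightarrow> real \<Rightarrow> real \<Rightarrow> real" where
  "generation_const p A U \<kappa> = 3 powr p * (2 * (2 * (1 / \<kappa>\<^sup>2)) powr p * U
     + 2 * (2 * (1 / \<kappa>\<^sup>2)) powr p * (U * paraproduct_const p A U) + (2 / \<kappa>) powr p)"

text \<open>\<open>a\<close> and \<open>a'\<close> play the role of \<open>c\<close> and \<open>c'\<close> for the product of the accretive function with a
  vector-valued \<open>f\<close>, and \<open>F\<close> that of the averages of the norm of \<open>f\<close>. The object of interest is
  the sequence of quotients \<open>a i / c i\<close>.\<close>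

locale accretive_martingale = accretive_filtration \<Omega> w \<pi> n acc c c' \<delta> \<kappa> A \<rho> C1 C2
  for \<Omega> :: "'a set" and w and \<pi> :: "nat \<Rightarrow> 'a \<Rightarrow> 'b" and n acc c c' \<delta> \<kappa> A \<rho> C1 C2 +
  fixes a a' :: "nat \<Rightarrow> 'a \<Rightarrow> 'x::complex_banach" and F :: "nat \<Rightarrow> 'a \<Rightarrow> real" and p U :: real
  assumes a_adapted: "i \<le> n \<Longrightarrow> adapted i (a i)"
    and a'_adapted: "i < n \<Longrightarrow> adapted (Suc i) (a' i)"
    and a_centred: "i < n \<Longrightarrow> centred i (\<lambda>x. a' i x - a i x)"
    and a_keep: "i < n \<Longrightarrow> x \<in> \<Omega> \<Longrightarrow> \<not> acc (Suc i) x \<Longrightarrow> a (Suc i) x = a' i x"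
    and a_le: "i \<le> n \<Longrightarrow> x \<in> \<Omega> \<Longrightarrow> norm (a i x) \<le> F i x"
    and a'_le: "i < n \<Longrightarrow> x \<in> \<Omega> \<Longrightarrow> norm (a' i x) \<le> F (Suc i) x"
    and F_adapted: "i \<le> n \<Longrightarrow> adapted i (F i)"
    and F_mean: "i \<le> n \<Longrightarrow> x \<in> \<Omega> \<Longrightarrow> (\<Sum>y\<in>block i x. w y * F i y) \<le> (\<Sum>y\<in>block i x. w y * F n y)"
    and p: "1 < p" and U: "1 \<le> U"
    and UMD_ineq: "\<And>(d :: nat \<Rightarrow> 'a \<Rightarrow> 'x) \<sigma>. (\<And>k. k < n \<Longrightarrow> adapted (Suc k) (d k)) \<Longrightarrow>
      (\<And>k. k < n \<Longrightarrow> centred k (d k)) \<Longrightarrow> (\<And>k. \<sigma> k \<in> {-1, 1}) \<Longrightarrow>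
      (\<Sum>x\<in>\<Omega>. w x * norm (\<Sum>k<n. \<sigma> k *\<^sub>R d k x) powr p) \<le> U * (\<Sum>x\<in>\<Omega>. w x * norm (\<Sum>k<n. d k x) powr p)"
begin

lemma F_nonneg: "i \<le> n \<Longrightarrow> x \<in> \<Omega> \<Longrightarrow> 0 \<le> F i x"
  using a_le norm_ge_zero order_trans by blast

definition F_start :: "nat \<Rightarrow> 'a \<Rightarrow> real" where
  "F_start j x = (\<Sum>i\<le>n. if starts (gen x) j i then F i x else 0)"

lemma F_start_nonneg: "x \<in> \<Omega> \<Longrightarrow> 0 \<le> F_start j x"
  unfolding F_start_def by (intro sum_nonneg) (auto intro: F_nonneg)

lemma F_start_powr: "0 < q \<Longrightarrow> F_start j x powr q = (\<Sum>i\<le>n. if starts (gen x) j i then F i x powr q else 0)"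
  unfolding F_start_def by (rule sum_starts_apply[where \<phi>="\<lambda>t. t powr q"]) auto

lemma F_start_zero: "x \<in> \<Omega> \<Longrightarrow> gen x n < j \<Longrightarrow> F_start j x = 0"
  unfolding F_start_def
proof (intro sum.neutral ballI)
  fix i assume "gen x n < j" "i \<in> {..n}"
  then have "\<not> starts (gen x) j i" using N_mono[of i n x] by (auto simp: starts_def)
  then show "(if starts (gen x) j i then F i x else 0) = 0" by simp
qed

subsection \<open>The Carleson embedding\<close>

text \<open>By duality: after one factor \<open>F\<close> has been replaced by the terminal value of the
  martingale, Young's inequality leaves a sum over generations of the kind controlled by the
  exponential moment, which is absorbed.\<close>

lemma carleson_embedding:
  "(\<Sum>x\<in>\<Omega>. w x * (\<Sum>j\<le>n. F_start j x powr p)) \<le> carleson_const \<rho> p C2 * (\<Sum>x\<in>\<Omega>. w x * F n x powr p)"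
proof -
  let ?S = "\<Sum>x\<in>\<Omega>. w x * (\<Sum>j\<le>n. F_start j x powr p)" and ?P = "\<Sum>x\<in>\<Omega>. w x * F n x powr p"
  define p' where "p' = p / (p - 1)"
  define K where "K = gen_const \<rho> p'"
  have p': "1 < p'" "p' * (p - 1) = p" using p by (auto simp: p'_def)
  have K: "0 < K" unfolding K_def by (rule gen_const_pos)
  \<comment> \<open>With this \<open>t\<close> the sum to be bounded reappears after Young's inequality with the factor one half.\<close>
  define t where "t = (2 * K * C2) powr (1 / p')"
  have KC: "0 < 2 * K * C2" using K C1_le_C2 by simp
  have t: "0 < t" "t powr p' = 2 * K * C2" using KC p' by (auto simp: t_def powr_powr)
  define Y where "Y x = (\<Sum>j\<le>gen x n. F_start j x powr (p - 1))" for x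
  have Y_all: "Y x = (\<Sum>j\<le>n. F_start j x powr (p - 1))" if "x \<in> \<Omega>" for x
    unfolding Y_def using N_le[of x n] F_start_zero[OF that] by (intro sum.mono_neutral_left) auto
  have Sij: "(\<Sum>x\<in>\<Omega>. w x * (\<Sum>j\<le>n. g j x * F_start j x powr p))
      = (\<Sum>j\<le>n. \<Sum>i\<le>n. \<Sum>x\<in>\<Omega>. w x * (g j x * (if starts (gen x) j i then F i x powr p else 0)))" for g
  proof -
    have "g j x * F_start j x powr p = (\<Sum>i\<le>n. g j x * (if starts (gen x) j i then F i x powr p else 0))" for j x
      using p by (subst F_start_powr) (auto simp: sum_distrib_left)
    then show ?thesis by (simp only: sum_weight_swap)
  qed
  have "?S = (\<Sum>j\<le>n. \<Sum>i\<le>n. \<Sum>x\<in>\<Omega>. w x * (if starts (gen x) j i then F i x powr p else 0))"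
    using Sij[of "\<lambda>_ _. 1"] by simp
  also have "\<dots> \<le> (\<Sum>j\<le>n. \<Sum>i\<le>n. \<Sum>x\<in>\<Omega>. w x * (F n x * (if starts (gen x) j i then F i x powr (p - 1) else 0)))"
  proof (rule sum_mono, rule sum_mono)
    fix j i assume "i \<in> {..n}"
    then have i: "i \<le> n" by simp
    show "(\<Sum>x\<in>\<Omega>. w x * (if starts (gen x) j i then F i x powr p else 0))
      \<le> (\<Sum>x\<in>\<Omega>. w x * (F n x * (if starts (gen x) j i then F i x powr (p - 1) else 0)))"
    proof (rule sum_mono_blocks[where k=i])
      fix x assume x: "x \<in> \<Omega>"
      have st: "starts (gen y) j i = starts (gen x) j i" "F i y = F i x" if "y \<in> block i x" for y
        using starts_block[OF i x that] adaptedD[OF F_adapted[OF i] x that] by auto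
      show "(\<Sum>y\<in>block i x. w y * (if starts (gen y) j i then F i y powr p else 0))
        \<le> (\<Sum>y\<in>block i x. w y * (F n y * (if starts (gen y) j i then F i y powr (p - 1) else 0)))"
      proof (cases "starts (gen x) j i")
        case True
        have "F i x powr p = F i x * F i x powr (p - 1)"
          using F_nonneg[OF i x] by (cases "F i x = 0") (auto simp: powr_diff)
        then have "(\<Sum>y\<in>block i x. w y * F i x powr p) = (\<Sum>y\<in>block i x. w y * F i y) * F i x powr (p - 1)"
          by (simp add: st sum_distrib_right mult.assoc cong: sum.cong)
        also have "\<dots> \<le> (\<Sum>y\<in>block i x. w y * F n y) * F i x powr (p - 1)"
          by (intro mult_right_mono F_mean i x) auto
        finally show ?thesis using True by (simp add: st sum_distrib_right mult.assoc cong: sum.cong)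
      qed (simp add: st)
    qed
  qed
  also have "\<dots> = (\<Sum>x\<in>\<Omega>. w x * (F n x * Y x))"
  proof -
    have "F n x * Y x = (\<Sum>j\<le>n. \<Sum>i\<le>n. F n x * (if starts (gen x) j i then F i x powr (p - 1) else 0))" if "x \<in> \<Omega>" for x
      using p by (simp add: Y_all[OF that] F_start_powr sum_distrib_left)
    then have "(\<Sum>x\<in>\<Omega>. w x * (F n x * Y x)) = (\<Sum>x\<in>\<Omega>. w x * (\<Sum>j\<le>n. \<Sum>i\<le>n. F n x * (if starts (gen x) j i then F i x powr (p - 1) else 0)))"
      by (intro sum.cong) auto
    then show ?thesis by (simp only: sum_weight_swap)
  qed
  also have "\<dots> \<le> (\<Sum>x\<in>\<Omega>. w x * (t powr p * F n x powr p + 1 / (2 * K * C2) * Y x powr p'))"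
  proof (intro sum_mono mult_left_mono w_nonneg)
    fix x assume x: "x \<in> \<Omega>"
    have Y0: "0 \<le> Y x" unfolding Y_def by (intro sum_nonneg) auto
    have "F n x * Y x = (Y x / t) * (t * F n x)" using t by simp
    also have "\<dots> \<le> (Y x / t) powr p' + (t * F n x) powr p"
      unfolding p'_def using F_nonneg[of n x] x Y0 t p by (intro product_le_powr_add) auto
    finally show "F n x * Y x \<le> t powr p * F n x powr p + 1 / (2 * K * C2) * Y x powr p'"
      using F_nonneg[of n x] x Y0 t by (simp add: powr_mult powr_divide)
  qed auto
  also have "\<dots> = t powr p * ?P + 1 / (2 * K * C2) * (\<Sum>x\<in>\<Omega>. w x * Y x powr p')"
    by (simp add: distrib_left sum.distrib sum_distrib_left mult.left_commute)
  also have "\<dots> \<le> t powr p * ?P + 1 / (2 * K * C2) * (K * (C2 * ?S))"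
  proof (intro add_left_mono mult_left_mono)
    have "(\<Sum>x\<in>\<Omega>. w x * Y x powr p') \<le> (\<Sum>x\<in>\<Omega>. w x * (K * (\<Sum>j\<le>n. \<rho> ^ (gen x n - j) * F_start j x powr p)))"
    proof (intro sum_mono mult_left_mono w_nonneg)
      fix x assume x: "x \<in> \<Omega>"
      have "Y x powr p' \<le> K * (\<Sum>j\<le>gen x n. \<rho> ^ (gen x n - j) * (F_start j x powr (p - 1)) powr p')"
        unfolding Y_def K_def by (rule powr_sum_generations) (use \<rho> p' in auto)
      also have "\<dots> = K * (\<Sum>j\<le>gen x n. \<rho> ^ (gen x n - j) * F_start j x powr p)"
        using p'(2) by (simp add: powr_powr mult.commute)
      also have "\<dots> \<le> K * (\<Sum>j\<le>n. \<rho> ^ (gen x n - j) * F_start j x powr p)"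
        using N_le[of x n] K \<rho> by (intro mult_left_mono sum_mono2) auto
      finally show "Y x powr p' \<le> K * (\<Sum>j\<le>n. \<rho> ^ (gen x n - j) * F_start j x powr p)" .
    qed auto
    also have "\<dots> = K * (\<Sum>x\<in>\<Omega>. w x * (\<Sum>j\<le>n. \<rho> ^ (gen x n - j) * F_start j x powr p))"
      by (simp add: sum_distrib_left mult.left_commute)
    also have "\<dots> \<le> K * (C2 * ?S)"
    proof (rule mult_left_mono)
      have "(\<Sum>x\<in>\<Omega>. w x * (\<Sum>j\<le>n. \<rho> ^ (gen x n - j) * F_start j x powr p))
        \<le> (\<Sum>j\<le>n. \<Sum>i\<le>n. C2 * (\<Sum>x\<in>\<Omega>. w x * (if starts (gen x) j i then F i x powr p else 0)))"
        unfolding Sij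
      proof (rule sum_mono, rule sum_mono)
        fix j i assume "i \<in> {..n}"
        then have i: "i \<le> n" by simp
        have "adapted i (\<lambda>x. F i x powr p)"
        proof (rule adaptedI)
          fix x y assume "x \<in> \<Omega>" "y \<in> \<Omega>" "\<pi> i x = \<pi> i y"
          from adapted_eq[OF F_adapted[OF i] this] show "F i x powr p = F i y powr p" by simp
        qed
        then show "(\<Sum>x\<in>\<Omega>. w x * (\<rho> ^ (gen x n - j) * (if starts (gen x) j i then F i x powr p else 0)))
          \<le> C2 * (\<Sum>x\<in>\<Omega>. w x * (if starts (gen x) j i then F i x powr p else 0))"
          by (intro weighted_starts i) auto
      qed
      also have "\<dots> = C2 * ?S"
        using Sij[of "\<lambda>_ _. 1"] by (simp add: sum_distrib_left)
      finally show "(\<Sum>x\<in>\<Omega>. w x * (\<Sum>j\<le>n. \<rho> ^ (gen x n - j) * F_start j x powr p)) \<le> C2 * ?S" .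
    qed (use K in simp)
    finally show "(\<Sum>x\<in>\<Omega>. w x * Y x powr p') \<le> K * (C2 * ?S)" .
  qed (use KC in auto)
  also have "1 / (2 * K * C2) * (K * (C2 * ?S)) = ?S / 2" using K C1_le_C2 by simp
  finally have S: "?S \<le> 2 * t powr p * ?P" by simp
  have "t powr p = (2 * K * C2) powr (p - 1)"
    using p by (simp add: t_def powr_powr p'_def)
  then show ?thesis using S by (simp add: carleson_const_def K_def p'_def)
qed

subsection \<open>One generation\<close>

abbreviation I :: "nat set" where "I \<equiv> {..<n}"

abbreviation total :: "(nat \<Rightarrow> 'a \<Rightarrow> 'x) \<Rightarrow> real" where
  "total d \<equiv> \<Sum>x\<in>\<Omega>. w x * norm (\<Sum>k<n. d k x) powr p"

abbreviation random_total :: "(nat \<Rightarrow> 'a \<Rightarrow> 'x) \<Rightarrow> real" where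
  "random_total d \<equiv> \<Sum>x\<in>\<Omega>. w x * sign_avg I (\<lambda>\<sigma>. norm (\<Sum>k<n. \<sigma> k *\<^sub>R d k x) powr p)"

definition on_gen :: "nat \<Rightarrow> (nat \<Rightarrow> 'a \<Rightarrow> 'v::zero) \<Rightarrow> nat \<Rightarrow> 'a \<Rightarrow> 'v" where
  "on_gen j d k x = (if gen x k = j then d k x else 0)"

lemma random_total_le:
  assumes "\<And>k. k < n \<Longrightarrow> adapted (Suc k) (d k)" "\<And>k. k < n \<Longrightarrow> centred k (d k)"
  shows "random_total d \<le> U * total d"
proof -
  have "random_total d = sign_avg I (\<lambda>\<sigma>. \<Sum>x\<in>\<Omega>. w x * norm (\<Sum>k<n. \<sigma> k *\<^sub>R d k x) powr p)"
    by (rule sum_sign_avg)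
  also have "\<dots> \<le> sign_avg I (\<lambda>\<sigma>. U * total d)"
  proof (rule sign_avg_mono)
    fix \<sigma> assume \<sigma>: "\<sigma> \<in> signs I"
    have "(\<Sum>x\<in>\<Omega>. w x * norm (\<Sum>k<n. (if k < n then \<sigma> k else 1) *\<^sub>R d k x) powr p) \<le> U * total d"
      by (rule UMD_ineq) (use assms signsD[OF \<sigma>] in auto)
    then show "(\<Sum>x\<in>\<Omega>. w x * norm (\<Sum>k<n. \<sigma> k *\<^sub>R d k x) powr p) \<le> U * total d" by simp
  qed
  also have "\<dots> = U * total d" by (rule sign_avg_const) simp
  finally show ?thesis .
qed

lemma total_le_random:
  assumes "\<And>k. k < n \<Longrightarrow> adapted (Suc k) (d k)" "\<And>k. k < n \<Longrightarrow> centred k (d k)"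
  shows "total d \<le> U * random_total d"
proof -
  have "total d = sign_avg I (\<lambda>\<sigma>. total d)" by (rule sign_avg_const[symmetric]) simp
  also have "\<dots> \<le> sign_avg I (\<lambda>\<sigma>. U * (\<Sum>x\<in>\<Omega>. w x * norm (\<Sum>k<n. \<sigma> k *\<^sub>R d k x) powr p))"
  proof (rule sign_avg_mono)
    fix \<sigma> assume \<sigma>: "\<sigma> \<in> signs I"
    have sq: "\<sigma> k * \<sigma> k = 1" if "k < n" for k using signsD[OF \<sigma>, of k] that by auto
    have "(\<Sum>x\<in>\<Omega>. w x * norm (\<Sum>k<n. (if k < n then \<sigma> k else 1) *\<^sub>R (\<sigma> k *\<^sub>R d k x)) powr p)
      \<le> U * (\<Sum>x\<in>\<Omega>. w x * norm (\<Sum>k<n. \<sigma> k *\<^sub>R d k x) powr p)"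
    proof (rule UMD_ineq)
      fix k assume k: "k < n"
      show "adapted (Suc k) (\<lambda>x. \<sigma> k *\<^sub>R d k x)"
      proof (rule adaptedI)
        fix x y assume "x \<in> \<Omega>" "y \<in> \<Omega>" "\<pi> (Suc k) x = \<pi> (Suc k) y"
        from adapted_eq[OF assms(1)[OF k] this] show "\<sigma> k *\<^sub>R d k x = \<sigma> k *\<^sub>R d k y" by simp
      qed
      show "centred k (\<lambda>x. \<sigma> k *\<^sub>R d k x)"
        using centred_linear[OF assms(2)[OF k], of "\<lambda>_. ()" "\<lambda>_ v. \<sigma> k *\<^sub>R v"]
        by (simp add: adapted_def linear_iff scaleR_add_right)
    qed (use signsD[OF \<sigma>] in auto)
    then show "total d \<le> U * (\<Sum>x\<in>\<Omega>. w x * norm (\<Sum>k<n. \<sigma> k *\<^sub>R d k x) powr p)"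
      by (simp add: sq)
  qed
  also have "\<dots> = U * random_total d"
    unfolding sign_avg_cmult sum_sign_avg ..
  finally show ?thesis .
qed

lemma on_gen_adapted: "k < n \<Longrightarrow> adapted (Suc k) (d k) \<Longrightarrow> adapted (Suc k) (on_gen j d k)"
proof (rule adaptedI)
  fix x y assume k: "k < n" and ad: "adapted (Suc k) (d k)" and xy: "x \<in> \<Omega>" "y \<in> \<Omega>" "\<pi> (Suc k) x = \<pi> (Suc k) y"
  have "gen x k = gen y k"
    by (rule adapted_eq[OF gen_adapted[OF less_imp_le[OF k]] xy(1,2) refine[OF k xy]])
  then show "on_gen j d k x = on_gen j d k y"
    using adapted_eq[OF ad xy] by (simp add: on_gen_def)
qed

lemma on_gen_centred:
  fixes d :: "nat \<Rightarrow> 'a \<Rightarrow> 'v::real_vector"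
  assumes k: "k < n" and "centred k (d k)"
  shows "centred k (on_gen j d k)"
proof -
  have "adapted k (\<lambda>x. gen x k = j)"
  proof (rule adaptedI)
    fix y z assume "y \<in> \<Omega>" "z \<in> \<Omega>" "\<pi> k y = \<pi> k z"
    from adapted_eq[OF gen_adapted this] k show "(gen y k = j) = (gen z k = j)" by simp
  qed
  then show ?thesis
    using centred_restrict[OF assms(2)] unfolding on_gen_def by blast
qed

abbreviation da :: "nat \<Rightarrow> 'a \<Rightarrow> 'x" where "da i x \<equiv> a' i x - a i x"

text \<open>\<open>Z j\<close> collects the values at which a martingale that runs only during the generation
  \<open>j\<close> starts and ends.\<close>

definition Z :: "nat \<Rightarrow> 'a \<Rightarrow> real" where
  "Z j x = F_start j x + F_start (Suc j) x + (if gen x n = j then F n x else 0)"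

lemma Z_nonneg: "x \<in> \<Omega> \<Longrightarrow> 0 \<le> Z j x"
  unfolding Z_def by (auto intro!: add_nonneg_nonneg F_start_nonneg F_nonneg)

lemma telescope_le_Z:
  fixes g g' :: "nat \<Rightarrow> 'a \<Rightarrow> 'x"
  assumes x: "x \<in> \<Omega>"
    and keep: "\<And>i. i < n \<Longrightarrow> gen x (Suc i) = gen x i \<Longrightarrow> g (Suc i) x = g' i x"
    and g: "\<And>i. i \<le> n \<Longrightarrow> norm (g i x) \<le> F i x" and g': "\<And>i. i < n \<Longrightarrow> norm (g' i x) \<le> F (Suc i) x"
  shows "norm (\<Sum>k<n. on_gen j (\<lambda>i x. g' i x - g i x) k x) \<le> Z j x"
proof -
  let ?e = "\<Sum>i<n. if ends (gen x) j i then g' i x else 0" and ?l = "if gen x n = j then g n x else 0"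
    and ?s = "\<Sum>i\<le>n. if starts (gen x) j i then g i x else 0"
  have s: "norm ?s \<le> F_start j x"
    unfolding F_start_def by (rule sum_norm_le) (use g in auto)
  have e: "norm ?e \<le> F_start (Suc j) x"
    unfolding F_start_def starts_shift by (rule sum_norm_le) (use g' in auto)
  have l: "norm ?l \<le> (if gen x n = j then F n x else 0)" using g[of n] by simp
  have eq: "(\<Sum>k<n. on_gen j (\<lambda>i x. g' i x - g i x) k x) = ?e + ?l - ?s"
    unfolding on_gen_def by (rule telescope) (use keep in auto)
  have "norm (?e + ?l - ?s) \<le> norm ?e + norm ?l + norm ?s"
    by (rule order_trans[OF norm_triangle_ineq4]) (rule add_right_mono[OF norm_triangle_ineq])
  also have "\<dots> \<le> F_start (Suc j) x + (if gen x n = j then F n x else 0) + F_start j x"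
    by (rule add_mono[OF add_mono[OF e l] s])
  finally show ?thesis unfolding eq by (simp add: Z_def)
qed

lemma acc_gen: "gen x (Suc i) = gen x i \<Longrightarrow> \<not> acc (Suc i) x"
  using acc_step[of i x] by auto

lemma da_adapted: "k < n \<Longrightarrow> adapted (Suc k) (\<lambda>x. da k x)"
proof (rule adaptedI)
  fix x y assume k: "k < n" and xy: "x \<in> \<Omega>" "y \<in> \<Omega>" "\<pi> (Suc k) x = \<pi> (Suc k) y"
  have "a k x = a k y"
    by (rule adapted_eq[OF a_adapted[OF less_imp_le[OF k]] xy(1,2) refine[OF k xy]])
  then show "da k x = da k y" using adapted_eq[OF a'_adapted[OF k] xy] by simp
qed

lemma dc_adapted: "k < n \<Longrightarrow> adapted (Suc k) (\<lambda>x. dc k x)"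
proof (rule adaptedI)
  fix x y assume k: "k < n" and xy: "x \<in> \<Omega>" "y \<in> \<Omega>" "\<pi> (Suc k) x = \<pi> (Suc k) y"
  have "c k x = c k y"
    by (rule adapted_eq[OF c_adapted[OF less_imp_le[OF k]] xy(1,2) refine[OF k xy]])
  then show "dc k x = dc k y" using adapted_eq[OF c'_adapted[OF k] xy] by simp
qed

lemma powr_total_le:
  assumes "\<And>x. x \<in> \<Omega> \<Longrightarrow> norm (\<Sum>k<n. d k x) \<le> g x"
  shows "total d \<le> (\<Sum>x\<in>\<Omega>. w x * g x powr p)"
  using p by (intro sum_mono mult_left_mono powr_mono2 assms w_nonneg) auto

abbreviation ZZ :: "nat \<Rightarrow> real" where "ZZ j \<equiv> \<Sum>x\<in>\<Omega>. w x * Z j x powr p"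

lemma random_da_le: "random_total (on_gen j da) \<le> U * ZZ j"
proof -
  have "random_total (on_gen j da) \<le> U * total (on_gen j da)"
    by (intro random_total_le on_gen_adapted on_gen_centred da_adapted a_centred)
  also have "\<dots> \<le> U * ZZ j"
    using U a_keep a_le a'_le by (intro mult_left_mono powr_total_le telescope_le_Z) (auto dest: acc_gen)
  finally show ?thesis .
qed

lemma contraction_random_total:
  assumes "0 < K" "\<And>k x. k < n \<Longrightarrow> x \<in> \<Omega> \<Longrightarrow> cmod (m k x) \<le> K"
  shows "random_total (\<lambda>k x. m k x *\<^sub>C d k x) \<le> 2 * (2 * K) powr p * random_total d"
proof -
  have "random_total (\<lambda>k x. m k x *\<^sub>C d k x)
    \<le> (\<Sum>x\<in>\<Omega>. w x * (2 * (2 * K) powr p * sign_avg I (\<lambda>\<sigma>. norm (\<Sum>k<n. \<sigma> k *\<^sub>R d k x) powr p)))"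
    using assms p by (intro sum_mono mult_left_mono w_nonneg sign_avg_complex_contraction) auto
  then show ?thesis by (simp add: sum_distrib_left mult.left_commute)
qed

text \<open>Multipliers that are bounded and known in advance: the UMD inequality introduces signs, the
  contraction principle removes the multipliers, and the UMD inequality removes the signs.\<close>

lemma c_da_le: "total (on_gen j (\<lambda>k x. c k x *\<^sub>C da k x)) \<le> U * (2 * 2 powr p) * U * ZZ j"
proof -
  have eq: "on_gen j (\<lambda>k x. c k x *\<^sub>C da k x) = (\<lambda>k x. c k x *\<^sub>C on_gen j da k x)"
    by (auto simp: on_gen_def fun_eq_iff)
  have ad: "adapted (Suc k) (\<lambda>x. c k x *\<^sub>C da k x)" if k: "k < n" for k
  proof (rule adaptedI)
    fix x y assume xy: "x \<in> \<Omega>" "y \<in> \<Omega>" "\<pi> (Suc k) x = \<pi> (Suc k) y"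
    have "c k x = c k y"
      by (rule adapted_eq[OF c_adapted[OF less_imp_le[OF k]] xy(1,2) refine[OF k xy]])
    then show "c k x *\<^sub>C da k x = c k y *\<^sub>C da k y" using adapted_eq[OF da_adapted[OF k] xy] by simp
  qed
  have ce: "centred k (\<lambda>x. c k x *\<^sub>C da k x)" if "k < n" for k
    by (rule centred_linear[OF a_centred[OF that] c_adapted[OF less_imp_le[OF that]] scaleC_linear_right])
  have "total (on_gen j (\<lambda>k x. c k x *\<^sub>C da k x)) \<le> U * random_total (on_gen j (\<lambda>k x. c k x *\<^sub>C da k x))"
    by (intro total_le_random on_gen_adapted on_gen_centred ad ce)
  also have "\<dots> \<le> U * (2 * (2 * 1) powr p * random_total (on_gen j da))"
    unfolding eq using U c_le by (intro mult_left_mono contraction_random_total) auto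
  also have "\<dots> \<le> U * (2 * (2 * 1) powr p * (U * ZZ j))"
    using U random_da_le by (intro mult_left_mono) auto
  finally show ?thesis by (simp add: mult.assoc)
qed

text \<open>Random signs decouple the two increments. By Hoelder's inequality in the signs one factor is
  a moment of the scalar random sum, bounded because the square sum is.\<close>

lemma dc_da_le: "total (on_gen j (\<lambda>k x. dc k x *\<^sub>C da k x)) \<le> (moment_const p A + 1) powr p * U * ZZ j"
proof -
  have "total (on_gen j (\<lambda>k x. dc k x *\<^sub>C da k x))
    \<le> (\<Sum>x\<in>\<Omega>. w x * ((moment_const p A + 1) powr p * sign_avg I (\<lambda>\<sigma>. norm (\<Sum>k<n. \<sigma> k *\<^sub>R on_gen j da k x) powr p)))"
  proof (intro sum_mono mult_left_mono w_nonneg)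
    fix x assume x: "x \<in> \<Omega>"
    let ?s = "\<lambda>\<sigma>. cmod (\<Sum>k<n. \<sigma> k *\<^sub>R on_gen j dc k x)" and ?y = "\<lambda>\<sigma>. norm (\<Sum>k<n. \<sigma> k *\<^sub>R on_gen j da k x)"
    have eq: "(\<Sum>k<n. on_gen j (\<lambda>k x. dc k x *\<^sub>C da k x) k x) = (\<Sum>k<n. on_gen j dc k x *\<^sub>C on_gen j da k x)"
      by (intro sum.cong) (auto simp: on_gen_def)
    have eq2: "(\<Sum>k<n. on_gen j dc k x *\<^sub>C on_gen j da k x) = sign_avg I (\<lambda>\<sigma>. (\<Sum>k<n. \<sigma> k *\<^sub>R on_gen j dc k x) *\<^sub>C (\<Sum>k<n. \<sigma> k *\<^sub>R on_gen j da k x))"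
      by (rule sign_avg_product) simp
    have "norm (\<Sum>k<n. on_gen j (\<lambda>k x. dc k x *\<^sub>C da k x) k x) \<le> sign_avg I (\<lambda>\<sigma>. ?s \<sigma> * ?y \<sigma>)"
      unfolding eq eq2 using norm_sign_avg_le[of I "\<lambda>\<sigma>. (\<Sum>k<n. \<sigma> k *\<^sub>R on_gen j dc k x) *\<^sub>C (\<Sum>k<n. \<sigma> k *\<^sub>R on_gen j da k x)"]
      by (simp add: norm_scaleC)
    then have "norm (\<Sum>k<n. on_gen j (\<lambda>k x. dc k x *\<^sub>C da k x) k x) powr p \<le> sign_avg I (\<lambda>\<sigma>. ?s \<sigma> * ?y \<sigma>) powr p"
      using p by (intro powr_mono2) auto
    also have "\<dots> \<le> (moment_const p A + 1) powr p * sign_avg I (\<lambda>\<sigma>. ?y \<sigma> powr p)"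
    proof (rule sign_avg_product_le)
      have "(\<Sum>k<n. (cmod (on_gen j dc k x))\<^sup>2) = (\<Sum>k<n. if gen x k = j then (cmod (dc k x))\<^sup>2 else 0)"
        by (intro sum.cong) (auto simp: on_gen_def)
      also have "\<dots> \<le> A + 4" by (rule square_sum_le) (use x in auto)
      finally show "sign_avg I (\<lambda>\<sigma>. ?s \<sigma> powr (p / (p - 1))) \<le> moment_const p A"
        unfolding moment_const_def using p by (intro sign_avg_moment) auto
    qed (use p in auto)
    finally show "norm (\<Sum>k<n. on_gen j (\<lambda>k x. dc k x *\<^sub>C da k x) k x) powr p
      \<le> (moment_const p A + 1) powr p * sign_avg I (\<lambda>\<sigma>. ?y \<sigma> powr p)" .
  qed auto
  also have "\<dots> = (moment_const p A + 1) powr p * random_total (on_gen j da)"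
    by (simp add: sum_distrib_left mult.left_commute)
  also have "\<dots> \<le> (moment_const p A + 1) powr p * (U * ZZ j)"
    by (intro mult_left_mono random_da_le) auto
  finally show ?thesis by (simp add: mult.assoc)
qed

text \<open>The contraction principle does not apply to the vectors \<open>a\<close> as multipliers of the increments
  of \<open>c\<close>. Summation by parts replaces these products by the increments of \<open>c a\<close>, which
  telescope, and the two sums \<open>c da\<close> and \<open>dc da\<close>.\<close>

lemma random_a_dc_le: "random_total (on_gen j (\<lambda>k x. dc k x *\<^sub>C a k x)) \<le> U * paraproduct_const p A U * ZZ j"
proof -
  have ad: "adapted (Suc k) (\<lambda>x. dc k x *\<^sub>C a k x)" if k: "k < n" for k
  proof (rule adaptedI)
    fix x y assume xy: "x \<in> \<Omega>" "y \<in> \<Omega>" "\<pi> (Suc k) x = \<pi> (Suc k) y"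
    have "a k x = a k y"
      by (rule adapted_eq[OF a_adapted[OF less_imp_le[OF k]] xy(1,2) refine[OF k xy]])
    then show "dc k x *\<^sub>C a k x = dc k y *\<^sub>C a k y" using adapted_eq[OF dc_adapted[OF k] xy] by simp
  qed
  have ce: "centred k (\<lambda>x. dc k x *\<^sub>C a k x)" if "k < n" for k
    using centred_linear[OF c_centred[OF that] a_adapted, of "\<lambda>z v. v *\<^sub>C z"] that scaleC_linear_left by auto
  have "random_total (on_gen j (\<lambda>k x. dc k x *\<^sub>C a k x)) \<le> U * total (on_gen j (\<lambda>k x. dc k x *\<^sub>C a k x))"
    by (intro random_total_le on_gen_adapted on_gen_centred ad ce)
  also have "\<dots> \<le> U * (\<Sum>x\<in>\<Omega>. w x * (3 powr p * (norm (\<Sum>k<n. on_gen j (\<lambda>k x. c' k x *\<^sub>C a' k x - c k x *\<^sub>C a k x) k x) powr p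
      + norm (\<Sum>k<n. on_gen j (\<lambda>k x. c k x *\<^sub>C da k x) k x) powr p + norm (\<Sum>k<n. on_gen j (\<lambda>k x. dc k x *\<^sub>C da k x) k x) powr p)))"
  proof (intro mult_left_mono sum_mono w_nonneg powr_norm_add3_le)
    fix x
    let ?t1 = "\<Sum>k<n. on_gen j (\<lambda>k x. c' k x *\<^sub>C a' k x - c k x *\<^sub>C a k x) k x"
      and ?t2 = "\<Sum>k<n. on_gen j (\<lambda>k x. c k x *\<^sub>C da k x) k x" and ?t3 = "\<Sum>k<n. on_gen j (\<lambda>k x. dc k x *\<^sub>C da k x) k x"
    have eq: "(\<Sum>k<n. on_gen j (\<lambda>k x. dc k x *\<^sub>C a k x) k x) = ?t1 - ?t2 - ?t3"
      unfolding sum_subtractf[symmetric]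
      by (intro sum.cong) (auto simp: on_gen_def scaleC_diff_left scaleC_diff_right)
    show "norm (\<Sum>k<n. on_gen j (\<lambda>k x. dc k x *\<^sub>C a k x) k x) \<le> norm ?t1 + norm ?t2 + norm ?t3"
      unfolding eq
      by (rule order_trans[OF norm_triangle_ineq4 add_right_mono[OF norm_triangle_ineq4]])
  qed (use U p in auto)
  also have "\<dots> = U * (3 powr p * (total (on_gen j (\<lambda>k x. c' k x *\<^sub>C a' k x - c k x *\<^sub>C a k x))
      + total (on_gen j (\<lambda>k x. c k x *\<^sub>C da k x)) + total (on_gen j (\<lambda>k x. dc k x *\<^sub>C da k x))))"
    by (simp only: mult.left_commute[of _ "3 powr p"] sum_distrib_left[symmetric] distrib_left sum.distrib)
  also have "\<dots> \<le> U * (3 powr p * (ZZ j + U * (2 * 2 powr p) * U * ZZ j + (moment_const p A + 1) powr p * U * ZZ j))"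
  proof (intro mult_left_mono add_mono c_da_le dc_da_le powr_total_le telescope_le_Z)
    fix x i assume x: "x \<in> \<Omega>"
    have sc: "norm (z *\<^sub>C v) \<le> B" if "cmod z \<le> 1" "norm v \<le> B" for z and v :: 'x and B
    proof -
      have "norm (z *\<^sub>C v) \<le> 1 * norm v" unfolding norm_scaleC using that by (intro mult_right_mono) auto
      then show ?thesis using that by simp
    qed
    show "norm (c i x *\<^sub>C a i x) \<le> F i x" if "i \<le> n" using that x c_le a_le by (intro sc) auto
    show "norm (c' i x *\<^sub>C a' i x) \<le> F (Suc i) x" if "i < n" using that x c'_le a'_le by (intro sc) auto
    show "c (Suc i) x *\<^sub>C a (Suc i) x = c' i x *\<^sub>C a' i x" if "i < n" "gen x (Suc i) = gen x i"
      using that gen_keep[OF _ x] a_keep[OF _ x acc_gen] by simp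
  qed (use U in auto)
  finally show ?thesis by (simp add: paraproduct_const_def algebra_simps)
qed

definition quotient :: "nat \<Rightarrow> 'a \<Rightarrow> 'x" where
  "quotient i x = inverse (c i x) *\<^sub>C a i x"

abbreviation dq :: "nat \<Rightarrow> 'a \<Rightarrow> 'x" where "dq i x \<equiv> quotient (Suc i) x - quotient i x"

lemma c_nonzero: "i \<le> n \<Longrightarrow> x \<in> \<Omega> \<Longrightarrow> c i x \<noteq> 0"
  using c_ge[of i x] \<kappa> by auto

lemma inverse_c_le: "i \<le> n \<Longrightarrow> x \<in> \<Omega> \<Longrightarrow> cmod (inverse (c i x)) \<le> 1 / \<kappa>"
  using le_imp_inverse_le[OF c_ge \<kappa>(1)] by (simp add: norm_inverse inverse_eq_divide[of \<kappa>])

text \<open>Inside a generation $d(a/c) = da / c' - a\,dc / (c c')$, where the first multiplier looks ahead by one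
  step. This is harmless, as the contraction principle is applied at each point separately. At the
  step that ends the generation the accretive function may change, and the difference is \<open>da / c\<close>
  up to an error controlled by the averages of the norm at the stop.\<close>

lemma generation_estimate: "random_total (on_gen j dq) \<le> generation_const p A U \<kappa> * ZZ j"
proof -
  \<comment> \<open>On the last step of a generation \<open>m2\<close> is zero and \<open>e\<close> is the error; before, \<open>e\<close> is zero.\<close>
  define m1 where "m1 i x = (if gen x (Suc i) = gen x i then inverse (c' i x) else inverse (c i x))" for i x
  define m2 where "m2 i x = (if gen x (Suc i) = gen x i then - inverse (c i x * c' i x) else 0)" for i x
  define e where "e i x = (if gen x (Suc i) = gen x i then 0 else quotient (Suc i) x - inverse (c i x) *\<^sub>C a' i x)" for i x
  have k1: "1 / \<kappa> \<le> 1 / \<kappa>\<^sup>2" using \<kappa> by (simp add: field_simps power2_eq_square)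
  have dec: "dq i x = m1 i x *\<^sub>C da i x + m2 i x *\<^sub>C (dc i x *\<^sub>C a i x) + e i x" if i: "i < n" and x: "x \<in> \<Omega>" for i x
  proof (cases "gen x (Suc i) = gen x i")
    case True
    have c: "c (Suc i) x = c' i x" "a (Suc i) x = a' i x"
      using gen_keep[OF i x True] a_keep[OF i x acc_gen[OF True]] by auto
    have "c i x \<noteq> 0" "c' i x \<noteq> 0" using c_nonzero[of i x] c_nonzero[of "Suc i" x] i x c by auto
    then have m: "- inverse (c i x * c' i x) * dc i x = inverse (c' i x) - inverse (c i x)"
      by (simp add: field_simps)
    have "m2 i x *\<^sub>C (dc i x *\<^sub>C a i x) = (- inverse (c i x * c' i x) * dc i x) *\<^sub>C a i x"
      using True by (simp only: m2_def simp_thms if_True scaleC_scaleC)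
    then have "m2 i x *\<^sub>C (dc i x *\<^sub>C a i x) = inverse (c' i x) *\<^sub>C a i x - inverse (c i x) *\<^sub>C a i x"
      unfolding m by (simp only: scaleC_diff_left)
    then show ?thesis using True by (simp add: quotient_def m1_def e_def c scaleC_diff_right)
  qed (simp add: quotient_def m1_def m2_def e_def scaleC_diff_right)
  have m1: "cmod (m1 i x) \<le> 1 / \<kappa>\<^sup>2" if "i < n" "x \<in> \<Omega>" for i x
    using inverse_c_le[of i x] inverse_c_le[of "Suc i" x] that gen_keep[of i x] k1 by (auto simp: m1_def)
  have m2: "cmod (m2 i x) \<le> 1 / \<kappa>\<^sup>2" if i: "i < n" and x: "x \<in> \<Omega>" for i x
  proof (cases "gen x (Suc i) = gen x i")
    case True
    have "cmod (m2 i x) = cmod (inverse (c i x)) * cmod (inverse (c (Suc i) x))"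
      using True gen_keep[OF i x True] by (simp add: m2_def norm_mult norm_inverse)
    also have "\<dots> \<le> (1 / \<kappa>) * (1 / \<kappa>)"
      using inverse_c_le[of i x] inverse_c_le[of "Suc i" x] i x \<kappa> by (intro mult_mono) auto
    finally show ?thesis by (simp add: power2_eq_square)
  qed (use \<kappa> in \<open>simp add: m2_def\<close>)
  have e_le: "norm (\<Sum>k<n. \<sigma> k *\<^sub>R on_gen j e k x) \<le> norm (2 / \<kappa> * Z j x)" if x: "x \<in> \<Omega>" and \<sigma>: "\<sigma> \<in> signs I" for \<sigma> x
  proof -
    have "norm (\<Sum>k<n. \<sigma> k *\<^sub>R on_gen j e k x) \<le> (\<Sum>k<n. 2 / \<kappa> * (if ends (gen x) j k then F (Suc k) x else 0))"
    proof (rule sum_norm_le)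
      fix k assume "k \<in> {..<n}"
      then have k: "k < n" by simp
      have "norm (e k x) \<le> 2 / \<kappa> * F (Suc k) x"
      proof -
        have sc: "norm (z *\<^sub>C v) \<le> 1 / \<kappa> * F (Suc k) x" if "cmod z \<le> 1 / \<kappa>" "norm v \<le> F (Suc k) x" for z and v :: 'x
          unfolding norm_scaleC using that \<kappa> by (intro mult_mono) auto
        have "norm (quotient (Suc k) x) \<le> 1 / \<kappa> * F (Suc k) x"
          unfolding quotient_def by (rule sc[OF inverse_c_le a_le]) (use k x in auto)
        moreover have "norm (inverse (c k x) *\<^sub>C a' k x) \<le> 1 / \<kappa> * F (Suc k) x"
          by (rule sc[OF inverse_c_le a'_le]) (use k x in auto)
        ultimately show ?thesis
          using norm_triangle_ineq4[of "quotient (Suc k) x" "inverse (c k x) *\<^sub>C a' k x"] F_nonneg[of "Suc k" x] k x \<kappa>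
          by (auto simp: e_def)
      qed
      moreover have "\<bar>\<sigma> k\<bar> = 1" using signsD[OF \<sigma>, of k] k by auto
      ultimately show "norm (\<sigma> k *\<^sub>R on_gen j e k x) \<le> 2 / \<kappa> * (if ends (gen x) j k then F (Suc k) x else 0)"
        using N_Suc[of x k] by (auto simp: on_gen_def ends_def e_def)
    qed
    also have "\<dots> = 2 / \<kappa> * F_start (Suc j) x"
      unfolding F_start_def starts_shift by (simp add: sum_distrib_left)
    also have "\<dots> \<le> 2 / \<kappa> * Z j x"
      using \<kappa> F_start_nonneg[OF x] F_nonneg[of n x] x by (intro mult_left_mono) (auto simp: Z_def)
    also have "\<dots> \<le> norm (2 / \<kappa> * Z j x)" unfolding real_norm_def by (rule abs_ge_self)
    finally show ?thesis .
  qed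
  let ?A = "\<lambda>k x. m1 k x *\<^sub>C on_gen j da k x" and ?B = "\<lambda>k x. m2 k x *\<^sub>C on_gen j (\<lambda>k x. dc k x *\<^sub>C a k x) k x"
  have pt: "norm (\<Sum>k<n. \<sigma> k *\<^sub>R on_gen j dq k x) powr p \<le> 3 powr p * (norm (\<Sum>k<n. \<sigma> k *\<^sub>R ?A k x) powr p
      + norm (\<Sum>k<n. \<sigma> k *\<^sub>R ?B k x) powr p + (2 / \<kappa>) powr p * Z j x powr p)" if x: "x \<in> \<Omega>" and \<sigma>: "\<sigma> \<in> signs I" for \<sigma> x
  proof -
    let ?a = "\<Sum>k<n. \<sigma> k *\<^sub>R ?A k x" and ?b = "\<Sum>k<n. \<sigma> k *\<^sub>R ?B k x" and ?e = "\<Sum>k<n. \<sigma> k *\<^sub>R on_gen j e k x"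
    have "(\<Sum>k<n. \<sigma> k *\<^sub>R on_gen j dq k x) = ?a + ?b + ?e"
      unfolding sum.distrib[symmetric]
      by (intro sum.cong refl) (auto simp: on_gen_def dec[OF _ x] scaleR_add_right)
    then have "norm (\<Sum>k<n. \<sigma> k *\<^sub>R on_gen j dq k x) \<le> norm ?a + norm ?b + norm ?e"
      using norm_triangle_ineq[of "?a + ?b" ?e] norm_triangle_ineq[of ?a ?b] by simp
    then have "norm (\<Sum>k<n. \<sigma> k *\<^sub>R on_gen j dq k x) \<le> norm ?a + norm ?b + 2 / \<kappa> * Z j x"
      using e_le[OF x \<sigma>] Z_nonneg[OF x, of j] \<kappa> by simp
    then have "norm (\<Sum>k<n. \<sigma> k *\<^sub>R on_gen j dq k x) powr p \<le> (norm ?a + norm ?b + 2 / \<kappa> * Z j x) powr p"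
      using p by (intro powr_mono2) auto
    also have "\<dots> \<le> 3 powr p * (norm ?a powr p + norm ?b powr p + (2 / \<kappa> * Z j x) powr p)"
      using Z_nonneg[OF x, of j] \<kappa> p by (intro powr_add3_le) auto
    finally show ?thesis using Z_nonneg[OF x, of j] \<kappa> by (simp add: powr_mult powr_divide)
  qed
  have "random_total (on_gen j dq) \<le> (\<Sum>x\<in>\<Omega>. w x * sign_avg I (\<lambda>\<sigma>. 3 powr p * (norm (\<Sum>k<n. \<sigma> k *\<^sub>R ?A k x) powr p
      + norm (\<Sum>k<n. \<sigma> k *\<^sub>R ?B k x) powr p + (2 / \<kappa>) powr p * Z j x powr p)))"
    by (intro sum_mono mult_left_mono sign_avg_mono pt w_nonneg)
  also have "\<dots> = 3 powr p * (random_total ?A + random_total ?B + (2 / \<kappa>) powr p * ZZ j)"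
    unfolding sign_avg_cmult sign_avg_add
    by (simp add: sign_avg_const sum_distrib_left distrib_left sum.distrib mult_ac)
  also have "\<dots> \<le> 3 powr p * (2 * (2 * (1 / \<kappa>\<^sup>2)) powr p * (U * ZZ j)
     + 2 * (2 * (1 / \<kappa>\<^sup>2)) powr p * (U * paraproduct_const p A U * ZZ j) + (2 / \<kappa>) powr p * ZZ j)"
  proof (intro mult_left_mono add_mono order_refl)
    show "random_total ?A \<le> 2 * (2 * (1 / \<kappa>\<^sup>2)) powr p * (U * ZZ j)"
      by (rule order_trans[OF contraction_random_total mult_left_mono[OF random_da_le]]) (use m1 \<kappa> in auto)
    show "random_total ?B \<le> 2 * (2 * (1 / \<kappa>\<^sup>2)) powr p * (U * paraproduct_const p A U * ZZ j)"
      by (rule order_trans[OF contraction_random_total mult_left_mono[OF random_a_dc_le]]) (use m2 \<kappa> in auto)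
  qed auto
  also have "\<dots> = generation_const p A U \<kappa> * ZZ j"
    by (simp add: generation_const_def algebra_simps)
  finally show ?thesis .
qed

subsection \<open>Summation over the generations\<close>

lemma sum_ZZ: "(\<Sum>j\<le>n. ZZ j) \<le> 3 powr p * (2 * carleson_const \<rho> p C2 + 1) * (\<Sum>x\<in>\<Omega>. w x * F n x powr p)"
proof -
  let ?P = "\<Sum>x\<in>\<Omega>. w x * F n x powr p" and ?S = "\<Sum>x\<in>\<Omega>. w x * (\<Sum>j\<le>n. F_start j x powr p)"
  have "(\<Sum>j\<le>n. Z j x powr p) \<le> 3 powr p * ((\<Sum>j\<le>n. F_start j x powr p) + (\<Sum>j\<le>n. F_start j x powr p) + F n x powr p)"
    if x: "x \<in> \<Omega>" for x
  proof -
    have "(\<Sum>j\<le>n. Z j x powr p) \<le> (\<Sum>j\<le>n. 3 powr p * (F_start j x powr p + F_start (Suc j) x powr p + (if gen x n = j then F n x else 0) powr p))"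
      unfolding Z_def using F_start_nonneg[OF x] F_nonneg[of n x] x p by (intro sum_mono powr_add3_le) auto
    also have "\<dots> = 3 powr p * ((\<Sum>j\<le>n. F_start j x powr p) + (\<Sum>j\<le>n. F_start (Suc j) x powr p) + (\<Sum>j\<le>n. (if gen x n = j then F n x else 0) powr p))"
      by (simp only: sum_distrib_left[symmetric] sum.distrib)
    also have "\<dots> \<le> 3 powr p * ((\<Sum>j\<le>n. F_start j x powr p) + (\<Sum>j\<le>n. F_start j x powr p) + F n x powr p)"
    proof (intro mult_left_mono add_mono order_refl)
      have "(\<Sum>j\<le>n. F_start (Suc j) x powr p) \<le> (\<Sum>j\<le>Suc n. F_start j x powr p)"
        by (subst sum.atMost_Suc_shift) simp
      also have "\<dots> = (\<Sum>j\<le>n. F_start j x powr p)"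
        using F_start_zero[OF x, of "Suc n"] N_le[of x n] by simp
      finally show "(\<Sum>j\<le>n. F_start (Suc j) x powr p) \<le> (\<Sum>j\<le>n. F_start j x powr p)" .
      have "(\<Sum>j\<le>n. (if gen x n = j then F n x else 0) powr p) = (\<Sum>j\<le>n. if gen x n = j then F n x powr p else 0)"
        by (intro sum.cong) auto
      then show "(\<Sum>j\<le>n. (if gen x n = j then F n x else 0) powr p) \<le> F n x powr p" by simp
    qed auto
    finally show ?thesis .
  qed
  then have "(\<Sum>x\<in>\<Omega>. w x * (\<Sum>j\<le>n. Z j x powr p)) \<le> (\<Sum>x\<in>\<Omega>. w x * (3 powr p * ((\<Sum>j\<le>n. F_start j x powr p) + (\<Sum>j\<le>n. F_start j x powr p) + F n x powr p)))"
    by (intro sum_mono mult_left_mono w_nonneg)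
  also have "\<dots> = 3 powr p * (?S + ?S + ?P)"
    by (simp only: mult.left_commute[of _ "3 powr p"] sum_distrib_left[symmetric] distrib_left sum.distrib)
  also have "\<dots> \<le> 3 powr p * (carleson_const \<rho> p C2 * ?P + carleson_const \<rho> p C2 * ?P + ?P)"
    by (intro mult_left_mono add_mono carleson_embedding order_refl) auto
  finally show ?thesis by (simp add: sum_weight_swap algebra_simps)
qed

lemma dq_on_gen_ends_adapted:
  assumes k: "k < n"
  shows "adapted (Suc k) (\<lambda>x. if ends (gen x) j k then norm (\<Sum>i<n. \<sigma> i *\<^sub>R on_gen j dq i x) powr p else 0)"
proof (rule adaptedI)
  fix x y assume x: "x \<in> \<Omega>" and y: "y \<in> \<Omega>" and eq: "\<pi> (Suc k) x = \<pi> (Suc k) y"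
  have yb: "y \<in> block (Suc k) x" using y eq by (simp add: block_def)
  have ends: "ends (gen y) j k = ends (gen x) j k" by (rule ends_block[OF k x yb])
  have "on_gen j dq i x = on_gen j dq i y" if e: "ends (gen x) j k" and i: "i < n" for i
  proof (cases "i \<le> k")
    case True
    have *: "gen y i = gen x i" using gen_block[of i "Suc k" x y] True k x yb by simp
    have "c l y = c l x" "a l y = a l x" if "l \<le> Suc k" for l
      using adaptedD[OF adapted_mono[OF c_adapted] x yb, of l] adaptedD[OF adapted_mono[OF a_adapted] x yb, of l] that k by auto
    then show ?thesis using True * by (simp add: on_gen_def quotient_def)
  next
    case False
    have "gen x i \<noteq> j" "gen y i \<noteq> j"
      using N_mono[of "Suc k" i x] N_mono[of "Suc k" i y] False e ends by (auto simp: ends_def)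
    then show ?thesis by (simp add: on_gen_def)
  qed
  then show "(if ends (gen x) j k then norm (\<Sum>i<n. \<sigma> i *\<^sub>R on_gen j dq i x) powr p else 0)
     = (if ends (gen y) j k then norm (\<Sum>i<n. \<sigma> i *\<^sub>R on_gen j dq i y) powr p else 0)"
    using ends by simp
qed

text \<open>The generations are added up with the weights \<open>\<rho> ^ (N - j)\<close>, where \<open>N\<close> is the number of the
  last generation at the given point; the exponential moment then removes these weights.\<close>

theorem quotient_differences_estimate:
  "random_total dq \<le> gen_const \<rho> p * (\<rho> * C2) * generation_const p A U \<kappa> * (3 powr p * (2 * carleson_const \<rho> p C2 + 1))
     * (\<Sum>x\<in>\<Omega>. w x * F n x powr p)"
proof -
  let ?X = "\<lambda>j \<sigma> x. \<Sum>i<n. \<sigma> i *\<^sub>R on_gen j dq i x"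
  have pt: "norm (\<Sum>i<n. \<sigma> i *\<^sub>R dq i x) powr p \<le> gen_const \<rho> p * (\<Sum>j\<le>n. \<rho> ^ (gen x n - j) * norm (?X j \<sigma> x) powr p)" for \<sigma> x
  proof -
    have "dq i x = (\<Sum>j\<le>gen x n. on_gen j dq i x)" if "i < n" for i
      using N_mono[of i n x] that by (simp add: on_gen_def)
    then have "(\<Sum>i<n. \<sigma> i *\<^sub>R dq i x) = (\<Sum>i<n. \<Sum>j\<le>gen x n. \<sigma> i *\<^sub>R on_gen j dq i x)"
      by (intro sum.cong) (auto simp: scaleR_sum_right simp del: sum.delta)
    also have "\<dots> = (\<Sum>j\<le>gen x n. ?X j \<sigma> x)" by (rule sum.swap)
    finally have "norm (\<Sum>i<n. \<sigma> i *\<^sub>R dq i x) powr p \<le> (\<Sum>j\<le>gen x n. norm (?X j \<sigma> x)) powr p"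
      using p by (auto intro!: powr_mono2 norm_sum)
    also have "\<dots> \<le> gen_const \<rho> p * (\<Sum>j\<le>gen x n. \<rho> ^ (gen x n - j) * norm (?X j \<sigma> x) powr p)"
      by (rule powr_sum_generations) (use \<rho> p in auto)
    also have "\<dots> \<le> gen_const \<rho> p * (\<Sum>j\<le>n. \<rho> ^ (gen x n - j) * norm (?X j \<sigma> x) powr p)"
      using N_le[of x n] gen_const_pos[of \<rho> p] \<rho> by (intro mult_left_mono sum_mono2) auto
    finally show ?thesis .
  qed
  have "random_total dq = sign_avg I (\<lambda>\<sigma>. \<Sum>x\<in>\<Omega>. w x * norm (\<Sum>i<n. \<sigma> i *\<^sub>R dq i x) powr p)"
    by (rule sum_sign_avg)
  also have "\<dots> \<le> sign_avg I (\<lambda>\<sigma>. \<Sum>j\<le>n. gen_const \<rho> p * (\<rho> * C2) * (\<Sum>x\<in>\<Omega>. w x * norm (?X j \<sigma> x) powr p))"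
  proof (rule sign_avg_mono)
    fix \<sigma> :: "nat \<Rightarrow> real"
    have "(\<Sum>x\<in>\<Omega>. w x * norm (\<Sum>i<n. \<sigma> i *\<^sub>R dq i x) powr p)
      \<le> (\<Sum>x\<in>\<Omega>. w x * (\<Sum>j\<le>n. gen_const \<rho> p * (\<rho> ^ (gen x n - j) * norm (?X j \<sigma> x) powr p)))"
      using pt by (intro sum_mono mult_left_mono w_nonneg) (auto simp: sum_distrib_left)
    also have "\<dots> = (\<Sum>j\<le>n. gen_const \<rho> p * (\<Sum>x\<in>\<Omega>. w x * (\<rho> ^ (gen x n - j) * norm (?X j \<sigma> x) powr p)))"
      by (simp only: sum_weight_swap mult.left_commute[of _ "gen_const \<rho> p"] sum_distrib_left[symmetric])
    also have "\<dots> \<le> (\<Sum>j\<le>n. gen_const \<rho> p * (\<rho> * C2 * (\<Sum>x\<in>\<Omega>. w x * norm (?X j \<sigma> x) powr p)))"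
      using gen_const_pos[of \<rho> p]
      by (intro sum_mono mult_left_mono weighted_generation dq_on_gen_ends_adapted) auto
    finally show "(\<Sum>x\<in>\<Omega>. w x * norm (\<Sum>i<n. \<sigma> i *\<^sub>R dq i x) powr p)
      \<le> (\<Sum>j\<le>n. gen_const \<rho> p * (\<rho> * C2) * (\<Sum>x\<in>\<Omega>. w x * norm (?X j \<sigma> x) powr p))"
      by (simp only: mult.assoc)
  qed
  also have "\<dots> = gen_const \<rho> p * (\<rho> * C2) * (\<Sum>j\<le>n. random_total (on_gen j dq))"
  proof -
    have "sign_avg I (\<lambda>\<sigma>. \<Sum>j\<le>n. K * \<phi> j \<sigma>) = K * (\<Sum>j\<le>n. sign_avg I (\<phi> j))" for K :: real and \<phi> :: "nat \<Rightarrow> (nat \<Rightarrow> real) \<Rightarrow> real"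
      using sum_sign_avg[of "\<lambda>_. K" I \<phi> "{..n}"] by (simp add: sum_distrib_left)
    then show ?thesis by (simp only: sum_sign_avg)
  qed
  also have "\<dots> \<le> gen_const \<rho> p * (\<rho> * C2) * (\<Sum>j\<le>n. generation_const p A U \<kappa> * ZZ j)"
    using gen_const_pos[of \<rho> p] \<rho> C2 by (intro mult_left_mono sum_mono generation_estimate) auto
  also have "\<dots> = gen_const \<rho> p * (\<rho> * C2) * generation_const p A U \<kappa> * (\<Sum>j\<le>n. ZZ j)"
    by (simp only: sum_distrib_left[symmetric] mult.assoc)
  also have "\<dots> \<le> gen_const \<rho> p * (\<rho> * C2) * generation_const p A U \<kappa> *
      (3 powr p * (2 * carleson_const \<rho> p C2 + 1) * (\<Sum>x\<in>\<Omega>. w x * F n x powr p))"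
  proof (intro mult_left_mono sum_ZZ mult_nonneg_nonneg)
    show "0 \<le> generation_const p A U \<kappa>"
      using U \<kappa> by (auto simp: generation_const_def paraproduct_const_def intro!: mult_nonneg_nonneg add_nonneg_nonneg)
  qed (use gen_const_pos[of \<rho> p] \<rho> C2 in auto)
  finally show ?thesis by (simp only: mult.assoc)
qed

end

section \<open>Geometry of a dyadic system\<close>

locale dyadic_shifts =
  fixes \<beta> :: "int \<Rightarrow> real ^ 'n::finite"
  assumes \<beta>: "\<beta> j $ i \<in> {0, 1}"
begin

definition shift :: "int \<Rightarrow> real ^ 'n" where
  "shift k = (\<Sum>\<^sub>\<infinity>j\<in>{..<k}. (2 powi j) *\<^sub>R \<beta> j)"

text \<open>A cube of side $2^k$ is described by its integer coordinates; taking the parent halves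
  them.\<close>

definition idx :: "int \<Rightarrow> real ^ 'n \<Rightarrow> int ^ 'n" where
  "idx k x = (\<chi> i. \<lfloor>(x $ i - shift k $ i) / 2 powi k\<rfloor>)"

definition cube :: "int \<Rightarrow> real ^ 'n \<Rightarrow> (real ^ 'n) set" where
  "cube k x = {y. idx k y = idx k x}"

lemma summable_shift: "(\<lambda>j. (2 powi j) *\<^sub>R \<beta> j) summable_on {..<k}"
proof (rule abs_summable_summable)
  have bij: "bij_betw (\<lambda>n::nat. k - 1 - int n) UNIV {..<k}"
    by (rule bij_betwI[where g="\<lambda>j. nat (k - 1 - j)"]) auto
  have eq: "(2::real) powi (k - 1 - int n) = 2 powi (k - 1) * (1/2) ^ n" for n
    by (simp add: power_int_diff power_one_over)
  have "(\<lambda>n. (2::real) powi (k - 1) * (1/2) ^ n * real CARD('n)) summable_on UNIV"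
    by (rule summable_nonneg_imp_summable_on) (auto intro!: summable_mult summable_mult2 summable_geometric)
  then have "(\<lambda>j. (2::real) powi j * real CARD('n)) summable_on {..<k}"
    by (subst summable_on_reindex_bij_betw[OF bij, symmetric]) (simp add: eq)
  then show "(\<lambda>j. norm ((2 powi j) *\<^sub>R \<beta> j)) summable_on {..<k}"
  proof (rule summable_on_comparison_test)
    fix j
    have "norm (\<beta> j) \<le> (\<Sum>i\<in>UNIV. \<bar>\<beta> j $ i\<bar>)" by (rule norm_le_l1_cart)
    also have "\<dots> \<le> (\<Sum>i\<in>(UNIV::'n set). 1)"
    proof (rule sum_mono)
      fix i show "\<bar>\<beta> j $ i\<bar> \<le> 1" using \<beta>[of j i] by auto
    qed
    finally show "norm ((2 powi j) *\<^sub>R \<beta> j) \<le> 2 powi j * real CARD('n)"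
      by (simp add: mult_left_mono)
  qed auto
qed

lemma shift_Suc: "shift (k + 1) = shift k + (2 powi k) *\<^sub>R \<beta> k"
proof -
  have "{..<k + 1} = insert k {..<k}" by auto
  then show ?thesis
    unfolding shift_def using infsum_insert[OF summable_shift, of k k] by (simp add: add.commute)
qed

lemma idx_Suc: "idx (k + 1) x $ i = (idx k x $ i - \<lfloor>\<beta> k $ i\<rfloor>) div 2"
proof -
  have b: "real_of_int \<lfloor>\<beta> k $ i\<rfloor> = \<beta> k $ i" using \<beta>[of k i] by auto
  have sh: "shift (k + 1) $ i = shift k $ i + 2 powi k * \<beta> k $ i" by (simp add: shift_Suc)
  have pw: "(2::real) powi (k + 1) = 2 * 2 powi k" by (simp add: power_int_add)
  have eq: "(x $ i - shift (k + 1) $ i) / 2 powi (k + 1) = ((x $ i - shift k $ i) / 2 powi k - real_of_int \<lfloor>\<beta> k $ i\<rfloor>) / real_of_int 2"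
    unfolding sh pw b by (simp add: field_simps)
  have "idx (k + 1) x $ i = \<lfloor>((x $ i - shift k $ i) / 2 powi k - real_of_int \<lfloor>\<beta> k $ i\<rfloor>) / real_of_int 2\<rfloor>"
    unfolding idx_def vec_lambda_beta eq ..
  also have "\<dots> = (idx k x $ i - \<lfloor>\<beta> k $ i\<rfloor>) div 2"
    by (subst floor_divide_real_eq_div) (auto simp: idx_def)
  finally show ?thesis .
qed

lemma idx_surj: "\<exists>x. idx k x = m"
  by (rule exI[of _ "\<chi> i. shift k $ i + 2 powi k * real_of_int (m $ i)"]) (simp add: idx_def vec_eq_iff)

lemma idx_parent: "idx k x = idx k y \<Longrightarrow> idx (k + 1) x = idx (k + 1) y"
  by (simp add: vec_eq_iff idx_Suc)

lemma idx_mono: "k \<le> l \<Longrightarrow> idx k x = idx k y \<Longrightarrow> idx l x = idx l y"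
proof (induction l rule: int_ge_induct)
  case (step l)
  then show ?case using idx_parent by blast
qed

lemma self_cube [simp]: "x \<in> cube k x"
  by (simp add: cube_def)

lemma cube_eq: "y \<in> cube k x \<Longrightarrow> cube k y = cube k x"
  by (simp add: cube_def)

lemma cube_mono: "k \<le> l \<Longrightarrow> cube k x \<subseteq> cube l x"
proof
  fix y assume "k \<le> l" "y \<in> cube k x"
  then show "y \<in> cube l x" using idx_mono[of k l y x] by (simp add: cube_def)
qed

lemma mem_image_add: "y \<in> (\<lambda>x. x + s) ` H \<longleftrightarrow> y - s \<in> H" for s :: "real ^ 'n"
proof
  assume "y - s \<in> H"
  then show "y \<in> (\<lambda>x. x + s) ` H" by (rule rev_image_eqI) simp
qed auto

lemma half_open_cube_eq:
  "(\<lambda>x. x + shift k) ` half_open_cube (\<chi> i. 2 powi k * real_of_int (m $ i)) (2 powi k) = {y. idx k y = m}" (is "?L = ?R")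
proof -
  have iff: "(2 powi k * real_of_int a \<le> t \<and> t < 2 powi k * real_of_int a + 2 powi k) \<longleftrightarrow> \<lfloor>t / 2 powi k\<rfloor> = a" for t a
    by (simp add: floor_eq_iff pos_le_divide_eq pos_divide_less_eq algebra_simps)
  have "y \<in> ?L \<longleftrightarrow> y - shift k \<in> half_open_cube (\<chi> i. 2 powi k * real_of_int (m $ i)) (2 powi k)" for y
    by (rule mem_image_add)
  moreover have "y - shift k \<in> half_open_cube (\<chi> i. 2 powi k * real_of_int (m $ i)) (2 powi k) \<longleftrightarrow> idx k y = m" for y
    by (simp add: half_open_cube_def idx_def vec_eq_iff iff)
  ultimately show ?thesis by (intro set_eqI) simp
qed

lemma half_open_cube_shift: "(\<lambda>x. x + s) ` half_open_cube a l = half_open_cube (a + s) l"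
  for s :: "real ^ 'n"
proof -
  have "y \<in> (\<lambda>x. x + s) ` half_open_cube a l \<longleftrightarrow> y - s \<in> half_open_cube a l" for y
    by (rule mem_image_add)
  moreover have "y - s \<in> half_open_cube a l \<longleftrightarrow> y \<in> half_open_cube (a + s) l" for y
    by (simp add: half_open_cube_def algebra_simps)
  ultimately show ?thesis by (intro set_eqI) simp
qed

lemma dyadic_eq: "dyadic \<beta> k = range (cube k)"
proof -
  have "dyadic \<beta> k = {{y. idx k y = m} | m. True}"
    unfolding dyadic_def standard_dyadic_def shift_def[symmetric] half_open_cube_eq[symmetric] by blast
  also have "\<dots> = range (cube k)"
  proof (intro set_eqI iffI)
    fix S assume "S \<in> {{y. idx k y = m} | m. True}"
    then obtain m where S: "S = {y. idx k y = m}" by blast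
    obtain x where "idx k x = m" using idx_surj by blast
    then have "S = cube k x" by (simp add: S cube_def)
    then show "S \<in> range (cube k)" by simp
  qed (auto simp: cube_def)
  finally show ?thesis .
qed

lemma cube_in_dyadic [simp]: "cube k x \<in> dyadic_system \<beta>"
  by (auto simp: dyadic_system_def dyadic_eq)

lemma dyadicE:
  assumes "R \<in> dyadic_system \<beta>" "x \<in> R"
  obtains k where "R = cube k x"
proof -
  obtain k y where "R = cube k y" using assms(1) by (auto simp: dyadic_system_def dyadic_eq)
  then show thesis using that[of k] cube_eq[of x k y] assms(2) by simp
qed

lemma cube_in_cubes: "cube k x \<in> cubes"
proof -
  have eq: "cube k x = half_open_cube ((\<chi> i. 2 powi k * real_of_int (idx k x $ i)) + shift k) (2 powi k)"
    unfolding cube_def half_open_cube_eq[symmetric] half_open_cube_shift ..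
  show ?thesis unfolding cubes_def mem_Collect_eq by (intro exI conjI, rule eq) simp
qed

lemma sets_cube [measurable]: "cube k x \<in> sets borel"
proof -
  have "half_open_cube a l \<in> sets borel" for a :: "real ^ 'n" and l
  proof -
    have "half_open_cube a l = (\<Inter>i. {x. a $ i \<le> x $ i} \<inter> {x. x $ i < a $ i + l})"
      by (auto simp: half_open_cube_def)
    also have "\<dots> \<in> sets borel"
      by (intro sets.finite_INT sets.Int borel_closed borel_open closed_halfspace_component_ge_cart
          open_halfspace_component_lt_cart) auto
    finally show ?thesis .
  qed
  then show ?thesis using cube_in_cubes[of k x] by (auto simp: cubes_def)
qed

lemma cube_strict: "cube k x \<noteq> cube (k + 1) x"
proof -
  define m where "m = (\<chi> i. if even (idx k x $ i - \<lfloor>\<beta> k $ i\<rfloor>) then idx k x $ i + 1 else idx k x $ i - 1)"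
  obtain y where y: "idx k y = m" using idx_surj by blast
  have par: "(if even (u - c) then u + 1 - c else u - 1 - c) div 2 = (u - c) div 2" for u c :: int
    by (auto elim!: evenE oddE)
  have "idx (k + 1) y $ i = idx (k + 1) x $ i" for i
    unfolding idx_Suc y m_def using par[of "idx k x $ i" "\<lfloor>\<beta> k $ i\<rfloor>"] by auto
  then have "y \<in> cube (k + 1) x" by (simp add: cube_def vec_eq_iff)
  moreover have "idx k y $ undefined \<noteq> idx k x $ undefined" unfolding y m_def by simp
  then have "y \<notin> cube k x" by (auto simp: cube_def)
  ultimately show ?thesis by blast
qed

lemma cube_subset_strict: "k < l \<Longrightarrow> cube k x \<subset> cube l x"
  using cube_mono[of k "k + 1" x] cube_mono[of "k + 1" l x] cube_strict[of k x] by auto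

lemma cube_subset_iff: "cube k x \<subseteq> cube l x \<longleftrightarrow> k \<le> l"
  using cube_mono[of k l x] cube_subset_strict[of l k x] by (cases "k \<le> l") auto

lemma finite_int_box: "finite {u :: int ^ 'n. \<forall>i. u $ i \<in> S i}" if "\<And>i. finite (S i)"
proof (rule finite_imageD)
  have "vec_nth ` {u :: int ^ 'n. \<forall>i. u $ i \<in> S i} \<subseteq> PiE UNIV S" by auto
  then show "finite (vec_nth ` {u :: int ^ 'n. \<forall>i. u $ i \<in> S i})"
    by (rule finite_subset) (rule finite_PiE, simp_all add: that)
qed (simp add: inj_on_def vec_nth_inject)

lemma finite_descendants: "finite (idx (k - int i) ` cube k x)"
proof (induction i)
  case 0
  have "idx k ` cube k x \<subseteq> {idx k x}" by (auto simp: cube_def)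
  then show ?case by (simp add: finite_subset)
next
  case (Suc i)
  let ?l = "k - int (Suc i)"
  have "idx ?l y \<in> (\<Union>v\<in>idx (k - int i) ` cube k x. {u. \<forall>c. u $ c \<in> {2 * v $ c..2 * v $ c + 2}})" if y: "y \<in> cube k x" for y
  proof (rule UN_I[of "idx (k - int i) y"])
    have "idx ?l y $ c \<in> {2 * idx (k - int i) y $ c..2 * idx (k - int i) y $ c + 2}" for c
    proof -
      have "idx (?l + 1) y $ c = (idx ?l y $ c - \<lfloor>\<beta> ?l $ c\<rfloor>) div 2" by (rule idx_Suc)
      moreover have "\<lfloor>\<beta> ?l $ c\<rfloor> = 0 \<or> \<lfloor>\<beta> ?l $ c\<rfloor> = 1" using \<beta>[of ?l c] by auto
      moreover have "?l + 1 = k - int i" by simp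
      ultimately show ?thesis by (auto simp: )
    qed
    then show "idx ?l y \<in> {u. \<forall>c. u $ c \<in> {2 * idx (k - int i) y $ c..2 * idx (k - int i) y $ c + 2}}" by simp
  qed (use y in auto)
  then have "idx ?l ` cube k x \<subseteq> (\<Union>v\<in>idx (k - int i) ` cube k x. {u. \<forall>c. u $ c \<in> {2 * v $ c..2 * v $ c + 2}})" by blast
  then show ?case
    by (rule finite_subset) (intro finite_UN_I Suc finite_int_box finite_atLeastAtMost_int)
qed

lemma cube_bounded:
  assumes "y \<in> cube k x"
  shows "infnorm (y - x) < 2 powi k"
proof -
  have c: "\<bar>(y - x) $ i\<bar> < 2 powi k" for i
  proof -
    have "\<lfloor>(y $ i - shift k $ i) / 2 powi k\<rfloor> = \<lfloor>(x $ i - shift k $ i) / 2 powi k\<rfloor>"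
      using assms by (simp add: cube_def idx_def vec_eq_iff)
    then have "\<bar>(y $ i - shift k $ i) / 2 powi k - (x $ i - shift k $ i) / 2 powi k\<bar> < 1" by linarith
    then have "\<bar>(y $ i - x $ i) / 2 powi k\<bar> < 1" by (simp add: diff_divide_distrib)
    then show ?thesis by (simp add: abs_divide)
  qed
  have "(y - x) \<bullet> axis i 1 = (y - x) $ i" for i by (simp add: inner_axis)
  then show ?thesis
    unfolding infnorm_Max using c by (subst Max_less_iff) (auto simp: Basis_vec_def)
qed

end

section \<open>Stopping cubes and their ancestors\<close>

locale stopping_cubes = dyadic_shifts \<beta> for \<beta> :: "int \<Rightarrow> real ^ 'n::finite" +
  fixes \<mu> :: "(real ^ 'n) measure" and b :: "(real ^ 'n) set \<Rightarrow> real ^ 'n \<Rightarrow> complex" and \<delta> :: real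
    and Q\<^sub>0 :: "(real ^ 'n) set" and k0 :: int and x0 :: "real ^ 'n"
  assumes Q0: "Q\<^sub>0 = cube k0 x0"
begin

abbreviation cand :: "(real ^ 'n) set \<Rightarrow> (real ^ 'n) set set" where
  "cand R \<equiv> stopping_candidates \<mu> \<beta> b \<delta> R"

abbreviation lay :: "nat \<Rightarrow> (real ^ 'n) set set" where
  "lay j \<equiv> layer \<mu> \<beta> b \<delta> Q\<^sub>0 j"

definition max_cand :: "(real ^ 'n) set \<Rightarrow> (real ^ 'n) set \<Rightarrow> bool" where
  "max_cand R Q \<longleftrightarrow> Q \<in> cand R \<and> (\<forall>Q'\<in>cand R. Q \<subseteq> Q' \<longrightarrow> Q' = Q)"

definition layers :: "(real ^ 'n) set set" where
  "layers = (\<Union>j. lay j)"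

abbreviation anc :: "(real ^ 'n) set \<Rightarrow> (real ^ 'n) set" where
  "anc Q \<equiv> stopping_ancestor \<mu> \<beta> b \<delta> Q\<^sub>0 Q"

definition Q :: "nat \<Rightarrow> real ^ 'n \<Rightarrow> (real ^ 'n) set" where
  "Q i x = cube (k0 - int i) x"

lemma lay_Suc: "S \<in> lay (Suc j) \<longleftrightarrow> (\<exists>R\<in>lay j. max_cand R S)"
  by (auto simp: max_cand_def)

lemma cand_dyadic: "S \<in> cand R \<Longrightarrow> S \<in> dyadic_system \<beta>"
  and cand_subset: "S \<in> cand R \<Longrightarrow> S \<subset> R"
  by (auto simp: stopping_candidates_def)

lemma lay_dyadic: "R \<in> lay j \<Longrightarrow> R \<in> dyadic_system \<beta> \<and> R \<subseteq> Q\<^sub>0"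
proof (induction j arbitrary: R)
  case (Suc j)
  then obtain P where "P \<in> lay j" "max_cand P R" unfolding lay_Suc by blast
  then show ?case using Suc.IH[of P] cand_dyadic[of R P] cand_subset[of R P] by (auto simp: max_cand_def)
qed (simp add: Q0)

lemma layersI: "R \<in> lay j \<Longrightarrow> R \<in> layers"
  by (auto simp: layers_def)

lemma layers_dyadic: "R \<in> layers \<Longrightarrow> R \<in> dyadic_system \<beta>" "R \<in> layers \<Longrightarrow> R \<subseteq> Q\<^sub>0"
  using lay_dyadic by (auto simp: layers_def)

lemma Q0_layers: "Q\<^sub>0 \<in> layers"
  by (rule layersI[of _ 0]) simp

lemma comparable:
  assumes "R \<in> dyadic_system \<beta>" "S \<in> dyadic_system \<beta>" "x \<in> R" "x \<in> S"
  shows "R \<subseteq> S \<or> S \<subseteq> R"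
proof -
  obtain k l where "R = cube k x" "S = cube l x" using assms by (meson dyadicE)
  then show ?thesis using cube_mono[of k l x] cube_mono[of l k x] by (cases "k \<le> l") auto
qed

lemma lay_disjoint: "R \<in> lay j \<Longrightarrow> S \<in> lay j \<Longrightarrow> x \<in> R \<Longrightarrow> x \<in> S \<Longrightarrow> R = S"
proof (induction j arbitrary: R S)
  case (Suc j)
  obtain P P' where P: "P \<in> lay j" "max_cand P R" "P' \<in> lay j" "max_cand P' S"
    using Suc.prems(1,2) unfolding lay_Suc by blast
  then have sub: "R \<subset> P" "S \<subset> P'" using cand_subset by (auto simp: max_cand_def)
  then have "P = P'" using Suc P by blast
  moreover have "R \<subseteq> S \<or> S \<subseteq> R"
    using comparable[of R S x] Suc.prems lay_dyadic by blast
  ultimately show ?case using P by (auto simp: max_cand_def)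
qed simp

lemma lay_chain: "R \<in> lay m \<Longrightarrow> j \<le> m \<Longrightarrow> \<exists>P\<in>lay j. R \<subseteq> P"
proof (induction m arbitrary: R)
  case (Suc m)
  show ?case
  proof (cases "j = Suc m")
    case False
    obtain P where P: "P \<in> lay m" "max_cand P R" using Suc.prems(1) unfolding lay_Suc by blast
    then obtain P' where "P' \<in> lay j" "P \<subseteq> P'" using Suc False by (metis le_SucE)
    moreover have "R \<subset> P" using P cand_subset by (auto simp: max_cand_def)
    ultimately show ?thesis by blast
  qed (use Suc.prems in auto)
qed auto

lemma Q_0: "x \<in> Q\<^sub>0 \<Longrightarrow> Q 0 x = Q\<^sub>0"
  by (simp add: Q_def Q0 cube_eq)

lemma self_Q [simp]: "x \<in> Q i x"
  by (simp add: Q_def)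

lemma Q_subset_iff: "Q i x \<subseteq> Q l x \<longleftrightarrow> l \<le> i"
  by (auto simp: Q_def cube_subset_iff)

lemma Q_eq_iff: "Q i x = Q l x \<longleftrightarrow> l = i"
  by (auto simp: set_eq_subset Q_subset_iff)

lemma Q_subset_Q0: "x \<in> Q\<^sub>0 \<Longrightarrow> Q i x \<subseteq> Q\<^sub>0"
  using Q_subset_iff[of i x 0] Q_0 by simp

lemma Q_eq: "y \<in> Q i x \<Longrightarrow> Q i y = Q i x"
  unfolding Q_def by (rule cube_eq)

lemma Q_dyadic [simp]: "Q i x \<in> dyadic_system \<beta>"
  by (simp add: Q_def)

lemma dyadic_in_Q0E:
  assumes "R \<in> dyadic_system \<beta>" "x \<in> R" "R \<subseteq> Q\<^sub>0"
  obtains l where "R = Q l x"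
proof -
  obtain k where k: "R = cube k x" using dyadicE[OF assms(1,2)] by blast
  have "x \<in> Q\<^sub>0" using assms by auto
  then have "Q\<^sub>0 = cube k0 x" by (simp add: Q0 cube_eq)
  then have "k \<le> k0" using assms(3) k by (simp add: cube_subset_iff)
  then have "R = Q (nat (k0 - k)) x" by (simp add: Q_def k)
  then show ?thesis by (rule that)
qed

text \<open>Since both cubes are dyadic, a larger one contains the parent.\<close>

lemma layer_above:
  assumes "R \<in> layers" "Q (Suc i) x \<subseteq> R" "R \<noteq> Q (Suc i) x"
  shows "Q i x \<subseteq> R"
proof -
  have "x \<in> R" using assms(2) self_Q by blast
  then obtain l where l: "R = Q l x" using dyadic_in_Q0E layers_dyadic assms(1) by blast
  then have "l \<le> Suc i" "l \<noteq> Suc i" using assms by (auto simp: Q_subset_iff)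
  then show ?thesis unfolding l Q_subset_iff by simp
qed

lemma anc_Q0: "anc Q\<^sub>0 = Q\<^sub>0"
proof -
  have "(LEAST R. R \<in> (\<Union>j. lay j) \<and> Q\<^sub>0 \<subseteq> R) = Q\<^sub>0"
    by (rule Least_equality) (use Q0_layers in \<open>auto simp: layers_def\<close>)
  then show ?thesis by (simp add: stopping_ancestor_def)
qed

lemma anc_0: "x \<in> Q\<^sub>0 \<Longrightarrow> anc (Q 0 x) = Q\<^sub>0"
  by (simp add: Q_0 anc_Q0)

lemma anc_Suc:
  assumes "x \<in> Q\<^sub>0"
  shows "anc (Q (Suc i) x) = (if Q (Suc i) x \<in> layers then Q (Suc i) x else anc (Q i x))"
proof (cases "Q (Suc i) x \<in> layers")
  case True
  then have "(LEAST R. R \<in> layers \<and> Q (Suc i) x \<subseteq> R) = Q (Suc i) x"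
    by (intro Least_equality) auto
  then show ?thesis using True Q_subset_Q0[OF assms] by (simp add: stopping_ancestor_def layers_def)
next
  case False
  have "(R \<in> layers \<and> Q (Suc i) x \<subseteq> R) \<longleftrightarrow> (R \<in> layers \<and> Q i x \<subseteq> R)" for R
    using layer_above[of R i x] False Q_subset_iff[of "Suc i" x i] by auto
  then show ?thesis using False Q_subset_Q0[OF assms] by (simp add: stopping_ancestor_def layers_def)
qed

lemma anc_layers: "x \<in> Q\<^sub>0 \<Longrightarrow> anc (Q i x) \<in> layers \<and> Q i x \<subseteq> anc (Q i x)"
proof (induction i)
  case (Suc i)
  have "Q (Suc i) x \<subseteq> Q i x" by (simp add: Q_subset_iff)
  then show ?case using Suc by (auto simp: anc_Suc)
qed (simp add: anc_Q0 Q0_layers Q_0)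

lemma anc_least: "x \<in> Q\<^sub>0 \<Longrightarrow> R \<in> layers \<Longrightarrow> Q i x \<subseteq> R \<Longrightarrow> anc (Q i x) \<subseteq> R"
proof (induction i)
  case 0
  then show ?case by (simp add: anc_Q0 Q_0)
next
  case (Suc i)
  then show ?case using layer_above[of R i x] by (auto simp: anc_Suc)
qed

lemma anc_above: "\<not> R \<subseteq> Q\<^sub>0 \<Longrightarrow> anc R = Q\<^sub>0"
  by (simp add: stopping_ancestor_def)

text \<open>A cube that is not an ancestor is not a stopping candidate, as otherwise a maximal candidate
  above it would lie in the next layer.\<close>

lemma not_cand_anc:
  assumes x: "x \<in> Q\<^sub>0"
  shows "Q i x \<notin> cand (anc (Q i x))"
proof
  let ?R = "anc (Q i x)"
  assume c: "Q i x \<in> cand ?R"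
  obtain j where R: "?R \<in> lay j" using anc_layers[OF x, of i] by (auto simp: layers_def)
  define l where "l = (LEAST l. Q l x \<in> cand ?R)"
  have l: "Q l x \<in> cand ?R" unfolding l_def using c by (rule LeastI)
  have li: "l \<le> i" unfolding l_def using c by (rule Least_le)
  have "max_cand ?R (Q l x)"
    unfolding max_cand_def
  proof (intro conjI ballI impI l)
    fix S assume S: "S \<in> cand ?R" "Q l x \<subseteq> S"
    have "S \<subseteq> Q\<^sub>0" using cand_subset[OF S(1)] layers_dyadic anc_layers[OF x, of i] by blast
    moreover have "x \<in> S" using S(2) self_Q by blast
    ultimately obtain l' where l': "S = Q l' x" using dyadic_in_Q0E cand_dyadic[OF S(1)] by blast
    then have "l' \<le> l" using S(2) by (simp add: Q_subset_iff)
    moreover have "l \<le> l'" unfolding l_def using S(1) l' by (intro Least_le) simp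
    ultimately show "S = Q l x" using l' by simp
  qed
  then have "Q l x \<in> layers" using R by (intro layersI[of _ "Suc j"]) (auto simp: lay_Suc simp del: layer.simps)
  then have "?R \<subseteq> Q l x" using li by (intro anc_least x) (auto simp: Q_subset_iff)
  then show False using cand_subset[OF l] by blast
qed

text \<open>The cube whose candidates produced a stopping cube is the ancestor of the dyadic parent.\<close>

lemma layer_cand_anc:
  assumes x: "x \<in> Q\<^sub>0" and L: "Q (Suc i) x \<in> layers"
  shows "Q (Suc i) x \<in> cand (anc (Q i x))"
proof -
  let ?A = "anc (Q i x)"
  have A: "?A \<in> layers" "Q i x \<subseteq> ?A" using anc_layers[OF x] by auto
  obtain j where "Q (Suc i) x \<in> lay j" using L by (auto simp: layers_def)
  moreover have "Q (Suc i) x \<noteq> Q\<^sub>0" using Q_0[OF x] Q_eq_iff[of "Suc i" x 0] by simp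
  ultimately obtain j' R where R: "R \<in> lay j'" "max_cand R (Q (Suc i) x)"
    by (cases j) (auto simp: lay_Suc simp del: layer.simps(2))
  have cR: "Q (Suc i) x \<in> cand R" using R by (simp add: max_cand_def)
  have "Q i x \<subseteq> R" using layer_above[OF layersI[OF R(1)]] cand_subset[OF cR] by blast
  then have AR: "?A \<subseteq> R" using anc_least[OF x layersI[OF R(1)]] by blast
  have xA: "x \<in> ?A" using A self_Q by blast
  obtain m where m: "?A \<in> lay m" using A by (auto simp: layers_def)
  have "?A = R"
  proof (rule ccontr)
    assume ne: "?A \<noteq> R"
    show False
    proof (cases "m \<le> j'")
      case True
      then obtain P where P: "P \<in> lay m" "R \<subseteq> P" using lay_chain[OF R(1)] by blast
      then have "P = ?A" using lay_disjoint[OF P(1) m, of x] AR xA by blast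
      then show False using P AR ne by blast
    next
      case False
      then obtain P where P: "P \<in> lay (Suc j')" "?A \<subseteq> P" using lay_chain[OF m, of "Suc j'"] by auto
      then obtain R' where R': "R' \<in> lay j'" "max_cand R' P" unfolding lay_Suc by blast
      then have "P \<subset> R'" using cand_subset by (auto simp: max_cand_def)
      then have "R' = R" using lay_disjoint[OF R'(1) R(1), of x] AR xA P by blast
      then have "P \<in> cand R" using R' by (simp add: max_cand_def)
      moreover have sub: "Q (Suc i) x \<subseteq> Q i x" by (simp add: Q_subset_iff)
      ultimately have "P = Q (Suc i) x" using R(2) A P unfolding max_cand_def by blast
      then have "Q i x \<subseteq> Q (Suc i) x" using A P by blast
      then show False by (simp add: Q_subset_iff)
    qed
  qed
  then show ?thesis using cR by simp
qed

end

section \<open>Averages over dyadic cubes\<close>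

lemma scaleC_bounded_bilinear: "bounded_bilinear (\<lambda>c (x::'x::complex_banach). c *\<^sub>C x)"
  by (rule bounded_bilinear.intro)
     (auto simp: scaleC_add_left scaleC_add_right scaleC_scaleR_left scaleC_scaleR_right norm_scaleC intro!: exI[of _ 1])

lemmas tendsto_scaleC = bounded_bilinear.tendsto[OF scaleC_bounded_bilinear]

lemma strongly_measurable_scaleC:
  fixes f :: "'a \<Rightarrow> 'x::complex_banach"
  assumes "g \<in> borel_measurable M" "strongly_measurable M f"
  shows "strongly_measurable M (\<lambda>x. g x *\<^sub>C f x)"
  using assms(1)[folded strongly_measurable_iff_borel] assms(2)
  by (rule strongly_measurable_compose2) (rule tendsto_scaleC)

lemma strong_integrable_dominated:
  assumes "strongly_measurable M g" "strong_integrable M f" "AE x in M. norm (g x) \<le> norm (f x)"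
  shows "strong_integrable M g"
proof -
  have "(\<integral>\<^sup>+x. norm (g x) \<partial>M) \<le> (\<integral>\<^sup>+x. norm (f x) \<partial>M)"
    using assms(3) by (intro nn_integral_mono_AE) (auto elim!: eventually_mono)
  then show ?thesis using assms by (auto simp: strong_integrable_def order_le_less_trans)
qed

lemma strong_integrable_indicator:
  fixes g :: "'a \<Rightarrow> 'x::real_normed_vector"
  assumes "A \<in> sets M" "strong_integrable M g"
  shows "strong_integrable M (\<lambda>x. indicator A x *\<^sub>R g x)"
  using assms by (intro strong_integrable_dominated[OF _ assms(2)] strongly_measurable_indicator)
    (auto simp: strong_integrable_def indicator_def)

lemma strong_integral_indicator_cong:
  assumes "\<And>x. x \<in> A \<Longrightarrow> g x = h x"
  shows "strong_integral M (\<lambda>x. indicator A x *\<^sub>R g x) = strong_integral M (\<lambda>x. indicator A x *\<^sub>R h x)"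
  by (rule arg_cong[where f="strong_integral M"], rule ext) (use assms in \<open>auto simp: indicator_def\<close>)

lemma cube_average_cong: "(\<And>x. x \<in> A \<Longrightarrow> g x = h x) \<Longrightarrow> cube_average M g A = cube_average M h A"
  unfolding cube_average_def using strong_integral_indicator_cong[of A g h M] by simp

text \<open>The tangent at the mean, which is Jensen's inequality for powers before integration.\<close>

lemma powr_tangent:
  fixes t m p :: real
  assumes "1 < p" "0 \<le> t" "0 \<le> m"
  shows "p * m powr (p - 1) * t - (p - 1) * m powr p \<le> t powr p"
proof -
  define q where "q = p / (p - 1)"
  have q: "1 < q" "1 / p + 1 / q = 1" using assms by (auto simp: q_def field_simps)
  have "t * m powr (p - 1) \<le> t powr p / p + (m powr (p - 1)) powr q / q"
    using assms q by (intro Youngs_inequality) auto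
  also have "(m powr (p - 1)) powr q = m powr p" using assms by (simp add: powr_powr q_def)
  also have "m powr p / q = m powr p * (p - 1) / p" by (simp add: q_def)
  finally have "t * m powr (p - 1) * p \<le> (t powr p / p + m powr p * (p - 1) / p) * p"
    using assms by (intro mult_right_mono) auto
  also have "\<dots> = t powr p + m powr p * (p - 1)" using assms by (simp add: distrib_right)
  finally show ?thesis by (simp add: algebra_simps)
qed

locale dyadic_measure = stopping_cubes \<beta> \<mu> b \<delta> Q\<^sub>0 k0 x0
  for \<beta> :: "int \<Rightarrow> real ^ 'n::finite" and \<mu> b \<delta> Q\<^sub>0 k0 x0 +
  assumes sets_\<mu> [measurable_cong, simp]: "sets \<mu> = sets borel"
    and finite_\<mu>: "finite_measure \<mu>"
    and AE_Q0: "AE x in \<mu>. x \<in> Q\<^sub>0"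
    and accretive: "accretive_system \<mu> \<delta> b"
    and \<delta>: "0 < \<delta>" "\<delta> < 1"
begin

sublocale finite_measure \<mu> by (rule finite_\<mu>)

lemma space_\<mu> [simp]: "space \<mu> = UNIV"
  using sets_eq_imp_space_eq[OF sets_\<mu>] by simp

lemma Q_sets [measurable, simp]: "Q i x \<in> sets \<mu>"
  by (simp add: Q_def)

lemma Q_borel [simp]: "Q i x \<in> sets borel"
  by (simp add: Q_def)

lemma Q_cubes: "Q i x \<in> cubes"
  by (simp add: Q_def cube_in_cubes)

lemma dyadic_cubes: "R \<in> dyadic_system \<beta> \<Longrightarrow> R \<in> cubes"
  by (auto simp: dyadic_system_def dyadic_eq cube_in_cubes)

lemma b_measurable: "R \<in> cubes \<Longrightarrow> b R \<in> borel_measurable \<mu>"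
  and b_le: "R \<in> cubes \<Longrightarrow> AE x in \<mu>. cmod (b R x) \<le> 1"
  and b_outside: "R \<in> cubes \<Longrightarrow> AE x in \<mu>. x \<notin> R \<longrightarrow> b R x = 0"
  and b_ge: "R \<in> cubes \<Longrightarrow> \<delta> * measure \<mu> R \<le> cmod (LINT x:R|\<mu>. b R x)"
  using accretive unfolding accretive_system_def by auto

lemma anc_cubes: "x \<in> Q\<^sub>0 \<Longrightarrow> anc (Q i x) \<in> cubes"
  using anc_layers[of x i] layers_dyadic dyadic_cubes by blast

lemma strong_integrable_const: "strong_integrable \<mu> (\<lambda>_. v::'v::real_normed_vector)"
  unfolding strong_integrable_def
  by (auto intro!: strongly_measurable_simple simp: emeasure_eq_measure simp flip: ennreal_mult')

lemma strong_integrable_b: "R \<in> cubes \<Longrightarrow> strong_integrable \<mu> (b R)"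
  by (rule strong_integrable_dominated[OF _ strong_integrable_const[of "1::real"]])
     (auto simp: strongly_measurable_iff_borel b_measurable b_le)

lemma strong_integrable_b_scaleC:
  fixes f :: "real ^ 'n \<Rightarrow> 'x::complex_banach"
  assumes "R \<in> cubes" "strong_integrable \<mu> f"
  shows "strong_integrable \<mu> (\<lambda>x. b R x *\<^sub>C f x)"
proof (rule strong_integrable_dominated[OF _ assms(2)])
  show "strongly_measurable \<mu> (\<lambda>x. b R x *\<^sub>C f x)"
    using assms by (intro strongly_measurable_scaleC b_measurable) (auto simp: strong_integrable_def)
  show "AE x in \<mu>. norm (b R x *\<^sub>C f x) \<le> norm (f x)"
    using b_le[OF assms(1)] by eventually_elim (auto simp: norm_scaleC mult_left_le_one_le)
qed

lemma strong_integral_average: "strong_integral \<mu> (\<lambda>x. indicator A x *\<^sub>R g x) = measure \<mu> A *\<^sub>R cube_average \<mu> g A"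
  if "measure \<mu> A \<noteq> 0" for g :: "_ \<Rightarrow> 'v::banach"
  using that by (simp add: cube_average_def)

lemma cube_average_norm_le:
  fixes g :: "_ \<Rightarrow> 'v::banach" and h :: "_ \<Rightarrow> real"
  assumes A: "A \<in> sets \<mu>" and g: "strong_integrable \<mu> g" and h: "strong_integrable \<mu> h"
    and le: "AE x in \<mu>. norm (g x) \<le> h x"
  shows "norm (cube_average \<mu> g A) \<le> cube_average \<mu> h A"
proof -
  have hi: "integrable \<mu> h" using h by (auto simp: strong_integrable_def strongly_measurable_iff_borel intro!: integrableI_bounded)
  have "norm (strong_integral \<mu> (\<lambda>x. indicator A x *\<^sub>R g x)) \<le> (LINT x|\<mu>. norm (indicator A x *\<^sub>R g x))"
    by (intro strong_integral_norm_le strong_integrable_indicator A g)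
  also have "\<dots> \<le> (LINT x|\<mu>. indicator A x *\<^sub>R h x)"
  proof (rule integral_mono_AE')
    show "integrable \<mu> (\<lambda>x. indicator A x *\<^sub>R h x)" using A hi by (intro integrable_mult_indicator)
    show "AE x in \<mu>. norm (indicator A x *\<^sub>R g x) \<le> indicator A x *\<^sub>R h x"
      using le by eventually_elim (auto simp: indicator_def)
    show "AE x in \<mu>. 0 \<le> indicator A x *\<^sub>R h x"
      using le by eventually_elim (auto simp: indicator_def intro: order_trans[OF norm_ge_zero])
  qed
  finally show ?thesis
    unfolding cube_average_def strong_integral_eq_lebesgue_integral[symmetric]
    by (simp add: mult_left_mono)
qed

lemma cube_average_one: "cube_average \<mu> (\<lambda>_. 1::real) A \<le> 1" if "A \<in> sets \<mu>"
  using that by (simp add: cube_average_def strong_integral_eq_lebesgue_integral)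
    (cases "measure \<mu> A = 0"; simp)

lemma set_integral_average:
  assumes "measure \<mu> A \<noteq> 0"
  shows "cmod (LINT x:A|\<mu>. b R x) = measure \<mu> A * cmod (cube_average \<mu> (b R) A)"
  using strong_integral_average[OF assms, of "b R"]
  by (simp add: set_lebesgue_integral_def strong_integral_eq_lebesgue_integral)

text \<open>Either the cube is its own ancestor and accretivity applies, or it is not a stopping candidate
  for its ancestor.\<close>

lemma average_b_ge:
  assumes x: "x \<in> Q\<^sub>0" and pos: "0 < measure \<mu> (Q i x)"
  shows "\<delta>\<^sup>2 \<le> cmod (cube_average \<mu> (b (anc (Q i x))) (Q i x))"
    and "anc (Q i x) = Q i x \<Longrightarrow> \<delta> \<le> cmod (cube_average \<mu> (b (anc (Q i x))) (Q i x))"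
proof -
  have ge: "\<delta> \<le> cmod (cube_average \<mu> (b (anc (Q i x))) (Q i x))" if e: "anc (Q i x) = Q i x"
    using b_ge[OF Q_cubes, of i x] set_integral_average[of "Q i x" "Q i x"] pos e by (simp add: mult.commute)
  then show "anc (Q i x) = Q i x \<Longrightarrow> \<delta> \<le> cmod (cube_average \<mu> (b (anc (Q i x))) (Q i x))" .
  show "\<delta>\<^sup>2 \<le> cmod (cube_average \<mu> (b (anc (Q i x))) (Q i x))"
  proof (cases "anc (Q i x) = Q i x")
    case True
    have "\<delta>\<^sup>2 \<le> \<delta>" using \<delta> by (simp add: power2_eq_square mult_left_le)
    then show ?thesis using ge[OF True] by linarith
  next
    case False
    then have "Q i x \<subset> anc (Q i x)" using anc_layers[OF x, of i] by auto
    then have "\<not> cmod (LINT y:Q i x|\<mu>. b (anc (Q i x)) y) < \<delta>\<^sup>2 * measure \<mu> (Q i x)"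
      using not_cand_anc[OF x, of i] by (simp add: stopping_candidates_def)
    then show ?thesis
      using set_integral_average[of "Q i x" "anc (Q i x)"] pos by (simp add: mult.commute not_less)
  qed
qed

lemma average_b_small:
  assumes x: "x \<in> Q\<^sub>0" and pos: "0 < measure \<mu> (Q (Suc i) x)" and L: "Q (Suc i) x \<in> layers"
  shows "cmod (cube_average \<mu> (b (anc (Q i x))) (Q (Suc i) x)) \<le> \<delta>\<^sup>2"
  using layer_cand_anc[OF x L] set_integral_average[of "Q (Suc i) x" "anc (Q i x)"] pos
  by (simp add: stopping_candidates_def mult.commute)

subsection \<open>The operators on cubes\<close>

lemma dyadic_sum:
  fixes v :: "(real ^ 'n) set \<Rightarrow> 'v::real_normed_vector"
  shows "(\<Sum>\<^sub>\<infinity>R\<in>dyadic \<beta> k. indicator R x *\<^sub>R v R) = v (cube k x)"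
proof -
  have "(\<Sum>\<^sub>\<infinity>R\<in>dyadic \<beta> k. indicator R x *\<^sub>R v R) = (\<Sum>\<^sub>\<infinity>R\<in>{cube k x}. v R)"
  proof (rule infsum_cong_neutral)
    fix R assume "R \<in> dyadic \<beta> k - {cube k x}"
    then have "x \<notin> R" using cube_eq[of x k] by (auto simp: dyadic_eq)
    then show "indicator R x *\<^sub>R v R = 0" by simp
  qed (auto simp: dyadic_eq)
  then show ?thesis by simp
qed

lemma dyadic_expectation_eq: "dyadic_expectation \<mu> \<beta> k g x = cube_average \<mu> g (cube k x)"
  unfolding dyadic_expectation_def by (rule dyadic_sum)

lemma b_anc_eq: "b_anc \<mu> \<beta> b \<delta> Q\<^sub>0 k x = b (anc (cube k x)) x"
  unfolding b_anc_def by (rule dyadic_sum)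

lemma E_adj_eq: "E_adj \<mu> \<beta> b \<delta> Q\<^sub>0 k f x = inverse (cube_average \<mu> (b (anc (cube k x))) (cube k x)) *\<^sub>C
    cube_average \<mu> (\<lambda>y. b (anc (cube k x)) y *\<^sub>C f y) (cube k x)"
proof -
  have b: "b_anc \<mu> \<beta> b \<delta> Q\<^sub>0 k y = b (anc (cube k x)) y" if "y \<in> cube k x" for y
    using cube_eq[OF that] by (simp add: b_anc_eq)
  show ?thesis
    unfolding E_adj_def dyadic_expectation_eq
    by (intro arg_cong2[where f="\<lambda>z v. inverse z *\<^sub>C v"] cube_average_cong) (simp_all add: b)
qed

lemma cube_above:
  assumes "x \<in> Q\<^sub>0" "k0 \<le> k"
  shows "Q\<^sub>0 \<subseteq> cube k x"
  using cube_mono[OF assms(2), of x] assms(1) by (simp add: Q0 cube_eq)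

text \<open>Above \<open>Q\<^sub>0\<close> the accretive function is that of \<open>Q\<^sub>0\<close>, and all averages are over the same set up to
  null sets.\<close>

lemma E_adj_above:
  fixes f :: "real ^ 'n \<Rightarrow> 'x::complex_banach"
  assumes x: "x \<in> Q\<^sub>0" and k: "k0 \<le> k" and f: "strong_integrable \<mu> f"
  shows "E_adj \<mu> \<beta> b \<delta> Q\<^sub>0 k f x = E_adj \<mu> \<beta> b \<delta> Q\<^sub>0 k0 f x"
proof -
  have anc: "anc (cube l x) = Q\<^sub>0" if "k0 \<le> l" for l
    using cube_above[OF x that] anc_Q0 anc_above[of "cube l x"] by (cases "cube l x \<subseteq> Q\<^sub>0") auto
  have int: "cube_average \<mu> g (cube l x) = cube_average \<mu> g Q\<^sub>0"
    if l: "k0 \<le> l" and g: "strong_integrable \<mu> g" for l and g :: "_ \<Rightarrow> 'v::banach"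
  proof -
    have sub: "Q\<^sub>0 \<subseteq> cube l x" by (rule cube_above[OF x l])
    have s: "Q\<^sub>0 \<in> sets \<mu>" by (simp add: Q0)
    have "AE y in \<mu>. indicator (cube l x) y *\<^sub>R g y = indicator Q\<^sub>0 y *\<^sub>R g y"
      using AE_Q0 by eventually_elim (use sub in \<open>auto simp: indicator_def\<close>)
    then have "strong_integral \<mu> (\<lambda>y. indicator (cube l x) y *\<^sub>R g y) = strong_integral \<mu> (\<lambda>y. indicator Q\<^sub>0 y *\<^sub>R g y)"
      using s by (intro strong_integral_cong_AE strong_integrable_indicator g) auto
    moreover have "measure \<mu> (cube l x) = measure \<mu> Q\<^sub>0"
      using AE_Q0 s by (intro finite_measure_eq_AE) (use sub in \<open>auto elim!: eventually_mono\<close>)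
    ultimately show ?thesis by (simp add: cube_average_def)
  qed
  have Q0c: "Q\<^sub>0 \<in> cubes" by (simp add: Q0 cube_in_cubes)
  show ?thesis
    unfolding E_adj_eq anc[OF k] anc[OF order_refl]
    by (simp add: int k strong_integrable_b[OF Q0c] strong_integrable_b_scaleC[OF Q0c f])
qed

lemma D_adj_above:
  fixes f :: "real ^ 'n \<Rightarrow> 'x::complex_banach"
  assumes "x \<in> Q\<^sub>0" "k0 < k" "strong_integrable \<mu> f"
  shows "D_adj \<mu> \<beta> b \<delta> Q\<^sub>0 k f x = 0"
  unfolding D_adj_def using E_adj_above[of x k f] E_adj_above[of x "k - 1" f] assms by simp

lemma finite_leaves: "finite {Q n x | x. x \<in> Q\<^sub>0}" for n
proof -
  have "{Q n x | x. x \<in> Q\<^sub>0} \<subseteq> (\<lambda>m. {y. idx (k0 - int n) y = m}) ` (idx (k0 - int n) ` cube k0 x0)"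
    by (auto simp: Q_def cube_def Q0)
  then show ?thesis by (rule finite_subset) (intro finite_imageI finite_descendants)
qed

lemma Q_finer: "Q k x = Q k y \<Longrightarrow> i \<le> k \<Longrightarrow> Q i x = Q i y"
  using Q_eq[of x i y] Q_subset_iff[of k x i] Q_subset_iff[of k y i] self_Q[of x k] by auto

end

subsection \<open>Leaves\<close>

locale leaves = dyadic_measure \<beta> \<mu> b \<delta> Q\<^sub>0 k0 x0
  for \<beta> :: "int \<Rightarrow> real ^ 'n::finite" and \<mu> b \<delta> Q\<^sub>0 k0 x0 +
  fixes n :: nat
begin

text \<open>Each cube of the last level with positive measure is represented by one of its points.\<close>

definition \<Omega> :: "(real ^ 'n) set" where
  "\<Omega> = (\<lambda>S. SOME x. x \<in> S) ` {Q n x | x. x \<in> Q\<^sub>0 \<and> 0 < measure \<mu> (Q n x)}"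

definition wt :: "real ^ 'n \<Rightarrow> real" where "wt x = measure \<mu> (Q n x)"

lemma finite_\<Omega>': "finite \<Omega>"
proof -
  have "{Q n x | x. x \<in> Q\<^sub>0 \<and> 0 < measure \<mu> (Q n x)} \<subseteq> {Q n x | x. x \<in> Q\<^sub>0}" by blast
  from finite_subset[OF this finite_leaves] show ?thesis unfolding \<Omega>_def by (rule finite_imageI)
qed

lemma some_Q: "(SOME y. y \<in> Q n x) \<in> Q n x"
  by (rule someI[of _ x]) simp

lemma \<Omega>D: assumes "x \<in> \<Omega>" shows "x \<in> Q\<^sub>0" "0 < wt x"
proof -
  obtain z where z: "z \<in> Q\<^sub>0" "0 < measure \<mu> (Q n z)" "x = (SOME y. y \<in> Q n z)"
    using assms by (auto simp: \<Omega>_def)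
  then have "x \<in> Q n z" using some_Q by simp
  then show "x \<in> Q\<^sub>0" "0 < wt x"
    using Q_eq[of x n z] Q_subset_Q0[OF z(1), of n] z by (auto simp: wt_def)
qed

lemma \<Omega>_unique: "x \<in> \<Omega> \<Longrightarrow> y \<in> \<Omega> \<Longrightarrow> Q n x = Q n y \<Longrightarrow> x = y"
proof -
  assume xy: "x \<in> \<Omega>" "y \<in> \<Omega>" and eq: "Q n x = Q n y"
  have "x = (SOME z. z \<in> Q n x)" if "x \<in> \<Omega>" for x
  proof -
    obtain z where z: "x = (SOME y. y \<in> Q n z)" using \<open>x \<in> \<Omega>\<close> by (auto simp: \<Omega>_def)
    then have "Q n x = Q n z" using some_Q Q_eq by metis
    then show ?thesis using z by simp
  qed
  from this[OF xy(1)] this[OF xy(2)] eq show ?thesis by simp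
qed

lemma \<Omega>_rep: "x \<in> Q\<^sub>0 \<Longrightarrow> 0 < measure \<mu> (Q n x) \<Longrightarrow> \<exists>y\<in>\<Omega>. Q n y = Q n x"
  using Q_eq[OF some_Q[of x]] by (auto simp: \<Omega>_def)

lemma AE_leaf: "AE x in \<mu>. x \<in> Q\<^sub>0 \<and> 0 < measure \<mu> (Q n x)"
proof -
  let ?N = "{Q n x | x. x \<in> Q\<^sub>0 \<and> measure \<mu> (Q n x) = 0}"
  have fin: "finite ?N" by (rule finite_subset[OF _ finite_leaves]) blast
  have "(\<Union>S\<in>?N. S) \<in> null_sets \<mu>"
    using fin by (intro null_sets_UN' countable_finite) (auto simp: null_sets_def emeasure_eq_measure)
  then have "AE x in \<mu>. x \<notin> (\<Union>S\<in>?N. S)" by (rule AE_not_in)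
  with AE_Q0 show ?thesis
  proof eventually_elim
    case (elim x)
    then have "measure \<mu> (Q n x) \<noteq> 0" by auto
    then show ?case using elim by (simp add: zero_less_measure_iff)
  qed
qed

sublocale filtered_set \<Omega> wt Q n
proof
  show "finite \<Omega>" by (rule finite_\<Omega>')
  show "0 \<le> wt x" for x by (simp add: wt_def)
  show "Q k x = Q k y" if "Q (Suc k) x = Q (Suc k) y" for k x y
    by (rule Q_finer[OF that]) simp
qed

lemma sum_indicator_leaves:
  assumes y: "y \<in> \<Omega>" and z: "Q n y = Q n z" and B: "y \<in> B" "B \<subseteq> \<Omega>"
  shows "(\<Sum>u\<in>B. indicator (Q n u) z *\<^sub>R v u) = (v y :: 'v::real_vector)"
proof -
  have "indicator (Q n u) z *\<^sub>R v u = (if u = y then v y else 0)" if "u \<in> B" for u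
  proof (cases "z \<in> Q n u")
    case True
    then have "Q n u = Q n y" using Q_eq[of z n u] z by simp
    then have "u = y" using \<Omega>_unique that B y by auto
    then show ?thesis using True by simp
  next
    case False
    have "u \<noteq> y"
    proof
      assume "u = y"
      then have "z \<in> Q n u" by (simp only: z self_Q)
      with False show False by contradiction
    qed
    then show ?thesis using False by simp
  qed
  then have "(\<Sum>u\<in>B. indicator (Q n u) z *\<^sub>R v u) = (\<Sum>u\<in>B. if u = y then v y else 0)"
    by (intro sum.cong) auto
  then show ?thesis using B finite_subset[OF B(2)] by simp
qed

text \<open>Almost every point of the cube lies in exactly one of the leaves.\<close>

lemma leaf_sum:
  fixes g :: "_ \<Rightarrow> 'v::banach"
  assumes x: "x \<in> \<Omega>" and i: "i \<le> n" and g: "strong_integrable \<mu> g"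
  shows "(\<Sum>y\<in>block i x. wt y *\<^sub>R cube_average \<mu> g (Q n y)) = measure \<mu> (Q i x) *\<^sub>R cube_average \<mu> g (Q i x)"
proof -
  have mono: "measure \<mu> (Q n x) \<le> measure \<mu> (Q i x)"
    using i by (intro finite_measure_mono) (simp_all add: Q_subset_iff)
  then have pos: "0 < measure \<mu> (Q i x)" using \<Omega>D(2)[OF x] by (simp add: wt_def)
  have hs: "has_strong_integral \<mu> (\<lambda>z. \<Sum>y\<in>block i x. indicator (Q n y) z *\<^sub>R g z) (\<Sum>y\<in>block i x. strong_integral \<mu> (\<lambda>z. indicator (Q n y) z *\<^sub>R g z))"
    by (intro has_strong_integral_sum strong_integrable_has_strong_integral strong_integrable_indicator g) auto
  have "strong_integral \<mu> (\<lambda>z. indicator (Q i x) z *\<^sub>R g z) = strong_integral \<mu> (\<lambda>z. \<Sum>y\<in>block i x. indicator (Q n y) z *\<^sub>R g z)"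
  proof (rule strong_integral_cong_AE)
    show "strong_integrable \<mu> (\<lambda>z. indicator (Q i x) z *\<^sub>R g z)"
      by (intro strong_integrable_indicator g) auto
    have "strong_integrable \<mu> (\<lambda>z. \<Sum>y\<in>B. indicator (Q n y) z *\<^sub>R g z)" if "finite B" for B
      using that
    proof (induction B rule: finite_induct)
      case (insert u B)
      show ?case
        unfolding sum.insert[OF insert.hyps]
        by (intro strong_integrable_add strong_integrable_indicator g insert.IH) simp
    qed (simp add: strong_integrable_const)
    then show "strong_integrable \<mu> (\<lambda>z. \<Sum>y\<in>block i x. indicator (Q n y) z *\<^sub>R g z)" by simp
    show "AE z in \<mu>. indicator (Q i x) z *\<^sub>R g z = (\<Sum>y\<in>block i x. indicator (Q n y) z *\<^sub>R g z)"
      using AE_leaf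
    proof eventually_elim
      case (elim z)
      then obtain y where y: "y \<in> \<Omega>" "Q n y = Q n z" using \<Omega>_rep by blast
      then have yi: "Q i y = Q i z" using Q_finer i by blast
      show ?case
      proof (cases "z \<in> Q i x")
        case True
        then have "y \<in> block i x" using y yi Q_eq[OF True] by (simp add: block_def)
        moreover have "block i x \<subseteq> \<Omega>" using block_subset by blast
        ultimately show ?thesis
          using sum_indicator_leaves[OF y, of "block i x" "\<lambda>_. g z"] True by simp
      next
        case False
        have "z \<notin> Q n u" if "u \<in> block i x" for u
        proof
          assume "z \<in> Q n u"
          then have "Q n z = Q n u" by (rule Q_eq)
          then have "Q i z = Q i x" using Q_finer[of n z u i] i that by (simp add: block_def)
          then show False using False self_Q[of z i] by simp
        qed
        then show ?thesis using False by simp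
      qed
    qed
  qed
  then have "strong_integral \<mu> (\<lambda>z. indicator (Q i x) z *\<^sub>R g z) = (\<Sum>y\<in>block i x. strong_integral \<mu> (\<lambda>z. indicator (Q n y) z *\<^sub>R g z))"
    by (simp only: strong_integral_eqI[OF hs])
  moreover have "strong_integral \<mu> (\<lambda>z. indicator (Q n y) z *\<^sub>R g z) = wt y *\<^sub>R cube_average \<mu> g (Q n y)" if "y \<in> block i x" for y
    using strong_integral_average[of "Q n y" g] \<Omega>D(2)[OF block_subset[OF that]] by (simp add: wt_def)
  ultimately show ?thesis
    using strong_integral_average[of "Q i x" g] pos by simp
qed

lemma wt_block: "x \<in> \<Omega> \<Longrightarrow> i \<le> n \<Longrightarrow> (\<Sum>y\<in>block i x. wt y) = measure \<mu> (Q i x)"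
proof -
  assume x: "x \<in> \<Omega>" and i: "i \<le> n"
  have one: "cube_average \<mu> (\<lambda>_. 1::real) (Q i y) = 1" if "y \<in> \<Omega>" "i \<le> n" for i y
  proof -
    have "measure \<mu> (Q n y) \<le> measure \<mu> (Q i y)"
      using that by (intro finite_measure_mono) (simp_all add: Q_subset_iff)
    then show ?thesis
      using \<Omega>D(2)[OF that(1)] by (simp add: cube_average_def strong_integral_eq_lebesgue_integral wt_def)
  qed
  have "(\<Sum>y\<in>block i x. wt y *\<^sub>R cube_average \<mu> (\<lambda>_. 1::real) (Q n y)) = measure \<mu> (Q i x) *\<^sub>R cube_average \<mu> (\<lambda>_. 1::real) (Q i x)"
    by (rule leaf_sum[OF x i strong_integrable_const])
  then show ?thesis using one[OF x i] one[OF block_subset] by simp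
qed

lemma pos_Q: "x \<in> \<Omega> \<Longrightarrow> i \<le> n \<Longrightarrow> 0 < measure \<mu> (Q i x)"
proof -
  assume x: "x \<in> \<Omega>" and "i \<le> n"
  then have "measure \<mu> (Q n x) \<le> measure \<mu> (Q i x)"
    by (intro finite_measure_mono) (simp_all add: Q_subset_iff)
  then show ?thesis using \<Omega>D(2)[OF x] by (simp add: wt_def)
qed

lemma block_average:
  fixes g :: "_ \<Rightarrow> 'v::banach"
  assumes x: "x \<in> \<Omega>" and ik: "i \<le> k" "k \<le> n" and g: "strong_integrable \<mu> g"
  shows "(\<Sum>y\<in>block i x. wt y *\<^sub>R cube_average \<mu> g (Q k y)) = measure \<mu> (Q i x) *\<^sub>R cube_average \<mu> g (Q i x)"
proof -
  have i: "i \<le> n" using ik by simp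
  have "centred k (\<lambda>y. cube_average \<mu> g (Q k y) - cube_average \<mu> g (Q n y))"
    unfolding centred_def
  proof
    fix z assume z: "z \<in> \<Omega>"
    have "Q k y = Q k z" if "y \<in> block k z" for y using that by (simp add: block_def)
    then have "(\<Sum>y\<in>block k z. wt y *\<^sub>R cube_average \<mu> g (Q k y)) = (\<Sum>y\<in>block k z. wt y) *\<^sub>R cube_average \<mu> g (Q k z)"
      by (simp add: scaleR_sum_left cong: sum.cong)
    then show "(\<Sum>y\<in>block k z. wt y *\<^sub>R (cube_average \<mu> g (Q k y) - cube_average \<mu> g (Q n y))) = 0"
      by (simp add: scaleR_diff_right sum_subtractf leaf_sum[OF z ik(2) g] wt_block[OF z ik(2)])
  qed
  from sum_block_centred[OF ik x this]
  have "(\<Sum>y\<in>block i x. wt y *\<^sub>R cube_average \<mu> g (Q k y)) = (\<Sum>y\<in>block i x. wt y *\<^sub>R cube_average \<mu> g (Q n y))"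
    by (simp add: scaleR_diff_right sum_subtractf)
  then show ?thesis by (simp add: leaf_sum[OF x i g])
qed

lemma average_centred:
  fixes g :: "(real ^ 'n) set \<Rightarrow> _ \<Rightarrow> 'v::banach"
  assumes i: "i < n" and g: "\<And>x. x \<in> \<Omega> \<Longrightarrow> strong_integrable \<mu> (g (Q i x))"
  shows "centred i (\<lambda>x. cube_average \<mu> (g (Q i x)) (Q (Suc i) x) - cube_average \<mu> (g (Q i x)) (Q i x))"
  unfolding centred_def
proof
  fix x assume x: "x \<in> \<Omega>"
  have e: "Q i y = Q i x" if "y \<in> block i x" for y using that by (simp add: block_def)
  have "(\<Sum>y\<in>block i x. wt y *\<^sub>R (cube_average \<mu> (g (Q i y)) (Q (Suc i) y) - cube_average \<mu> (g (Q i y)) (Q i y)))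
    = (\<Sum>y\<in>block i x. wt y *\<^sub>R cube_average \<mu> (g (Q i x)) (Q (Suc i) y)) - (\<Sum>y\<in>block i x. wt y *\<^sub>R cube_average \<mu> (g (Q i x)) (Q i y))"
    unfolding sum_subtractf[symmetric] by (intro sum.cong refl) (simp only: e scaleR_diff_right)
  also have "\<dots> = 0"
    using block_average[OF x, of i "Suc i" "g (Q i x)"] block_average[OF x, of i i "g (Q i x)"] i g[OF x] by simp
  finally show "(\<Sum>y\<in>block i x. wt y *\<^sub>R (cube_average \<mu> (g (Q i y)) (Q (Suc i) y) - cube_average \<mu> (g (Q i y)) (Q i y))) = 0" .
qed

lemma adapted_Q: "(\<And>x y. Q i x = Q i y \<Longrightarrow> h x = h y) \<Longrightarrow> adapted i h"
  by (rule adaptedI)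

text \<open>The leaves with their measures form a filtered finite set. On it the averages of the accretive
  functions and of their products with \<open>f\<close> are a pair \<open>c\<close>, \<open>a\<close> as above, with stopping cubes as
  accretive stops, and the adjoint operators are the quotients \<open>a / c\<close>.\<close>

lemma leaf_estimate:
  fixes f :: "real ^ 'n \<Rightarrow> 'x::complex_banach"
  assumes f: "strong_integrable \<mu> f" and p: "1 < p" and U: "1 \<le> U"
    and UMD_ineq: "\<And>(d :: nat \<Rightarrow> real ^ 'n \<Rightarrow> 'x) \<sigma>. (\<And>k. k < n \<Longrightarrow> adapted (Suc k) (d k)) \<Longrightarrow>
      (\<And>k. k < n \<Longrightarrow> centred k (d k)) \<Longrightarrow> (\<And>k. \<sigma> k \<in> {-1, 1}) \<Longrightarrow>
      (\<Sum>x\<in>\<Omega>. wt x * norm (\<Sum>k<n. \<sigma> k *\<^sub>R d k x) powr p) \<le> U * (\<Sum>x\<in>\<Omega>. wt x * norm (\<Sum>k<n. d k x) powr p)"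
    and params: "1 < \<rho>" "0 < A" "0 \<le> C1" "0 \<le> C2" "1 + \<rho> * C1 + \<rho> * C2 / A \<le> C2"
      "1 + \<rho> * C1 * ((1 - \<delta>) / (1 - \<delta>\<^sup>2)) + \<rho> * C2 / A \<le> C1"
  shows "(\<Sum>x\<in>\<Omega>. wt x * sign_avg {..<n} (\<lambda>\<sigma>. norm (\<Sum>i<n. \<sigma> i *\<^sub>R D_adj \<mu> \<beta> b \<delta> Q\<^sub>0 (k0 - int i) f x) powr p))
    \<le> gen_const \<rho> p * (\<rho> * C2) * generation_const p A U (\<delta>\<^sup>2) * (3 powr p * (2 * carleson_const \<rho> p C2 + 1))
     * (\<Sum>x\<in>\<Omega>. wt x * cube_average \<mu> (\<lambda>y. norm (f y)) (Q n x) powr p)"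
proof -
  define acc where "acc i x \<longleftrightarrow> Q i x \<in> layers" for i x
  define c where "c i x = cube_average \<mu> (b (anc (Q i x))) (Q i x)" for i x
  define c' where "c' i x = cube_average \<mu> (b (anc (Q i x))) (Q (Suc i) x)" for i x
  define a where "a i x = cube_average \<mu> (\<lambda>y. b (anc (Q i x)) y *\<^sub>C f y) (Q i x)" for i x
  define a' where "a' i x = cube_average \<mu> (\<lambda>y. b (anc (Q i x)) y *\<^sub>C f y) (Q (Suc i) x)" for i x
  define F where "F i x = cube_average \<mu> (\<lambda>y. norm (f y)) (Q i x)" for i x
  have R: "anc (Q i x) \<in> cubes" if "x \<in> \<Omega>" for i x using anc_cubes \<Omega>D(1)[OF that] by simp
  have nf: "strong_integrable \<mu> (\<lambda>y. norm (f y))"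
    using f borel_measurable_norm_strongly_measurable[of \<mu> f]
    by (simp add: strong_integrable_def strongly_measurable_iff_borel)
  have keep: "anc (Q (Suc i) x) = anc (Q i x)" if "x \<in> \<Omega>" "\<not> acc (Suc i) x" for i x
    using anc_Suc[OF \<Omega>D(1)[OF that(1)]] that(2) by (simp add: acc_def)
  have b1: "norm (cube_average \<mu> (b (anc (Q i x))) S) \<le> 1" if "x \<in> \<Omega>" "S \<in> sets \<mu>" for i x S
    by (rule order_trans[OF cube_average_norm_le[OF that(2) strong_integrable_b[OF R] strong_integrable_const b_le[OF R]] cube_average_one])
       (use that in auto)
  have a1: "norm (cube_average \<mu> (\<lambda>y. b (anc (Q i x)) y *\<^sub>C f y) S) \<le> cube_average \<mu> (\<lambda>y. norm (f y)) S"
    if "x \<in> \<Omega>" "S \<in> sets \<mu>" for i x S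
  proof (rule cube_average_norm_le[OF that(2) strong_integrable_b_scaleC[OF R[OF that(1)] f] nf])
    show "AE y in \<mu>. norm (b (anc (Q i x)) y *\<^sub>C f y) \<le> norm (f y)"
      using b_le[OF R[OF that(1), of i]] by eventually_elim (auto simp: norm_scaleC mult_left_le_one_le)
  qed
  have Suc_eq: "Q i x = Q i y" if "Q (Suc i) x = Q (Suc i) y" for i x y
    by (rule Q_finer[OF that]) simp
  interpret accretive_martingale \<Omega> wt Q n acc c c' \<delta> "\<delta>\<^sup>2" A \<rho> C1 C2 a a' F p U
  proof unfold_locales
    fix i
    show "adapted i (acc i)" by (rule adapted_Q) (simp add: acc_def)
    show "adapted i (c i)" by (rule adapted_Q) (simp add: c_def)
    show "adapted i (a i)" by (rule adapted_Q) (simp add: a_def)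
    show "adapted i (F i)" by (rule adapted_Q) (simp add: F_def)
    show "adapted (Suc i) (c' i)"
    proof (rule adapted_Q)
      fix x y assume e: "Q (Suc i) x = Q (Suc i) y"
      show "c' i x = c' i y" unfolding c'_def e Suc_eq[OF e] ..
    qed
    show "adapted (Suc i) (a' i)"
    proof (rule adapted_Q)
      fix x y assume e: "Q (Suc i) x = Q (Suc i) y"
      show "a' i x = a' i y" unfolding a'_def e Suc_eq[OF e] ..
    qed
  next
    show "acc 0 x" if "x \<in> \<Omega>" for x using Q_0[OF \<Omega>D(1)[OF that]] Q0_layers by (simp add: acc_def)
  next
    fix i assume i: "i < n"
    show "centred i (\<lambda>x. c' i x - c i x)"
      unfolding c_def c'_def using average_centred[OF i, of "\<lambda>S. b (anc S)"] strong_integrable_b[OF R] by blast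
    show "centred i (\<lambda>x. a' i x - a i x)"
      unfolding a_def a'_def using average_centred[OF i, of "\<lambda>S y. b (anc S) y *\<^sub>C f y"] strong_integrable_b_scaleC[OF R f] by blast
  next
    fix i x assume i: "i < n" and x: "x \<in> \<Omega>"
    show "c (Suc i) x = c' i x" if "\<not> acc (Suc i) x" by (simp add: c_def c'_def keep[OF x that])
    show "a (Suc i) x = a' i x" if "\<not> acc (Suc i) x" by (simp add: a_def a'_def keep[OF x that])
    show "cmod (c' i x) \<le> 1" unfolding c'_def by (rule b1[OF x]) simp
    show "norm (a' i x) \<le> F (Suc i) x" unfolding a'_def F_def by (rule a1[OF x]) simp
    show "cmod (c' i x) \<le> \<delta>\<^sup>2" if "acc (Suc i) x"
      unfolding c'_def using average_b_small[OF \<Omega>D(1)[OF x] pos_Q[OF x]] i that by (simp add: acc_def)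
  next
    fix i x assume i: "i \<le> n" and x: "x \<in> \<Omega>"
    show "cmod (c i x) \<le> 1" unfolding c_def by (rule b1[OF x]) simp
    show "norm (a i x) \<le> F i x" unfolding a_def F_def by (rule a1[OF x]) simp
    show "\<delta>\<^sup>2 \<le> cmod (c i x)" unfolding c_def by (rule average_b_ge(1)[OF \<Omega>D(1)[OF x] pos_Q[OF x i]])
    show "\<delta> \<le> cmod (c i x)" if "acc i x"
    proof -
      have "anc (Q i x) = Q i x"
        using that anc_Suc[OF \<Omega>D(1)[OF x]] anc_0[OF \<Omega>D(1)[OF x]] Q_0[OF \<Omega>D(1)[OF x]]
        by (cases i) (auto simp: acc_def)
      then show ?thesis unfolding c_def by (rule average_b_ge(2)[OF \<Omega>D(1)[OF x] pos_Q[OF x i]])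
    qed
    show "(\<Sum>y\<in>block i x. wt y * F i y) \<le> (\<Sum>y\<in>block i x. wt y * F n y)"
      using block_average[OF x order_refl i nf] block_average[OF x i order_refl nf] by (simp add: F_def)
  next
    show "0 < \<delta>\<^sup>2" "\<delta>\<^sup>2 < 1" using \<delta> by (auto simp: power_less_one_iff)
  qed (use p U params UMD_ineq in auto)
  have E: "E_adj \<mu> \<beta> b \<delta> Q\<^sub>0 (k0 - int i) f x = quotient i x" for i x
    by (simp add: E_adj_eq quotient_def c_def a_def Q_def)
  have D: "D_adj \<mu> \<beta> b \<delta> Q\<^sub>0 (k0 - int i) f x = quotient (Suc i) x - quotient i x" for i x
    unfolding D_adj_def using E[of i x] E[of "Suc i" x] by (simp add: algebra_simps)
  show ?thesis
    using quotient_differences_estimate unfolding D F_def .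
qed

end

section \<open>Random signs\<close>

lemma AE_random_signs:
  assumes "random_signs P \<epsilon>"
  shows "AE w in P. \<epsilon> k w \<in> {-1, 1}"
proof -
  interpret prob_space P using assms by (simp add: random_signs_def)
  have m [measurable]: "\<epsilon> k \<in> borel_measurable P"
    using assms by (auto simp: random_signs_def indep_vars_def)
  have pr: "prob {w \<in> space P. \<epsilon> k w = 1} = 1/2" "prob {w \<in> space P. \<epsilon> k w = -1} = 1/2"
    using assms by (auto simp: random_signs_def)
  have "prob ({w \<in> space P. \<epsilon> k w = 1} \<union> {w \<in> space P. \<epsilon> k w = -1}) = 1"
    by (subst finite_measure_Union) (auto simp: pr)
  then have "AE w in P. w \<in> {w \<in> space P. \<epsilon> k w = 1} \<union> {w \<in> space P. \<epsilon> k w = -1}"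
    by (subst (asm) prob_eq_1) auto
  then show ?thesis by eventually_elim auto
qed

lemma prob_random_signs:
  assumes rs: "random_signs P \<epsilon>" and I: "finite I" "inj_on \<kappa> I" and \<sigma>: "\<sigma> \<in> signs I"
  shows "measure P {w \<in> space P. \<forall>i\<in>I. \<epsilon> (\<kappa> i) w = \<sigma> i} = (1/2) ^ card I"
proof (cases "I = {}")
  case True
  have "prob_space P" using rs by (simp add: random_signs_def)
  then show ?thesis using True by (simp add: prob_space.prob_space)
next
  case False
  interpret prob_space P using rs by (simp add: random_signs_def)
  have ind: "indep_vars (\<lambda>_. borel) \<epsilon> UNIV" using rs by (simp add: random_signs_def)
  define A where "A k = {\<sigma> (inv_into I \<kappa> k)}" for k
  have A: "A (\<kappa> i) = {\<sigma> i}" if "i \<in> I" for i using I(2) that by (simp add: A_def)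
  have "{w \<in> space P. \<forall>i\<in>I. \<epsilon> (\<kappa> i) w = \<sigma> i} = (\<Inter>k\<in>\<kappa> ` I. \<epsilon> k -` A k \<inter> space P)"
    using False by (auto simp: A)
  also have "prob \<dots> = (\<Prod>k\<in>\<kappa> ` I. prob (\<epsilon> k -` A k \<inter> space P))"
    by (rule indep_varsD[OF ind]) (use False I in \<open>auto simp: A_def\<close>)
  also have "\<dots> = (\<Prod>i\<in>I. prob (\<epsilon> (\<kappa> i) -` {\<sigma> i} \<inter> space P))"
    using I(2) by (simp add: prod.reindex A)
  also have "\<dots> = (\<Prod>i\<in>I. 1/2)"
  proof (rule prod.cong[OF refl])
    fix i assume "i \<in> I"
    then have s: "\<sigma> i = -1 \<or> \<sigma> i = 1" by (rule signsD[OF \<sigma>])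
    have "\<epsilon> (\<kappa> i) -` {\<sigma> i} \<inter> space P = {w \<in> space P. \<epsilon> (\<kappa> i) w = \<sigma> i}" by auto
    then show "prob (\<epsilon> (\<kappa> i) -` {\<sigma> i} \<inter> space P) = 1/2"
      using rs s by (auto simp: random_signs_def)
  qed
  finally show ?thesis by simp
qed

lemma expectation_random_signs:
  fixes v :: "'i \<Rightarrow> 'x::real_normed_vector"
  assumes rs: "random_signs P \<epsilon>" and I: "finite I" "inj_on \<kappa> I"
  shows "(\<integral>\<^sup>+w. ennreal (norm (\<Sum>i\<in>I. \<epsilon> (\<kappa> i) w *\<^sub>R v i) powr p) \<partial>P)
    = ennreal (sign_avg I (\<lambda>\<sigma>. norm (\<Sum>i\<in>I. \<sigma> i *\<^sub>R v i) powr p))"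
proof -
  interpret prob_space P using rs by (simp add: random_signs_def)
  have m [measurable]: "\<epsilon> k \<in> borel_measurable P" for k
    using rs by (auto simp: random_signs_def indep_vars_def)
  let ?E = "\<lambda>\<sigma>. {w \<in> space P. \<forall>i\<in>I. \<epsilon> (\<kappa> i) w = \<sigma> i}"
  let ?c = "\<lambda>\<sigma>. norm (\<Sum>i\<in>I. \<sigma> i *\<^sub>R v i) powr p"
  have E [measurable]: "?E \<sigma> \<in> sets P" for \<sigma> using I(1) by measurable
  have "AE w in P. \<forall>i\<in>I. \<epsilon> (\<kappa> i) w \<in> {-1, 1}"
    using I(1) AE_random_signs[OF rs] by (intro AE_finite_allI) auto
  then have "AE w in P. ennreal (norm (\<Sum>i\<in>I. \<epsilon> (\<kappa> i) w *\<^sub>R v i) powr p) = (\<Sum>\<sigma>\<in>signs I. ennreal (?c \<sigma>) * indicator (?E \<sigma>) w)"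
    using AE_space
  proof eventually_elim
    case (elim w)
    define \<tau> where "\<tau> = restrict (\<lambda>i. \<epsilon> (\<kappa> i) w) I"
    have \<tau>: "\<tau> \<in> signs I" using elim by (auto simp: \<tau>_def signs_def)
    have "indicator (?E \<sigma>) w = (of_bool (\<sigma> = \<tau>) :: ennreal)" if \<sigma>: "\<sigma> \<in> signs I" for \<sigma>
    proof -
      have "\<sigma> = \<tau>" if "\<forall>i\<in>I. \<epsilon> (\<kappa> i) w = \<sigma> i"
        by (rule PiE_ext[OF \<sigma>[unfolded signs_def] \<tau>[unfolded signs_def]]) (use that in \<open>auto simp: \<tau>_def\<close>)
      moreover have "\<forall>i\<in>I. \<epsilon> (\<kappa> i) w = \<tau> i" by (simp add: \<tau>_def)
      ultimately have "(\<forall>i\<in>I. \<epsilon> (\<kappa> i) w = \<sigma> i) \<longleftrightarrow> \<sigma> = \<tau>" by blast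
      then show ?thesis using elim by (simp add: indicator_def)
    qed
    then have "(\<Sum>\<sigma>\<in>signs I. ennreal (?c \<sigma>) * indicator (?E \<sigma>) w) = (\<Sum>\<sigma>\<in>signs I. if \<sigma> = \<tau> then ennreal (?c \<sigma>) else 0)"
      by (intro sum.cong) auto
    also have "\<dots> = ennreal (?c \<tau>)" using \<tau> finite_signs[OF I(1)] by simp
    also have "(\<Sum>i\<in>I. \<tau> i *\<^sub>R v i) = (\<Sum>i\<in>I. \<epsilon> (\<kappa> i) w *\<^sub>R v i)" by (intro sum.cong) (auto simp: \<tau>_def)
    finally show ?case by simp
  qed
  then have "(\<integral>\<^sup>+w. ennreal (norm (\<Sum>i\<in>I. \<epsilon> (\<kappa> i) w *\<^sub>R v i) powr p) \<partial>P)
     = (\<integral>\<^sup>+w. (\<Sum>\<sigma>\<in>signs I. ennreal (?c \<sigma>) * indicator (?E \<sigma>) w) \<partial>P)"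
    by (rule nn_integral_cong_AE)
  also have "\<dots> = (\<Sum>\<sigma>\<in>signs I. \<integral>\<^sup>+w. ennreal (?c \<sigma>) * indicator (?E \<sigma>) w \<partial>P)"
    by (rule nn_integral_sum) auto
  also have "\<dots> = (\<Sum>\<sigma>\<in>signs I. ennreal (?c \<sigma> * (1/2) ^ card I))"
    using prob_random_signs[OF rs I]
    by (intro sum.cong refl) (simp add: nn_integral_cmult_indicator emeasure_eq_measure ennreal_mult')
  also have "\<dots> = ennreal (\<Sum>\<sigma>\<in>signs I. ?c \<sigma> * (1/2) ^ card I)"
    by (rule sum_ennreal) auto
  also have "(\<Sum>\<sigma>\<in>signs I. ?c \<sigma> * (1/2) ^ card I) = sign_avg I ?c"
    by (simp add: sign_avg_def sum_divide_distrib power_one_over)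
  finally show ?thesis .
qed

section \<open>Unconditional convergence in $L^p$\<close>

lemma nn_powr_add_le:
  fixes f g :: "'a \<Rightarrow> 'x::real_normed_vector"
  assumes "strongly_measurable M f" "strongly_measurable M g" "0 \<le> p"
  shows "(\<integral>\<^sup>+z. ennreal (norm (f z + g z) powr p) \<partial>M)
    \<le> ennreal (2 powr p) * ((\<integral>\<^sup>+z. ennreal (norm (f z) powr p) \<partial>M) + (\<integral>\<^sup>+z. ennreal (norm (g z) powr p) \<partial>M))"
proof -
  have [measurable]: "(\<lambda>z. norm (f z)) \<in> borel_measurable M" "(\<lambda>z. norm (g z)) \<in> borel_measurable M"
    using assms by (auto intro: borel_measurable_norm_strongly_measurable)
  have "(\<integral>\<^sup>+z. ennreal (norm (f z + g z) powr p) \<partial>M)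
    \<le> (\<integral>\<^sup>+z. ennreal (2 powr p) * (ennreal (norm (f z) powr p) + ennreal (norm (g z) powr p)) \<partial>M)"
    using powr_norm_add_le[OF assms(3)]
    by (intro nn_integral_mono) (simp flip: ennreal_plus ennreal_mult')
  also have "\<dots> = ennreal (2 powr p) * ((\<integral>\<^sup>+z. ennreal (norm (f z) powr p) \<partial>M) + (\<integral>\<^sup>+z. ennreal (norm (g z) powr p) \<partial>M))"
    by (simp add: nn_integral_cmult nn_integral_add)
  finally show ?thesis .
qed

lemma nn_powr_diff_le:
  fixes f g :: "'a \<Rightarrow> 'x::real_normed_vector"
  assumes "strongly_measurable M f" "strongly_measurable M g" "strongly_measurable M h" "0 \<le> p"
  shows "(\<integral>\<^sup>+z. ennreal (norm (f z - h z) powr p) \<partial>M)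
    \<le> ennreal (2 powr p) * ((\<integral>\<^sup>+z. ennreal (norm (g z - f z) powr p) \<partial>M) + (\<integral>\<^sup>+z. ennreal (norm (g z - h z) powr p) \<partial>M))"
  using nn_powr_add_le[OF strongly_measurable_diff[OF assms(1,2)] strongly_measurable_diff[OF assms(2,3)] assms(4)]
  by (simp add: norm_minus_commute)

lemma ennreal_term_le_suminf: "f i \<le> (\<Sum>i. f i)" for f :: "nat \<Rightarrow> ennreal"
  using sum_le_suminf[of f "{i}"] by simp

text \<open>A fast $L^p$ Cauchy sequence of simple functions converges almost everywhere. Off a null set
  its limit is a pointwise limit of simple functions, hence strongly measurable.\<close>

lemma simple_functions_converge:
  fixes h :: "nat \<Rightarrow> 'a \<Rightarrow> 'x::banach"
  assumes h: "\<And>i. simple_function M (h i)" and p: "1 \<le> p" and B: "0 \<le> B"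
    and cauchy: "\<And>i. (\<integral>\<^sup>+z. ennreal (norm (h (Suc i) z - h i z) powr p) \<partial>M) \<le> ennreal (B * (1 / 4 powr p) ^ i)"
  obtains g where "strongly_measurable M g" "AE z in M. (\<lambda>i. h i z) \<longlonglongrightarrow> g z"
proof -
  let ?d = "\<lambda>i z. norm (h (Suc i) z - h i z)"
  have sd: "simple_function M (\<lambda>z. ?d i z)" for i
    by (rule simple_function_compose2[OF h h])
  then have [measurable]: "(\<lambda>z. ?d i z) \<in> borel_measurable M" for i
    by (rule borel_measurable_simple_function)
  \<comment> \<open>The weights \<open>2 ^ i\<close> on the increments of size \<open>4 ^ (- i)\<close> keep the series integrable, and turn a pointwise
    bound of its terms into summability of the increments.\<close>
  define r where "r = (1/2::real) powr p"
  have r: "0 < r" "r < 1" using powr_mono'[of 1 p "1/2"] p by (auto simp: r_def)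
  have pow: "(2 powr p) ^ i * (1 / 4 powr p) ^ i = r ^ i" for i
  proof -
    have "4 powr p = 2 powr p * 2 powr p" by (simp flip: powr_mult)
    then have "2 powr p * (1 / 4 powr p) = 1 / 2 powr p" by simp
    also have "\<dots> = r" by (simp add: r_def powr_divide)
    finally show ?thesis by (metis power_mult_distrib)
  qed
  have "(\<integral>\<^sup>+z. (\<Sum>i. ennreal ((2 powr p) ^ i * ?d i z powr p)) \<partial>M) = (\<Sum>i. \<integral>\<^sup>+z. ennreal ((2 powr p) ^ i * ?d i z powr p) \<partial>M)"
    by (rule nn_integral_suminf) auto
  also have "\<dots> \<le> (\<Sum>i. ennreal (B * r ^ i))"
  proof (rule suminf_le)
    fix i
    have "(\<integral>\<^sup>+z. ennreal ((2 powr p) ^ i * ?d i z powr p) \<partial>M) = ennreal ((2 powr p) ^ i) * (\<integral>\<^sup>+z. ennreal (?d i z powr p) \<partial>M)"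
      by (subst nn_integral_cmult[symmetric]) (auto simp: ennreal_mult')
    also have "\<dots> \<le> ennreal ((2 powr p) ^ i) * ennreal (B * (1 / 4 powr p) ^ i)"
      by (intro mult_left_mono cauchy) auto
    also have "\<dots> = ennreal (B * r ^ i)"
      unfolding pow[symmetric] using B by (subst ennreal_mult[symmetric]) (auto simp: mult.left_commute)
    finally show "(\<integral>\<^sup>+z. ennreal ((2 powr p) ^ i * ?d i z powr p) \<partial>M) \<le> ennreal (B * r ^ i)" .
  qed auto
  also have "\<dots> = ennreal (\<Sum>i. B * r ^ i)"
    using B r by (intro suminf_ennreal2 summable_mult summable_geometric) auto
  finally have "(\<integral>\<^sup>+z. (\<Sum>i. ennreal ((2 powr p) ^ i * ?d i z powr p)) \<partial>M) \<noteq> \<infinity>"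
    by (auto simp: top_unique)
  then have "AE z in M. (\<Sum>i. ennreal ((2 powr p) ^ i * ?d i z powr p)) \<noteq> \<infinity>"
    by (intro nn_integral_PInf_AE) auto
  then have conv: "AE z in M. convergent (\<lambda>i. h i z)"
  proof eventually_elim
    case (elim z)
    obtain S where S: "0 \<le> S" "(\<Sum>i. ennreal ((2 powr p) ^ i * ?d i z powr p)) = ennreal S"
    proof (cases "\<Sum>i. ennreal ((2 powr p) ^ i * ?d i z powr p)" rule: ennreal_cases)
      case (real r)
      then show thesis by (rule that)
    next
      case top
      with elim show thesis unfolding infinity_ennreal_def by contradiction
    qed
    have le: "?d i z \<le> S powr (1/p) * (1/2) ^ i" for i
    proof -
      have "ennreal ((2 powr p) ^ i * ?d i z powr p) \<le> ennreal S"
        unfolding S(2)[symmetric] by (rule ennreal_term_le_suminf)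
      then have "(2 powr p) ^ i * ?d i z powr p \<le> S" using S(1) by simp
      also have "(2 powr p) ^ i * ?d i z powr p = (2 ^ i * ?d i z) powr p"
        by (simp add: powr_mult powr_power powr_realpow[symmetric] powr_powr mult.commute)
      finally have "((2 ^ i * ?d i z) powr p) powr (1/p) \<le> S powr (1/p)"
        using p by (intro powr_mono2) auto
      then show ?thesis using p by (simp add: powr_powr field_simps)
    qed
    have "summable (\<lambda>i. S powr (1/p) * (1/2::real) ^ i)" by (intro summable_mult summable_geometric) auto
    then have "summable (\<lambda>i. h (Suc i) z - h i z)"
      by (rule summable_comparison_test[rotated]) (use le in auto)
    then have "(\<lambda>k. \<Sum>i<k. h (Suc i) z - h i z) \<longlonglongrightarrow> (\<Sum>i. h (Suc i) z - h i z)"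
      by (rule summable_LIMSEQ)
    then have "(\<lambda>k. h k z - h 0 z) \<longlonglongrightarrow> (\<Sum>i. h (Suc i) z - h i z)"
      using sum_lessThan_telescope[of "\<lambda>i. h i z"] by simp
    from tendsto_add[OF tendsto_const[of "h 0 z"] this]
    have "(\<lambda>k. h k z) \<longlonglongrightarrow> h 0 z + (\<Sum>i. h (Suc i) z - h i z)" by simp
    then show ?case by (auto simp: convergent_def)
  qed
  then obtain N where N: "{z \<in> space M. \<not> convergent (\<lambda>i. h i z)} \<subseteq> N" "emeasure M N = 0" "N \<in> sets M"
    by (rule AE_E)
  define g where "g z = (if z \<in> N then 0 else lim (\<lambda>i. h i z))" for z
  show thesis
  proof
    show "strongly_measurable M g"
      unfolding strongly_measurable_def
    proof (intro exI[of _ "\<lambda>i z. if z \<in> N then 0 else h i z"] conjI allI ballI)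
      show "simple_function M (\<lambda>z. if z \<in> N then 0 else h i z)" for i
        by (rule simple_function_If_set) (use h N in auto)
      show "(\<lambda>i. if z \<in> N then 0 else h i z) \<longlonglongrightarrow> g z" if "z \<in> space M" for z
        using N(1) that convergent_LIMSEQ_iff[of "\<lambda>i. h i z"] by (auto simp: g_def)
    qed
    have "AE z in M. z \<notin> N" using N by (intro AE_not_in) auto
    then show "AE z in M. (\<lambda>i. h i z) \<longlonglongrightarrow> g z"
      using AE_space by eventually_elim (use N(1) convergent_LIMSEQ_iff in \<open>auto simp: g_def\<close>)
  qed
qed

lemma fatou_powr:
  fixes h :: "nat \<Rightarrow> 'a \<Rightarrow> 'x::real_normed_vector"
  assumes "\<And>m. strongly_measurable M (h m)" "strongly_measurable M f" "strongly_measurable M g" "0 < p"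
    and "AE z in M. (\<lambda>m. h m z) \<longlonglongrightarrow> g z"
    and le: "\<And>m. k \<le> m \<Longrightarrow> (\<integral>\<^sup>+z. ennreal (norm (f z - h m z) powr p) \<partial>M) \<le> C"
  shows "(\<integral>\<^sup>+z. ennreal (norm (f z - g z) powr p) \<partial>M) \<le> C"
proof -
  have [measurable]: "(\<lambda>z. norm (f z - h m z)) \<in> borel_measurable M" for m
    by (intro borel_measurable_norm_strongly_measurable strongly_measurable_diff assms)
  have "(\<integral>\<^sup>+z. ennreal (norm (f z - g z) powr p) \<partial>M) = (\<integral>\<^sup>+z. liminf (\<lambda>m. ennreal (norm (f z - h m z) powr p)) \<partial>M)"
  proof (rule nn_integral_cong_AE)
    show "AE z in M. ennreal (norm (f z - g z) powr p) = liminf (\<lambda>m. ennreal (norm (f z - h m z) powr p))"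
      using assms(5)
    proof eventually_elim
      case (elim z)
      have "(\<lambda>m. ennreal (norm (f z - h m z) powr p)) \<longlonglongrightarrow> ennreal (norm (f z - g z) powr p)"
        using assms(4) by (intro tendsto_ennrealI tendsto_powr' tendsto_norm tendsto_diff tendsto_const elim) auto
      then show ?case by (intro lim_imp_Liminf[symmetric]) auto
    qed
  qed
  also have "\<dots> \<le> liminf (\<lambda>m. \<integral>\<^sup>+z. ennreal (norm (f z - h m z) powr p) \<partial>M)"
    by (rule nn_integral_liminf) auto
  also have "\<dots> \<le> limsup (\<lambda>m. \<integral>\<^sup>+z. ennreal (norm (f z - h m z) powr p) \<partial>M)"
    by (rule Liminf_le_Limsup) simp
  also have "\<dots> \<le> C"
    by (rule Limsup_bounded) (use le in \<open>auto simp: eventually_sequentially\<close>)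
  finally show ?thesis .
qed

lemma in_LpI:
  assumes "strongly_measurable M f" "(\<integral>\<^sup>+z. ennreal (norm (f z) powr p) \<partial>M) < \<infinity>"
  shows "in_Lp M p f"
proof -
  have [measurable]: "(\<lambda>z. norm (f z)) \<in> borel_measurable M"
    by (rule borel_measurable_norm_strongly_measurable[OF assms(1)])
  show ?thesis using assms unfolding in_Lp_def by (auto intro!: integrableI_bounded)
qed

lemma in_Lp_nn_integral:
  assumes "in_Lp M p f"
  shows "(\<integral>\<^sup>+z. ennreal (norm (f z) powr p) \<partial>M) = ennreal (LINT z|M. norm (f z) powr p)"
  using assms unfolding in_Lp_def by (intro nn_integral_eq_integral) auto

text \<open>Uniformly bounded partial sums that are eventually close to each of a sequence of simple
  functions converge unconditionally.\<close>

lemma unconditional_Lp_limit: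
  fixes u :: "'k \<Rightarrow> 'a \<Rightarrow> 'x::banach"
  assumes u: "\<And>k. strongly_measurable M (u k)" and p: "1 < p"
    and h: "\<And>i. simple_function M (h i)" and fin: "\<And>i. finite (D i)" and B: "0 \<le> B"
    and approx: "\<And>i K. finite K \<Longrightarrow> D i \<subseteq> K \<Longrightarrow>
      (\<integral>\<^sup>+z. ennreal (norm ((\<Sum>k\<in>K. u k z) - h i z) powr p) \<partial>M) \<le> ennreal (B * (1 / 4 powr p) ^ i)"
    and L: "0 \<le> L" and bound: "\<And>K. finite K \<Longrightarrow> (\<integral>\<^sup>+z. ennreal (norm (\<Sum>k\<in>K. u k z) powr p) \<partial>M) \<le> ennreal L"
  shows "\<exists>g. has_sum_Lp M p u g UNIV \<and> (LINT z|M. norm (g z) powr p) \<le> 2 powr p * L"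
proof -
  let ?q = "1 / 4 powr p :: real" and ?S = "\<lambda>K z. \<Sum>k\<in>K. u k z"
  have q: "0 < ?q" "?q < 1" using powr_mono[of 1 p 4] p by auto
  have hs: "strongly_measurable M (h i)" for i by (rule strongly_measurable_simple[OF h])
  have Ss: "strongly_measurable M (?S K)" if "finite K" for K by (rule strongly_measurable_sum[OF that u])
  let ?B = "2 powr p * (2 * B)"
  have hh: "(\<integral>\<^sup>+z. ennreal (norm (h i z - h j z) powr p) \<partial>M) \<le> ennreal (?B * ?q ^ min i j)" for i j
  proof -
    let ?K = "D i \<union> D j"
    have K: "finite ?K" using fin by simp
    have "(\<integral>\<^sup>+z. ennreal (norm (h i z - h j z) powr p) \<partial>M)
      \<le> ennreal (2 powr p) * ((\<integral>\<^sup>+z. ennreal (norm (?S ?K z - h i z) powr p) \<partial>M) + (\<integral>\<^sup>+z. ennreal (norm (?S ?K z - h j z) powr p) \<partial>M))"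
      by (rule nn_powr_diff_le[OF hs Ss[OF K] hs]) (use p in simp)
    also have "\<dots> \<le> ennreal (2 powr p) * (ennreal (B * ?q ^ i) + ennreal (B * ?q ^ j))"
      by (intro mult_left_mono add_mono approx K) auto
    also have "\<dots> \<le> ennreal (2 powr p) * (ennreal (B * ?q ^ min i j) + ennreal (B * ?q ^ min i j))"
      using q B by (intro mult_left_mono add_mono ennreal_leI power_decreasing) auto
    also have "\<dots> = ennreal (?B * ?q ^ min i j)"
      using q B by (simp flip: ennreal_plus ennreal_mult)
    finally show ?thesis .
  qed
  have hh': "(\<integral>\<^sup>+z. ennreal (norm (h (Suc i) z - h i z) powr p) \<partial>M) \<le> ennreal (?B * ?q ^ i)" for i
    using hh[of "Suc i" i] by simp
  obtain g where g: "strongly_measurable M g" "AE z in M. (\<lambda>i. h i z) \<longlonglongrightarrow> g z"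
    by (rule simple_functions_converge[OF h _ _ hh']) (use p B in auto)
  have hg: "(\<integral>\<^sup>+z. ennreal (norm (h i z - g z) powr p) \<partial>M) \<le> ennreal (?B * ?q ^ i)" for i
  proof (rule fatou_powr[OF hs hs g(1) _ g(2)])
    show "(\<integral>\<^sup>+z. ennreal (norm (h i z - h m z) powr p) \<partial>M) \<le> ennreal (?B * ?q ^ i)" if "i \<le> m" for m
      using hh[of i m] that by simp
  qed (use p in simp)
  let ?C = "2 powr p * (B + ?B)"
  have Sg: "(\<integral>\<^sup>+z. ennreal (norm (?S K z - g z) powr p) \<partial>M) \<le> ennreal (?C * ?q ^ i)" if K: "finite K" "D i \<subseteq> K" for K i
  proof -
    have "(\<integral>\<^sup>+z. ennreal (norm ((?S K z - h i z) + (h i z - g z)) powr p) \<partial>M)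
      \<le> ennreal (2 powr p) * ((\<integral>\<^sup>+z. ennreal (norm (?S K z - h i z) powr p) \<partial>M) + (\<integral>\<^sup>+z. ennreal (norm (h i z - g z) powr p) \<partial>M))"
      using K p by (intro nn_powr_add_le strongly_measurable_diff Ss hs g) auto
    also have "\<dots> \<le> ennreal (2 powr p) * (ennreal (B * ?q ^ i) + ennreal (?B * ?q ^ i))"
      by (intro mult_left_mono add_mono approx K hg) auto
    also have "\<dots> = ennreal (?C * ?q ^ i)"
      using q B by (simp add: algebra_simps flip: ennreal_plus ennreal_mult)
    finally show ?thesis by simp
  qed
  have uLp: "in_Lp M p (u k)" for k
    using bound[of "{k}"] by (intro in_LpI u) (auto simp: order_le_less_trans)
  have SgLp: "in_Lp M p (\<lambda>z. ?S K z - g z)" if "finite K" "D i \<subseteq> K" for K i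
    using Sg[OF that] that by (intro in_LpI strongly_measurable_diff Ss g) (auto simp: order_le_less_trans)
  have gle: "(\<integral>\<^sup>+z. ennreal (norm (g z) powr p) \<partial>M) \<le> ennreal (2 powr p * (?C * ?q ^ i + L))" for i
  proof -
    have "(\<integral>\<^sup>+z. ennreal (norm (g z - 0) powr p) \<partial>M)
      \<le> ennreal (2 powr p) * ((\<integral>\<^sup>+z. ennreal (norm (?S (D i) z - g z) powr p) \<partial>M) + (\<integral>\<^sup>+z. ennreal (norm (?S (D i) z - 0) powr p) \<partial>M))"
      using p by (intro nn_powr_diff_le g Ss fin strongly_measurable_simple) auto
    also have "\<dots> \<le> ennreal (2 powr p) * (ennreal (?C * ?q ^ i) + ennreal L)"
      using bound[OF fin[of i]] Sg[OF fin order_refl, of i] by (intro mult_left_mono add_mono) auto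
    also have "\<dots> = ennreal (2 powr p * (?C * ?q ^ i + L))"
      using q B L by (simp flip: ennreal_plus ennreal_mult)
    finally show ?thesis by simp
  qed
  have gLp: "in_Lp M p g"
    using gle[of 0] by (intro in_LpI g) (auto simp: order_le_less_trans)
  have le_i: "(LINT z|M. norm (g z) powr p) \<le> 2 powr p * (?C * ?q ^ i + L)" for i
    using gle[of i] in_Lp_nn_integral[OF gLp] q B L by (simp add: ennreal_le_iff)
  have lim_i: "(\<lambda>i. 2 powr p * (?C * ?q ^ i + L)) \<longlonglongrightarrow> 2 powr p * (?C * 0 + L)"
    using q by (intro tendsto_intros LIMSEQ_realpow_zero) auto
  have "(LINT z|M. norm (g z) powr p) \<le> 2 powr p * (?C * 0 + L)"
    by (rule LIMSEQ_le_const[OF lim_i]) (use le_i in blast)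
  then have g_final: "(LINT z|M. norm (g z) powr p) \<le> 2 powr p * L" by simp
  have "((\<lambda>K. Lp_norm M p (\<lambda>z. ?S K z - g z)) \<longlongrightarrow> 0) (finite_subsets_at_top UNIV)"
  proof (rule tendstoI)
    fix e :: real assume e: "0 < e"
    have "(\<lambda>i. ?C * ?q ^ i) \<longlonglongrightarrow> ?C * 0"
      using q by (intro tendsto_intros LIMSEQ_realpow_zero) auto
    then have "\<forall>\<^sub>F i in sequentially. ?C * ?q ^ i < e powr p"
      using e by (intro order_tendstoD) auto
    then obtain i where i: "?C * ?q ^ i < e powr p" by (auto simp: eventually_sequentially)
    have "dist (Lp_norm M p (\<lambda>z. ?S K z - g z)) 0 < e" if K: "finite K" "D i \<subseteq> K" for K
    proof -
      have "ennreal (LINT z|M. norm (?S K z - g z) powr p) \<le> ennreal (?C * ?q ^ i)"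
        using Sg[OF K] in_Lp_nn_integral[OF SgLp[OF K]] by simp
      then have "(LINT z|M. norm (?S K z - g z) powr p) \<le> ?C * ?q ^ i"
        using q B by (simp add: ennreal_le_iff)
      then have "(LINT z|M. norm (?S K z - g z) powr p) < e powr p" using i by linarith
      then have "(LINT z|M. norm (?S K z - g z) powr p) powr (1/p) < (e powr p) powr (1/p)"
        using p by (intro powr_less_mono2) auto
      then show ?thesis using e p by (simp add: Lp_norm_def powr_powr)
    qed
    then show "\<forall>\<^sub>F K in finite_subsets_at_top UNIV. dist (Lp_norm M p (\<lambda>z. ?S K z - g z)) 0 < e"
      using fin[of i] by (auto simp: eventually_finite_subsets_at_top)
  qed
  then show ?thesis using uLp gLp g_final unfolding has_sum_Lp_def by blast
qed

section \<open>The bound for finite sums\<close>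

context leaves
begin

lemma nn_integral_leaves:
  assumes \<Phi>: "\<And>x y. x \<in> Q\<^sub>0 \<Longrightarrow> Q n x = Q n y \<Longrightarrow> \<Phi> x = \<Phi> y" and nn: "\<And>x. 0 \<le> \<Phi> x"
  shows "(\<integral>\<^sup>+x. ennreal (\<Phi> x) \<partial>\<mu>) = ennreal (\<Sum>y\<in>\<Omega>. wt y * \<Phi> y)"
proof -
  have "AE z in \<mu>. ennreal (\<Phi> z) = (\<Sum>y\<in>\<Omega>. ennreal (\<Phi> y) * indicator (Q n y) z)"
    using AE_leaf
  proof eventually_elim
    case (elim z)
    then obtain y where y: "y \<in> \<Omega>" "Q n y = Q n z" using \<Omega>_rep by blast
    have "(\<Sum>u\<in>\<Omega>. \<Phi> u * indicator (Q n u) z) = \<Phi> y"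
      using sum_indicator_leaves[OF y y(1) order_refl, of \<Phi>] by (simp add: mult.commute)
    also have "\<Phi> y = \<Phi> z" by (rule \<Phi>[OF \<Omega>D(1)[OF y(1)] y(2)])
    finally have "ennreal (\<Phi> z) = ennreal (\<Sum>u\<in>\<Omega>. \<Phi> u * indicator (Q n u) z)" by simp
    also have "\<dots> = (\<Sum>u\<in>\<Omega>. ennreal (\<Phi> u * indicator (Q n u) z))"
      using nn by (intro sum_ennreal[symmetric]) auto
    also have "\<dots> = (\<Sum>u\<in>\<Omega>. ennreal (\<Phi> u) * indicator (Q n u) z)"
      by (intro sum.cong) (auto simp: indicator_def)
    finally show ?case .
  qed
  then have "(\<integral>\<^sup>+x. ennreal (\<Phi> x) \<partial>\<mu>) = (\<integral>\<^sup>+z. (\<Sum>y\<in>\<Omega>. ennreal (\<Phi> y) * indicator (Q n y) z) \<partial>\<mu>)"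
    by (rule nn_integral_cong_AE)
  also have "\<dots> = (\<Sum>y\<in>\<Omega>. \<integral>\<^sup>+z. ennreal (\<Phi> y) * indicator (Q n y) z \<partial>\<mu>)"
    by (rule nn_integral_sum) auto
  also have "\<dots> = (\<Sum>y\<in>\<Omega>. ennreal (wt y * \<Phi> y))"
    using nn by (intro sum.cong refl) (simp add: nn_integral_cmult_indicator emeasure_eq_measure wt_def ennreal_mult mult.commute)
  also have "\<dots> = ennreal (\<Sum>y\<in>\<Omega>. wt y * \<Phi> y)"
    using nn by (intro sum_ennreal) (simp add: wt_def)
  finally show ?thesis .
qed

lemma cube_average_powr_le:
  fixes t :: "_ \<Rightarrow> real"
  assumes p: "1 < p" and t: "integrable \<mu> t" "integrable \<mu> (\<lambda>x. t x powr p)" "\<And>x. 0 \<le> t x" and y: "y \<in> \<Omega>"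
  shows "wt y * cube_average \<mu> t (Q n y) powr p \<le> (LINT x|\<mu>. indicator (Q n y) x * t x powr p)"
proof -
  define m where "m = cube_average \<mu> t (Q n y)"
  have pos: "0 < wt y" by (rule \<Omega>D(2)[OF y])
  have int: "integrable \<mu> (\<lambda>x. indicator (Q n y) x * h x)" if "integrable \<mu> h" for h :: "_ \<Rightarrow> real"
    using integrable_mult_indicator[OF Q_sets that, of n y] by simp
  have avg: "(LINT x|\<mu>. indicator (Q n y) x * t x) = wt y * m"
    using pos by (simp add: m_def cube_average_def strong_integral_eq_lebesgue_integral wt_def)
  have m: "0 \<le> m"
  proof -
    have "0 \<le> wt y * m" unfolding avg[symmetric] using t(3) by (intro integral_nonneg_AE) auto
    then show ?thesis using pos by (simp add: zero_le_mult_iff)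
  qed
  have "wt y * m powr p = p * m powr (p - 1) * (wt y * m) - (p - 1) * m powr p * wt y"
    using m by (cases "m = 0") (auto simp: powr_diff field_simps)
  also have "\<dots> = (LINT x|\<mu>. p * m powr (p - 1) * (indicator (Q n y) x * t x) - (p - 1) * m powr p * (indicator (Q n y) x * 1))"
    using int[OF t(1)] int[of "\<lambda>_. 1"] by (simp add: avg wt_def)
  also have "\<dots> \<le> (LINT x|\<mu>. indicator (Q n y) x * t x powr p)"
  proof (rule integral_mono)
    show "p * m powr (p - 1) * (indicator (Q n y) x * t x) - (p - 1) * m powr p * (indicator (Q n y) x * 1) \<le> indicator (Q n y) x * t x powr p" for x
      using powr_tangent[OF p t(3) m, of x] by (auto simp: indicator_def)
  qed (intro Bochner_Integration.integrable_diff integrable_mult_right int t integrable_const)+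
  finally show ?thesis by (simp add: m_def)
qed

lemma averages_le_integral:
  fixes t :: "_ \<Rightarrow> real"
  assumes p: "1 < p" and t: "integrable \<mu> t" "integrable \<mu> (\<lambda>x. t x powr p)" "\<And>x. 0 \<le> t x"
  shows "(\<Sum>y\<in>\<Omega>. wt y * cube_average \<mu> t (Q n y) powr p) \<le> (LINT x|\<mu>. t x powr p)"
proof -
  have int: "integrable \<mu> (\<lambda>x. indicator (Q n y) x * t x powr p)" for y
    using integrable_mult_indicator[OF Q_sets t(2), of n y] by simp
  have "(\<Sum>y\<in>\<Omega>. wt y * cube_average \<mu> t (Q n y) powr p) \<le> (\<Sum>y\<in>\<Omega>. LINT x|\<mu>. indicator (Q n y) x * t x powr p)"
    by (intro sum_mono cube_average_powr_le p t)
  also have "\<dots> = (LINT x|\<mu>. (\<Sum>y\<in>\<Omega>. indicator (Q n y) x * t x powr p))"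
    using int by (intro Bochner_Integration.integral_sum[symmetric]) auto
  also have "\<dots> = (LINT x|\<mu>. t x powr p)"
  proof (rule integral_cong_AE)
    show "AE x in \<mu>. (\<Sum>y\<in>\<Omega>. indicator (Q n y) x * t x powr p) = t x powr p"
      using AE_leaf
    proof eventually_elim
      case (elim z)
      then obtain y where y: "y \<in> \<Omega>" "Q n y = Q n z" using \<Omega>_rep by blast
      show ?case using sum_indicator_leaves[OF y y(1) order_refl, of "\<lambda>_. t z powr p"] by simp
    qed
    show "(\<lambda>x. \<Sum>y\<in>\<Omega>. indicator (Q n y) x * t x powr p) \<in> borel_measurable \<mu>"
      by (rule borel_measurable_integrable[OF Bochner_Integration.integrable_sum]) (rule int)
  qed (rule borel_measurable_integrable[OF t(2)])
  finally show ?thesis .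
qed

lemma D_adj_const:
  assumes "i < n" "Q n x = Q n y"
  shows "D_adj \<mu> \<beta> b \<delta> Q\<^sub>0 (k0 - int i) f x = D_adj \<mu> \<beta> b \<delta> Q\<^sub>0 (k0 - int i) f y"
proof -
  have "Q (Suc i) x = Q (Suc i) y" "Q i x = Q i y"
    using Q_finer[OF assms(2), of "Suc i"] Q_finer[OF assms(2), of i] assms(1) by auto
  then have "cube (k0 - int i - 1) x = cube (k0 - int i - 1) y" "cube (k0 - int i) x = cube (k0 - int i) y"
    by (simp_all add: Q_def algebra_simps)
  then show ?thesis by (simp add: D_adj_def E_adj_eq)
qed

end

text \<open>The proportion \<open>(1 - \<delta>) / (1 - \<delta>\<^sup>2) = 1 / (1 + \<delta>)\<close> of mass that meets a further accretive stop
  is below one, so a weight \<open>\<rho>\<close> slightly above one can be afforded. The threshold \<open>A\<close> is chosen last and so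
  large that the stops caused by the square sums hardly count.\<close>

lemma stopping_parameters:
  fixes \<delta> :: real
  assumes "0 < \<delta>" "\<delta> < 1"
  obtains \<rho> A C1 C2 :: real where "1 < \<rho>" "0 < A" "0 \<le> C1" "0 \<le> C2" "1 + \<rho> * C1 + \<rho> * C2 / A \<le> C2"
    "1 + \<rho> * C1 * ((1 - \<delta>) / (1 - \<delta>\<^sup>2)) + \<rho> * C2 / A \<le> C1"
proof -
  define r where "r = (1 - \<delta>) / (1 - \<delta>\<^sup>2)"
  have "1 - \<delta>\<^sup>2 = (1 - \<delta>) * (1 + \<delta>)" by (simp add: power2_eq_square algebra_simps)
  then have r': "r = 1 / (1 + \<delta>)" using assms by (simp add: r_def)
  have r: "0 < r" "r < 1" using assms by (auto simp: r')
  \<comment> \<open>This is half way, in the harmonic sense, between \<open>1\<close> and \<open>1 / r\<close>, so that still \<open>\<rho> * r < 1\<close>.\<close>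
  define \<rho> where "\<rho> = 2 / (1 + r)"
  define s where "s = \<rho> * r"
  define C1 where "C1 = 4 / (1 - s)"
  define C2 where "C2 = 2 * (1 + \<rho> * C1)"
  define A where "A = \<rho> * C2 + 2 * \<rho>"
  have \<rho>: "1 < \<rho>" using r by (simp add: \<rho>_def)
  have s: "s < 1" using r by (simp add: s_def \<rho>_def)
  have C1: "0 < C1" using s by (simp add: C1_def)
  have C1s: "C1 * (1 - s) = 4"
    using s by (subst nonzero_eq_divide_eq[symmetric]) (auto simp: C1_def)
  have C2: "0 < C2" using \<rho> C1 by (simp add: C2_def add_pos_pos)
  have A: "0 < A" using \<rho> C2 by (simp add: A_def add_pos_pos)
  have a1: "\<rho> * C2 / A \<le> 1" using A \<rho> by (simp add: A_def)
  have "2 * \<rho> \<le> A" using \<rho> C2 by (simp add: A_def)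
  then have "2 * \<rho> * C2 \<le> A * C2" using C2 by (intro mult_right_mono) auto
  then have a2: "\<rho> * C2 / A \<le> C2 / 2" using A by (simp add: field_simps)
  show thesis
  proof (rule that[of \<rho> A C1 C2])
    show "1 + \<rho> * C1 + \<rho> * C2 / A \<le> C2"
    proof -
      have "1 + \<rho> * C1 = C2 / 2" by (simp add: C2_def)
      then show ?thesis using a2 by linarith
    qed
    have "1 + s * C1 + \<rho> * C2 / A \<le> C1" using a1 C1s by (simp add: algebra_simps)
    then show "1 + \<rho> * C1 * ((1 - \<delta>) / (1 - \<delta>\<^sup>2)) + \<rho> * C2 / A \<le> C1"
      by (simp add: s_def r_def mult_ac)
  qed (use \<rho> A C1 C2 in auto)
qed

lemma (in finite_measure) in_Lp_strong_integrable:
  fixes f :: "'a \<Rightarrow> 'x::real_normed_vector"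
  assumes "in_Lp M p f" "1 < p"
  shows "strong_integrable M f"
proof -
  have m: "strongly_measurable M f" and i: "integrable M (\<lambda>x. norm (f x) powr p)"
    using assms(1) by (auto simp: in_Lp_def)
  have [measurable]: "(\<lambda>x. norm (f x)) \<in> borel_measurable M"
    by (rule borel_measurable_norm_strongly_measurable[OF m])
  have "norm (f x) \<le> 1 + norm (f x) powr p" for x
  proof (cases "norm (f x) \<le> 1")
    case False
    then have "norm (f x) powr 1 \<le> norm (f x) powr p" using assms(2) by (intro powr_mono) auto
    then show ?thesis using False by simp
  qed (simp add: add_increasing2)
  then have "integrable M (\<lambda>x. norm (f x))"
    by (intro Bochner_Integration.integrable_bound[OF Bochner_Integration.integrable_add[OF integrable_const[of 1] i]]) auto
  then show ?thesis using m by (simp add: strong_integrable_def integrable_iff_bounded)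
qed

text \<open>The operators of the levels above \<open>Q\<^sub>0\<close> vanish. By the contraction principle the remaining
  indices may be completed to an initial segment of levels below \<open>Q\<^sub>0\<close>, whose terms are constant on
  the leaves. The constant is chosen before the measure, the dyadic system and the function.\<close>

lemma finite_sum_bound:
  fixes \<delta> p :: real
  assumes "UMD TYPE('x::complex_banach)" and p: "1 < p" and "0 < \<delta>" "\<delta> < 1"
  obtains C where "0 \<le> C"
    "\<And>\<beta> (\<mu> :: (real ^ 'n::finite) measure) b Q\<^sub>0 k0 x0 (P :: 'w measure) \<epsilon> (f :: real ^ 'n \<Rightarrow> 'x) K.
      dyadic_measure \<beta> \<mu> b \<delta> Q\<^sub>0 k0 x0 \<Longrightarrow> random_signs P \<epsilon> \<Longrightarrow> in_Lp \<mu> p f \<Longrightarrow> finite K \<Longrightarrow>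
      (\<integral>\<^sup>+x. \<integral>\<^sup>+w. ennreal (norm (\<Sum>k\<in>K. \<epsilon> k w *\<^sub>R D_adj \<mu> \<beta> b \<delta> Q\<^sub>0 k f x) powr p) \<partial>P \<partial>\<mu>)
        \<le> ennreal (C * (LINT x|\<mu>. norm (f x) powr p))"
proof -
  obtain U where U: "1 \<le> U" and UMD: "\<And>(\<Omega> :: (real ^ 'n) set) w (\<pi> :: nat \<Rightarrow> real ^ 'n \<Rightarrow> (real ^ 'n) set) n (d :: nat \<Rightarrow> real ^ 'n \<Rightarrow> 'x) \<sigma>. finite \<Omega> \<Longrightarrow>
      (\<And>x. x \<in> \<Omega> \<Longrightarrow> 0 \<le> w x) \<Longrightarrow>
      (\<And>k x y. k < n \<Longrightarrow> x \<in> \<Omega> \<Longrightarrow> y \<in> \<Omega> \<Longrightarrow> \<pi> (Suc k) x = \<pi> (Suc k) y \<Longrightarrow> \<pi> k x = \<pi> k y) \<Longrightarrow>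
      (\<And>k x y. k < n \<Longrightarrow> x \<in> \<Omega> \<Longrightarrow> y \<in> \<Omega> \<Longrightarrow> \<pi> (Suc k) x = \<pi> (Suc k) y \<Longrightarrow> d k x = d k y) \<Longrightarrow>
      (\<And>k x. k < n \<Longrightarrow> x \<in> \<Omega> \<Longrightarrow> (\<Sum>y | y \<in> \<Omega> \<and> \<pi> k y = \<pi> k x. w y *\<^sub>R d k y) = 0) \<Longrightarrow>
      (\<And>k. \<sigma> k \<in> {-1, 1}) \<Longrightarrow>
      (\<Sum>x\<in>\<Omega>. w x * norm (\<Sum>k<n. \<sigma> k *\<^sub>R d k x) powr p)
        \<le> U * (\<Sum>x\<in>\<Omega>. w x * norm (\<Sum>k<n. d k x) powr p)"
    by (rule UMD_inequality_finite[OF assms(1,2)]) blast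
  obtain \<rho> A C1 C2 where par: "1 < \<rho>" "0 < A" "0 \<le> C1" "0 \<le> C2" "1 + \<rho> * C1 + \<rho> * C2 / A \<le> C2"
    "1 + \<rho> * C1 * ((1 - \<delta>) / (1 - \<delta>\<^sup>2)) + \<rho> * C2 / A \<le> C1"
    by (rule stopping_parameters[OF assms(3,4)])
  define C where "C = max 0 (gen_const \<rho> p * (\<rho> * C2) * generation_const p A U (\<delta>\<^sup>2) * (3 powr p * (2 * carleson_const \<rho> p C2 + 1)))"
  show thesis
  proof (rule that[of C])
    show "0 \<le> C" by (simp add: C_def)
    fix \<beta> and \<mu> :: "(real ^ 'n) measure" and b Q\<^sub>0 k0 x0 and P :: "'w measure" and \<epsilon> :: "int \<Rightarrow> 'w \<Rightarrow> real" and f :: "real ^ 'n \<Rightarrow> 'x" and K :: "int set"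
    assume dm: "dyadic_measure \<beta> \<mu> b \<delta> Q\<^sub>0 k0 x0" and rs: "random_signs P \<epsilon>" and f: "in_Lp \<mu> p f" and K: "finite K"
    define n where "n = nat (k0 - Min (insert k0 K)) + 1"
    interpret dyadic_measure \<beta> \<mu> b \<delta> Q\<^sub>0 k0 x0 by (rule dm)
    interpret leaves \<beta> \<mu> b \<delta> Q\<^sub>0 k0 x0 n by unfold_locales
    let ?D = "\<lambda>k x. D_adj \<mu> \<beta> b \<delta> Q\<^sub>0 k f x" and ?\<kappa> = "\<lambda>i. k0 - int i"
    let ?\<Phi> = "\<lambda>x. sign_avg {..<n} (\<lambda>\<sigma>. norm (\<Sum>i<n. \<sigma> i *\<^sub>R ?D (?\<kappa> i) x) powr p)"
    have fi: "strong_integrable \<mu> f" by (rule in_Lp_strong_integrable[OF f p])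
    have inj: "inj_on ?\<kappa> {..<n}" by (auto simp: inj_on_def)
    have low: "k \<in> ?\<kappa> ` {..<n}" if "k \<in> K" "k \<le> k0" for k
    proof (rule image_eqI)
      show "k = ?\<kappa> (nat (k0 - k))" using that by simp
      have "Min (insert k0 K) \<le> k" using that K by (intro Min_le) auto
      then show "nat (k0 - k) \<in> {..<n}" by (simp add: n_def)
    qed
    have "(\<integral>\<^sup>+x. \<integral>\<^sup>+w. ennreal (norm (\<Sum>k\<in>K. \<epsilon> k w *\<^sub>R ?D k x) powr p) \<partial>P \<partial>\<mu>) \<le> (\<integral>\<^sup>+x. ennreal (?\<Phi> x) \<partial>\<mu>)"
    proof (rule nn_integral_mono_AE)
      show "AE x in \<mu>. (\<integral>\<^sup>+w. ennreal (norm (\<Sum>k\<in>K. \<epsilon> k w *\<^sub>R ?D k x) powr p) \<partial>P) \<le> ennreal (?\<Phi> x)"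
        using AE_Q0
      proof eventually_elim
        case (elim x)
        let ?m = "\<lambda>i. of_bool (?\<kappa> i \<in> K) :: real"
        have sum: "(\<Sum>k\<in>K. \<epsilon> k w *\<^sub>R ?D k x) = (\<Sum>i<n. \<epsilon> (?\<kappa> i) w *\<^sub>R ?m i *\<^sub>R ?D (?\<kappa> i) x)" for w
        proof -
          have z: "?D k x = 0" if "k \<in> K" "k \<notin> ?\<kappa> ` {..<n}" for k
            using low[OF that(1)] that(2) D_adj_above[OF elim _ fi, of k] by (cases "k \<le> k0") auto
          have "(\<Sum>k\<in>K. \<epsilon> k w *\<^sub>R ?D k x) = (\<Sum>k\<in>K \<inter> ?\<kappa> ` {..<n}. \<epsilon> k w *\<^sub>R ?D k x)"
            by (rule sum.mono_neutral_right) (use K z in auto)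
          also have "\<dots> = (\<Sum>k\<in>?\<kappa> ` {..<n}. if k \<in> K then \<epsilon> k w *\<^sub>R ?D k x else 0)"
            by (subst Int_commute) (rule sum.inter_restrict, simp)
          also have "\<dots> = (\<Sum>i<n. if ?\<kappa> i \<in> K then \<epsilon> (?\<kappa> i) w *\<^sub>R ?D (?\<kappa> i) x else 0)"
            by (subst sum.reindex[OF inj]) simp
          also have "\<dots> = (\<Sum>i<n. \<epsilon> (?\<kappa> i) w *\<^sub>R ?m i *\<^sub>R ?D (?\<kappa> i) x)"
            by (intro sum.cong) auto
          finally show ?thesis .
        qed
        have "(\<integral>\<^sup>+w. ennreal (norm (\<Sum>k\<in>K. \<epsilon> k w *\<^sub>R ?D k x) powr p) \<partial>P)
          = ennreal (sign_avg {..<n} (\<lambda>\<sigma>. norm (\<Sum>i<n. \<sigma> i *\<^sub>R ?m i *\<^sub>R ?D (?\<kappa> i) x) powr p))"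
          unfolding sum by (rule expectation_random_signs[OF rs _ inj]) simp
        also have "\<dots> \<le> ennreal (?\<Phi> x)"
          using sign_avg_contraction[of "{..<n}" p ?m 0 "\<lambda>i. ?D (?\<kappa> i) x"] p by (intro ennreal_leI) simp
        finally show ?case .
      qed
    qed
    also have "\<dots> = ennreal (\<Sum>y\<in>\<Omega>. wt y * ?\<Phi> y)"
    proof (rule nn_integral_leaves)
      show "?\<Phi> x = ?\<Phi> y" if "Q n x = Q n y" for x y
      proof (rule sign_avg_cong)
        fix \<sigma>
        have "(\<Sum>i<n. \<sigma> i *\<^sub>R ?D (?\<kappa> i) x) = (\<Sum>i<n. \<sigma> i *\<^sub>R ?D (?\<kappa> i) y)"
          by (intro sum.cong refl arg_cong[where f="\<lambda>v. _ *\<^sub>R v"] D_adj_const that) simp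
        then show "norm (\<Sum>i<n. \<sigma> i *\<^sub>R ?D (?\<kappa> i) x) powr p = norm (\<Sum>i<n. \<sigma> i *\<^sub>R ?D (?\<kappa> i) y) powr p" by simp
      qed
      show "0 \<le> ?\<Phi> x" for x by (rule sign_avg_nonneg) simp
    qed
    also have "(\<Sum>y\<in>\<Omega>. wt y * ?\<Phi> y) \<le> C * (\<Sum>x\<in>\<Omega>. wt x * cube_average \<mu> (\<lambda>y. norm (f y)) (Q n x) powr p)"
    proof -
      have "(\<Sum>y\<in>\<Omega>. wt y * ?\<Phi> y) \<le> gen_const \<rho> p * (\<rho> * C2) * generation_const p A U (\<delta>\<^sup>2) * (3 powr p * (2 * carleson_const \<rho> p C2 + 1))
          * (\<Sum>x\<in>\<Omega>. wt x * cube_average \<mu> (\<lambda>y. norm (f y)) (Q n x) powr p)"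
      proof (rule leaf_estimate[OF fi p U _ par])
        fix d :: "nat \<Rightarrow> real ^ 'n \<Rightarrow> 'x" and \<sigma> :: "nat \<Rightarrow> real"
        assume ad: "\<And>k. k < n \<Longrightarrow> adapted (Suc k) (d k)" and ce: "\<And>k. k < n \<Longrightarrow> centred k (d k)" and \<sigma>: "\<And>k. \<sigma> k \<in> {-1, 1}"
        show "(\<Sum>x\<in>\<Omega>. wt x * norm (\<Sum>k<n. \<sigma> k *\<^sub>R d k x) powr p) \<le> U * (\<Sum>x\<in>\<Omega>. wt x * norm (\<Sum>k<n. d k x) powr p)"
        proof (rule UMD[of \<Omega> wt n Q d \<sigma>, OF finite_\<Omega> w_nonneg refine adapted_eq[OF ad] _ \<sigma>])
          show "(\<Sum>y | y \<in> \<Omega> \<and> Q k y = Q k x. wt y *\<^sub>R d k y) = 0" if "k < n" "x \<in> \<Omega>" for k x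
            using ce[OF that(1)] that(2) by (simp add: centred_def block_def)
        qed
      qed
      also have "\<dots> \<le> C * (\<Sum>x\<in>\<Omega>. wt x * cube_average \<mu> (\<lambda>y. norm (f y)) (Q n x) powr p)"
        by (intro mult_right_mono sum_nonneg) (auto simp: C_def wt_def)
      finally show ?thesis .
    qed
    also have "\<dots> \<le> C * (LINT x|\<mu>. norm (f x) powr p)"
    proof (intro mult_left_mono averages_le_integral p)
      show "integrable \<mu> (\<lambda>x. norm (f x))"
        using fi borel_measurable_norm_strongly_measurable[of \<mu> f]
        by (auto simp: strong_integrable_def intro!: integrableI_bounded)
      show "integrable \<mu> (\<lambda>x. norm (f x) powr p)" using f by (simp add: in_Lp_def)
    qed (auto simp: C_def)
    finally show "(\<integral>\<^sup>+x. \<integral>\<^sup>+w. ennreal (norm (\<Sum>k\<in>K. \<epsilon> k w *\<^sub>R ?D k x) powr p) \<partial>P \<partial>\<mu>)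
        \<le> ennreal (C * (LINT x|\<mu>. norm (f x) powr p))" by (simp add: ennreal_leI)
  qed
qed

section \<open>Convergence\<close>

context dyadic_measure
begin

lemma anc_cube_cubes: "anc (cube k x) \<in> cubes"
proof (cases "cube k x \<subseteq> Q\<^sub>0")
  case True
  then have x: "x \<in> Q\<^sub>0" using self_cube by blast
  obtain l where "cube k x = Q l x" using dyadic_in_Q0E[OF cube_in_dyadic self_cube True] by blast
  then show ?thesis using anc_cubes[OF x] by simp
next
  case False
  then show ?thesis using anc_above by (simp add: Q0 cube_in_cubes)
qed

lemma cube_average_diff:
  fixes f g :: "_ \<Rightarrow> 'v::banach"
  assumes A: "A \<in> sets \<mu>" and f: "strong_integrable \<mu> f" and g: "strong_integrable \<mu> g"
  shows "cube_average \<mu> (\<lambda>x. f x - g x) A = cube_average \<mu> f A - cube_average \<mu> g A"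
proof -
  let ?f = "\<lambda>x. indicator A x *\<^sub>R f x" and ?g = "\<lambda>x. indicator A x *\<^sub>R g x"
  have "has_strong_integral \<mu> (\<lambda>x. ?f x + - ?g x) (strong_integral \<mu> ?f + - strong_integral \<mu> ?g)"
    by (intro has_strong_integral_add has_strong_integral_bounded_linear[OF bounded_linear_minus[OF bounded_linear_ident]]
        strong_integrable_has_strong_integral strong_integrable_indicator A f g)
  then have "strong_integral \<mu> (\<lambda>x. indicator A x *\<^sub>R (f x - g x)) = strong_integral \<mu> ?f - strong_integral \<mu> ?g"
    by (intro strong_integral_eqI) (simp add: scaleR_diff_right)
  then show ?thesis by (simp add: cube_average_def scaleR_diff_right)
qed

lemma D_adj_diff:
  fixes f g :: "real ^ 'n \<Rightarrow> 'x::complex_banach"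
  assumes "strong_integrable \<mu> f" "strong_integrable \<mu> g"
  shows "D_adj \<mu> \<beta> b \<delta> Q\<^sub>0 k (\<lambda>x. f x - g x) x = D_adj \<mu> \<beta> b \<delta> Q\<^sub>0 k f x - D_adj \<mu> \<beta> b \<delta> Q\<^sub>0 k g x"
proof -
  have "E_adj \<mu> \<beta> b \<delta> Q\<^sub>0 k (\<lambda>x. f x - g x) x = E_adj \<mu> \<beta> b \<delta> Q\<^sub>0 k f x - E_adj \<mu> \<beta> b \<delta> Q\<^sub>0 k g x" for k
    unfolding E_adj_eq scaleC_diff_right
    by (simp add: cube_average_diff strong_integrable_b_scaleC[OF anc_cube_cubes] assms scaleC_diff_right)
  then show ?thesis by (simp add: D_adj_def)
qed

lemma E_adj_outside:
  assumes "cube k x \<inter> Q\<^sub>0 = {}"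
  shows "E_adj \<mu> \<beta> b \<delta> Q\<^sub>0 k f x = 0"
proof -
  have "AE z in \<mu>. z \<notin> cube k x" using AE_Q0 by eventually_elim (use assms in auto)
  then have "cube k x \<in> null_sets \<mu>" by (subst AE_iff_null_sets) auto
  then have "measure \<mu> (cube k x) = 0" by (simp add: measure_eq_0_null_sets)
  then show ?thesis by (simp add: E_adj_eq cube_average_def)
qed

lemma finite_cubes_Q0: "finite (cube k ` Q\<^sub>0)"
proof (cases "k \<le> k0")
  case True
  then have "cube k ` Q\<^sub>0 = {Q (nat (k0 - k)) x | x. x \<in> Q\<^sub>0}" by (auto simp: Q_def)
  then show ?thesis using finite_leaves by simp
next
  case False
  have "cube k x = cube k x0" if "x \<in> Q\<^sub>0" for x
    using cube_above[of x0 k] that False cube_eq[of x k x0] by (auto simp: Q0)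
  then have "cube k ` Q\<^sub>0 \<subseteq> {cube k x0}" by auto
  then show ?thesis by (rule finite_subset) simp
qed

lemma simple_function_sum_indicator:
  fixes v :: "'s \<Rightarrow> 'v::real_vector"
  assumes "finite F" "\<And>S. S \<in> F \<Longrightarrow> A S \<in> sets M"
  shows "simple_function M (\<lambda>x. \<Sum>S\<in>F. indicator (A S) x *\<^sub>R v S)"
  using assms
proof (induction F rule: finite_induct)
  case (insert S F)
  have "simple_function M (\<lambda>x. indicator (A S) x *\<^sub>R v S)"
    by (rule simple_function_compose1[OF simple_function_indicator, of _ _ "\<lambda>t. t *\<^sub>R v S"]) (use insert in auto)
  then show ?case
    unfolding sum.insert[OF insert.hyps] by (rule simple_function_compose2) (use insert in auto)
qed simp

lemma simple_function_strong_integrable: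
  fixes g :: "_ \<Rightarrow> 'x::real_normed_vector"
  assumes g: "simple_function \<mu> g"
  shows "strong_integrable \<mu> g"
proof -
  define T where "T = (\<Sum>v\<in>g ` space \<mu>. norm v)"
  have fin: "finite (g ` space \<mu>)" using g by (simp add: simple_function_def)
  have "(\<integral>\<^sup>+x. ennreal (norm (g x)) \<partial>\<mu>) \<le> (\<integral>\<^sup>+x. ennreal T \<partial>\<mu>)"
  proof (rule nn_integral_mono)
    fix x assume "x \<in> space \<mu>"
    then have "norm (g x) \<le> T" unfolding T_def by (intro member_le_sum fin) auto
    then show "ennreal (norm (g x)) \<le> ennreal T" by (rule ennreal_leI)
  qed
  also have "\<dots> < \<infinity>" by (simp add: emeasure_eq_measure ennreal_mult_less_top)
  finally show ?thesis using strongly_measurable_simple[OF g] by (simp add: strong_integrable_def)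
qed

lemma simple_D_adj:
  fixes f :: "real ^ 'n \<Rightarrow> 'x::complex_banach"
  shows "simple_function \<mu> (D_adj \<mu> \<beta> b \<delta> Q\<^sub>0 k f)"
proof -
  have E: "simple_function \<mu> (E_adj \<mu> \<beta> b \<delta> Q\<^sub>0 k f)" for k
  proof -
    define v where "v S = inverse (cube_average \<mu> (b (anc S)) S) *\<^sub>C cube_average \<mu> (\<lambda>y. b (anc S) y *\<^sub>C f y) S" for S
    have fin: "finite (cube k ` Q\<^sub>0)" by (rule finite_cubes_Q0)
    have "E_adj \<mu> \<beta> b \<delta> Q\<^sub>0 k f = (\<lambda>x. \<Sum>S\<in>cube k ` Q\<^sub>0. indicator S x *\<^sub>R v S)"
    proof
      fix x
      have "(\<Sum>S\<in>cube k ` Q\<^sub>0. indicator S x *\<^sub>R v S) = (\<Sum>S\<in>cube k ` Q\<^sub>0. if S = cube k x then v S else 0)"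
        using cube_eq[of x k] by (intro sum.cong) (auto simp: indicator_def)
      also have "\<dots> = (if cube k x \<in> cube k ` Q\<^sub>0 then v (cube k x) else 0)" using fin by simp
      also have "\<dots> = E_adj \<mu> \<beta> b \<delta> Q\<^sub>0 k f x"
      proof (cases "cube k x \<in> cube k ` Q\<^sub>0")
        case False
        have "cube k x \<inter> Q\<^sub>0 = {}"
        proof (rule ccontr)
          assume "cube k x \<inter> Q\<^sub>0 \<noteq> {}"
          then obtain z where z: "z \<in> cube k x" "z \<in> Q\<^sub>0" by blast
          then have "cube k x = cube k z" using cube_eq by simp
          then show False using False z by blast
        qed
        then show ?thesis using False E_adj_outside by simp
      qed (simp add: v_def E_adj_eq)
      finally show "E_adj \<mu> \<beta> b \<delta> Q\<^sub>0 k f x = (\<Sum>S\<in>cube k ` Q\<^sub>0. indicator S x *\<^sub>R v S)" by simp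
    qed
    moreover have "simple_function \<mu> (\<lambda>x. \<Sum>S\<in>cube k ` Q\<^sub>0. indicator S x *\<^sub>R v S)"
      by (rule simple_function_sum_indicator[OF fin]) auto
    ultimately show ?thesis by (simp only:)
  qed
  have "simple_function \<mu> (\<lambda>x. E_adj \<mu> \<beta> b \<delta> Q\<^sub>0 (k - 1) f x - E_adj \<mu> \<beta> b \<delta> Q\<^sub>0 k f x)"
    by (rule simple_function_compose2[OF E E])
  then show ?thesis by (simp add: D_adj_def[abs_def])
qed

text \<open>A constant value can be taken out of the average of \<open>b g\<close>, which leaves the same value at two
  successive levels.\<close>

lemma AE_D_adj_step:
  fixes g :: "real ^ 'n \<Rightarrow> 'x::complex_banach"
  assumes const: "\<And>x y. x \<in> Q\<^sub>0 \<Longrightarrow> y \<in> Q m x \<Longrightarrow> g y = g x" and k: "k \<le> k0 - int m"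
  shows "AE x in \<mu>. D_adj \<mu> \<beta> b \<delta> Q\<^sub>0 k g x = 0"
proof -
  define i where "i = nat (k0 - k)"
  have i: "k = k0 - int i" "k - 1 = k0 - int (Suc i)" "m \<le> i" using k by (auto simp: i_def)
  interpret L: leaves \<beta> \<mu> b \<delta> Q\<^sub>0 k0 x0 "Suc i" by unfold_locales
  have E: "E_adj \<mu> \<beta> b \<delta> Q\<^sub>0 (k0 - int l) g x = g x" if x: "x \<in> Q\<^sub>0" and pos: "0 < measure \<mu> (Q l x)" and l: "m \<le> l" for l x
  proof -
    let ?R = "anc (Q l x)"
    have R: "?R \<in> cubes" by (rule anc_cubes[OF x])
    have gx: "g y = g x" if "y \<in> Q l x" for y
    proof (rule const[OF x])
      show "y \<in> Q m x" using that l Q_subset_iff[of l x m] by blast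
    qed
    have "cube_average \<mu> (\<lambda>y. b ?R y *\<^sub>C g y) (Q l x) = cube_average \<mu> (\<lambda>y. b ?R y *\<^sub>C g x) (Q l x)"
      by (rule cube_average_cong) (simp only: gx)
    also have "\<dots> = cube_average \<mu> (b ?R) (Q l x) *\<^sub>C g x"
    proof -
      have "has_strong_integral \<mu> (\<lambda>y. (indicator (Q l x) y *\<^sub>R b ?R y) *\<^sub>C g x) (strong_integral \<mu> (\<lambda>y. indicator (Q l x) y *\<^sub>R b ?R y) *\<^sub>C g x)"
        by (intro has_strong_integral_bounded_linear[OF scaleC_bounded_linear_left] strong_integrable_has_strong_integral
            strong_integrable_indicator strong_integrable_b R) simp
      then have "strong_integral \<mu> (\<lambda>y. indicator (Q l x) y *\<^sub>R (b ?R y *\<^sub>C g x)) = strong_integral \<mu> (\<lambda>y. indicator (Q l x) y *\<^sub>R b ?R y) *\<^sub>C g x"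
        by (intro strong_integral_eqI) (simp only: scaleC_scaleR_left)
      then show ?thesis by (simp only: cube_average_def scaleC_scaleR_left)
    qed
    finally have avg: "cube_average \<mu> (\<lambda>y. b ?R y *\<^sub>C g y) (Q l x) = cube_average \<mu> (b ?R) (Q l x) *\<^sub>C g x" .
    have "cube_average \<mu> (b ?R) (Q l x) \<noteq> 0"
      using average_b_ge(1)[OF x pos] zero_less_power[OF \<delta>(1), of 2] by auto
    then show ?thesis
      unfolding E_adj_eq Q_def[symmetric] avg by (simp add: scaleC_scaleC)
  qed
  show ?thesis
    using L.AE_leaf
  proof eventually_elim
    case (elim x)
    have "measure \<mu> (Q (Suc i) x) \<le> measure \<mu> (Q i x)"
      by (intro finite_measure_mono) (simp_all add: Q_subset_iff)
    then show ?case
      unfolding D_adj_def i(2) using E[of x i] E[of x "Suc i"] elim i by simp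
  qed
qed

subsection \<open>Density of step functions\<close>

lemma small_cube:
  assumes "open U" "x \<in> U"
  shows "\<exists>m. Q m x \<subseteq> U"
proof -
  obtain r where r: "0 < r" "ball x r \<subseteq> U" using assms open_contains_ball by blast
  define s where "s = sqrt (real DIM(real ^ 'n)) * 2 powi k0"
  have s: "0 < s" by (simp add: s_def)
  obtain m where m: "(1/2) ^ m < r / s" using real_arch_pow_inv[of "r / s" "1/2"] r s by auto
  have "Q m x \<subseteq> U"
  proof
    fix y assume "y \<in> Q m x"
    then have "infnorm (y - x) < 2 powi (k0 - int m)" unfolding Q_def by (rule cube_bounded)
    also have "\<dots> = 2 powi k0 * (1/2) ^ m" by (simp add: power_int_diff power_one_over)
    finally have "sqrt (real DIM(real ^ 'n)) * infnorm (y - x) \<le> s * (1/2) ^ m"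
      by (simp add: s_def mult.assoc mult_left_mono)
    moreover have "norm (y - x) \<le> sqrt (real DIM(real ^ 'n)) * infnorm (y - x)" by (rule norm_le_infnorm)
    moreover have "s * (1/2) ^ m < r" using m s by (simp add: pos_less_divide_eq mult.commute)
    ultimately have "dist x y < r" by (simp add: dist_norm norm_minus_commute)
    then show "y \<in> U" using r by auto
  qed
  then show ?thesis ..
qed

text \<open>Outer regularity provides an open set slightly larger than \<open>A\<close>, which is exhausted by the cubes of
  level \<open>m\<close> inside it as \<open>m\<close> grows.\<close>

lemma set_approx:
  assumes A: "A \<in> sets \<mu>" and e: "0 < e"
  shows "\<exists>B m. B \<in> sets \<mu> \<and> (\<forall>x\<in>Q\<^sub>0. \<forall>y\<in>Q m x. y \<in> B \<longleftrightarrow> x \<in> B) \<and> measure \<mu> ((A - B) \<union> (B - A)) < e"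
proof -
  have outer: "emeasure \<mu> A = (INF U\<in>{U. A \<subseteq> U \<and> open U}. emeasure \<mu> U)"
    using A by (intro outer_regular) auto
  have "ennreal (measure \<mu> A) < ennreal (measure \<mu> A + e/2)"
    using e by (intro ennreal_lessI) (auto intro: add_nonneg_pos)
  then have "(INF U\<in>{U. A \<subseteq> U \<and> open U}. emeasure \<mu> U) < ennreal (measure \<mu> A + e/2)"
    unfolding outer[symmetric] by (simp only: emeasure_eq_measure)
  then obtain U where U: "A \<subseteq> U" "open U" "emeasure \<mu> U < ennreal (measure \<mu> A + e/2)"
    unfolding INF_less_iff by blast
  have Us: "U \<in> sets \<mu>" using U(2) by auto
  have UA: "measure \<mu> (U - A) < e/2"
  proof -
    have "measure \<mu> U < measure \<mu> A + e/2"
      using U(3) unfolding emeasure_eq_measure by (simp only: ennreal_less_iff[OF measure_nonneg])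
    moreover have "measure \<mu> (U - A) = measure \<mu> U - measure \<mu> A"
      using U(1) A Us by (intro finite_measure_Diff) auto
    ultimately show ?thesis by simp
  qed
  define B where "B m = {x \<in> Q\<^sub>0. Q m x \<subseteq> U}" for m
  have Bs: "B m \<in> sets \<mu>" for m
  proof -
    have "B m = \<Union> {S. S \<in> {Q m x | x. x \<in> Q\<^sub>0} \<and> S \<subseteq> U}"
    proof (intro set_eqI iffI)
      fix x assume "x \<in> \<Union> {S. S \<in> {Q m x | x. x \<in> Q\<^sub>0} \<and> S \<subseteq> U}"
      then obtain z where z: "z \<in> Q\<^sub>0" "x \<in> Q m z" "Q m z \<subseteq> U" by blast
      then show "x \<in> B m" using Q_eq[of x m z] Q_subset_Q0[of z m] by (auto simp: B_def)
    qed (use self_Q in \<open>force simp: B_def\<close>)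
    moreover have "finite {S. S \<in> {Q m x | x. x \<in> Q\<^sub>0} \<and> S \<subseteq> U}"
      using finite_leaves[of m] by (rule rev_finite_subset) auto
    ultimately show ?thesis by (auto intro!: sets.finite_Union)
  qed
  have "incseq B"
  proof (rule incseq_SucI, rule subsetI)
    fix m x assume "x \<in> B m"
    moreover have "Q (Suc m) x \<subseteq> Q m x" by (simp add: Q_subset_iff)
    ultimately show "x \<in> B (Suc m)" by (auto simp: B_def)
  qed
  moreover have "(\<Union>m. B m) = U \<inter> Q\<^sub>0"
    using small_cube[OF U(2)] self_Q by (force simp: B_def)
  ultimately have lim: "(\<lambda>m. measure \<mu> (B m)) \<longlonglongrightarrow> measure \<mu> (U \<inter> Q\<^sub>0)"
    using finite_Lim_measure_incseq[of B] Bs by (auto simp: image_subset_iff)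
  have "measure \<mu> (U \<inter> Q\<^sub>0) = measure \<mu> U"
    using AE_Q0 Us by (intro finite_measure_eq_AE) (auto simp: Q0 elim!: eventually_mono)
  then have "\<forall>\<^sub>F m in sequentially. measure \<mu> U - e/2 < measure \<mu> (B m)"
    using e by (intro order_tendstoD(1)[OF lim]) simp
  then obtain m where m: "measure \<mu> U - e/2 < measure \<mu> (B m)" by (auto simp: eventually_sequentially)
  have BU: "B m \<subseteq> U" using self_Q by (force simp: B_def)
  have "measure \<mu> ((A - B m) \<union> (B m - A)) \<le> measure \<mu> ((U - B m) \<union> (U - A))"
    using U(1) BU A Us Bs by (intro finite_measure_mono) auto
  also have "\<dots> \<le> measure \<mu> (U - B m) + measure \<mu> (U - A)"
    using A Us Bs by (intro measure_Un_le) auto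
  also have "measure \<mu> (U - B m) = measure \<mu> U - measure \<mu> (B m)"
    using BU Us Bs by (intro finite_measure_Diff) auto
  also have "measure \<mu> U - measure \<mu> (B m) + measure \<mu> (U - A) < e" using m UA by simp
  finally have "measure \<mu> ((A - B m) \<union> (B m - A)) < e" .
  moreover have "\<forall>x\<in>Q\<^sub>0. \<forall>y\<in>Q m x. y \<in> B m \<longleftrightarrow> x \<in> B m"
  proof (intro ballI)
    fix x y assume x: "x \<in> Q\<^sub>0" and y: "y \<in> Q m x"
    have "y \<in> Q\<^sub>0" "Q m y = Q m x" using Q_subset_Q0[OF x] y Q_eq by auto
    then show "y \<in> B m \<longleftrightarrow> x \<in> B m" using x by (simp add: B_def)
  qed
  ultimately show ?thesis using Bs by blast
qed

lemma ennreal_mult_indicator: "ennreal (c * indicator A x) = ennreal c * indicator A x"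
  by (cases "x \<in> A") simp_all

lemma simple_function_approx:
  fixes s :: "real ^ 'n \<Rightarrow> 'x::real_normed_vector"
  assumes s: "simple_function \<mu> s" and e: "0 < e" and p: "0 < p"
  shows "\<exists>g m. simple_function \<mu> g \<and> (\<forall>x\<in>Q\<^sub>0. \<forall>y\<in>Q m x. g y = g x) \<and>
    (\<integral>\<^sup>+x. ennreal (norm (s x - g x) powr p) \<partial>\<mu>) \<le> ennreal e"
proof -
  define V where "V = range s"
  define T where "T = (\<Sum>v\<in>V. norm v)"
  define \<eta> where "\<eta> = e / (T powr p * real (card V) + 1)"
  have V: "finite V" using s by (simp add: V_def simple_function_def)
  have den: "0 < T powr p * real (card V) + 1" by (intro add_nonneg_pos) auto
  have \<eta>: "0 < \<eta>" using e den by (simp add: \<eta>_def)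
  have As: "s -` {v} \<in> sets \<mu>" if "v \<in> V" for v using s that by (auto simp: simple_function_def V_def)
  have "\<forall>v\<in>V. \<exists>B m. B \<in> sets \<mu> \<and> (\<forall>x\<in>Q\<^sub>0. \<forall>y\<in>Q m x. y \<in> B \<longleftrightarrow> x \<in> B) \<and> measure \<mu> ((s -` {v} - B) \<union> (B - s -` {v})) < \<eta>"
    using set_approx[OF As \<eta>] by blast
  then obtain B m where Bm: "\<And>v. v \<in> V \<Longrightarrow> B v \<in> sets \<mu>"
    "\<And>v x y. v \<in> V \<Longrightarrow> x \<in> Q\<^sub>0 \<Longrightarrow> y \<in> Q (m v) x \<Longrightarrow> y \<in> B v \<longleftrightarrow> x \<in> B v"
    "\<And>v. v \<in> V \<Longrightarrow> measure \<mu> ((s -` {v} - B v) \<union> (B v - s -` {v})) < \<eta>"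
    unfolding bchoice_iff by blast
  let ?D = "\<lambda>v. (s -` {v} - B v) \<union> (B v - s -` {v})"
  have Ds: "?D v \<in> sets \<mu>" if "v \<in> V" for v using As Bm(1) that by auto
  define g where "g x = (\<Sum>v\<in>V. indicator (B v) x *\<^sub>R v)" for x
  define M where "M = Max (insert 0 (m ` V))"
  have "simple_function \<mu> g"
    unfolding g_def by (rule simple_function_sum_indicator[OF V]) (rule Bm(1))
  moreover have "\<forall>x\<in>Q\<^sub>0. \<forall>y\<in>Q M x. g y = g x"
  proof (intro ballI)
    fix x y assume x: "x \<in> Q\<^sub>0" and y: "y \<in> Q M x"
    have "y \<in> B v \<longleftrightarrow> x \<in> B v" if v: "v \<in> V" for v
    proof -
      have "m v \<le> M" using V v by (auto simp: M_def)
      then have "y \<in> Q (m v) x" using y Q_subset_iff[of M x "m v"] by auto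
      then show ?thesis by (rule Bm(2)[OF v x])
    qed
    then show "g y = g x" unfolding g_def by (intro sum.cong refl) (simp add: indicator_def)
  qed
  moreover have "(\<integral>\<^sup>+x. ennreal (norm (s x - g x) powr p) \<partial>\<mu>) \<le> ennreal e"
  proof -
    have sx: "s x = (\<Sum>v\<in>V. indicator (s -` {v}) x *\<^sub>R v)" for x
    proof -
      have "(\<Sum>v\<in>V. indicator (s -` {v}) x *\<^sub>R v) = (\<Sum>v\<in>V. if v = s x then s x else 0)"
        by (intro sum.cong) (auto simp: indicator_def)
      then show ?thesis using V by (simp add: V_def)
    qed
    have diff: "s x - g x = (\<Sum>v\<in>V. (indicator (s -` {v}) x - indicator (B v) x :: real) *\<^sub>R v)" for x
      by (simp only: sx[of x] g_def sum_subtractf scaleR_diff_left)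
    have le: "norm (s x - g x) powr p \<le> T powr p * indicator (\<Union>v\<in>V. ?D v) x" for x
    proof (cases "\<exists>v\<in>V. x \<in> ?D v")
      case True
      then have one: "indicator (\<Union>v\<in>V. ?D v) x = (1 :: real)" by (intro indicator_simps(1)) (rule UN_iff[THEN iffD2])
      have "norm (s x - g x) \<le> T"
        unfolding diff T_def by (rule sum_norm_le) (auto simp: indicator_def)
      then have "norm (s x - g x) powr p \<le> T powr p" using p by (intro powr_mono2) simp_all
      then show ?thesis unfolding one by (simp only: mult_1_right)
    next
      case False
      have "(indicator (s -` {v}) x - indicator (B v) x :: real) *\<^sub>R v = 0" if "v \<in> V" for v
      proof -
        have "x \<in> s -` {v} \<longleftrightarrow> x \<in> B v" using False that by blast
        then show ?thesis by (simp only: indicator_def diff_self scaleR_zero_left)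
      qed
      then have zero: "s x - g x = 0" unfolding diff by (rule sum.neutral[OF ballI])
      have "0 \<le> T powr p * indicator (\<Union>v\<in>V. ?D v) x" by (intro mult_nonneg_nonneg) auto
      then show ?thesis unfolding zero by (simp only: norm_zero powr_0)
    qed
    have U: "(\<Union>v\<in>V. ?D v) \<in> sets \<mu>" using V Ds by (intro sets.finite_UN) auto
    have "(\<integral>\<^sup>+x. ennreal (norm (s x - g x) powr p) \<partial>\<mu>) \<le> (\<integral>\<^sup>+x. ennreal (T powr p) * indicator (\<Union>v\<in>V. ?D v) x \<partial>\<mu>)"
    proof (rule nn_integral_mono)
      fix x
      have "ennreal (norm (s x - g x) powr p) \<le> ennreal (T powr p * indicator (\<Union>v\<in>V. ?D v) x)"
        by (rule ennreal_leI[OF le])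
      also have "\<dots> = ennreal (T powr p) * indicator (\<Union>v\<in>V. ?D v) x"
        by (rule ennreal_mult_indicator)
      finally show "ennreal (norm (s x - g x) powr p) \<le> ennreal (T powr p) * indicator (\<Union>v\<in>V. ?D v) x" .
    qed
    also have "\<dots> = ennreal (T powr p * measure \<mu> (\<Union>v\<in>V. ?D v))"
      using U by (simp add: nn_integral_cmult_indicator emeasure_eq_measure ennreal_mult')
    also have "\<dots> \<le> ennreal e"
    proof (rule ennreal_leI)
      have "measure \<mu> (\<Union>v\<in>V. ?D v) \<le> (\<Sum>v\<in>V. measure \<mu> (?D v))"
        using V Ds by (intro finite_measure_subadditive_finite) auto
      also have "\<dots> \<le> (\<Sum>v\<in>V. \<eta>)" by (intro sum_mono less_imp_le Bm(3))
      finally have "T powr p * measure \<mu> (\<Union>v\<in>V. ?D v) \<le> T powr p * (real (card V) * \<eta>)"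
        by (intro mult_left_mono) auto
      also have "\<dots> \<le> (T powr p * real (card V) + 1) * \<eta>" using \<eta> by (simp add: algebra_simps)
      also have "\<dots> = e" using den by (simp add: \<eta>_def)
      finally show "T powr p * measure \<mu> (\<Union>v\<in>V. ?D v) \<le> e" .
    qed
    finally show ?thesis .
  qed
  ultimately show ?thesis by blast
qed

lemma step_function_dense:
  fixes f :: "real ^ 'n \<Rightarrow> 'x::real_normed_vector"
  assumes f: "in_Lp \<mu> p f" and e: "0 < e" and p: "0 < p"
  shows "\<exists>g m. simple_function \<mu> g \<and> (\<forall>x\<in>Q\<^sub>0. \<forall>y\<in>Q m x. g y = g x) \<and>
    (\<integral>\<^sup>+x. ennreal (norm (f x - g x) powr p) \<partial>\<mu>) \<le> ennreal e"
proof -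
  have fm: "strongly_measurable \<mu> f" using f by (simp add: in_Lp_def)
  have [measurable]: "(\<lambda>x. norm (f x)) \<in> borel_measurable \<mu>" by (rule borel_measurable_norm_strongly_measurable[OF fm])
  obtain s where s: "\<And>i. simple_function \<mu> (s i)" "\<And>x. x \<in> space \<mu> \<Longrightarrow> (\<lambda>i. s i x) \<longlonglongrightarrow> f x"
    "\<And>i x. x \<in> space \<mu> \<Longrightarrow> norm (s i x) \<le> 2 * norm (f x)"
    by (rule strongly_measurable_dominated_approx[OF fm]) blast
  have sm: "strongly_measurable \<mu> (s i)" for i by (rule strongly_measurable_simple[OF s(1)])
  have [measurable]: "(\<lambda>x. norm (f x - s i x)) \<in> borel_measurable \<mu>" for i
    by (intro borel_measurable_norm_strongly_measurable strongly_measurable_diff fm sm)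
  have lim: "(\<lambda>i. \<integral>\<^sup>+x. ennreal (norm (f x - s i x) powr p) \<partial>\<mu>) \<longlonglongrightarrow> (\<integral>\<^sup>+x. 0 \<partial>\<mu>)"
  proof (rule nn_integral_dominated_convergence[where w="\<lambda>x. ennreal (3 powr p * norm (f x) powr p)"])
    show "AE x in \<mu>. ennreal (norm (f x - s i x) powr p) \<le> ennreal (3 powr p * norm (f x) powr p)" for i
    proof (rule AE_I2, rule ennreal_leI)
      fix x assume x: "x \<in> space \<mu>"
      have "norm (f x - s i x) \<le> 3 * norm (f x)"
        using norm_triangle_ineq4[of "f x" "s i x"] s(3)[OF x, of i] by simp
      then have "norm (f x - s i x) powr p \<le> (3 * norm (f x)) powr p" using p by (intro powr_mono2) auto
      then show "norm (f x - s i x) powr p \<le> 3 powr p * norm (f x) powr p" by (simp add: powr_mult)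
    qed
    show "AE x in \<mu>. (\<lambda>i. ennreal (norm (f x - s i x) powr p)) \<longlonglongrightarrow> 0"
    proof (rule AE_I2)
      fix x assume x: "x \<in> space \<mu>"
      have "(\<lambda>i. ennreal (norm (f x - s i x) powr p)) \<longlonglongrightarrow> ennreal (norm (f x - f x) powr p)"
        using p by (intro tendsto_ennrealI tendsto_powr' tendsto_norm tendsto_diff tendsto_const s x) auto
      then show "(\<lambda>i. ennreal (norm (f x - s i x) powr p)) \<longlonglongrightarrow> 0" by simp
    qed
    have "integrable \<mu> (\<lambda>x. 3 powr p * norm (f x) powr p)" using f by (simp add: in_Lp_def)
    then have "(\<integral>\<^sup>+ x. ennreal (3 powr p * norm (f x) powr p) \<partial>\<mu>) = ennreal (LINT x|\<mu>. 3 powr p * norm (f x) powr p)"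
      by (intro nn_integral_eq_integral) auto
    then show "(\<integral>\<^sup>+ x. ennreal (3 powr p * norm (f x) powr p) \<partial>\<mu>) < \<infinity>" by simp
  qed auto
  define e' where "e' = e / (2 * 2 powr p)"
  have e': "0 < e'" using e by (simp add: e'_def)
  have "\<forall>\<^sub>F i in sequentially. (\<integral>\<^sup>+x. ennreal (norm (f x - s i x) powr p) \<partial>\<mu>) < ennreal e'"
    using lim e' by (intro order_tendstoD(2)) auto
  then obtain i where i: "(\<integral>\<^sup>+x. ennreal (norm (f x - s i x) powr p) \<partial>\<mu>) < ennreal e'"
    by (auto simp: eventually_sequentially)
  obtain g m where g: "simple_function \<mu> g" "\<forall>x\<in>Q\<^sub>0. \<forall>y\<in>Q m x. g y = g x"
    "(\<integral>\<^sup>+x. ennreal (norm (s i x - g x) powr p) \<partial>\<mu>) \<le> ennreal e'"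
    using simple_function_approx[OF s(1) e' p] by blast
  have "(\<integral>\<^sup>+x. ennreal (norm ((f x - s i x) + (s i x - g x)) powr p) \<partial>\<mu>)
    \<le> ennreal (2 powr p) * ((\<integral>\<^sup>+x. ennreal (norm (f x - s i x) powr p) \<partial>\<mu>) + (\<integral>\<^sup>+x. ennreal (norm (s i x - g x) powr p) \<partial>\<mu>))"
    using p by (intro nn_powr_add_le strongly_measurable_diff fm sm strongly_measurable_simple[OF g(1)]) auto
  also have "\<dots> \<le> ennreal (2 powr p) * (ennreal e' + ennreal e')"
    using i g(3) by (intro mult_left_mono add_mono) auto
  also have "\<dots> = ennreal e" using e' by (simp add: e'_def flip: ennreal_plus ennreal_mult')
  finally show ?thesis using g by auto
qed

subsection \<open>The random series\<close>

text \<open>For a step function only finitely many operators are nonzero, and the corresponding random sum is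
  simple on the product space. Step functions are dense, and by the uniform bound the error made by
  replacing \<open>f\<close> is small for all partial sums simultaneously.\<close>

lemma random_series_converges:
  fixes f :: "real ^ 'n \<Rightarrow> 'x::complex_banach" and P :: "'w measure"
  assumes rs: "random_signs P \<epsilon>" and f: "in_Lp \<mu> p f" and p: "1 < p" and C: "0 \<le> C"
    and bound: "\<And>(f :: real ^ 'n \<Rightarrow> 'x) K. in_Lp \<mu> p f \<Longrightarrow> finite K \<Longrightarrow>
      (\<integral>\<^sup>+x. \<integral>\<^sup>+w. ennreal (norm (\<Sum>k\<in>K. \<epsilon> k w *\<^sub>R D_adj \<mu> \<beta> b \<delta> Q\<^sub>0 k f x) powr p) \<partial>P \<partial>\<mu>)
        \<le> ennreal (C * (LINT x|\<mu>. norm (f x) powr p))"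
  shows "\<exists>g. has_sum_Lp (\<mu> \<Otimes>\<^sub>M P) p (\<lambda>k (x, w). \<epsilon> k w *\<^sub>R D_adj \<mu> \<beta> b \<delta> Q\<^sub>0 k f x) g UNIV \<and>
    (LINT z|(\<mu> \<Otimes>\<^sub>M P). norm (g z) powr p) \<le> 2 powr p * (C * (LINT x|\<mu>. norm (f x) powr p))"
proof -
  interpret P: prob_space P using rs by (simp add: random_signs_def)
  let ?M = "\<mu> \<Otimes>\<^sub>M P" and ?D = "\<lambda>k f x. D_adj \<mu> \<beta> b \<delta> Q\<^sub>0 k f x"
  let ?u = "\<lambda>k (z :: (real ^ 'n) \<times> 'w). \<epsilon> k (snd z) *\<^sub>R ?D k f (fst z)"
  have \<epsilon> [measurable]: "\<epsilon> k \<in> borel_measurable P" for k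
    using rs by (auto simp: random_signs_def P.indep_vars_def)
  let ?q = "1 / 4 powr p :: real"
  have "\<exists>g m. simple_function \<mu> g \<and> (\<forall>x\<in>Q\<^sub>0. \<forall>y\<in>Q m x. g y = g x) \<and>
    (\<integral>\<^sup>+x. ennreal (norm (f x - g x) powr p) \<partial>\<mu>) \<le> ennreal (?q ^ i)" for i :: nat
    by (rule step_function_dense[OF f]) (use p in auto)
  then have "\<forall>i :: nat. \<exists>g m. simple_function \<mu> g \<and> (\<forall>x\<in>Q\<^sub>0. \<forall>y\<in>Q m x. g y = g x) \<and>
    (\<integral>\<^sup>+x. ennreal (norm (f x - g x) powr p) \<partial>\<mu>) \<le> ennreal (?q ^ i)" by blast
  then obtain g m where g: "\<And>i. simple_function \<mu> (g i)" "\<And>i x y. x \<in> Q\<^sub>0 \<Longrightarrow> y \<in> Q (m i) x \<Longrightarrow> g i y = g i x"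
    "\<And>i. (\<integral>\<^sup>+x. ennreal (norm (f x - g i x) powr p) \<partial>\<mu>) \<le> ennreal (?q ^ i)"
    unfolding choice_iff by blast
  define K where "K i = {k0 - int (m i) + 1..k0}" for i
  \<comment> \<open>Values other than \<open>\<plusminus>1\<close> may occur on a null set; removing them leaves simple functions.\<close>
  define sg :: "real \<Rightarrow> real" where "sg t = (if t = 1 then 1 else if t = -1 then -1 else 0)" for t
  have sg: "simple_function P (\<lambda>w. sg (\<epsilon> k w))" for k
  proof -
    have "simple_function P (\<lambda>w. indicator {w \<in> space P. \<epsilon> k w = 1} w - indicator {w \<in> space P. \<epsilon> k w = -1} w :: real)"
      by (intro simple_function_diff simple_function_indicator) auto
    then show ?thesis
      by (rule simple_function_cong[THEN iffD1, rotated]) (auto simp: sg_def indicator_def)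
  qed
  define h where "h i z = (\<Sum>k\<in>K i. sg (\<epsilon> k (snd z)) *\<^sub>R ?D k (g i) (fst z))" for i and z :: "(real ^ 'n) \<times> 'w"
  have gs: "strong_integrable \<mu> (g i)" for i
    by (rule simple_function_strong_integrable[OF g(1)])
  have fs: "strong_integrable \<mu> f" by (rule in_Lp_strong_integrable[OF f p])
  have Dfst: "simple_function ?M (\<lambda>z. ?D k f (fst z))" for k and f :: "real ^ 'n \<Rightarrow> 'x"
    by (rule simple_function_comp[OF measurable_fst simple_D_adj])
  have prod: "(\<integral>\<^sup>+z. ennreal (norm (F z) powr p) \<partial>?M) = (\<integral>\<^sup>+x. \<integral>\<^sup>+w. ennreal (norm (F (x, w)) powr p) \<partial>P \<partial>\<mu>)"
    if "strongly_measurable ?M F" for F :: "_ \<Rightarrow> 'x"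
  proof -
    have [measurable]: "(\<lambda>z. norm (F z)) \<in> borel_measurable ?M" by (rule borel_measurable_norm_strongly_measurable[OF that])
    show ?thesis by (rule P.nn_integral_fst[symmetric]) measurable
  qed
  have um: "strongly_measurable ?M (?u k)" for k
    by (intro strongly_measurable_scaleR strongly_measurable_simple Dfst) measurable
  have hsimple: "simple_function ?M (h i)" for i
  proof -
    have "simple_function ?M (\<lambda>z. \<Sum>k\<in>L. sg (\<epsilon> k (snd z)) *\<^sub>R ?D k (g i) (fst z))" if "finite L" for L
      using that
    proof (induction L rule: finite_induct)
      case (insert k L)
      have "simple_function ?M (\<lambda>z. sg (\<epsilon> k (snd z)) *\<^sub>R ?D k (g i) (fst z))"
        by (rule simple_function_compose2[OF simple_function_comp[OF measurable_snd sg] Dfst])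
      then show ?case unfolding sum.insert[OF insert.hyps] using insert.IH by (rule simple_function_compose2)
    qed simp
    from this[of "K i"] show ?thesis by (simp add: h_def[abs_def] K_def)
  qed
  have fg: "in_Lp \<mu> p (\<lambda>x. f x - g i x)" for i
    using g(3)[of i] fs gs[of i]
    by (intro in_LpI strongly_measurable_diff) (auto simp: strong_integrable_def order_le_less_trans)
  have "\<exists>G. has_sum_Lp ?M p ?u G UNIV \<and> (LINT z|?M. norm (G z) powr p) \<le> 2 powr p * (C * (LINT x|\<mu>. norm (f x) powr p))"
  proof (rule unconditional_Lp_limit[OF um p hsimple, where D=K and B=C])
    show "finite (K i)" for i by (simp add: K_def)
    show "0 \<le> C * (LINT x|\<mu>. norm (f x) powr p)" using C by (intro mult_nonneg_nonneg integral_nonneg_AE) auto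
    show "(\<integral>\<^sup>+z. ennreal (norm (\<Sum>k\<in>L. ?u k z) powr p) \<partial>?M) \<le> ennreal (C * (LINT x|\<mu>. norm (f x) powr p))" if L: "finite L" for L
      using bound[OF f L] prod[OF strongly_measurable_sum[OF L um]] by simp
    show "(\<integral>\<^sup>+z. ennreal (norm ((\<Sum>k\<in>L. ?u k z) - h i z) powr p) \<partial>?M) \<le> ennreal (C * ?q ^ i)"
      if L: "finite L" "K i \<subseteq> L" for i L
    proof -
      have "(\<integral>\<^sup>+z. ennreal (norm ((\<Sum>k\<in>L. ?u k z) - h i z) powr p) \<partial>?M)
        = (\<integral>\<^sup>+x. \<integral>\<^sup>+w. ennreal (norm ((\<Sum>k\<in>L. \<epsilon> k w *\<^sub>R ?D k f x) - h i (x, w)) powr p) \<partial>P \<partial>\<mu>)"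
        by (subst prod) (auto intro!: strongly_measurable_diff strongly_measurable_sum L um strongly_measurable_simple[OF hsimple])
      also have "\<dots> = (\<integral>\<^sup>+x. \<integral>\<^sup>+w. ennreal (norm (\<Sum>k\<in>L. \<epsilon> k w *\<^sub>R ?D k (\<lambda>x. f x - g i x) x) powr p) \<partial>P \<partial>\<mu>)"
      proof (rule nn_integral_cong_AE)
        have "AE x in \<mu>. ?D k (g i) x = 0" if "k \<in> L - K i" for k
        proof (cases "k \<le> k0")
          case True
          then show ?thesis using that by (intro AE_D_adj_step[OF g(2)]) (auto simp: K_def)
        next
          case False
          show ?thesis using AE_Q0 by eventually_elim (rule D_adj_above[OF _ _ gs], use False in auto)
        qed
        then have "AE x in \<mu>. \<forall>k\<in>L - K i. ?D k (g i) x = 0"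
          using L by (intro AE_finite_allI) auto
        then show "AE x in \<mu>. (\<integral>\<^sup>+w. ennreal (norm ((\<Sum>k\<in>L. \<epsilon> k w *\<^sub>R ?D k f x) - h i (x, w)) powr p) \<partial>P)
          = (\<integral>\<^sup>+w. ennreal (norm (\<Sum>k\<in>L. \<epsilon> k w *\<^sub>R ?D k (\<lambda>x. f x - g i x) x) powr p) \<partial>P)"
        proof eventually_elim
          case (elim x)
          have "AE w in P. \<forall>k\<in>L. \<epsilon> k w \<in> {-1, 1}"
            using L AE_random_signs[OF rs] by (intro AE_finite_allI) auto
          then have "AE w in P. (\<Sum>k\<in>L. \<epsilon> k w *\<^sub>R ?D k f x) - h i (x, w) = (\<Sum>k\<in>L. \<epsilon> k w *\<^sub>R ?D k (\<lambda>x. f x - g i x) x)"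
          proof eventually_elim
            case w: (elim w)
            have "h i (x, w) = (\<Sum>k\<in>K i. \<epsilon> k w *\<^sub>R ?D k (g i) x)"
              unfolding h_def using w L by (intro sum.cong) (auto simp: sg_def)
            also have "\<dots> = (\<Sum>k\<in>L. \<epsilon> k w *\<^sub>R ?D k (g i) x)"
              using L elim by (intro sum.mono_neutral_left) auto
            finally show ?case
              by (simp add: D_adj_diff[OF fs gs] scaleR_diff_right sum_subtractf)
          qed
          then show ?case by (intro nn_integral_cong_AE) (auto elim!: eventually_mono)
        qed
      qed
      also have "\<dots> \<le> ennreal (C * (LINT x|\<mu>. norm (f x - g i x) powr p))" by (rule bound[OF fg L(1)])
      also have "\<dots> \<le> ennreal (C * ?q ^ i)"
      proof (intro ennreal_leI mult_left_mono C)
        show "(LINT x|\<mu>. norm (f x - g i x) powr p) \<le> ?q ^ i"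
          using g(3)[of i] in_Lp_nn_integral[OF fg[of i]] by (simp add: ennreal_le_iff)
      qed
      finally show ?thesis .
    qed
  qed (rule C)
  then show ?thesis by (simp add: case_prod_unfold)
qed

end

text \<open>The complement of the support is a union of open null sets, hence by the Lindelof property of
  countably many of them. So the cube carries the measure, and the growth condition makes its mass
  finite.\<close>

lemma dyadic_measureI:
  fixes \<mu> :: "(real ^ 'n::finite) measure"
  assumes sets: "sets \<mu> = sets borel"
    and growth: "\<And>x \<rho>. 0 < \<rho> \<Longrightarrow> emeasure \<mu> {y. infnorm (y - x) < \<rho>} \<le> ennreal (\<rho> powr d)"
    and \<beta>: "\<And>j i. \<beta> j $ i \<in> {0, 1}"
    and Q0: "Q\<^sub>0 \<in> dyadic_system \<beta>" and supp: "measure_support \<mu> \<subseteq> Q\<^sub>0"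
    and acc: "accretive_system \<mu> \<delta> b" and \<delta>: "0 < \<delta>" "\<delta> < 1"
  obtains k0 x0 where "dyadic_measure \<beta> \<mu> b \<delta> Q\<^sub>0 k0 x0"
proof -
  interpret dyadic_shifts \<beta> by standard (rule \<beta>)
  obtain k0 x0 where Q: "Q\<^sub>0 = cube k0 x0" using Q0 by (auto simp: dyadic_system_def dyadic_eq)
  have sp: "space \<mu> = UNIV" using sets_eq_imp_space_eq[OF sets] by simp
  let ?F = "{U. open U \<and> emeasure \<mu> U = 0}"
  obtain F' where F': "F' \<subseteq> ?F" "countable F'" "\<Union>F' = \<Union>?F"
    using Lindelof[of ?F] by auto
  have "(\<Union>U\<in>F'. U) \<in> null_sets \<mu>"
    using F' by (intro null_sets_UN') (auto simp: null_sets_def sets)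
  then have null: "AE x in \<mu>. x \<notin> \<Union>?F" using AE_not_in[of "\<Union>F'" \<mu>] F'(3) by simp
  have out: "x \<in> \<Union>?F" if "x \<notin> Q\<^sub>0" for x
    using that supp by (auto simp: measure_support_def)
  have AE: "AE x in \<mu>. x \<in> Q\<^sub>0" using null by eventually_elim (use out in blast)
  have "emeasure \<mu> (space \<mu>) = emeasure \<mu> Q\<^sub>0"
    using AE by (intro emeasure_eq_AE) (auto simp: Q sets sp elim!: eventually_mono)
  also have "\<dots> \<le> emeasure \<mu> {y. infnorm (y - x0) < 2 powi k0}"
  proof (rule emeasure_mono)
    show "Q\<^sub>0 \<subseteq> {y. infnorm (y - x0) < 2 powi k0}" using cube_bounded by (auto simp: Q)
    have "open {y. infnorm (y - x0) < 2 powi k0}"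
      by (intro open_Collect_less continuous_intros continuous_on_infnorm)
    then show "{y. infnorm (y - x0) < 2 powi k0} \<in> sets \<mu>" by (simp add: sets)
  qed
  also have "\<dots> \<le> ennreal ((2 powi k0) powr d)" by (rule growth) simp
  finally have "emeasure \<mu> (space \<mu>) < top" by (rule le_less_trans) (rule ennreal_less_top)
  then have fin: "emeasure \<mu> (space \<mu>) \<noteq> \<infinity>" unfolding infinity_ennreal_def by (rule less_imp_neq)
  have "dyadic_measure \<beta> \<mu> b \<delta> Q\<^sub>0 k0 x0"
    by (intro dyadic_measure.intro dyadic_measure_axioms.intro stopping_cubes.intro stopping_cubes_axioms.intro
        dyadic_shifts_axioms finite_measureI fin AE acc \<delta> Q sets)
  then show thesis by (rule that)
qed

theorem theorem4p16:
  fixes S :: "'s measure" and rep :: "'x::complex_banach \<Rightarrow> 's \<Rightarrow> complex"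
    and d \<delta> p :: real
  assumes "function_lattice S rep" and "UMD TYPE('x)"
    and "1 < p"
    and "0 < d" and "d \<le> real CARD('n::finite)"
    and "0 < \<delta>" and "\<delta> < 1"
  shows "\<exists>C. \<forall>(\<mu> :: (real ^ 'n) measure) (\<beta> :: int \<Rightarrow> real ^ 'n) Q\<^sub>0 b
             (P :: 'w measure) (\<epsilon> :: int \<Rightarrow> 'w \<Rightarrow> real) (f :: real ^ 'n \<Rightarrow> 'x).
     sets \<mu> = sets borel \<longrightarrow>
     compact (measure_support \<mu>) \<longrightarrow>
     (\<forall>x. \<forall>\<rho>>0. emeasure \<mu> {y. infnorm (y - x) < \<rho>} \<le> ennreal (\<rho> powr d)) \<longrightarrow>
     (\<forall>j i. \<beta> j $ i \<in> {0, 1}) \<longrightarrow>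
     Q\<^sub>0 \<in> dyadic_system \<beta> \<longrightarrow> measure_support \<mu> \<subseteq> Q\<^sub>0 \<longrightarrow>
     accretive_system \<mu> \<delta> b \<longrightarrow>
     random_signs P \<epsilon> \<longrightarrow>
     in_Lp \<mu> p f \<longrightarrow>
     (\<exists>g. has_sum_Lp (\<mu> \<Otimes>\<^sub>M P) p (\<lambda>k (x, w). \<epsilon> k w *\<^sub>R D_adj \<mu> \<beta> b \<delta> Q\<^sub>0 k f x) g UNIV \<and>
          Lp_norm (\<mu> \<Otimes>\<^sub>M P) p g \<le> C * Lp_norm \<mu> p f)"
proof -
  obtain C where C: "0 \<le> C" and bound: "\<And>\<beta> (\<mu> :: (real ^ 'n) measure) b Q\<^sub>0 k0 x0 (P :: 'w measure) \<epsilon> (f :: real ^ 'n \<Rightarrow> 'x) K.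
      dyadic_measure \<beta> \<mu> b \<delta> Q\<^sub>0 k0 x0 \<Longrightarrow> random_signs P \<epsilon> \<Longrightarrow> in_Lp \<mu> p f \<Longrightarrow> finite K \<Longrightarrow>
      (\<integral>\<^sup>+x. \<integral>\<^sup>+w. ennreal (norm (\<Sum>k\<in>K. \<epsilon> k w *\<^sub>R D_adj \<mu> \<beta> b \<delta> Q\<^sub>0 k f x) powr p) \<partial>P \<partial>\<mu>)
        \<le> ennreal (C * (LINT x|\<mu>. norm (f x) powr p))"
    by (rule finite_sum_bound[OF assms(2,3,6,7)]) blast
  show ?thesis
  proof (intro exI[of _ "(2 powr p * C) powr (1 / p)"] allI impI)
    fix \<mu> :: "(real ^ 'n) measure" and \<beta> :: "int \<Rightarrow> real ^ 'n" and Q\<^sub>0 b and P :: "'w measure"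
      and \<epsilon> :: "int \<Rightarrow> 'w \<Rightarrow> real" and f :: "real ^ 'n \<Rightarrow> 'x"
    assume sets: "sets \<mu> = sets borel"
      and growth: "\<forall>x. \<forall>\<rho>>0. emeasure \<mu> {y. infnorm (y - x) < \<rho>} \<le> ennreal (\<rho> powr d)"
      and \<beta>: "\<forall>j i. \<beta> j $ i \<in> {0, 1}" and Q: "Q\<^sub>0 \<in> dyadic_system \<beta>" "measure_support \<mu> \<subseteq> Q\<^sub>0"
      and acc: "accretive_system \<mu> \<delta> b" and rs: "random_signs P \<epsilon>" and f: "in_Lp \<mu> p f"
    obtain k0 x0 where dm: "dyadic_measure \<beta> \<mu> b \<delta> Q\<^sub>0 k0 x0"
    proof (rule dyadic_measureI[where d=d])
      show "emeasure \<mu> {y. infnorm (y - x) < \<rho>} \<le> ennreal (\<rho> powr d)" if "0 < \<rho>" for x \<rho>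
        using growth that by blast
      show "\<beta> j $ i \<in> {0, 1}" for j i using \<beta> by blast
    qed (rule sets Q acc assms(6,7))+
    obtain g where g: "has_sum_Lp (\<mu> \<Otimes>\<^sub>M P) p (\<lambda>k (x, w). \<epsilon> k w *\<^sub>R D_adj \<mu> \<beta> b \<delta> Q\<^sub>0 k f x) g UNIV"
      and le: "(LINT z|(\<mu> \<Otimes>\<^sub>M P). norm (g z) powr p) \<le> 2 powr p * (C * (LINT x|\<mu>. norm (f x) powr p))"
      using dyadic_measure.random_series_converges[OF dm rs f assms(3) C bound[OF dm rs]] by blast
    have "Lp_norm (\<mu> \<Otimes>\<^sub>M P) p g \<le> (2 powr p * (C * (LINT x|\<mu>. norm (f x) powr p))) powr (1 / p)"
      unfolding Lp_norm_def
    proof (rule powr_mono2[OF _ _ le])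
      show "0 \<le> (LINT z|(\<mu> \<Otimes>\<^sub>M P). norm (g z) powr p)" by (intro integral_nonneg_AE) simp
    qed (use assms(3) in simp)
    also have "\<dots> = (2 powr p * C) powr (1 / p) * Lp_norm \<mu> p f"
      unfolding Lp_norm_def mult.assoc[symmetric] by (rule powr_mult)
    finally have "Lp_norm (\<mu> \<Otimes>\<^sub>M P) p g \<le> (2 powr p * C) powr (1 / p) * Lp_norm \<mu> p f" .
    with g show "\<exists>g. has_sum_Lp (\<mu> \<Otimes>\<^sub>M P) p (\<lambda>k (x, w). \<epsilon> k w *\<^sub>R D_adj \<mu> \<beta> b \<delta> Q\<^sub>0 k f x) g UNIV \<and>
          Lp_norm (\<mu> \<Otimes>\<^sub>M P) p g \<le> (2 powr p * C) powr (1 / p) * Lp_norm \<mu> p f" by blast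
  qed
qed

end
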